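(* Let $(a,b)\subset\mathbb{R}$ be a finite interval, let $m,r\ge 1$ and $n\ge 0$ be integers, let $1\le p\le\infty$ and $\varepsilon_0>0$. For every $\varepsilon\in[0,\varepsilon_0)$ let $A_{r-j}(\cdot;\varepsilon)\in (W_p^{n})^{m\times m}$, $j\in\{1,\dots,r\}$, be matrix-valued functions and let $B(\varepsilon)\colon (W_p^{n+r})^m\to\mathbb{C}^{rm}$ be a continuous linear operator. Consider the boundary-value problem $$L(\varepsilon)y(t,\varepsilon):=y^{(r)}(t,\varepsilon)+\sum_{j=1}^{r}A_{r-j}(t,\varepsilon)\,y^{(r-j)}(t,\varepsilon)=f(t,\varepsilon),\quad t\in(a,b),\qquad B(\varepsilon)y(\cdot;\varepsilon)=c(\varepsilon),$$ with $f(\cdot;\varepsilon)\in(W_p^n)^m$, $c(\varepsilon)\in\mathbb{C}^{rm}$ and unknown $y(\cdot;\varepsilon)\in(W_p^{n+r})^m$. The solution to this problem depends continuously on the parameter $\varepsilon$ at $\varepsilon=0$ if and only if the following three conditions all hold (limits as $\varepsilon\to0+$): (0) the homogeneous boundary-value problem $L(0)y(t,0)=0$, $t\in(a,b)$, $B(0)y(\cdot,0)=0$ has only the trivial solution; (I) $A_{r-j}(\cdot;\varepsilon)\to A_{r-j}(\cdot;0)$ in the space $(W_p^n)^{m\times m}$ for each $j\in\{1,\dots,r\}$; (II) $B(\varepsilon)y\to B(0)y$ in $\mathbb{C}^{rm}$ for every $y\in(W_p^{n+r})^m$.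
   Context: For an integer $s\ge 1$, $W_p^{s}=W_p^{s}([a,b];\mathbb{C})$ is the complex Sobolev space $\{y\in C^{s-1}[a,b] : y^{(s-1)}\in AC[a,b],\ y^{(s)}\in L_p[a,b]\}$, and $W_p^0:=L_p$. It is a Banach space with norm $\|y\|_{s,p}=\sum_{k=0}^{s}\|y^{(k)}\|_p$, where $\|\cdot\|_p$ is the norm in $L_p([a,b];\mathbb{C})$. $(W_p^s)^m:=W_p^s([a,b];\mathbb{C}^m)$ and $(W_p^s)^{m\times m}:=W_p^s([a,b];\mathbb{C}^{m\times m})$ are the Sobolev spaces of vector-valued (column) functions and matrix-valued functions with entries in $W_p^s$, with the analogous norms. A solution satisfies the differential equation everywhere on $(a,b)$ if $n\ge1$ and almost everywhere if $n=0$. Definition. A solution to the boundary-value problem depends continuously on the parameter $\varepsilon$ at $\varepsilon=0$ if the following two conditions are satisfied (limits as $\varepsilon\to0+$): $(\ast)$ there exists a positive number $\varepsilon_1<\varepsilon_0$ such that, for any $\varepsilon\in[0,\varepsilon_1)$ and arbitrarily chosen right-hand sides $f(\cdot;\varepsilon)\in(W_p^n)^m$ and $c(\varepsilon)\in\mathbb{C}^{rm}$, the problem has a unique solution $y(\cdot;\varepsilon)\in(W_p^{n+r})^m$; $(\ast\ast)$ the convergence of the right-hand sides $f(\cdot;\varepsilon)\to f(\cdot;0)$ in $(W_p^n)^m$ and $c(\varepsilon)\to c(0)$ in $\mathbb{C}^{rm}$ implies the convergence of the solutions $y(\cdot;\varepsilon)\to y(\cdot;0)$ in $(W_p^{n+r})^m$.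 *)

theory Defs
  imports "HOL-Analysis.Analysis" "HOL-Probability.Essential_Supremum"
begin

text \<open>
  Functions on the compact interval \<open>[a, b]\<close> are represented by total functions on \<open>real\<close>; nothing
  below depends on the values outside \<open>[a, b]\<close>. The function spaces are defined for an arbitrary
  Euclidean target space, so that one definition covers scalars (\<open>complex\<close>), column vectors
  (\<open>complex ^ 'm\<close>) and square matrices (\<open>complex ^ 'm ^ 'm\<close>).
\<close>

definition Lp_space :: "real \<Rightarrow> real \<Rightarrow> ereal \<Rightarrow> (real \<Rightarrow> 'a::euclidean_space) set" where
  "Lp_space a b p = {f. f \<in> borel_measurable (lebesgue_on {a..b}) \<and>
     (if p = \<infinity> then esssup (lebesgue_on {a..b}) (\<lambda>t. ereal (norm (f t))) < \<infinity>
      else integrable (lebesgue_on {a..b}) (\<lambda>t. norm (f t) powr real_of_ereal p))}"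

definition Lp_norm :: "real \<Rightarrow> real \<Rightarrow> ereal \<Rightarrow> (real \<Rightarrow> 'a::euclidean_space) \<Rightarrow> real" where
  "Lp_norm a b p f =
     (if p = \<infinity> then real_of_ereal (esssup (lebesgue_on {a..b}) (\<lambda>t. ereal (norm (f t))))
      else (LINT t|lebesgue_on {a..b}. norm (f t) powr real_of_ereal p) powr (1 / real_of_ereal p))"

text \<open>
  The usual epsilon-delta definition: \<open>d\<close> ranges over the finite families of non-overlapping compact
  subintervals of \<open>[a, b]\<close>.
\<close>

definition abs_continuous_on :: "real \<Rightarrow> real \<Rightarrow> (real \<Rightarrow> 'a::euclidean_space) \<Rightarrow> bool" where
  "abs_continuous_on a b f \<longleftrightarrow>
     (\<forall>e>0. \<exists>\<delta>>0. \<forall>d. d division_of \<Union>d \<and> \<Union>d \<subseteq> {a..b} \<and> (\<Sum>K\<in>d. Sup K - Inf K) < \<delta> \<longrightarrow>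
        (\<Sum>K\<in>d. norm (f (Sup K) - f (Inf K))) < e)"

text \<open>
  The \<open>k\<close>-th derivative on \<open>[a, b]\<close>, one-sided at the end points. At points where the derivative
  does not exist (a null set, for the top derivative of a Sobolev function) the value is arbitrary.
\<close>

definition ideriv :: "real \<Rightarrow> real \<Rightarrow> nat \<Rightarrow> (real \<Rightarrow> 'a::euclidean_space) \<Rightarrow> real \<Rightarrow> 'a" where
  "ideriv a b k y = ((\<lambda>g t. vector_derivative g (at t within {a..b})) ^^ k) y"

definition C_space :: "real \<Rightarrow> real \<Rightarrow> nat \<Rightarrow> (real \<Rightarrow> 'a::euclidean_space) set" where
  "C_space a b k = {y. (\<forall>i<k. ideriv a b i y differentiable_on {a..b}) \<and>
                       (\<forall>i\<le>k. continuous_on {a..b} (ideriv a b i y))}"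

definition sobolev_space ::
    "real \<Rightarrow> real \<Rightarrow> ereal \<Rightarrow> nat \<Rightarrow> (real \<Rightarrow> 'a::euclidean_space) set" where
  "sobolev_space a b p s =
     (if s = 0 then Lp_space a b p
      else {y. y \<in> C_space a b (s - 1) \<and> abs_continuous_on a b (ideriv a b (s - 1) y) \<and>
               ideriv a b s y \<in> Lp_space a b p})"

definition sobolev_norm ::
    "real \<Rightarrow> real \<Rightarrow> ereal \<Rightarrow> nat \<Rightarrow> (real \<Rightarrow> 'a::euclidean_space) \<Rightarrow> real" where
  "sobolev_norm a b p s y = (\<Sum>k\<le>s. Lp_norm a b p (ideriv a b k y))"

text \<open>
  Well-definedness of \<open>T\<close> on functions modulo their values outside \<open>[a, b]\<close> follows from linearity
  and continuity, because a function vanishing on \<open>[a, b]\<close> has norm zero.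
\<close>

definition continuous_linear_operator ::
    "real \<Rightarrow> real \<Rightarrow> ereal \<Rightarrow> nat \<Rightarrow> ((real \<Rightarrow> complex ^ 'm) \<Rightarrow> complex ^ 'q) \<Rightarrow> bool" where
  "continuous_linear_operator a b p s T \<longleftrightarrow>
     (\<forall>y\<in>sobolev_space a b p s. \<forall>z\<in>sobolev_space a b p s. T (\<lambda>t. y t + z t) = T y + T z) \<and>
     (\<forall>u. \<forall>y\<in>sobolev_space a b p s. T (\<lambda>t. u *s y t) = u *s T y) \<and>
     (\<forall>y\<in>sobolev_space a b p s. \<forall>e>0. \<exists>\<delta>>0. \<forall>z\<in>sobolev_space a b p s.
        sobolev_norm a b p s (\<lambda>t. z t - y t) < \<delta> \<longrightarrow> norm (T z - T y) < e)"

text \<open>\<open>A l\<close> is the coefficient of the \<open>l\<close>-th derivative, \<open>l < r\<close>.\<close>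

definition diff_op ::
    "real \<Rightarrow> real \<Rightarrow> nat \<Rightarrow> (nat \<Rightarrow> real \<Rightarrow> complex ^ 'm ^ 'm) \<Rightarrow> (real \<Rightarrow> complex ^ 'm)
      \<Rightarrow> real \<Rightarrow> complex ^ 'm" where
  "diff_op a b r A y t = ideriv a b r y t + (\<Sum>j=1..r. A (r - j) t *v ideriv a b (r - j) y t)"

definition bvp_solution ::
    "real \<Rightarrow> real \<Rightarrow> ereal \<Rightarrow> nat \<Rightarrow> nat \<Rightarrow> (nat \<Rightarrow> real \<Rightarrow> complex ^ 'm ^ 'm)
      \<Rightarrow> ((real \<Rightarrow> complex ^ 'm) \<Rightarrow> complex ^ 'q) \<Rightarrow> (real \<Rightarrow> complex ^ 'm) \<Rightarrow> complex ^ 'q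
      \<Rightarrow> (real \<Rightarrow> complex ^ 'm) \<Rightarrow> bool" where
  "bvp_solution a b p n r A B f c y \<longleftrightarrow>
     y \<in> sobolev_space a b p (n + r) \<and>
     (if n = 0 then AE t in lebesgue_on {a<..<b}. diff_op a b r A y t = f t
      else \<forall>t\<in>{a<..<b}. diff_op a b r A y t = f t) \<and>
     B y = c"

text \<open>\<open>A l \<epsilon>\<close> and \<open>B \<epsilon>\<close> are the data at parameter value \<open>\<epsilon>\<close>.\<close>

definition depends_continuously ::
    "real \<Rightarrow> real \<Rightarrow> ereal \<Rightarrow> nat \<Rightarrow> nat \<Rightarrow> real \<Rightarrow> (nat \<Rightarrow> real \<Rightarrow> real \<Rightarrow> complex ^ 'm ^ 'm)
      \<Rightarrow> (real \<Rightarrow> (real \<Rightarrow> complex ^ 'm) \<Rightarrow> complex ^ 'q) \<Rightarrow> bool" where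
  "depends_continuously a b p n r \<epsilon>0 A B \<longleftrightarrow>
     (\<exists>\<epsilon>1. 0 < \<epsilon>1 \<and> \<epsilon>1 < \<epsilon>0 \<and>
       (\<forall>\<epsilon>\<in>{0..<\<epsilon>1}. \<forall>f\<in>sobolev_space a b p n. \<forall>c.
          \<exists>y. bvp_solution a b p n r (\<lambda>l. A l \<epsilon>) (B \<epsilon>) f c y \<and>
              (\<forall>z. bvp_solution a b p n r (\<lambda>l. A l \<epsilon>) (B \<epsilon>) f c z \<longrightarrow> (\<forall>t\<in>{a..b}. z t = y t))) \<and>
       (\<forall>f c y.
          (\<forall>\<epsilon>\<in>{0..<\<epsilon>1}. f \<epsilon> \<in> sobolev_space a b p n) \<longrightarrow>
          (\<forall>\<epsilon>\<in>{0..<\<epsilon>1}. bvp_solution a b p n r (\<lambda>l. A l \<epsilon>) (B \<epsilon>) (f \<epsilon>) (c \<epsilon>) (y \<epsilon>)) \<longrightarrow>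
          ((\<lambda>\<epsilon>. sobolev_norm a b p n (\<lambda>t. f \<epsilon> t - f 0 t)) \<longlongrightarrow> 0) (at_right 0) \<longrightarrow>
          (c \<longlongrightarrow> c 0) (at_right 0) \<longrightarrow>
          ((\<lambda>\<epsilon>. sobolev_norm a b p (n + r) (\<lambda>t. y \<epsilon> t - y 0 t)) \<longlongrightarrow> 0) (at_right 0)))"

end

theory Submission
  imports Defs
begin

text \<open>
  A function lies in \<open>W\<^sub>p\<^sup>s\<^sup>+\<^sup>1\<close> iff it is a primitive of a function in \<open>W\<^sub>p\<^sup>s\<close>. Hence the operator \<open>L(\<epsilon>)\<close> together
  with the Cauchy data at \<open>a\<close> is boundedly invertible on the Sobolev scale: a contraction argument with an
  exponential weight gives solutions for integrable coefficients, Gronwall's inequality the a priori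
  estimate, and the equation itself the higher regularity.

  Sufficiency: solving with Cauchy data \<open>x\<close> turns the boundary condition into a square linear system
  \<open>\<Lambda>(\<epsilon>) x = c(\<epsilon>) - B(\<epsilon>) g(\<epsilon>)\<close>. Its matrix converges because \<open>B(\<epsilon>)\<close> is bounded uniformly near \<open>0\<close> (uniform
  boundedness principle), and it is invertible at \<open>0\<close> by uniqueness.

  Necessity: for fixed \<open>y\<close>, the solutions \<open>y(\<epsilon>)\<close> with data \<open>L(0) y\<close>, \<open>B(0) y\<close> tend to \<open>y\<close>, and
  \<open>(L(\<epsilon>) - L(0)) y = L(\<epsilon>) (y - y(\<epsilon>))\<close>; taking \<open>y = (t - a)\<^sup>l e\<^sub>i / l!\<close> and absorbing the error yields (I). Then the
  solutions with data \<open>L(\<epsilon>) y\<close>, \<open>B(0) y\<close> also tend to \<open>y\<close>, and their difference from \<open>y\<close> is a combination of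
  fundamental solutions with coefficient vector \<open>B(0) y - B(\<epsilon>) y\<close>, which yields (II).
\<close>

text \<open>The spaces are given by epsilon-delta absolute continuity and pointwise derivatives,
  while every estimate lives on integrals. Much of the work is therefore the fundamental theorem for
  Lebesgue integrals: a.e. differentiation, and a density for each absolutely continuous function.
  The top derivative is determined only a.e., so equations are read modulo \<open>eqW\<close>. Two
  obstacles shape the main argument. For necessity no bound on L(\<epsilon>) or B(\<epsilon>) near 0
  is at hand. The coefficient distance S(\<epsilon>) is shown to satisfy S \<le> const * (1 + S) *
  \<rho> with \<rho> -> 0, and the defect of B(\<epsilon>) is measured by B(0) alone, applied to
  solutions at parameter 0; in both cases the unknown returns with a factor tending to 0. For
  sufficiency, pointwise convergence of B(\<epsilon>) bounds each B(\<epsilon>) y only below a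
  threshold that depends on y, so uniform boundedness is applied along sequences \<epsilon> -> 0.
  The a priori estimate is used at parameter 0 when limits are taken, which makes its constant
  independent of \<epsilon>.\<close>

section \<open>Absolutely continuous functions on an interval\<close>

text \<open>The bad intervals form a Vitali covering, and Henstock's lemma bounds the total length of any
  disjoint family of fine ones.\<close>

lemma negligible_Henstock_bad_points:
  fixes f :: "real \<Rightarrow> 'a::euclidean_space"
  assumes f: "f integrable_on {a..b}" and "0 < c"
  defines "S \<equiv> {x. \<forall>d>0. \<exists>u v. u < v \<and> v - u < d \<and> x \<in> {u..v} \<and> {u..v} \<subseteq> {a..b} \<and>
      c * (v - u) \<le> norm ((v - u) *\<^sub>R f x - integral {u..v} f)}"
  shows "negligible S"
  unfolding negligible_outer_le
proof safe
  fix e :: real assume "e > 0"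
  \<comment> \<open>Henstock's sum is made smaller than \<open>e * c\<close> because each bad
    interval contributes at least \<open>c\<close> times its length; dividing by \<open>c\<close>
    leaves total length at most \<open>e\<close>.\<close>
  then have ec: "0 < e * c" using \<open>0 < c\<close> by simp
  have f': "f integrable_on cbox a b" using f by simp
  obtain \<gamma> where \<gamma>: "gauge \<gamma>"
    and fine: "\<And>p. \<lbrakk>p tagged_partial_division_of cbox a b; \<gamma> fine p\<rbrakk> \<Longrightarrow>
      (\<Sum>(x, k)\<in>p. norm (Henstock_Kurzweil_Integration.content k *\<^sub>R f x - integral k f)) < e * c"
    by (rule Henstock_lemma[OF f' ec]) blast
  \<comment> \<open>Index set of the Vitali covering: tagged bad intervals that are already fine for
    the gauge, so that any finite disjoint subfamily is a fine tagged partial division.\<close>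
  define K where "K = {(x, u, v). u < v \<and> x \<in> {u..v} \<and> {u..v} \<subseteq> {a..b} \<and> {u..v} \<subseteq> \<gamma> x \<and>
      c * (v - u) \<le> norm ((v - u) *\<^sub>R f x - integral {u..v} f)}"
  define m where "m = (\<lambda>(x::real, u::real, v::real). (u + v) / 2)"
  define r where "r = (\<lambda>(x::real, u::real, v::real). (v - u) / 2)"
  have cb: "cball (m (x, u, v)) (r (x, u, v)) = {u..v}" for x u v
    by (simp add: m_def r_def cball_eq_atLeastAtMost field_simps)
  obtain C where C: "countable C" "C \<subseteq> K"
    "pairwise (\<lambda>i j. disjnt (cball (m i) (r i)) (cball (m j) (r j))) C"
    "negligible (S - (\<Union>i\<in>C. cball (m i) (r i)))"
  proof (rule Vitali_covering_theorem_cballs)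
    show "0 < r i" if "i \<in> K" for i
      using that by (auto simp: K_def r_def)
    fix x d :: real assume x: "x \<in> S" and "0 < d"
    obtain d' where d': "d' > 0" "ball x d' \<subseteq> \<gamma> x"
      using \<gamma> by (metis gauge_def open_contains_ball)
    from x obtain u v where uv: "u < v" "v - u < min d d'" "x \<in> {u..v}" "{u..v} \<subseteq> {a..b}"
      "c * (v - u) \<le> norm ((v - u) *\<^sub>R f x - integral {u..v} f)"
      unfolding S_def mem_Collect_eq using \<open>0 < d\<close> \<open>0 < d'\<close> by (meson min_less_iff_conj)
    have "{u..v} \<subseteq> ball x d'"
      using uv by (auto simp: dist_real_def)
    then have "(x, u, v) \<in> K"
      using uv d' unfolding K_def by auto
    moreover have "x \<in> cball (m (x, u, v)) (r (x, u, v))" "r (x, u, v) < d"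
      unfolding cb using uv by (auto simp: r_def)
    ultimately show "\<exists>i. i \<in> K \<and> x \<in> cball (m i) (r i) \<and> r i < d" by blast
  qed
  have bound: "measure lebesgue (\<Union>i\<in>F. cball (m i) (r i)) \<le> e" if F: "F \<subseteq> C" "finite F" for F
  proof -
    define p where "p = (\<lambda>(x, u, v). (x, {u..v})) ` F"
    have FK: "i \<in> K" if "i \<in> F" for i using F C that by auto
    have "p tagged_partial_division_of cbox a b"
      unfolding tagged_partial_division_of_def
    proof (intro conjI allI impI)
      show "finite p" using F by (simp add: p_def)
      show "x \<in> k" "k \<subseteq> cbox a b" "\<exists>a b. k = cbox a b" if xk: "(x, k) \<in> p" for x k
      proof -
        obtain u v where uv: "(x, u, v) \<in> F" "k = {u..v}" using xk by (auto simp: p_def)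
        then have "x \<in> {u..v} \<and> {u..v} \<subseteq> {a..b}" using FK unfolding K_def by blast
        then show "x \<in> k" "k \<subseteq> cbox a b" "\<exists>a b. k = cbox a b" using uv by auto
      qed
      fix x1 k1 x2 k2 assume *: "(x1, k1) \<in> p \<and> (x2, k2) \<in> p \<and> (x1, k1) \<noteq> (x2, k2)"
      then obtain u1 v1 u2 v2 where q: "(x1, u1, v1) \<in> F" "k1 = {u1..v1}" "(x2, u2, v2) \<in> F" "k2 = {u2..v2}"
        by (auto simp: p_def)
      then have "(x1, u1, v1) \<noteq> (x2, u2, v2)" using * by auto
      then have "disjnt k1 k2"
        using C(3) q F unfolding pairwise_def by (metis cb subsetD)
      then show "interior k1 \<inter> interior k2 = {}"
        using interior_subset unfolding disjnt_def by fast
    qed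
    moreover have "\<gamma> fine p"
      using FK by (auto simp: p_def fine_def K_def)
    ultimately have less: "(\<Sum>(x, k)\<in>p. norm (Henstock_Kurzweil_Integration.content k *\<^sub>R f x - integral k f)) < e * c"
      by (rule fine)
    have inj: "inj_on (\<lambda>(x, u, v). (x, {u..v})) F"
      using FK by (fastforce simp: inj_on_def K_def)
    have "measure lebesgue (\<Union>i\<in>F. cball (m i) (r i)) \<le> (\<Sum>i\<in>F. measure lebesgue (cball (m i) (r i)))"
      using F by (intro measure_UNION_le) auto
    also have "\<dots> = (\<Sum>(x, u, v)\<in>F. v - u)"
      using FK by (intro sum.cong) (force simp: cb K_def)+
    also have "c * \<dots> \<le> (\<Sum>(x, u, v)\<in>F. norm ((v - u) *\<^sub>R f x - integral {u..v} f))"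
      unfolding sum_distrib_left using FK by (intro sum_mono) (auto simp: K_def)
    also have "\<dots> = (\<Sum>(x, k)\<in>p. norm (Henstock_Kurzweil_Integration.content k *\<^sub>R f x - integral k f))"
      unfolding p_def sum.reindex[OF inj]
    proof (intro sum.cong refl)
      fix i assume i: "i \<in> F"
      obtain x u v where xuv: "i = (x, u, v)" by (metis surj_pair)
      with FK[OF i] have "u < v" by (auto simp: K_def)
      then show "(case i of (x, u, v) \<Rightarrow> norm ((v - u) *\<^sub>R f x - integral {u..v} f)) =
          ((\<lambda>(x, k). norm (Henstock_Kurzweil_Integration.content k *\<^sub>R f x - integral k f)) \<circ> (\<lambda>(x, u, v). (x, {u..v}))) i"
        by (simp add: xuv)
    qed
    also note less
    finally show ?thesis using \<open>0 < c\<close> by (simp add: mult.commute)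
  qed
  \<comment> \<open>The bound for finite subfamilies passes to the countable union, and the part of
    \<open>S\<close> that the selected balls miss is negligible.\<close>
  let ?U = "\<Union>i\<in>C. cball (m i) (r i)"
  let ?T = "?U \<union> (S - ?U)"
  have m1: "?U \<in> lmeasurable" and m2: "measure lebesgue ?U \<le> e"
    using fmeasurable_UN_bound[OF C(1), of "\<lambda>i. cball (m i) (r i)" lebesgue e]
      measure_UN_bound[OF C(1), of "\<lambda>i. cball (m i) (r i)" lebesgue e] bound by auto
  have m3: "S - ?U \<in> lmeasurable" "measure lebesgue (S - ?U) = 0"
    using C(4) by (auto simp: negligible_iff_measure)
  show "\<exists>T. S \<subseteq> T \<and> T \<in> lmeasurable \<and> measure lebesgue T \<le> e"
  proof (intro exI[of _ ?T] conjI)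
    show "?T \<in> lmeasurable" using m1 m3 by blast
    have "measure lebesgue ?T \<le> measure lebesgue ?U + measure lebesgue (S - ?U)"
      using m1 m3 by (intro measure_Un_le) (auto simp: fmeasurableD)
    then show "measure lebesgue ?T \<le> e" using m2 m3 by simp
  qed blast
qed

lemma AE_lebesgue_on_negligible:
  "S \<in> sets lebesgue \<Longrightarrow> (AE x in lebesgue_on S. P x) \<longleftrightarrow> negligible {x\<in>S. \<not> P x}"
proof -
  assume S: "S \<in> sets lebesgue"
  have "(AE x in lebesgue_on S. P x) \<longleftrightarrow> (AE x in lebesgue. x \<in> S \<longrightarrow> P x)"
    using S by (subst AE_restrict_space_iff) auto
  also have "\<dots> \<longleftrightarrow> negligible {x\<in>S. \<not> P x}"
    unfolding eventually_ae_filter_negligible using negligible_subset by (auto intro!: exI[of _ "{x \<in> S. \<not> P x}"])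
  finally show ?thesis .
qed

text \<open>At a point outside every bad set for \<open>1 / Suc n\<close>, all short intervals
  containing the point have error at most any prescribed multiple of their length. Intervals having
  the point as an end point then give the difference quotients from both sides.\<close>

lemma has_vector_derivative_integral_AE:
  fixes f :: "real \<Rightarrow> 'a::euclidean_space"
  assumes f: "f integrable_on {a..b}"
  shows "AE x in lebesgue_on {a..b}. ((\<lambda>t. integral {a..t} f) has_vector_derivative f x) (at x within {a..b})"
proof -
  define S where "S c = {x. \<forall>d>0. \<exists>u v. u < v \<and> v - u < d \<and> x \<in> {u..v} \<and> {u..v} \<subseteq> {a..b} \<and>
      c * (v - u) \<le> norm ((v - u) *\<^sub>R f x - integral {u..v} f)}" for c
  have "negligible (S c)" if "c > 0" for c
    unfolding S_def by (rule negligible_Henstock_bad_points[OF f that])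
  then have "negligible (\<Union>n. S (1 / real (Suc n)))"
    by (intro negligible_countable_Union) auto
  moreover have "((\<lambda>t. integral {a..t} f) has_vector_derivative f x) (at x within {a..b})"
    if x: "x \<in> {a..b}" "x \<notin> (\<Union>n. S (1 / real (Suc n)))" for x
    unfolding has_vector_derivative_def has_derivative_within_alt
  proof (intro conjI allI impI)
    show "bounded_linear (\<lambda>h. h *\<^sub>R f x)" by (rule bounded_linear_scaleR_left)
    fix e :: real assume "0 < e"
    then obtain n where n: "1 / real (Suc n) < e" using nat_approx_posE by auto
    from x have "x \<notin> S (1 / real (Suc n))" by blast
    then obtain d where "d > 0" and nd: "\<not> (\<exists>u v. u < v \<and> v - u < d \<and> x \<in> {u..v} \<and> {u..v} \<subseteq> {a..b} \<and>
      (1 / real (Suc n)) * (v - u) \<le> norm ((v - u) *\<^sub>R f x - integral {u..v} f))"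
      unfolding S_def mem_Collect_eq by blast
    have d: "norm ((v - u) *\<^sub>R f x - integral {u..v} f) < (1 / real (Suc n)) * (v - u)"
      if "u < v" "v - u < d" "x \<in> {u..v}" "{u..v} \<subseteq> {a..b}" for u v
      using nd that not_less by blast
    have d: "norm ((v - u) *\<^sub>R f x - integral {u..v} f) \<le> e * (v - u)"
      if "u < v" "v - u < d" "x \<in> {u..v}" "{u..v} \<subseteq> {a..b}" for u v
      using d[OF that] n that mult_right_mono[of "1 / real (Suc n)" e "v - u"] by linarith
    have diff: "integral {a..v} f - integral {a..u} f = integral {u..v} f" if "a \<le> u" "u \<le> v" "v \<le> b" for u v
    proof -
      have "integral {a..u} f + integral {u..v} f = integral {a..v} f"
        using that by (intro Henstock_Kurzweil_Integration.integral_combine integrable_subinterval_real[OF f]) auto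
      then show ?thesis by (simp add: algebra_simps)
    qed
    show "\<exists>d>0. \<forall>y\<in>{a..b}. norm (y - x) < d \<longrightarrow>
        norm (integral {a..y} f - integral {a..x} f - (y - x) *\<^sub>R f x) \<le> e * norm (y - x)"
    proof (intro exI[of _ d] conjI ballI impI \<open>d > 0\<close>)
      fix y assume y: "y \<in> {a..b}" "norm (y - x) < d"
      consider "y < x" | "y = x" | "x < y" by linarith
      then show "norm (integral {a..y} f - integral {a..x} f - (y - x) *\<^sub>R f x) \<le> e * norm (y - x)"
      proof cases
        case 1
        have "integral {a..y} f - integral {a..x} f - (y - x) *\<^sub>R f x = (x - y) *\<^sub>R f x - integral {y..x} f"
          using diff[of y x] 1 x y by (simp add: algebra_simps)
        with d[of y x] 1 x y show ?thesis by (auto simp: abs_if)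
      next
        case 3
        have "integral {a..y} f - integral {a..x} f - (y - x) *\<^sub>R f x = - ((y - x) *\<^sub>R f x - integral {x..y} f)"
          using diff[of x y] 3 x y by (simp add: algebra_simps)
        then have "norm (integral {a..y} f - integral {a..x} f - (y - x) *\<^sub>R f x) = norm ((y - x) *\<^sub>R f x - integral {x..y} f)"
          by (simp only: norm_minus_cancel)
        with d[of x y] 3 x y show ?thesis by (auto simp: abs_if)
      qed auto
    qed
  qed
  ultimately show ?thesis
    by (subst AE_lebesgue_on_negligible) (auto elim!: negligible_subset)
qed

text \<open>Truncation at a level \<open>n\<close>: the excess \<open>h - min h n\<close> has small
  integral over the whole interval by dominated convergence, and the truncated part contributes at
  most \<open>n\<close> times the total length.\<close>

lemma integral_small_on_divisions:
  fixes h :: "real \<Rightarrow> real"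
  assumes h: "integrable (lebesgue_on {a..b}) h" "\<And>t. 0 \<le> h t" and "e > 0"
  obtains \<delta> where "\<delta> > 0" "\<And>d. \<lbrakk>d division_of \<Union>d; \<Union>d \<subseteq> {a..b}; (\<Sum>K\<in>d. Sup K - Inf K) < \<delta>\<rbrakk>
      \<Longrightarrow> (\<Sum>K\<in>d. integral K h) < e"
proof -
  let ?M = "lebesgue_on {a..b}"
  have int: "integrable ?M (\<lambda>t. min (h t) (real n))" for n
    by (rule Bochner_Integration.integrable_bound[OF h(1)]) (use h in auto)
  have "(\<lambda>n. LINT t|?M. min (h t) (real n)) \<longlonglongrightarrow> (LINT t|?M. h t)"
  proof (rule integral_dominated_convergence[where w = h])
    show "AE x in ?M. (\<lambda>n. min (h x) (real n)) \<longlonglongrightarrow> h x"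
    proof (intro AE_I2)
      fix x
      obtain N :: nat where "h x \<le> real N" using real_arch_simple by blast
      then have "eventually (\<lambda>n. min (h x) (real n) = h x) sequentially"
        by (intro eventually_sequentiallyI[of N]) (auto simp: min_def)
      then show "(\<lambda>n. min (h x) (real n)) \<longlonglongrightarrow> h x" by (rule tendsto_eventually)
    qed
  qed (use h in auto)
  then have "eventually (\<lambda>n. (LINT t|?M. h t) - (LINT t|?M. min (h t) (real n)) < e / 2) sequentially"
    by (intro order_tendstoD(2)[of _ "(LINT t|?M. h t) - (LINT t|?M. h t)"] tendsto_intros) (use \<open>e > 0\<close> in auto)
  then obtain n :: nat where n: "(LINT t|?M. h t) - (LINT t|?M. min (h t) (real n)) < e / 2"
    by (auto simp: eventually_sequentially)
  define g where "g t = min (h t) (real n)" for t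
  have gi: "integrable ?M g" unfolding g_def by (rule int)
  have gI: "g integrable_on {a..b}" and hI: "h integrable_on {a..b}"
    using gi h by (auto intro: integrable_on_lebesgue_on)
  have small: "integral {a..b} (\<lambda>t. h t - g t) < e / 2"
    using n[folded g_def] lebesgue_integral_eq_integral[OF h(1)] lebesgue_integral_eq_integral[OF gi]
      Henstock_Kurzweil_Integration.integral_diff[OF hI gI] by simp
  \<comment> \<open>Half of \<open>e\<close> pays for the excess and half for the truncated part;
    \<open>n + 1\<close> keeps the denominator positive when \<open>n = 0\<close>.\<close>
  show ?thesis
  proof (rule that[of "e / (2 * (real n + 1))"])
    show "e / (2 * (real n + 1)) > 0" using \<open>e > 0\<close> by simp
    fix d :: "real set set" assume d: "d division_of \<Union>d" "\<Union>d \<subseteq> {a..b}"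
      and len: "(\<Sum>K\<in>d. Sup K - Inf K) < e / (2 * (real n + 1))"
    have Kab: "\<exists>u v. K = {u..v} \<and> u \<le> v \<and> {u..v} \<subseteq> {a..b}" if Kd: "K \<in> d" for K
      using division_ofD(2-4)[OF d(1) Kd] d(2) by (metis atLeastatMost_empty_iff2 cbox_interval order_trans)
    have sub: "f integrable_on K" if "f integrable_on {a..b}" "K \<in> d" for f :: "real \<Rightarrow> real" and K
      using Kab[OF that(2)] that(1) integrable_on_subinterval by blast
    have dI: "(\<lambda>t. h t - g t) integrable_on {a..b}" using hI gI by (rule Henstock_Kurzweil_Integration.integrable_diff)
    have "(\<Sum>K\<in>d. integral K h) = (\<Sum>K\<in>d. integral K g) + (\<Sum>K\<in>d. integral K (\<lambda>t. h t - g t))"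
      unfolding sum.distrib[symmetric]
      by (intro sum.cong refl) (simp add: Henstock_Kurzweil_Integration.integral_diff sub hI gI)
    moreover have "(\<Sum>K\<in>d. integral K g) \<le> (\<Sum>K\<in>d. real n * (Sup K - Inf K))"
    proof (rule sum_mono)
      fix K assume K: "K \<in> d"
      then obtain u v where uv: "K = {u..v}" "u \<le> v" using Kab by blast
      have "integral K g \<le> integral K (\<lambda>_. real n)"
        unfolding uv(1) by (rule integral_le) (use sub[OF gI K] uv in \<open>auto simp: g_def\<close>)
      then show "integral K g \<le> real n * (Sup K - Inf K)"
        using uv by (simp add: mult.commute)
    qed
    moreover have "\<dots> \<le> (real n + 1) * (\<Sum>K\<in>d. Sup K - Inf K)"
      unfolding sum_distrib_left using Kab by (intro sum_mono mult_right_mono) fastforce+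
    moreover have "\<dots> < e / 2"
      using len by (simp add: field_simps)
    moreover have "(\<Sum>K\<in>d. integral K (\<lambda>t. h t - g t)) = integral (\<Union>d) (\<lambda>t. h t - g t)"
      by (rule integral_combine_division_bottomup[OF d(1), symmetric]) (rule sub[OF dI])
    moreover have "integral (\<Union>d) (\<lambda>t. h t - g t) \<le> integral {a..b} (\<lambda>t. h t - g t)"
    proof (rule integral_subset_le[OF d(2)])
      show "(\<lambda>t. h t - g t) integrable_on \<Union> d"
        by (rule integrable_combine_division[OF d(1)]) (rule sub[OF dI])
    qed (use dI in \<open>auto simp: g_def\<close>)
    ultimately show "(\<Sum>K\<in>d. integral K h) < e" using small by linarith
  qed
qed

lemma abs_continuous_on_integral:
  fixes f :: "real \<Rightarrow> 'a::euclidean_space"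
  assumes f: "integrable (lebesgue_on {a..b}) f"
  shows "abs_continuous_on a b (\<lambda>t. integral {a..t} f)"
  unfolding abs_continuous_on_def
proof (intro allI impI)
  fix e :: real assume "e > 0"
  have nf: "integrable (lebesgue_on {a..b}) (\<lambda>t. norm (f t))" using f by simp
  obtain \<delta> where \<delta>: "\<delta> > 0" "\<And>d. \<lbrakk>d division_of \<Union>d; \<Union>d \<subseteq> {a..b}; (\<Sum>K\<in>d. Sup K - Inf K) < \<delta>\<rbrakk>
      \<Longrightarrow> (\<Sum>K\<in>d. integral K (\<lambda>t. norm (f t))) < e"
    by (rule integral_small_on_divisions[OF nf norm_ge_zero \<open>e > 0\<close>]) blast
  have fI: "f integrable_on {a..b}" "(\<lambda>t. norm (f t)) integrable_on {a..b}"
    using f nf by (auto intro: integrable_on_lebesgue_on)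
  have "(\<Sum>K\<in>d. norm (integral {a..Sup K} f - integral {a..Inf K} f)) < e"
    if d: "d division_of \<Union>d" "\<Union>d \<subseteq> {a..b}" "(\<Sum>K\<in>d. Sup K - Inf K) < \<delta>" for d
  proof -
    have "norm (integral {a..Sup K} f - integral {a..Inf K} f) \<le> integral K (\<lambda>t. norm (f t))" if Kd: "K \<in> d" for K
    proof -
      obtain u v where uv: "K = {u..v}" "u \<le> v" "{u..v} \<subseteq> {a..b}"
        using division_ofD(2-4)[OF d(1) Kd] d(2) by (metis atLeastatMost_empty_iff2 cbox_interval order_trans)
      have "integral {a..u} f + integral {u..v} f = integral {a..v} f"
        using uv by (intro Henstock_Kurzweil_Integration.integral_combine integrable_subinterval_real[OF fI(1)]) auto
      then have "integral {a..v} f - integral {a..u} f = integral {u..v} f" by (simp add: algebra_simps)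
      then have "integral {a..Sup K} f - integral {a..Inf K} f = integral {u..v} f"
        using uv by simp
      also have "norm \<dots> \<le> integral {u..v} (\<lambda>t. norm (f t))"
        using uv by (intro integral_norm_bound_integral integrable_subinterval_real[OF fI(1)]
          integrable_subinterval_real[OF fI(2)]) auto
      finally show ?thesis using uv by simp
    qed
    then have "(\<Sum>K\<in>d. norm (integral {a..Sup K} f - integral {a..Inf K} f)) \<le> (\<Sum>K\<in>d. integral K (\<lambda>t. norm (f t)))"
      by (rule sum_mono)
    with \<delta>(2)[OF d] show ?thesis by simp
  qed
  with \<delta>(1) show "\<exists>\<delta>>0. \<forall>d. d division_of \<Union> d \<and> \<Union> d \<subseteq> {a..b} \<and> (\<Sum>K\<in>d. Sup K - Inf K) < \<delta> \<longrightarrow>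
        (\<Sum>K\<in>d. norm (integral {a..Sup K} f - integral {a..Inf K} f)) < e" by blast
qed

section \<open>Interval families and total variation\<close>

text \<open>A pair \<open>(u, v)\<close> stands for the interval \<open>[u, v]\<close>. Degenerate intervals are excluded, so that families
  over non-overlapping intervals are disjoint as sets of pairs.\<close>

definition interval_families :: "real \<Rightarrow> real \<Rightarrow> (real \<times> real) set set" where
  "interval_families a b = {P. finite P \<and> (\<forall>p\<in>P. a \<le> fst p \<and> fst p < snd p \<and> snd p \<le> b) \<and>
     (\<forall>p\<in>P. \<forall>q\<in>P. p \<noteq> q \<longrightarrow> snd p \<le> fst q \<or> snd q \<le> fst p)}"

lemma interval_familiesD:
  assumes "P \<in> interval_families a b"
  shows "finite P" "\<And>p. p \<in> P \<Longrightarrow> a \<le> fst p \<and> fst p < snd p \<and> snd p \<le> b"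
    "\<And>p q. p \<in> P \<Longrightarrow> q \<in> P \<Longrightarrow> p = q \<or> snd p \<le> fst q \<or> snd q \<le> fst p"
  using assms unfolding interval_families_def by blast+

lemma interval_familiesI:
  assumes "finite P" "\<And>p. p \<in> P \<Longrightarrow> a \<le> fst p \<and> fst p < snd p \<and> snd p \<le> b"
    "\<And>p q. p \<in> P \<Longrightarrow> q \<in> P \<Longrightarrow> p = q \<or> snd p \<le> fst q \<or> snd q \<le> fst p"
  shows "P \<in> interval_families a b"
  using assms unfolding interval_families_def by blast

text \<open>Passes from divisions to pairs of end points, which can be cut and glued by elementary
  order arguments.\<close>

lemma abs_continuous_onD:
  assumes "abs_continuous_on a b f" "e > 0"
  obtains \<delta> where "\<delta> > 0" "\<And>P. \<lbrakk>P \<in> interval_families a b; (\<Sum>p\<in>P. snd p - fst p) < \<delta>\<rbrakk>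
    \<Longrightarrow> (\<Sum>p\<in>P. norm (f (snd p) - f (fst p))) < e"
proof -
  have "\<exists>\<delta>>0. \<forall>d. d division_of \<Union>d \<and> \<Union>d \<subseteq> {a..b} \<and> (\<Sum>K\<in>d. Sup K - Inf K) < \<delta> \<longrightarrow>
        (\<Sum>K\<in>d. norm (f (Sup K) - f (Inf K))) < e"
    using assms unfolding abs_continuous_on_def by blast
  then obtain \<delta> where \<delta>: "\<delta> > 0" "\<forall>d. d division_of \<Union>d \<and> \<Union>d \<subseteq> {a..b} \<and> (\<Sum>K\<in>d. Sup K - Inf K) < \<delta> \<longrightarrow>
        (\<Sum>K\<in>d. norm (f (Sup K) - f (Inf K))) < e"
    by blast
  show ?thesis
  proof (rule that[OF \<delta>(1)])
    fix P assume P: "P \<in> interval_families a b" and len: "(\<Sum>p\<in>P. snd p - fst p) < \<delta>"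
    note fam = interval_familiesD[OF P]
    let ?d = "(\<lambda>p. {fst p..snd p}) ` P"
    have lt: "a \<le> fst p" "fst p < snd p" "snd p \<le> b" if "p \<in> P" for p
      using fam(2)[OF that] by auto
    have le: "fst p \<le> snd p" if "p \<in> P" for p
      using lt[OF that] by simp
    have inj: "inj_on (\<lambda>p. {fst p..snd p}) P"
      using le by (auto simp: inj_on_def Icc_eq_Icc prod_eq_iff)
    have "?d division_of \<Union>?d"
      unfolding division_of_def
    proof (intro conjI ballI impI)
      show "finite ?d" using fam by auto
      show "\<exists>a b. K = cbox a b" "K \<noteq> {}" if K: "K \<in> ?d" for K
      proof -
        obtain p where p: "p \<in> P" "K = {fst p..snd p}" using K by auto
        then have "K = cbox (fst p) (snd p)" by simp
        then show "\<exists>a b. K = cbox a b" by blast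
        show "K \<noteq> {}" using p le by simp
      qed
      fix K1 K2 assume K: "K1 \<in> ?d" "K2 \<in> ?d" "K1 \<noteq> K2"
      then obtain p q where q: "p \<in> P" "K1 = {fst p..snd p}" "q \<in> P" "K2 = {fst q..snd q}" "p \<noteq> q"
        by auto
      then have "snd p \<le> fst q \<or> snd q \<le> fst p"
        using fam(3) by blast
      then show "interior K1 \<inter> interior K2 = {}" using q by auto
    qed auto
    moreover have "\<Union>?d \<subseteq> {a..b}" using fam(2) by fastforce
    moreover have "(\<Sum>K\<in>?d. Sup K - Inf K) = (\<Sum>p\<in>P. snd p - fst p)"
      unfolding sum.reindex[OF inj] by (intro sum.cong) (auto simp: le)
    moreover have "(\<Sum>K\<in>?d. norm (f (Sup K) - f (Inf K))) = (\<Sum>p\<in>P. norm (f (snd p) - f (fst p)))"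
      unfolding sum.reindex[OF inj] by (intro sum.cong) (auto simp: le)
    ultimately show "(\<Sum>p\<in>P. norm (f (snd p) - f (fst p))) < e"
      using \<delta>(2)[rule_format, of ?d] len by simp
  qed
qed

text \<open>Two members meet at most in an end point, so lengths add up to the measure of the
  union.\<close>

lemma interval_families_length:
  assumes P: "P \<in> interval_families a b"
  shows "(\<Sum>p\<in>P. snd p - fst p) = measure lebesgue (\<Union>p\<in>P. {fst p..snd p})"
    "a \<le> b \<Longrightarrow> (\<Sum>p\<in>P. snd p - fst p) \<le> b - a"
proof -
  note fam = interval_familiesD[OF P]
  have neg: "negligible ({fst p..snd p} \<inter> {fst q..snd q})" if "p \<in> P" "q \<in> P" "p \<noteq> q" for p q
  proof -
    have "{fst p..snd p} \<inter> {fst q..snd q} \<subseteq> {snd p} \<union> {snd q}"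
      using fam(3)[OF that(1,2)] that(3) by auto
    then show ?thesis by (rule negligible_subset[rotated]) (simp add: negligible_Un)
  qed
  have "measure lebesgue (\<Union>p\<in>P. {fst p..snd p}) = (\<Sum>p\<in>P. measure lebesgue {fst p..snd p})"
    using neg by (intro measure_negligible_finite_Union_image fam(1)) (auto simp: pairwise_def)
  also have "\<dots> = (\<Sum>p\<in>P. snd p - fst p)"
    using fam(2) by (intro sum.cong) (auto simp: less_imp_le)
  finally show eq: "(\<Sum>p\<in>P. snd p - fst p) = measure lebesgue (\<Union>p\<in>P. {fst p..snd p})" by simp
  have "measure lebesgue (\<Union>p\<in>P. {fst p..snd p}) \<le> measure lebesgue {a..b}"
    using fam(1,2) by (intro measure_mono_fmeasurable) (fastforce intro!: sets.finite_UN)+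
  then show "(\<Sum>p\<in>P. snd p - fst p) \<le> b - a" if "a \<le> b" using eq that by simp
qed

text \<open>Intervals straddling \<open>t\<close> are cut there and the triangle inequality pays for
  the cut. The cut point may lie anywhere; one of the two families is empty if it misses
  \<open>[s, u]\<close> on one side.\<close>

lemma interval_families_split:
  fixes F :: "real \<Rightarrow> 'a::real_normed_vector"
  assumes P: "P \<in> interval_families s u"
  obtains P1 P2 where "P1 \<in> interval_families s t" "P2 \<in> interval_families t u"
    "(\<Sum>p\<in>P. norm (F (snd p) - F (fst p)))
      \<le> (\<Sum>p\<in>P1. norm (F (snd p) - F (fst p))) + (\<Sum>p\<in>P2. norm (F (snd p) - F (fst p)))"
proof -
  note fam = interval_familiesD[OF P]
  define Q1 where "Q1 = {p\<in>P. fst p < t}"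
  define Q2 where "Q2 = {p\<in>P. t < snd p}"
  define P1 where "P1 = (\<lambda>p. (fst p, min (snd p) t)) ` Q1"
  define P2 where "P2 = (\<lambda>p. (max (fst p) t, snd p)) ` Q2"
  have Q: "p \<in> P" if "p \<in> Q1 \<or> p \<in> Q2" for p using that by (auto simp: Q1_def Q2_def)
  have d: "p = q \<or> (snd p \<le> fst q \<and> fst p < fst q \<and> snd p < snd q) \<or> (snd q \<le> fst p \<and> fst q < fst p \<and> snd q < snd p)"
    if "p \<in> P" "q \<in> P" for p q
    using fam(3)[OF that] fam(2)[OF that(1)] fam(2)[OF that(2)] by argo
  \<comment> \<open>Cutting moves only right end points in \<open>Q1\<close> and only left end
    points in \<open>Q2\<close>; the end points left in place already distinguish the
    members.\<close>
  have i1: "inj_on (\<lambda>p. (fst p, min (snd p) t)) Q1"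
    using d Q unfolding inj_on_def by (metis fst_conv less_irrefl)
  have i2: "inj_on (\<lambda>p. (max (fst p) t, snd p)) Q2"
    using d Q unfolding inj_on_def by (metis snd_conv less_irrefl)
  have "P1 \<in> interval_families s t"
  proof (rule interval_familiesI)
    show "finite P1" using fam(1) by (simp add: P1_def Q1_def)
    show "s \<le> fst p \<and> fst p < snd p \<and> snd p \<le> t" if "p \<in> P1" for p
      using that fam(2) by (auto simp: P1_def Q1_def)
    show "p = q \<or> snd p \<le> fst q \<or> snd q \<le> fst p" if pq: "p \<in> P1" "q \<in> P1" for p q
    proof -
      obtain p' q' where "p' \<in> Q1" "p = (fst p', min (snd p') t)" "q' \<in> Q1" "q = (fst q', min (snd q') t)"
        using pq by (auto simp: P1_def)
      then show ?thesis using d[of p' q'] Q by auto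
    qed
  qed
  moreover have "P2 \<in> interval_families t u"
  proof (rule interval_familiesI)
    show "finite P2" using fam(1) by (simp add: P2_def Q2_def)
    show "t \<le> fst p \<and> fst p < snd p \<and> snd p \<le> u" if "p \<in> P2" for p
      using that fam(2) by (auto simp: P2_def Q2_def)
    show "p = q \<or> snd p \<le> fst q \<or> snd q \<le> fst p" if pq: "p \<in> P2" "q \<in> P2" for p q
    proof -
      obtain p' q' where "p' \<in> Q2" "p = (max (fst p') t, snd p')" "q' \<in> Q2" "q = (max (fst q') t, snd q')"
        using pq by (auto simp: P2_def)
      then show ?thesis using d[of p' q'] Q by auto
    qed
  qed
  moreover have "(\<Sum>p\<in>P. norm (F (snd p) - F (fst p)))
      \<le> (\<Sum>p\<in>P1. norm (F (snd p) - F (fst p))) + (\<Sum>p\<in>P2. norm (F (snd p) - F (fst p)))"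
  proof -
    have "(\<Sum>p\<in>P1. norm (F (snd p) - F (fst p))) = (\<Sum>p\<in>Q1. norm (F (min (snd p) t) - F (fst p)))"
      unfolding P1_def sum.reindex[OF i1] by simp
    also have "\<dots> = (\<Sum>p\<in>P. if fst p < t then norm (F (min (snd p) t) - F (fst p)) else 0)"
      unfolding Q1_def using fam(1) by (simp add: sum.inter_filter)
    finally have 1: "(\<Sum>p\<in>P1. norm (F (snd p) - F (fst p))) = \<dots>" .
    have "(\<Sum>p\<in>P2. norm (F (snd p) - F (fst p))) = (\<Sum>p\<in>Q2. norm (F (snd p) - F (max (fst p) t)))"
      unfolding P2_def sum.reindex[OF i2] by simp
    also have "\<dots> = (\<Sum>p\<in>P. if t < snd p then norm (F (snd p) - F (max (fst p) t)) else 0)"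
      unfolding Q2_def using fam(1) by (simp add: sum.inter_filter)
    finally have 2: "(\<Sum>p\<in>P2. norm (F (snd p) - F (fst p))) = \<dots>" .
    have tri: "norm (F y - F x) \<le> norm (F t - F x) + norm (F y - F t)" for x y
      using norm_triangle_ineq[of "F t - F x" "F y - F t"] by simp
    show ?thesis unfolding 1 2 sum.distrib[symmetric]
    proof (rule sum_mono)
      fix p assume "p \<in> P"
      then show "norm (F (snd p) - F (fst p)) \<le> (if fst p < t then norm (F (min (snd p) t) - F (fst p)) else 0)
         + (if t < snd p then norm (F (snd p) - F (max (fst p) t)) else 0)"
        using fam(2)[of p] tri[of "snd p" "fst p"] by (auto simp: min_def max_def)
    qed
  qed
  ultimately show ?thesis by (rule that)
qed

text \<open>Refinement of a family. The subfamilies are disjoint as sets of pairs because a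
  nondegenerate interval cannot lie in two non-overlapping ones.\<close>

lemma interval_families_Un:
  fixes g :: "real \<times> real \<Rightarrow> real"
  assumes P: "P \<in> interval_families a b" and Q: "\<And>p. p \<in> P \<Longrightarrow> Q p \<in> interval_families (fst p) (snd p)"
  shows "(\<Union>p\<in>P. Q p) \<in> interval_families a b" "(\<Sum>q\<in>(\<Union>p\<in>P. Q p). g q) = (\<Sum>p\<in>P. \<Sum>q\<in>Q p. g q)"
proof -
  note fam = interval_familiesD[OF P] and famQ = interval_familiesD[OF Q]
  show "(\<Union>p\<in>P. Q p) \<in> interval_families a b"
  proof (rule interval_familiesI)
    show "finite (\<Union>p\<in>P. Q p)" using fam(1) famQ(1) by blast
    fix x assume "x \<in> (\<Union>p\<in>P. Q p)"
    then obtain p where p: "p \<in> P" "x \<in> Q p" by auto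
    then show "a \<le> fst x \<and> fst x < snd x \<and> snd x \<le> b"
      using fam(2)[of p] famQ(2)[of p x] by auto
    fix y assume "y \<in> (\<Union>p\<in>P. Q p)"
    then obtain q where q: "q \<in> P" "y \<in> Q q" by auto
    show "x = y \<or> snd x \<le> fst y \<or> snd y \<le> fst x"
    proof (cases "p = q")
      case True then show ?thesis using famQ(3)[of p x y] p q by blast
    next
      case False then show ?thesis
        using fam(3)[OF p(1) q(1)] famQ(2)[OF p] famQ(2)[OF q] by auto
    qed
  qed
  show "(\<Sum>q\<in>(\<Union>p\<in>P. Q p). g q) = (\<Sum>p\<in>P. \<Sum>q\<in>Q p. g q)"
  proof (rule sum.UNION_disjoint[OF fam(1)])
    show "\<forall>p\<in>P. finite (Q p)" using famQ(1) by blast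
    show "\<forall>i\<in>P. \<forall>j\<in>P. i \<noteq> j \<longrightarrow> Q i \<inter> Q j = {}"
    proof (intro ballI impI)
      fix i j assume ij: "i \<in> P" "j \<in> P" "i \<noteq> j"
      show "Q i \<inter> Q j = {}"
      proof (rule ccontr)
        assume "Q i \<inter> Q j \<noteq> {}"
        then obtain x where "x \<in> Q i" "x \<in> Q j" by auto
        then show False using fam(3)[OF ij(1,2)] famQ(2)[OF ij(1), of x] famQ(2)[OF ij(2), of x] ij(3) by auto
      qed
    qed
  qed
qed

lemma interval_families_Un2:
  fixes g :: "real \<times> real \<Rightarrow> real"
  assumes "P \<in> interval_families s t" "Q \<in> interval_families t u" "s \<le> t" "t \<le> u"
  shows "P \<union> Q \<in> interval_families s u" "(\<Sum>q\<in>P \<union> Q. g q) = (\<Sum>q\<in>P. g q) + (\<Sum>q\<in>Q. g q)"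
proof -
  note famP = interval_familiesD[OF assms(1)] and famQ = interval_familiesD[OF assms(2)]
  show "P \<union> Q \<in> interval_families s u"
    by (rule interval_familiesI) (use famP famQ assms(3,4) in \<open>fastforce+\<close>)
  have "P \<inter> Q = {}" using famP(2) famQ(2) by fastforce
  then show "(\<Sum>q\<in>P \<union> Q. g q) = (\<Sum>q\<in>P. g q) + (\<Sum>q\<in>Q. g q)"
    using famP(1) famQ(1) by (rule sum.union_disjoint[rotated 2])
qed

definition total_variation :: "(real \<Rightarrow> real) \<Rightarrow> real \<Rightarrow> real \<Rightarrow> real" where
  "total_variation F s t = (SUP P\<in>interval_families s t. \<Sum>p\<in>P. \<bar>F (snd p) - F (fst p)\<bar>)"

lemma interval_families_empty: "{} \<in> interval_families s t"
  by (simp add: interval_families_def)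

lemma interval_families_mono:
  assumes "s' \<le> s" "t \<le> t'"
  shows "interval_families s t \<subseteq> interval_families s' t'"
proof
  fix P assume "P \<in> interval_families s t"
  note D = interval_familiesD[OF this]
  show "P \<in> interval_families s' t'"
    by (rule interval_familiesI) (use D(1) D(2) D(3) assms in \<open>force+\<close>)
qed

text \<open>With \<open>\<delta>\<close> chosen for the tolerance 1, each piece of length
  \<open>\<delta> / 2\<close> contributes less than 1 to any variation sum; induction counts the
  pieces needed to cover \<open>[a, b]\<close>.\<close>

lemma abs_continuous_on_variation_bounded:
  fixes F :: "real \<Rightarrow> real"
  assumes F: "abs_continuous_on a b F"
  obtains C where "\<And>P. P \<in> interval_families a b \<Longrightarrow> (\<Sum>p\<in>P. \<bar>F (snd p) - F (fst p)\<bar>) \<le> C"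
proof -
  obtain \<delta> where \<delta>: "\<delta> > 0" "\<And>P. \<lbrakk>P \<in> interval_families a b; (\<Sum>p\<in>P. snd p - fst p) < \<delta>\<rbrakk>
    \<Longrightarrow> (\<Sum>p\<in>P. norm (F (snd p) - F (fst p))) < 1"
    using abs_continuous_onD[OF F, of 1] by auto
  have ind: "(\<Sum>p\<in>P. \<bar>F (snd p) - F (fst p)\<bar>) \<le> real k"
    if "P \<in> interval_families a t" "t \<le> b" "t \<le> a + k * (\<delta> / 2)" for P k t
    using that
  proof (induction k arbitrary: P t)
    case 0
    have "P = {}" using interval_familiesD(2)[OF 0(1)] 0(3) by fastforce
    then show ?case by simp
  next
    case (Suc k)
    \<comment> \<open>Pieces of length \<open>\<delta> / 2\<close> stay strictly below
      \<open>\<delta>\<close>. If this piece would start left of \<open>a\<close>, then all of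
      \<open>[a, t]\<close> is shorter than \<open>\<delta>\<close> and is handled at once.\<close>
    let ?s = "t - \<delta> / 2"
    obtain P1 P2 where P12: "P1 \<in> interval_families a ?s" "P2 \<in> interval_families ?s t"
      "(\<Sum>p\<in>P. norm (F (snd p) - F (fst p)))
      \<le> (\<Sum>p\<in>P1. norm (F (snd p) - F (fst p))) + (\<Sum>p\<in>P2. norm (F (snd p) - F (fst p)))"
      using interval_families_split[OF Suc.prems(1)] by blast
    have 1: "(\<Sum>p\<in>P1. \<bar>F (snd p) - F (fst p)\<bar>) \<le> real k"
      using Suc.prems \<open>\<delta> > 0\<close> by (intro Suc.IH[OF P12(1)]) (auto simp: field_simps)
    show ?case
    proof (cases "a \<le> ?s")
      case True
      have "P2 \<in> interval_families a b"
        using P12(2) interval_families_mono[OF True Suc.prems(2)] by blast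
      moreover have "(\<Sum>p\<in>P2. snd p - fst p) < \<delta>"
        using interval_families_length(2)[OF P12(2)] \<open>\<delta> > 0\<close> by simp
      ultimately have "(\<Sum>p\<in>P2. norm (F (snd p) - F (fst p))) < 1" by (rule \<delta>(2))
      then show ?thesis using 1 P12(3) by simp
    next
      case False
      show ?thesis
      proof (cases "a \<le> t")
        case True
        have "P \<in> interval_families a b"
          using Suc.prems(1) interval_families_mono[OF order.refl Suc.prems(2)] by blast
        moreover have "(\<Sum>p\<in>P. snd p - fst p) < \<delta>"
          using interval_families_length(2)[OF Suc.prems(1) True] \<open>\<delta> > 0\<close> False by simp
        ultimately have "(\<Sum>p\<in>P. norm (F (snd p) - F (fst p))) < 1" by (rule \<delta>(2))
        then show ?thesis by simp
      next
        case False
        have "P = {}" using interval_familiesD(2)[OF Suc.prems(1)] False by fastforce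
        then show ?thesis by simp
      qed
    qed
  qed
  obtain k :: nat where "(b - a) / (\<delta> / 2) \<le> real k" using real_arch_simple by blast
  then have "b \<le> a + k * (\<delta> / 2)" using \<open>\<delta> > 0\<close> by (simp add: field_simps)
  with ind show ?thesis using that by blast
qed

text \<open>\<open>V\<close> is the variation function of \<open>F\<close>. It inherits absolute
  continuity because its increments are approximated by variation sums of \<open>F\<close> over
  refinements, and refining does not increase the total length.\<close>

lemma abs_continuous_on_variation:
  fixes F :: "real \<Rightarrow> real"
  assumes F: "abs_continuous_on a b F" and "a \<le> b"
  obtains V where "\<And>s t. \<lbrakk>a \<le> s; s \<le> t; t \<le> b\<rbrakk> \<Longrightarrow> \<bar>F t - F s\<bar> \<le> V t - V s"
    "\<And>e. e > 0 \<Longrightarrow> \<exists>\<delta>>0. \<forall>P\<in>interval_families a b. (\<Sum>p\<in>P. snd p - fst p) < \<delta> \<longrightarrow>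
      (\<Sum>p\<in>P. V (snd p) - V (fst p)) < e"
proof -
  define v where "v P = (\<Sum>p\<in>P. \<bar>F (snd p) - F (fst p)\<bar>)" for P
  obtain C where C: "\<And>P. P \<in> interval_families a b \<Longrightarrow> v P \<le> C"
    using abs_continuous_on_variation_bounded[OF F] unfolding v_def by blast
  define V where "V t = (SUP P\<in>interval_families a t. v P)" for t
  have bdd: "bdd_above (v ` interval_families a t)" if "t \<le> b" for t
    using C interval_families_mono[OF order.refl that] by (intro bdd_aboveI2[where M = C]) blast
  have ne: "v ` interval_families a t \<noteq> {}" for t using interval_families_empty by blast
  \<comment> \<open>Together with the next fact this is additivity of the variation: gluing families
    gives one inequality, cutting a nearly optimal family at \<open>s\<close> the other up to
    \<open>h\<close>.\<close>
  have super: "v Q \<le> V t - V s" if "a \<le> s" "s \<le> t" "t \<le> b" "Q \<in> interval_families s t" for s t Q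
  proof -
    have "V s \<le> V t - v Q"
      unfolding V_def[of s]
    proof (rule cSUP_least)
      fix P assume P: "P \<in> interval_families a s"
      have "v (P \<union> Q) = v P + v Q" "P \<union> Q \<in> interval_families a t"
        unfolding v_def using interval_families_Un2[OF P that(4,1,2)] by blast+
      moreover have "v (P \<union> Q) \<le> V t"
        unfolding V_def by (rule cSUP_upper[OF calculation(2) bdd[OF that(3)]])
      ultimately show "v P \<le> V t - v Q" by simp
    qed (use interval_families_empty in blast)
    then show ?thesis by simp
  qed
  have sub: "\<exists>Q\<in>interval_families s t. V t - V s < v Q + h" if st: "a \<le> s" "s \<le> t" "t \<le> b" "h > 0" for s t h
  proof -
    have "V t - h < V t" using st by simp
    then obtain P where P: "P \<in> interval_families a t" "V t - h < v P"
      unfolding V_def[of t] using less_cSUP_iff[OF _ bdd[OF st(3)]] interval_families_empty by blast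
    obtain P1 P2 where "P1 \<in> interval_families a s" "P2 \<in> interval_families s t" "v P \<le> v P1 + v P2"
      unfolding v_def using interval_families_split[OF P(1), of s F] unfolding real_norm_def by blast
    moreover have "v P1 \<le> V s"
      unfolding V_def by (rule cSUP_upper[OF calculation(1) bdd]) (use st in simp)
    ultimately show ?thesis using P(2) by (intro bexI[of _ P2]) auto
  qed
  show ?thesis
  proof (rule that)
    fix s t assume st: "a \<le> s" "s \<le> t" "t \<le> b"
    show "\<bar>F t - F s\<bar> \<le> V t - V s"
    proof (cases "s = t")
      case False
      then have "{(s, t)} \<in> interval_families s t" using st by (simp add: interval_families_def)
      from super[OF st this] show ?thesis by (simp add: v_def)
    qed simp
  next
    fix e :: real assume "e > 0"
    then have e2: "e / 2 > 0" by simp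
    obtain \<delta> where \<delta>: "\<delta> > 0" "\<And>P. \<lbrakk>P \<in> interval_families a b; (\<Sum>p\<in>P. snd p - fst p) < \<delta>\<rbrakk>
      \<Longrightarrow> v P < e / 2"
      by (rule abs_continuous_onD[OF F e2]) (auto simp: v_def)
    have "(\<Sum>p\<in>P. V (snd p) - V (fst p)) < e" if P: "P \<in> interval_families a b" "(\<Sum>p\<in>P. snd p - fst p) < \<delta>" for P
    proof -
      note fam = interval_familiesD[OF P(1)]
      \<comment> \<open>The error \<open>h\<close> is paid once per member of \<open>P\<close> and
        may use up \<open>e / 2\<close> in total; adding 1 covers the empty family.\<close>
      define h where "h = e / (2 * (real (card P) + 1))"
      have h: "h > 0" "card P * h \<le> e / 2" using \<open>e > 0\<close> by (auto simp: h_def field_simps)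
      have "\<exists>Q. Q \<in> interval_families (fst p) (snd p) \<and> V (snd p) - V (fst p) < v Q + h" if "p \<in> P" for p
        using sub[of "fst p" "snd p" h] fam(2)[OF that] h(1) by fastforce
      then obtain Q where Q: "\<And>p. p \<in> P \<Longrightarrow> Q p \<in> interval_families (fst p) (snd p)"
        "\<And>p. p \<in> P \<Longrightarrow> V (snd p) - V (fst p) < v (Q p) + h" by metis
      note U = interval_families_Un[OF P(1) Q(1)]
      have "(\<Sum>q\<in>(\<Union>p\<in>P. Q p). snd q - fst q) = (\<Sum>p\<in>P. \<Sum>q\<in>Q p. snd q - fst q)"
        by (rule U(2))
      also have "\<dots> \<le> (\<Sum>p\<in>P. snd p - fst p)"
      proof (rule sum_mono)
        fix p assume "p \<in> P"
        with interval_families_length(2)[OF Q(1)] fam(2) show "(\<Sum>q\<in>Q p. snd q - fst q) \<le> snd p - fst p"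
          by (simp add: less_imp_le)
      qed
      finally have "v (\<Union>p\<in>P. Q p) < e / 2"
        using P(2) by (intro \<delta>(2) U(1)) auto
      moreover have "v (\<Union>p\<in>P. Q p) = (\<Sum>p\<in>P. v (Q p))"
        unfolding v_def by (rule U(2))
      ultimately have "(\<Sum>p\<in>P. v (Q p)) < e / 2" by simp
      moreover have "(\<Sum>p\<in>P. V (snd p) - V (fst p)) \<le> (\<Sum>p\<in>P. v (Q p) + h)"
        using Q(2) by (intro sum_mono less_imp_le)
      ultimately show ?thesis using h(2) by (simp add: sum.distrib)
    qed
    then show "\<exists>\<delta>>0. \<forall>P\<in>interval_families a b. (\<Sum>p\<in>P. snd p - fst p) < \<delta> \<longrightarrow>
      (\<Sum>p\<in>P. V (snd p) - V (fst p)) < e" using \<delta>(1) by blast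
  qed
qed

section \<open>Densities of absolutely continuous functions\<close>

text \<open>The Stieltjes measure of \<open>G\<close> is absolutely continuous with respect to
  Lebesgue measure, and its Radon-Nikodym derivative is the density.\<close>

lemma monotone_abs_continuous_has_density:
  fixes G :: "real \<Rightarrow> real"
  assumes mono: "\<And>s t. \<lbrakk>a \<le> s; s \<le> t; t \<le> b\<rbrakk> \<Longrightarrow> G s \<le> G t" and "a < b"
    and ac: "\<And>e. e > 0 \<Longrightarrow> \<exists>\<delta>>0. \<forall>P\<in>interval_families a b. (\<Sum>p\<in>P. snd p - fst p) < \<delta> \<longrightarrow>
      (\<Sum>p\<in>P. G (snd p) - G (fst p)) < e"
  obtains g where "integrable (lebesgue_on {a..b}) g" "\<And>t. t \<in> {a..b} \<Longrightarrow> G t = G a + integral {a..t} g"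
proof -
  \<comment> \<open>\<open>G\<close> is continued by constants so that a Stieltjes measure on the
    whole line exists and puts no mass outside \<open>[a, b]\<close>.\<close>
  define H where "H x = G (max a (min b x))" for x
  have H: "H x = G x" if "x \<in> {a..b}" for x using that by (simp add: H_def max_absorb2 min_absorb2)
  have Hhi: "H x = G b" if "b \<le> x" for x using that \<open>a < b\<close> by (simp add: H_def max_absorb2 min_absorb1)
  have Hlo: "H x = G a" if "x \<le> a" for x using that \<open>a < b\<close> by (simp add: H_def max_absorb1 min.coboundedI2)
  have Hmono: "H x \<le> H y" if "x \<le> y" for x y
    unfolding H_def using that \<open>a < b\<close> by (intro mono) (auto simp: min_def max_def)
  have "continuous_on {a..b} G"
    unfolding continuous_on_iff
  proof (intro ballI allI impI)
    fix x e :: real assume x: "x \<in> {a..b}" and "e > 0"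
    obtain \<delta> where \<delta>: "\<delta> > 0" "\<And>P. \<lbrakk>P\<in>interval_families a b; (\<Sum>p\<in>P. snd p - fst p) < \<delta>\<rbrakk> \<Longrightarrow>
      (\<Sum>p\<in>P. G (snd p) - G (fst p)) < e" using ac[OF \<open>e > 0\<close>] by blast
    have small: "\<bar>G v - G u\<bar> < e" if "a \<le> u" "u < v" "v \<le> b" "v - u < \<delta>" for u v
      using \<delta>(2)[of "{(u, v)}"] that mono[of u v] by (simp add: interval_families_def)
    show "\<exists>d>0. \<forall>x'\<in>{a..b}. dist x' x < d \<longrightarrow> dist (G x') (G x) < e"
    proof (intro exI[of _ \<delta>] conjI ballI impI \<delta>(1))
      fix y assume y: "y \<in> {a..b}" "dist y x < \<delta>"
      consider "y < x" | "y = x" | "x < y" by linarith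
      then show "dist (G y) (G x) < e"
        using small[of x y] small[of y x] x y \<open>e > 0\<close> by cases (auto simp: dist_real_def abs_minus_commute)
    qed
  qed
  moreover have "continuous_on UNIV (\<lambda>x. max a (min b x))"
    by (intro continuous_on_max continuous_on_min continuous_on_const continuous_on_id)
  moreover have "range (\<lambda>x. max a (min b x)) \<subseteq> {a..b}"
    using \<open>a < b\<close> by (auto simp: max_def min_def)
  ultimately have Hcont: "continuous_on UNIV H"
    unfolding H_def by (rule continuous_on_compose2)
  then have Hc: "continuous (at x) H" for x by (simp add: continuous_on_eq_continuous_at)
  have Hr: "continuous (at_right x) H" for x
    using Hc[of x] continuous_at_imp_continuous_within by blast
  define \<mu> where "\<mu> = interval_measure H"
  have sets: "sets \<mu> = sets borel" by (simp add: \<mu>_def)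
  have Ioc: "emeasure \<mu> {x<..y} = ennreal (H y - H x)" if "x \<le> y" for x y
    unfolding \<mu>_def using that Hmono Hr by (intro emeasure_interval_measure_Ioc)
  \<comment> \<open>Continuity of \<open>H\<close> excludes atoms, so closed intervals carry the
    same mass as half-open ones.\<close>
  have Icc: "emeasure \<mu> {x..y} = ennreal (H y - H x)" if "x \<le> y" for x y
    unfolding \<mu>_def using that Hmono Hcont by (intro emeasure_interval_measure_Icc)
  have hi: "emeasure \<mu> {b<..} = 0"
  proof -
    have "emeasure \<mu> {b<..b + real n} = 0" for n
      using Ioc[of b "b + real n"] Hhi[of b] Hhi[of "b + real n"] by simp
    then have "emeasure \<mu> (\<Union>n::nat. {b<..b + real n}) = 0"
      by (intro emeasure_UN_eq_0) (auto simp: sets)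
    moreover have ex: "\<exists>n::nat. x \<le> b + real n" for x
    proof -
      obtain n where "x - b \<le> real n" using real_arch_simple by blast
      then show ?thesis by (intro exI[of _ n]) simp
    qed
    have "(\<Union>n::nat. {b<..b + real n}) = {b<..}"
      by (intro equalityI subsetI) (use ex in \<open>simp_all add: UN_iff\<close>)
    ultimately show ?thesis by simp
  qed
  have lo: "emeasure \<mu> {..a} = 0"
  proof -
    have "emeasure \<mu> {a - real n..a} = 0" for n
      using Icc[of "a - real n" a] Hlo[of a] Hlo[of "a - real n"] by simp
    then have "emeasure \<mu> (\<Union>n::nat. {a - real n..a}) = 0"
      by (intro emeasure_UN_eq_0) (auto simp: sets)
    moreover have ex: "\<exists>n::nat. a - real n \<le> x" for x
    proof -
      obtain n where "a - x \<le> real n" using real_arch_simple by blast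
      then show ?thesis by (intro exI[of _ n]) simp
    qed
    have "(\<Union>n::nat. {a - real n..a}) = {..a}"
      by (intro equalityI subsetI) (use ex in \<open>simp_all add: UN_iff\<close>)
    ultimately show ?thesis by simp
  qed
  have fin: "finite_measure \<mu>"
  proof
    have "emeasure \<mu> UNIV \<le> emeasure \<mu> ({..a} \<union> {a<..b} \<union> {b<..})"
      by (rule emeasure_mono) (auto simp: sets)
    also have "\<dots> \<le> emeasure \<mu> {..a} + emeasure \<mu> {a<..b} + emeasure \<mu> {b<..}"
      by (intro order.trans[OF emeasure_subadditive] add_right_mono) (auto simp: sets intro!: emeasure_subadditive)
    also have "\<dots> < \<infinity>" using \<open>a < b\<close> by (simp add: lo hi Ioc)
    finally show "emeasure \<mu> (space \<mu>) \<noteq> \<infinity>"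
      by (simp add: \<mu>_def)
  qed
  interpret \<mu>: finite_measure \<mu> by (rule fin)
  \<comment> \<open>The epsilon-delta hypothesis bounds the mass of finite families of short total
    length; covering a null set by countably many intervals turns this into a statement about null
    sets.\<close>
  have "absolutely_continuous lborel \<mu>"
    unfolding absolutely_continuous_def
  proof
    fix N :: "real set" assume N: "N \<in> null_sets lborel"
    then have Nb: "N \<in> sets borel" by auto
    define N' where "N' = N \<inter> {a..b}"
    have N': "N' \<in> null_sets lborel" unfolding N'_def using N by (rule null_set_Int2) auto
    then have N'b: "N' \<in> sets borel" by auto
    have N'l: "N' \<in> lmeasurable" "measure lebesgue N' = 0"
      using N' null_sets_completionI[OF N'] negligible_iff_measure negligible_iff_null_sets by blast+
    have "measure \<mu> N' \<le> e" if "e > 0" for e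
    proof -
      obtain \<delta> where \<delta>: "\<delta> > 0" "\<And>P. \<lbrakk>P\<in>interval_families a b; (\<Sum>p\<in>P. snd p - fst p) < \<delta>\<rbrakk> \<Longrightarrow>
        (\<Sum>p\<in>P. G (snd p) - G (fst p)) < e" using ac[OF \<open>e > 0\<close>] by blast
      \<comment> \<open>A covering of the null set by non-overlapping, nondegenerate intervals of
        total length at most \<open>\<delta> / 2\<close>. Every finite subfamily is an interval
        family of length below \<open>\<delta>\<close>, hence of mass below \<open>e\<close>, and
        \<open>measure_UN_bound\<close> extends the bound to the countable union.\<close>
      have "N' \<subseteq> cbox a b" "\<delta> / 2 > 0" using \<delta>(1) by (auto simp: N'_def)
      then obtain \<D> where D: "countable \<D>"
        "\<And>K. K \<in> \<D> \<Longrightarrow> K \<subseteq> cbox a b \<and> K \<noteq> {} \<and> (\<exists>c d. K = cbox c d)"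
        "pairwise (\<lambda>A B. interior A \<inter> interior B = {}) \<D>"
        "\<And>K. \<lbrakk>K \<in> \<D>; box a b \<noteq> {}\<rbrakk> \<Longrightarrow> interior K \<noteq> {}" "N' \<subseteq> \<Union> \<D>"
        "\<Union> \<D> \<in> lmeasurable" "measure lebesgue (\<Union> \<D>) \<le> measure lebesgue N' + \<delta> / 2"
        by (rule measurable_outer_intervals_bounded[OF N'l(1)]) blast
      have DK: "\<exists>c d. K = {c..d} \<and> a \<le> c \<and> c < d \<and> d \<le> b" if "K \<in> \<D>" for K
      proof -
        obtain c d where "K = {c..d}" using D(2)[OF \<open>K \<in> \<D>\<close>] by auto
        then show ?thesis using D(2)[OF \<open>K \<in> \<D>\<close>] D(4)[OF \<open>K \<in> \<D>\<close>] \<open>a < b\<close> by auto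
      qed
      have DKb: "K \<in> sets borel" "K \<in> sets lebesgue" if "K \<in> \<D>" for K
        using DK[OF that] by auto
      have "measure \<mu> (\<Union>K\<in>\<D>. K) \<le> e"
      proof (rule measure_UN_bound[OF D(1)])
        show "K \<in> fmeasurable \<mu>" if "K \<in> \<D>" for K
          using DKb(1)[OF that] by (simp add: \<mu>.fmeasurable_eq_sets sets)
        fix F assume F: "F \<subseteq> \<D>" "finite F"
        define P where "P = (\<lambda>K. (Inf K, Sup K)) ` F"
        have IS: "{Inf K..Sup K} = K \<and> a \<le> Inf K \<and> Inf K < Sup K \<and> Sup K \<le> b" if KF: "K \<in> F" for K
        proof -
          obtain c d where "K = {c..d}" "a \<le> c" "c < d" "d \<le> b" using DK[of K] F(1) KF by blast
          then show ?thesis by simp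
        qed
        have inj: "inj_on (\<lambda>K. (Inf K, Sup K)) F"
        proof (rule inj_onI)
          fix K L assume KL: "K \<in> F" "L \<in> F" "(Inf K, Sup K) = (Inf L, Sup L)"
          have "K = {Inf K..Sup K}" using IS[OF KL(1)] by blast
          also have "\<dots> = {Inf L..Sup L}" using KL(3) by simp
          also have "\<dots> = L" using IS[OF KL(2)] by blast
          finally show "K = L" .
        qed
        have int: "interior K = {Inf K<..<Sup K}" if "K \<in> F" for K
          using interior_atLeastAtMost_real[of "Inf K" "Sup K"] IS[OF that] by simp
        have "P \<in> interval_families a b"
        proof (rule interval_familiesI)
          show "finite P" using F by (simp add: P_def)
          show "a \<le> fst p \<and> fst p < snd p \<and> snd p \<le> b" if "p \<in> P" for p
            using that IS by (auto simp: P_def)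
          fix p q assume "p \<in> P" "q \<in> P"
          then obtain K L where KL: "K \<in> F" "p = (Inf K, Sup K)" "L \<in> F" "q = (Inf L, Sup L)"
            by (auto simp: P_def)
          show "p = q \<or> snd p \<le> fst q \<or> snd q \<le> fst p"
          proof (cases "K = L")
            case False
            then have "interior K \<inter> interior L = {}" using D(3) KL F(1) unfolding pairwise_def by blast
            moreover have "interior K = {Inf K<..<Sup K}" "interior L = {Inf L<..<Sup L}"
              using int KL by blast+
            ultimately have "{max (Inf K) (Inf L)<..<min (Sup K) (Sup L)} = {}"
              by auto
            then have "min (Sup K) (Sup L) \<le> max (Inf K) (Inf L)" by simp
            then show ?thesis using KL IS[OF KL(1)] IS[OF KL(3)] by (auto simp: min_def max_def split: if_splits)
          qed (use KL in simp)
        qed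
        moreover have "(\<Sum>p\<in>P. snd p - fst p) < \<delta>"
        proof -
          have "(\<Sum>p\<in>P. snd p - fst p) = measure lebesgue (\<Union>p\<in>P. {fst p..snd p})"
            by (rule interval_families_length(1)[OF calculation])
          also have "(\<Union>p\<in>P. {fst p..snd p}) = \<Union>F" using IS by (auto simp: P_def)
          also have "measure lebesgue \<dots> \<le> measure lebesgue (\<Union>\<D>)"
            using F D(6) DKb(2) by (intro measure_mono_fmeasurable Union_mono sets.finite_Union) auto
          finally show ?thesis using D(7) N'l(2) \<delta>(1) by simp
        qed
        ultimately have less: "(\<Sum>p\<in>P. G (snd p) - G (fst p)) < e" by (rule \<delta>(2))
        have "measure \<mu> (\<Union>K\<in>F. K) \<le> (\<Sum>K\<in>F. measure \<mu> K)"
          using F DKb(1) by (intro \<mu>.finite_measure_subadditive_finite) (auto simp: sets)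
        also have "\<dots> = (\<Sum>K\<in>F. G (Sup K) - G (Inf K))"
        proof (rule sum.cong[OF refl])
          fix K assume "K \<in> F"
          with IS[of K] have K: "K = {Inf K..Sup K}" "Inf K \<le> Sup K" "Inf K \<in> {a..b}" "Sup K \<in> {a..b}" by auto
          have "emeasure \<mu> K = ennreal (H (Sup K) - H (Inf K))" by (subst K(1)) (rule Icc[OF K(2)])
          then show "measure \<mu> K = G (Sup K) - G (Inf K)"
            using Hmono[OF K(2)] H[OF K(3)] H[OF K(4)] by (simp add: measure_def)
        qed
        also have "\<dots> = (\<Sum>p\<in>P. G (snd p) - G (fst p))"
          unfolding P_def sum.reindex[OF inj] by simp
        finally show "measure \<mu> (\<Union>K\<in>F. K) \<le> e" using less by simp
      qed
      moreover have "measure \<mu> N' \<le> measure \<mu> (\<Union>K\<in>\<D>. K)"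
        using D(1,5) DKb(1) by (intro \<mu>.finite_measure_mono) (auto simp: sets intro!: sets.countable_Union)
      ultimately show ?thesis by simp
    qed
    then have "measure \<mu> N' \<le> 0" by (rule field_le_epsilon[where y = 0, simplified])
    then have N'0: "emeasure \<mu> N' = 0" by (simp add: \<mu>.emeasure_eq_measure measure_le_0_iff)
    have "emeasure \<mu> N \<le> emeasure \<mu> ({..a} \<union> N' \<union> {b<..})"
      by (rule emeasure_mono) (use N'b in \<open>auto simp: N'_def sets intro!: sets.Un\<close>)
    also have "\<dots> \<le> emeasure \<mu> {..a} + emeasure \<mu> N' + emeasure \<mu> {b<..}"
      using N'b by (intro order.trans[OF emeasure_subadditive] add_right_mono) (auto simp: sets intro!: emeasure_subadditive)
    also have "\<dots> = 0" by (simp add: lo hi N'0)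
    finally show "N \<in> null_sets \<mu>" using Nb by (auto simp: null_sets_def sets)
  qed
  then have acm: "absolutely_continuous lborel \<mu>" .
  obtain D where D: "D \<in> borel_measurable lborel" "AE x in lborel. RN_deriv lborel \<mu> x = ennreal (D x)"
    "\<And>x. 0 \<le> D x"
    by (rule sigma_finite_measure.real_RN_deriv[OF lborel.sigma_finite_measure_axioms fin acm])
      (use sets in \<open>auto simp: sets_lborel\<close>)
  have dens: "emeasure \<mu> A = (\<integral>\<^sup>+x. ennreal (D x) * indicator A x \<partial>lborel)" if "A \<in> sets borel" for A
  proof -
    have "emeasure \<mu> A = emeasure (density lborel (RN_deriv lborel \<mu>)) A"
      using sigma_finite_measure.density_RN_deriv[OF lborel.sigma_finite_measure_axioms acm] sets by simp
    also have "density lborel (RN_deriv lborel \<mu>) = density lborel (\<lambda>x. ennreal (D x))"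
      using D by (intro density_cong) auto
    also have "emeasure \<dots> A = (\<integral>\<^sup>+x. ennreal (D x) * indicator A x \<partial>lborel)"
      using D that by (intro emeasure_density) auto
    finally show ?thesis .
  qed
  \<comment> \<open>The nonnegative Lebesgue integral of the density over \<open>[a, t]\<close>
    equals the mass of that interval and is converted to a gauge integral.\<close>
  have I: "(D has_integral (G t - G a)) {a..t}" if t: "t \<in> {a..b}" for t
  proof -
    have "(\<integral>\<^sup>+x. ennreal (D x * indicator {a..t} x) \<partial>lborel) = emeasure \<mu> {a..t}"
      by (subst dens) (auto intro!: nn_integral_cong simp: indicator_def)
    also have "\<dots> = ennreal (G t - G a)"
      using t \<open>a < b\<close> by (simp add: Icc H)
    finally have "((\<lambda>x. D x * indicator {a..t} x) has_integral (G t - G a)) UNIV"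
      using D t mono[of a t] by (intro nn_integral_has_integral) auto
    then have "((\<lambda>x. if x \<in> {a..t} then D x else 0) has_integral (G t - G a)) UNIV"
      by (rule has_integral_eq[rotated]) (auto simp: indicator_def)
    then show ?thesis by (simp only: has_integral_restrict_UNIV)
  qed
  show ?thesis
  proof (rule that)
    have "D absolutely_integrable_on {a..b}"
      using I[of b] \<open>a < b\<close> D(3) by (intro nonnegative_absolutely_integrable_1) auto
    then show "integrable (lebesgue_on {a..b}) D"
      by (rule absolutely_integrable_imp_integrable) auto
    show "G t = G a + integral {a..t} D" if "t \<in> {a..b}" for t
      using integral_unique[OF I[OF that]] by simp
  qed
qed

lemma abs_continuous_on_lipschitz2:
  assumes g: "abs_continuous_on a b g" and h: "abs_continuous_on a b h" and "0 \<le> L"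
    and L: "\<And>s t. \<lbrakk>s \<in> {a..b}; t \<in> {a..b}\<rbrakk> \<Longrightarrow> norm (f t - f s) \<le> L * (norm (g t - g s) + norm (h t - h s))"
  shows "abs_continuous_on a b f"
  unfolding abs_continuous_on_def
proof (intro allI impI)
  fix e :: real assume "e > 0"
  then have e: "e / (2 * (L + 1)) > 0" using \<open>0 \<le> L\<close> by simp
  obtain \<delta>1 where \<delta>1: "\<delta>1 > 0" "\<forall>d. d division_of \<Union>d \<and> \<Union>d \<subseteq> {a..b} \<and> (\<Sum>K\<in>d. Sup K - Inf K) < \<delta>1 \<longrightarrow>
        (\<Sum>K\<in>d. norm (g (Sup K) - g (Inf K))) < e / (2 * (L + 1))"
    using g e unfolding abs_continuous_on_def by blast
  obtain \<delta>2 where \<delta>2: "\<delta>2 > 0" "\<forall>d. d division_of \<Union>d \<and> \<Union>d \<subseteq> {a..b} \<and> (\<Sum>K\<in>d. Sup K - Inf K) < \<delta>2 \<longrightarrow>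
        (\<Sum>K\<in>d. norm (h (Sup K) - h (Inf K))) < e / (2 * (L + 1))"
    using h e unfolding abs_continuous_on_def by blast
  have "(\<Sum>K\<in>d. norm (f (Sup K) - f (Inf K))) < e"
    if d: "d division_of \<Union>d" "\<Union>d \<subseteq> {a..b}" "(\<Sum>K\<in>d. Sup K - Inf K) < min \<delta>1 \<delta>2" for d
  proof -
    let ?G = "\<Sum>K\<in>d. norm (g (Sup K) - g (Inf K))" and ?H = "\<Sum>K\<in>d. norm (h (Sup K) - h (Inf K))"
    have "norm (f (Sup K) - f (Inf K)) \<le> L * (norm (g (Sup K) - g (Inf K)) + norm (h (Sup K) - h (Inf K)))"
      if K: "K \<in> d" for K
    proof -
      obtain u v where "K = cbox u v" "cbox u v \<noteq> {}" "cbox u v \<subseteq> {a..b}"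
        using division_ofD(2-4)[OF d(1) K] d(2) by blast
      then have "Sup K \<in> {a..b}" "Inf K \<in> {a..b}" by auto
      then show ?thesis by (intro L)
    qed
    then have "(\<Sum>K\<in>d. norm (f (Sup K) - f (Inf K))) \<le> L * (?G + ?H)"
      unfolding sum_distrib_left sum.distrib[symmetric] by (rule sum_mono)
    \<comment> \<open>\<open>L + 1\<close> is positive even for \<open>L = 0\<close>, as the strict
      estimate below requires.\<close>
    also have "\<dots> \<le> (L + 1) * (?G + ?H)"
      by (intro mult_right_mono add_nonneg_nonneg sum_nonneg) auto
    also have "\<dots> < (L + 1) * (e / (2 * (L + 1)) + e / (2 * (L + 1)))"
      using \<delta>1(2) \<delta>2(2) d \<open>0 \<le> L\<close> by (intro mult_strict_left_mono add_strict_mono) auto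
    also have "\<dots> = 2 * (L + 1) * (e / (2 * (L + 1)))"
    proof -
      have "(L + 1) * (x + x) = 2 * (L + 1) * x" for x by (simp add: algebra_simps)
      then show ?thesis .
    qed
    also have "\<dots> = e" using \<open>0 \<le> L\<close> by simp
    finally show ?thesis .
  qed
  with \<delta>1(1) \<delta>2(1) show "\<exists>\<delta>>0. \<forall>d. d division_of \<Union> d \<and> \<Union> d \<subseteq> {a..b} \<and> (\<Sum>K\<in>d. Sup K - Inf K) < \<delta> \<longrightarrow>
        (\<Sum>K\<in>d. norm (f (Sup K) - f (Inf K))) < e"
    by (intro exI[of _ "min \<delta>1 \<delta>2"]) simp
qed

lemma abs_continuous_on_lipschitz:
  assumes g: "abs_continuous_on a b g" and "0 \<le> L"
    and L: "\<And>s t. \<lbrakk>s \<in> {a..b}; t \<in> {a..b}\<rbrakk> \<Longrightarrow> norm (f t - f s) \<le> L * norm (g t - g s)"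
  shows "abs_continuous_on a b f"
proof (rule abs_continuous_on_lipschitz2[OF g g \<open>0 \<le> L\<close>])
  fix s t assume "s \<in> {a..b}" "t \<in> {a..b}"
  then have "norm (f t - f s) \<le> L * norm (g t - g s)" by (rule L)
  also have "\<dots> \<le> L * (norm (g t - g s) + norm (g t - g s))" using \<open>0 \<le> L\<close> by (intro mult_left_mono) auto
  finally show "norm (f t - f s) \<le> L * (norm (g t - g s) + norm (g t - g s))" .
qed

lemma AE_lebesgue_on_Icc:
  "(AE x in lebesgue_on {a..b::real}. P x) \<longleftrightarrow> negligible {x\<in>{a..b}. \<not> P x}"
  by (rule AE_lebesgue_on_negligible) auto

lemma integral_AE_cong:
  assumes "AE x in lebesgue_on {a..b}. f x = g x" "t \<le> (b::real)"
  shows "integral {a..t} f = integral {a..t} g"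
  by (rule integral_spike[OF assms(1)[unfolded AE_lebesgue_on_Icc]])
    (use assms(2) in auto)

text \<open>Jordan decomposition \<open>F = V - (V - F)\<close> with \<open>V\<close> the variation
  function: both parts are nondecreasing and absolutely continuous.\<close>

lemma abs_continuous_on_has_density_real:
  fixes F :: "real \<Rightarrow> real"
  assumes F: "abs_continuous_on a b F" and "a < b"
  shows "\<exists>g. integrable (lebesgue_on {a..b}) g \<and> (\<forall>t\<in>{a..b}. F t = F a + integral {a..t} g)"
proof -
  obtain V where V: "\<And>s t. \<lbrakk>a \<le> s; s \<le> t; t \<le> b\<rbrakk> \<Longrightarrow> \<bar>F t - F s\<bar> \<le> V t - V s"
    and ac: "\<And>e. e > 0 \<Longrightarrow> \<exists>\<delta>>0. \<forall>P\<in>interval_families a b. (\<Sum>p\<in>P. snd p - fst p) < \<delta> \<longrightarrow>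
      (\<Sum>p\<in>P. V (snd p) - V (fst p)) < e"
    by (rule abs_continuous_on_variation[OF F less_imp_le[OF \<open>a < b\<close>]]) blast
  have Vmono: "V s \<le> V t" if "a \<le> s" "s \<le> t" "t \<le> b" for s t
    using V[OF that] by simp
  obtain g1 where g1: "integrable (lebesgue_on {a..b}) g1" "\<And>t. t \<in> {a..b} \<Longrightarrow> V t = V a + integral {a..t} g1"
    by (rule monotone_abs_continuous_has_density[OF Vmono \<open>a < b\<close> ac]) blast+
  have Wmono: "V s - F s \<le> V t - F t" if "a \<le> s" "s \<le> t" "t \<le> b" for s t
    using V[OF that] by simp
  \<comment> \<open>An increment of \<open>V - F\<close> is at most twice the increment of
    \<open>V\<close>, so half the tolerance for \<open>V\<close> suffices.\<close>
  have acW: "\<exists>\<delta>>0. \<forall>P\<in>interval_families a b. (\<Sum>p\<in>P. snd p - fst p) < \<delta> \<longrightarrow>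
      (\<Sum>p\<in>P. (V (snd p) - F (snd p)) - (V (fst p) - F (fst p))) < e" if e: "e > 0" for e
  proof -
    have "e / 2 > 0" using e by simp
    then obtain \<delta> where \<delta>: "\<delta> > 0" "\<forall>P\<in>interval_families a b. (\<Sum>p\<in>P. snd p - fst p) < \<delta> \<longrightarrow>
      (\<Sum>p\<in>P. V (snd p) - V (fst p)) < e / 2" using ac by blast
    have "(\<Sum>p\<in>P. (V (snd p) - F (snd p)) - (V (fst p) - F (fst p))) < e"
      if P: "P \<in> interval_families a b" "(\<Sum>p\<in>P. snd p - fst p) < \<delta>" for P
    proof -
      have "(\<Sum>p\<in>P. (V (snd p) - F (snd p)) - (V (fst p) - F (fst p))) \<le> (\<Sum>p\<in>P. 2 * (V (snd p) - V (fst p)))"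
      proof (rule sum_mono)
        fix p assume p: "p \<in> P"
        have "a \<le> fst p" "fst p \<le> snd p" "snd p \<le> b" using interval_familiesD(2)[OF P(1) p] by auto
        from V[OF this] show "(V (snd p) - F (snd p)) - (V (fst p) - F (fst p)) \<le> 2 * (V (snd p) - V (fst p))"
          unfolding abs_le_iff by (simp add: algebra_simps)
      qed
      also have "\<dots> < e" using \<delta>(2) P unfolding sum_distrib_left[symmetric] by auto
      finally show ?thesis .
    qed
    with \<delta>(1) show ?thesis by blast
  qed
  define W where "W t = V t - F t" for t
  obtain g2 where g2: "integrable (lebesgue_on {a..b}) g2"
    "\<And>t. t \<in> {a..b} \<Longrightarrow> W t = W a + integral {a..t} g2"
    by (rule monotone_abs_continuous_has_density[of a b W, unfolded W_def, OF Wmono \<open>a < b\<close> acW, folded W_def]) blast+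
  show ?thesis
  proof (intro exI conjI ballI)
    show "integrable (lebesgue_on {a..b}) (\<lambda>t. g1 t - g2 t)" using g1 g2 by simp
    fix t assume t: "t \<in> {a..b}"
    have "g1 integrable_on {a..t}" "g2 integrable_on {a..t}"
      using g1(1) g2(1) t by (auto intro: integrable_on_subinterval[OF integrable_on_lebesgue_on])
    then have "integral {a..t} (\<lambda>t. g1 t - g2 t) = integral {a..t} g1 - integral {a..t} g2"
      by (rule Henstock_Kurzweil_Integration.integral_diff)
    then show "F t = F a + integral {a..t} (\<lambda>t. g1 t - g2 t)"
      using g1(2)[OF t] g2(2)[OF t] unfolding W_def by linarith
  qed
qed

lemma abs_continuous_on_has_density:
  fixes F :: "real \<Rightarrow> 'a::euclidean_space"
  assumes F: "abs_continuous_on a b F" and "a < b"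
  shows "\<exists>g. integrable (lebesgue_on {a..b}) g \<and> (\<forall>t\<in>{a..b}. F t = F a + integral {a..t} g)"
proof -
  have "\<exists>g. integrable (lebesgue_on {a..b}) g \<and> (\<forall>t\<in>{a..b}. F t \<bullet> i = F a \<bullet> i + integral {a..t} g)"
    if i: "i \<in> Basis" for i
  proof -
    have "abs_continuous_on a b (\<lambda>t. F t \<bullet> i)"
      by (rule abs_continuous_on_lipschitz[OF F, of 1])
        (auto simp: inner_diff_left[symmetric] Basis_le_norm[OF i])
    from abs_continuous_on_has_density_real[OF this \<open>a < b\<close>] show ?thesis .
  qed
  then have "\<forall>i\<in>Basis. \<exists>g. integrable (lebesgue_on {a..b}) g \<and> (\<forall>t\<in>{a..b}. F t \<bullet> i = F a \<bullet> i + integral {a..t} g)"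
    by blast
  from bchoice[OF this] obtain g where g: "\<And>i. i \<in> Basis \<Longrightarrow> integrable (lebesgue_on {a..b}) (g i)"
    "\<And>i t. i \<in> Basis \<Longrightarrow> t \<in> {a..b} \<Longrightarrow> F t \<bullet> i = F a \<bullet> i + integral {a..t} (g i)"
    by blast
  show ?thesis
  proof (intro exI conjI ballI)
    show "integrable (lebesgue_on {a..b}) (\<lambda>t. \<Sum>i\<in>Basis. g i t *\<^sub>R i)"
      using g(1) by (intro Bochner_Integration.integrable_sum integrable_scaleR_left) auto
    fix t assume t: "t \<in> {a..b}"
    have gi: "g i integrable_on {a..t}" if "i \<in> Basis" for i
      using g(1)[OF that] t by (auto intro: integrable_on_subinterval[OF integrable_on_lebesgue_on])
    have gI: "((\<lambda>t. g i t *\<^sub>R i) has_integral (F t \<bullet> i - F a \<bullet> i) *\<^sub>R i) {a..t}" if "i \<in> Basis" for i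
      using has_integral_scaleR_left[OF integrable_integral[OF gi[OF that]], of i] g(2)[OF that t] by simp
    have "((\<lambda>t. \<Sum>i\<in>Basis. g i t *\<^sub>R i) has_integral (\<Sum>i\<in>Basis. (F t \<bullet> i - F a \<bullet> i) *\<^sub>R i)) {a..t}"
      by (rule has_integral_sum[OF finite_Basis]) (rule gI)
    then have "integral {a..t} (\<lambda>t. \<Sum>i\<in>Basis. g i t *\<^sub>R i) = (\<Sum>i\<in>Basis. (F t \<bullet> i - F a \<bullet> i) *\<^sub>R i)"
      by (rule integral_unique)
    also have "\<dots> = F t - F a"
      unfolding inner_diff_left[symmetric] by (rule euclidean_representation)
    finally show "F t = F a + integral {a..t} (\<lambda>t. \<Sum>i\<in>Basis. g i t *\<^sub>R i)" by simp
  qed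
qed

section \<open>Volterra operators: weights, Gronwall's inequality and fixed points\<close>

text \<open>Volterra operators with kernel bounded by \<open>\<alpha>\<close> contract the norm \<open>sup \<bar>w\<bar> / \<phi>\<close>.\<close>

lemma volterra_weight:
  fixes \<alpha> :: "real \<Rightarrow> real"
  assumes \<alpha>: "integrable (lebesgue_on {a..b}) \<alpha>" "\<And>t. 0 \<le> \<alpha> t" and "a < b"
  obtains \<phi> where "continuous_on {a..b} \<phi>" "\<And>t. 1 \<le> \<phi> t"
    "\<And>s t. \<lbrakk>a \<le> s; s \<le> t; t \<le> b\<rbrakk> \<Longrightarrow> \<phi> s \<le> \<phi> t"
    "integrable (lebesgue_on {a..b}) (\<lambda>t. \<alpha> t * \<phi> t)"
    "\<And>t. t \<in> {a..b} \<Longrightarrow> integral {a..t} (\<lambda>t. \<alpha> t * \<phi> t) \<le> \<phi> t / 2"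
proof -
  let ?J = "\<lambda>t. integral {a..t} \<alpha>"
  \<comment> \<open>This weight satisfies \<open>\<phi>' = 2 * \<alpha> * \<phi>\<close> a.e., so
    the integral of \<open>\<alpha> * \<phi>\<close> is half an increment of \<open>\<phi>\<close>:
    the factor 2 in the exponent becomes the contraction constant 1/2.\<close>
  define \<phi> where "\<phi> t = exp (2 * ?J t)" for t
  have \<alpha>I: "\<alpha> integrable_on {a..b}" using \<alpha> by (auto intro: integrable_on_lebesgue_on)
  \<comment> \<open>The bound is wanted for every real \<open>t\<close>, also beyond
    \<open>b\<close> where \<open>\<alpha>\<close> may fail to be integrable; the integral is then 0
    by convention.\<close>
  have J0: "0 \<le> ?J t" for t
  proof (cases "\<alpha> integrable_on {a..t}")
    case True
    then show ?thesis using \<alpha>(2) by (rule Henstock_Kurzweil_Integration.integral_nonneg)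
  qed (simp add: not_integrable_integral)
  have Jm: "?J s \<le> ?J t" if "a \<le> s" "s \<le> t" "t \<le> b" for s t
    using that \<alpha>(2) by (intro integral_subset_le integrable_on_subinterval[OF \<alpha>I]) auto
  have mono: "\<phi> s \<le> \<phi> t" if "a \<le> s" "s \<le> t" "t \<le> b" for s t
    using Jm[OF that] by (simp add: \<phi>_def)
  have cont: "continuous_on {a..b} \<phi>"
    unfolding \<phi>_def using indefinite_integral_continuous_1[OF \<alpha>I] by (intro continuous_intros)
  have exp_le: "\<bar>exp y - exp x\<bar> \<le> exp M * \<bar>y - x\<bar>" if "x \<le> M" "y \<le> M" for x y M :: real
  proof -
    have *: "exp y - exp x \<le> exp M * (y - x)" if "x \<le> y" "y \<le> M" for x y :: real
    proof -
      have "exp y - exp x = exp y * (1 - exp (x - y))" by (simp add: algebra_simps exp_diff)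
      also have "\<dots> \<le> exp y * (y - x)" using exp_ge_add_one_self[of "x - y"] by (intro mult_left_mono, linarith, simp)
      also have "\<dots> \<le> exp M * (y - x)" using that by (intro mult_right_mono) auto
      finally show ?thesis .
    qed
    show ?thesis using *[of x y] *[of y x] that by (cases "x \<le> y") auto
  qed
  \<comment> \<open>The exponential is Lipschitz on the bounded range of \<open>2 * ?J\<close>, so
    \<open>\<phi>\<close> has a density. Comparing a.e. derivatives identifies that density as
    \<open>2 * \<alpha> * \<phi>\<close>, which is an integral chain rule.\<close>
  have "abs_continuous_on a b \<phi>"
  proof (rule abs_continuous_on_lipschitz[OF abs_continuous_on_integral[OF \<alpha>(1)], of "exp (2 * ?J b) * 2"])
    fix s t assume "s \<in> {a..b}" "t \<in> {a..b}"
    then show "norm (\<phi> t - \<phi> s) \<le> exp (2 * ?J b) * 2 * norm (?J t - ?J s)"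
      using exp_le[of "2 * ?J s" "2 * ?J b" "2 * ?J t"] Jm[of s b] Jm[of t b]
      by (simp add: \<phi>_def abs_mult right_diff_distrib[symmetric] del: right_diff_distrib_numeral)
  qed simp
  from abs_continuous_on_has_density[OF this \<open>a < b\<close>]
  obtain g where g: "integrable (lebesgue_on {a..b}) g" "\<And>t. t \<in> {a..b} \<Longrightarrow> \<phi> t = \<phi> a + integral {a..t} g"
    by blast
  have exp_deriv: "((\<lambda>t. exp (2 * f t)) has_field_derivative exp (2 * f t) * (2 * m)) (at t within T)"
    if "(f has_field_derivative m) (at t within T)" for f :: "real \<Rightarrow> real" and m t T
    using that by (auto intro!: derivative_eq_intros)
  have "AE t in lebesgue_on {a..b}. ((\<lambda>t. integral {a..t} g) has_vector_derivative g t) (at t within {a..b})"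
    using g(1) by (intro has_vector_derivative_integral_AE integrable_on_lebesgue_on) auto
  moreover have "AE t in lebesgue_on {a..b}. (?J has_vector_derivative \<alpha> t) (at t within {a..b})"
    by (intro has_vector_derivative_integral_AE \<alpha>I)
  ultimately have "AE t in lebesgue_on {a..b}. 2 * (\<alpha> t * \<phi> t) = g t"
    using AE_space
  proof eventually_elim
    case (elim t)
    then have t: "t \<in> {a..b}" by simp
    have "((\<lambda>t. \<phi> a + integral {a..t} g) has_vector_derivative g t) (at t within {a..b})"
      using has_vector_derivative_add[OF has_vector_derivative_const[of "\<phi> a"] elim(1)] by (simp only: add_0_left)
    then have 1: "(\<phi> has_vector_derivative g t) (at t within {a..b})"
      by (rule has_vector_derivative_transform[OF t, rotated]) (rule g(2))
    have "(?J has_field_derivative \<alpha> t) (at t within {a..b})"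
      using elim(2) by (simp add: has_real_derivative_iff_has_vector_derivative)
    then have "(\<phi> has_field_derivative \<phi> t * (2 * \<alpha> t)) (at t within {a..b})"
      unfolding \<phi>_def by (rule exp_deriv)
    then have 2: "(\<phi> has_vector_derivative \<phi> t * (2 * \<alpha> t)) (at t within {a..b})"
      by (simp add: has_real_derivative_iff_has_vector_derivative)
    have "g t = \<phi> t * (2 * \<alpha> t)"
      using vector_derivative_unique_within_closed_interval[of a b t \<phi>] 1 2 t \<open>a < b\<close> by simp
    then show ?case by simp
  qed
  then have AE: "AE t in lebesgue_on {a..b}. \<alpha> t * \<phi> t = g t / 2"
    by eventually_elim simp
  have meas: "(\<lambda>t. \<alpha> t * \<phi> t) \<in> borel_measurable (lebesgue_on {a..b})"
    by (intro borel_measurable_times borel_measurable_integrable[OF \<alpha>(1)] continuous_imp_measurable_on_sets_lebesgue cont) auto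
  show ?thesis
  proof (rule that[OF cont _ mono])
    show "1 \<le> \<phi> t" for t using J0 by (simp add: \<phi>_def)
    show "integrable (lebesgue_on {a..b}) (\<lambda>t. \<alpha> t * \<phi> t)"
      using g(1) AE meas by (subst integrable_cong_AE[where g = "\<lambda>t. g t / 2"]) auto
    fix t assume t: "t \<in> {a..b}"
    have "integral {a..t} (\<lambda>t. \<alpha> t * \<phi> t) = integral {a..t} (\<lambda>t. g t / 2)"
      by (rule integral_AE_cong[OF AE]) (use t in simp)
    also have "\<dots> = integral {a..t} g / 2" by simp
    also have "\<dots> \<le> \<phi> t / 2" using g(2)[OF t] by (simp add: \<phi>_def)
    finally show "integral {a..t} (\<lambda>t. \<alpha> t * \<phi> t) \<le> \<phi> t / 2" .
  qed auto
qed

text \<open>Let \<open>D\<close> be the maximum of \<open>\<Phi> / \<phi>\<close> for the weight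
  \<open>\<phi>\<close>, attained at \<open>t0\<close>. The integral inequality there reads
  \<open>D * \<phi> t0 \<le> S + D * \<phi> t0 / 2\<close>, hence \<open>D \<le> 2 * S\<close>. The
  constant \<open>2 * \<phi> b\<close> depends on \<open>\<beta>\<close> and the interval
  only.\<close>

lemma gronwall_integrable:
  fixes \<beta> :: "real \<Rightarrow> real"
  assumes \<beta>: "integrable (lebesgue_on {a..b}) \<beta>" "\<And>t. 0 \<le> \<beta> t" and "a < b"
  obtains C where "0 \<le> C" "\<And>\<Phi> S t. \<lbrakk>continuous_on {a..b} \<Phi>; \<And>t. t \<in> {a..b} \<Longrightarrow> 0 \<le> \<Phi> t; 0 \<le> S;
      \<And>t. t \<in> {a..b} \<Longrightarrow> \<Phi> t \<le> S + integral {a..t} (\<lambda>t. \<beta> t * \<Phi> t); t \<in> {a..b}\<rbrakk> \<Longrightarrow> \<Phi> t \<le> C * S"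
proof -
  obtain \<phi> where \<phi>: "continuous_on {a..b} \<phi>" "\<And>t. 1 \<le> \<phi> t"
    "\<And>s t. \<lbrakk>a \<le> s; s \<le> t; t \<le> b\<rbrakk> \<Longrightarrow> \<phi> s \<le> \<phi> t"
    "integrable (lebesgue_on {a..b}) (\<lambda>t. \<beta> t * \<phi> t)"
    "\<And>t. t \<in> {a..b} \<Longrightarrow> integral {a..t} (\<lambda>t. \<beta> t * \<phi> t) \<le> \<phi> t / 2"
    by (rule volterra_weight[OF \<beta> \<open>a < b\<close>]) blast
  have pos: "0 < \<phi> t" for t using \<phi>(2)[of t] by linarith
  show ?thesis
  proof (rule that[of "2 * \<phi> b"])
    show "0 \<le> 2 * \<phi> b" using pos[of b] by simp
    fix \<Phi> S t
    assume c: "continuous_on {a..b} \<Phi>" and nn: "\<And>t. t \<in> {a..b} \<Longrightarrow> 0 \<le> \<Phi> t" and S: "0 \<le> S"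
      and le: "\<And>t. t \<in> {a..b} \<Longrightarrow> \<Phi> t \<le> S + integral {a..t} (\<lambda>t. \<beta> t * \<Phi> t)" and t: "t \<in> {a..b}"
    have "continuous_on {a..b} (\<lambda>t. \<Phi> t / \<phi> t)"
      using c \<phi>(1) pos by (intro continuous_on_divide) (auto simp: less_imp_neq[symmetric] order.strict_implies_not_eq)
    then obtain t0 where t0: "t0 \<in> {a..b}" "\<And>t. t \<in> {a..b} \<Longrightarrow> \<Phi> t / \<phi> t \<le> \<Phi> t0 / \<phi> t0"
      using continuous_attains_sup[of "{a..b}" "\<lambda>t. \<Phi> t / \<phi> t"] \<open>a < b\<close> by auto
    define D where "D = \<Phi> t0 / \<phi> t0"
    have D: "\<Phi> t \<le> D * \<phi> t" if "t \<in> {a..b}" for t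
      using t0(2)[OF that] pos[of t] by (simp add: D_def divide_le_eq)
    have D0: "0 \<le> D" using nn[OF t0(1)] pos[of t0] by (simp add: D_def)
    have \<beta>\<Phi>: "integrable (lebesgue_on {a..b}) (\<lambda>t. \<beta> t * \<Phi> t)"
    proof (rule Bochner_Integration.integrable_bound[OF integrable_mult_right[OF \<phi>(4), of D]])
      show "(\<lambda>t. \<beta> t * \<Phi> t) \<in> borel_measurable (lebesgue_on {a..b})"
        by (intro borel_measurable_times borel_measurable_integrable[OF \<beta>(1)] continuous_imp_measurable_on_sets_lebesgue c) auto
      show "AE t in lebesgue_on {a..b}. norm (\<beta> t * \<Phi> t) \<le> norm (D * (\<beta> t * \<phi> t))"
      proof (rule AE_I2)
        fix t assume "t \<in> space (lebesgue_on {a..b})"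
        then have t: "t \<in> {a..b}" by simp
        have "\<beta> t * \<Phi> t \<le> \<beta> t * (D * \<phi> t)" using D[OF t] \<beta>(2) by (intro mult_left_mono)
        then show "norm (\<beta> t * \<Phi> t) \<le> norm (D * (\<beta> t * \<phi> t))"
          using nn[OF t] \<beta>(2)[of t] D0 pos[of t] by (simp add: abs_mult algebra_simps)
      qed
    qed
    have "\<Phi> t0 \<le> S + integral {a..t0} (\<lambda>t. \<beta> t * \<Phi> t)" by (rule le[OF t0(1)])
    also have "integral {a..t0} (\<lambda>t. \<beta> t * \<Phi> t) \<le> integral {a..t0} (\<lambda>t. D * (\<beta> t * \<phi> t))"
    proof (rule integral_le)
      show "(\<lambda>t. \<beta> t * \<Phi> t) integrable_on {a..t0}"
        using t0 by (intro integrable_on_subinterval[OF integrable_on_lebesgue_on[OF \<beta>\<Phi>]]) auto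
      show "(\<lambda>t. D * (\<beta> t * \<phi> t)) integrable_on {a..t0}"
        using t0 by (intro integrable_on_subinterval[OF integrable_on_lebesgue_on[OF integrable_mult_right[OF \<phi>(4), of D]]]) auto
      fix t assume "t \<in> {a..t0}"
      then have t: "t \<in> {a..b}" using t0 by simp
      have "\<beta> t * \<Phi> t \<le> \<beta> t * (D * \<phi> t)" using D[OF t] \<beta>(2) by (intro mult_left_mono)
      then show "\<beta> t * \<Phi> t \<le> D * (\<beta> t * \<phi> t)" by (simp add: algebra_simps)
    qed
    also have "\<dots> \<le> D * (\<phi> t0 / 2)"
      using mult_left_mono[OF \<phi>(5)[OF t0(1)] D0] by simp
    also have "\<dots> = \<Phi> t0 / 2" using pos[of t0] by (simp add: D_def)
    finally have "D * \<phi> t0 \<le> 2 * S" using pos[of t0] by (simp add: D_def)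
    moreover have "D * 1 \<le> D * \<phi> t0" using \<phi>(2) D0 by (intro mult_left_mono)
    ultimately have "D \<le> 2 * S" by simp
    then have "D * \<phi> t \<le> 2 * S * \<phi> b"
      using \<phi>(3)[of t b] t pos[of t] S by (intro mult_mono) auto
    then show "\<Phi> t \<le> 2 * \<phi> b * S" using D[OF t] by (simp add: algebra_simps)
  qed
qed

text \<open>The weighted supremum norm is turned into the ordinary one by the substitution
  \<open>w = \<phi> v\<close>, after which Banach's theorem applies to bounded continuous
  functions.\<close>

lemma volterra_fixed_point:
  fixes T :: "(real \<Rightarrow> 'e::euclidean_space) \<Rightarrow> real \<Rightarrow> 'e" and \<phi> :: "real \<Rightarrow> real"
  assumes "a < b" and \<phi>: "continuous_on {a..b} \<phi>" "\<And>t. 1 \<le> \<phi> t"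
    and Tc: "\<And>w. continuous_on {a..b} w \<Longrightarrow> continuous_on {a..b} (T w)"
    and Tl: "\<And>w1 w2 D t. \<lbrakk>continuous_on {a..b} w1; continuous_on {a..b} w2; 0 \<le> D;
      \<And>t. t \<in> {a..b} \<Longrightarrow> norm (w1 t - w2 t) \<le> D * \<phi> t; t \<in> {a..b}\<rbrakk> \<Longrightarrow> norm (T w1 t - T w2 t) \<le> D / 2 * \<phi> t"
  obtains w where "continuous_on {a..b} w" "\<And>t. t \<in> {a..b} \<Longrightarrow> T w t = w t"
proof -
  have pos: "0 < \<phi> t" for t using \<phi>(2)[of t] by linarith
  define cl where "cl t = max a (min b t)" for t
  have cl: "cl t \<in> {a..b}" for t using \<open>a < b\<close> by (auto simp: cl_def max_def min_def)
  have cl_id: "cl t = t" if "t \<in> {a..b}" for t using that by (simp add: cl_def max_absorb2 min_absorb2)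
  have clc: "continuous_on UNIV cl"
    unfolding cl_def by (intro continuous_on_max continuous_on_min continuous_on_const continuous_on_id)
  \<comment> \<open>Conjugating \<open>T\<close> by multiplication with \<open>\<phi>\<close> and
    freezing the argument by \<open>cl\<close> outside \<open>[a, b]\<close> yields a bounded
    continuous function on the whole line.\<close>
  define P where "P v t = T (\<lambda>s. \<phi> s *\<^sub>R apply_bcontfun v s) (cl t) /\<^sub>R \<phi> (cl t)" for v :: "real \<Rightarrow>\<^sub>C 'e" and t
  have vc: "continuous_on {a..b} (\<lambda>s. \<phi> s *\<^sub>R apply_bcontfun v s)" for v :: "real \<Rightarrow>\<^sub>C 'e"
    by (intro continuous_on_scaleR \<phi>(1) continuous_on_apply_bcontfun)
  have "P v \<in> bcontfun" for v
  proof -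
    have c: "continuous_on {a..b} (\<lambda>t. T (\<lambda>s. \<phi> s *\<^sub>R apply_bcontfun v s) t /\<^sub>R \<phi> t)"
      using Tc[OF vc] \<phi>(1) pos by (intro continuous_intros) (auto simp: order.strict_implies_not_eq[symmetric] less_imp_neq[symmetric])
    have "continuous_on UNIV (P v)"
      unfolding P_def using cl by (intro continuous_on_compose2[OF c clc]) auto
    moreover have "bounded (range (P v))"
    proof (rule bounded_subset[OF compact_imp_bounded[OF compact_continuous_image[OF c compact_Icc]]])
      show "range (P v) \<subseteq> (\<lambda>t. T (\<lambda>s. \<phi> s *\<^sub>R apply_bcontfun v s) t /\<^sub>R \<phi> t) ` {a..b}"
        using cl unfolding P_def by blast
    qed
    ultimately show ?thesis by (simp add: bcontfun_def)
  qed
  then have Papp: "apply_bcontfun (Bcontfun (P v)) = P v" for v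
    by (rule Bcontfun_inverse)
  have "\<exists>!v. Bcontfun (P v) = v"
  proof (rule banach_fix_type[of "1/2"])
    show "\<forall>v1 v2. dist (Bcontfun (P v1)) (Bcontfun (P v2)) \<le> 1 / 2 * dist v1 v2"
    proof (intro allI dist_bound)
      fix v1 v2 :: "real \<Rightarrow>\<^sub>C 'e" and t
      have "norm (T (\<lambda>s. \<phi> s *\<^sub>R apply_bcontfun v1 s) (cl t) - T (\<lambda>s. \<phi> s *\<^sub>R apply_bcontfun v2 s) (cl t))
        \<le> dist v1 v2 / 2 * \<phi> (cl t)"
      proof (rule Tl[OF vc vc _ _ cl])
        fix s
        have "norm (\<phi> s *\<^sub>R apply_bcontfun v1 s - \<phi> s *\<^sub>R apply_bcontfun v2 s) = \<phi> s * dist (apply_bcontfun v1 s) (apply_bcontfun v2 s)"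
          using pos[of s] by (simp add: scaleR_diff_right[symmetric] dist_norm)
        also have "\<dots> \<le> \<phi> s * dist v1 v2" using pos[of s] by (intro mult_left_mono dist_bounded) auto
        finally show "norm (\<phi> s *\<^sub>R apply_bcontfun v1 s - \<phi> s *\<^sub>R apply_bcontfun v2 s) \<le> dist v1 v2 * \<phi> s"
          by (simp add: mult.commute)
      qed auto
      then show "dist (apply_bcontfun (Bcontfun (P v1)) t) (apply_bcontfun (Bcontfun (P v2)) t) \<le> 1 / 2 * dist v1 v2"
        unfolding Papp unfolding P_def dist_norm scaleR_diff_right[symmetric]
        using pos[of "cl t"] by (simp add: divide_simps mult.commute)
    qed
  qed auto
  then obtain v where v: "Bcontfun (P v) = v" by blast
  have vt: "apply_bcontfun v t = P v t" for t using Papp[of v] v by simp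
  show ?thesis
  proof (rule that[OF vc[of v]])
    fix t assume t: "t \<in> {a..b}"
    show "T (\<lambda>s. \<phi> s *\<^sub>R apply_bcontfun v s) t = \<phi> t *\<^sub>R apply_bcontfun v t"
      using vt[of t] pos[of t] by (simp add: P_def cl_id[OF t])
  qed
qed

section \<open>The spaces \<open>L\<^sub>p\<close>\<close>

text \<open>If an argument vanishes, the claim reduces to \<open>w powr q \<le> w\<close> for
  \<open>0 \<le> w \<le> 1\<close>; otherwise it is convexity on the positive half-line.\<close>

lemma powr_convex_nonneg:
  fixes x y u v q :: real
  assumes "1 \<le> q" "0 \<le> x" "0 \<le> y" "0 \<le> u" "0 \<le> v" "u + v = 1"
  shows "(u * x + v * y) powr q \<le> u * x powr q + v * y powr q"
proof -
  have one: "(w * z) powr q \<le> w * z powr q" if "0 \<le> w" "w \<le> 1" "0 \<le> z" for w z :: real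
  proof -
    have "w powr q \<le> w powr 1" using that assms(1) by (intro powr_mono') auto
    then have "w powr q \<le> w" using that by simp
    then show ?thesis using that by (simp add: powr_mult mult_right_mono)
  qed
  consider "x = 0" | "y = 0" | "0 < x" "0 < y" using assms by linarith
  then show ?thesis
  proof cases
    case 1 then show ?thesis using one[of v y] assms by simp
  next
    case 2 then show ?thesis using one[of u x] assms by simp
  next
    case 3
    have "u = 1 - v" using assms by simp
    with 3 show ?thesis
      using convex_onD[OF powr_convex[OF assms(1)], of v x y] assms(4,5) by simp
  qed
qed

lemma borel_measurable_lebesgue_on_AE:
  fixes f g :: "'a::euclidean_space \<Rightarrow> 'b::euclidean_space"
  assumes f: "f \<in> borel_measurable (lebesgue_on S)" and S: "S \<in> sets lebesgue"
    and AE: "AE x in lebesgue_on S. f x = g x"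
  shows "g \<in> borel_measurable (lebesgue_on S)"
proof (rule borel_measurable_if_D)
  have "AE x in lebesgue. x \<in> S \<longrightarrow> f x = g x"
    using AE S by (subst (asm) AE_restrict_space_iff) auto
  then have "AE x in lebesgue. (if x \<in> S then f x else 0) = (if x \<in> S then g x else 0)"
    by eventually_elim auto
  then show "(\<lambda>x. if x \<in> S then g x else 0) \<in> borel_measurable lebesgue"
    by (rule borel_measurable_AE[OF borel_measurable_if_I[OF f S]])
qed

locale interval_Lp =
  fixes a b :: real and p :: ereal
  assumes ab: "a < b" and p1: "1 \<le> p"
begin

abbreviation M :: "real measure" where "M \<equiv> lebesgue_on {a..b}"
abbreviation Lp :: "(real \<Rightarrow> 'a::euclidean_space) set" where "Lp \<equiv> Lp_space a b p"
abbreviation N :: "(real \<Rightarrow> 'a::euclidean_space) \<Rightarrow> real" where "N \<equiv> Lp_norm a b p"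

lemma finite_M: "finite_measure M"
  by (intro finite_measure_lebesgue_on) auto

lemma emeasure_M: "emeasure M (space M) = ennreal (b - a)"
  using ab by (simp add: emeasure_restrict_space)

lemma esssup_norm:
  fixes f :: "real \<Rightarrow> 'a::euclidean_space"
  assumes f: "f \<in> borel_measurable M"
  shows "0 \<le> esssup M (\<lambda>t. ereal (norm (f t)))"
proof -
  have "esssup M (\<lambda>t. 0::ereal) \<le> esssup M (\<lambda>t. ereal (norm (f t)))"
    by (rule esssup_mono) auto
  moreover have "emeasure M (space M) \<noteq> 0" using ab unfolding emeasure_M by simp
  ultimately show ?thesis by (simp add: esssup_const)
qed

text \<open>No measurability is assumed: the essential supremum of a nonmeasurable function is
  infinite, and \<open>real_of_ereal\<close> maps infinity to 0.\<close>

lemma N_nonneg [simp]: "0 \<le> N f"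
proof (cases "p = \<infinity> \<and> f \<in> borel_measurable M")
  case True
  then show ?thesis using esssup_norm[of f] by (simp add: Lp_norm_def real_of_ereal_pos)
next
  case False
  moreover have "esssup M (\<lambda>t. ereal (norm (f t))) = top \<or> 0 \<le> esssup M (\<lambda>t. ereal (norm (f t)))"
  proof (cases "(\<lambda>t. ereal (norm (f t))) \<in> borel_measurable M")
    case True
    have "esssup M (\<lambda>t. 0::ereal) \<le> esssup M (\<lambda>t. ereal (norm (f t)))"
      by (rule esssup_mono) auto
    moreover have "emeasure M (space M) \<noteq> 0" using ab unfolding emeasure_M by simp
    ultimately show ?thesis by (simp add: esssup_const)
  qed (simp add: esssup_non_measurable)
  ultimately show ?thesis by (auto simp: Lp_norm_def real_of_ereal_pos)
qed

lemma Lp_measurable: "f \<in> Lp \<Longrightarrow> f \<in> borel_measurable M"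
  by (simp add: Lp_space_def)

lemma Linf_AE:
  assumes "p = \<infinity>" "f \<in> Lp"
  shows "AE t in M. norm (f t) \<le> N f"
proof -
  have "esssup M (\<lambda>t. ereal (norm (f t))) < \<infinity>" "0 \<le> esssup M (\<lambda>t. ereal (norm (f t)))"
    using assms esssup_norm[OF Lp_measurable] by (auto simp: Lp_space_def)
  then have "ereal (N f) = esssup M (\<lambda>t. ereal (norm (f t)))"
    using assms by (simp add: Lp_norm_def ereal_real' abs_ereal_pos)
  with esssup_AE[where M = M and f = "\<lambda>t. ereal (norm (f t))"]
  have "AE t in M. ereal (norm (f t)) \<le> ereal (N f)" by simp
  then show ?thesis by simp
qed

lemma LinfI:
  fixes f :: "real \<Rightarrow> 'a::euclidean_space"
  assumes "p = \<infinity>" "f \<in> borel_measurable M" "AE t in M. norm (f t) \<le> C"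
  shows "f \<in> Lp" "N f \<le> C"
proof -
  have le: "esssup M (\<lambda>t. ereal (norm (f t))) \<le> ereal C"
    using assms by (intro esssup_I) auto
  then have "esssup M (\<lambda>t. ereal (norm (f t))) < \<infinity>" by (rule order.strict_trans1) simp
  then show "f \<in> Lp" using assms by (simp add: Lp_space_def)
  show "N f \<le> C"
    using le esssup_norm[OF assms(2)] assms(1)
    by (cases "esssup M (\<lambda>t. ereal (norm (f t)))") (auto simp: Lp_norm_def)
qed

definition q :: real where "q = real_of_ereal p"

lemma q1: "p \<noteq> \<infinity> \<Longrightarrow> 1 \<le> q"
  using p1 unfolding q_def by (cases p) auto

definition I :: "(real \<Rightarrow> 'a::euclidean_space) \<Rightarrow> real" where "I f = (LINT t|M. norm (f t) powr q)"

lemma I_nonneg: "0 \<le> I f"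
  unfolding I_def by (intro integral_nonneg_AE) auto

lemma Lp_finite_iff: "p \<noteq> \<infinity> \<Longrightarrow> f \<in> Lp \<longleftrightarrow> f \<in> borel_measurable M \<and> integrable M (\<lambda>t. norm (f t) powr q)"
  by (simp add: Lp_space_def q_def)

lemma N_finite: "p \<noteq> \<infinity> \<Longrightarrow> N f = I f powr (1 / q)"
  by (simp add: Lp_norm_def q_def I_def)

lemma N_powr: "p \<noteq> \<infinity> \<Longrightarrow> N f powr q = I f"
  using q1 I_nonneg[of f] by (simp add: N_finite powr_powr)

lemma N_le_iff: "p \<noteq> \<infinity> \<Longrightarrow> 0 \<le> C \<Longrightarrow> N f \<le> C \<longleftrightarrow> I f \<le> C powr q"
proof -
  assume p: "p \<noteq> \<infinity>" and C: "0 \<le> C"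
  have "N f \<le> C \<longleftrightarrow> N f powr q \<le> C powr q"
    using q1[OF p] C N_nonneg[of f] by (metis less_eq_real_def not_le powr_less_mono2 powr_mono2 zero_less_one order.strict_trans2)
  then show ?thesis by (simp add: N_powr[OF p])
qed

text \<open>The comparison principle through which the later closure properties treat finite and
  infinite exponents at once.\<close>

lemma Lp_dominated:
  fixes f :: "real \<Rightarrow> 'a::euclidean_space" and g :: "real \<Rightarrow> 'b::euclidean_space"
  assumes g: "g \<in> Lp" and f: "f \<in> borel_measurable M" and "0 \<le> c"
    and le: "AE t in M. norm (f t) \<le> c * norm (g t)"
  shows "f \<in> Lp" "N f \<le> c * N g"
proof -
  have "f \<in> Lp \<and> N f \<le> c * N g"
  proof (cases "p = \<infinity>")
    case True
    have "AE t in M. norm (f t) \<le> c * N g"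
      using le Linf_AE[OF True g] by eventually_elim (meson \<open>0 \<le> c\<close> mult_left_mono order_trans)
    then show ?thesis using LinfI[OF True f] by blast
  next
    case False
    have gi: "integrable M (\<lambda>t. norm (g t) powr q)" using g by (simp add: Lp_finite_iff[OF False])
    have le': "AE t in M. norm (f t) powr q \<le> c powr q * norm (g t) powr q"
      using le by eventually_elim (use q1[OF False] \<open>0 \<le> c\<close> in \<open>simp add: powr_mult[symmetric] powr_mono2\<close>)
    have fi: "integrable M (\<lambda>t. norm (f t) powr q)"
    proof (rule Bochner_Integration.integrable_bound)
      show "integrable M (\<lambda>t. c powr q * norm (g t) powr q)" using gi by simp
      show "(\<lambda>t. norm (f t) powr q) \<in> borel_measurable M" using f by measurable
      show "AE t in M. norm (norm (f t) powr q) \<le> norm (c powr q * norm (g t) powr q)"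
        using le' by eventually_elim simp
    qed
    have "I f \<le> (LINT t|M. c powr q * norm (g t) powr q)"
      unfolding I_def using fi gi le' by (intro integral_mono_AE) auto
    also have "\<dots> = c powr q * I g" by (simp add: I_def)
    also have "\<dots> = (c * N g) powr q"
      using \<open>0 \<le> c\<close> N_nonneg[of g] by (simp add: powr_mult N_powr[OF False])
    finally have "N f \<le> c * N g" using \<open>0 \<le> c\<close> N_nonneg[of g] by (simp add: N_le_iff[OF False])
    then show ?thesis using fi f by (simp add: Lp_finite_iff[OF False])
  qed
  then show "f \<in> Lp" "N f \<le> c * N g" by auto
qed

lemma Lp_AE_cong:
  fixes f g :: "real \<Rightarrow> 'a::euclidean_space"
  assumes f: "f \<in> Lp" and AE: "AE t in M. f t = g t"
  shows "g \<in> Lp" "N g = N f"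
proof -
  have g: "g \<in> borel_measurable M"
    by (rule borel_measurable_lebesgue_on_AE[OF Lp_measurable[OF f] _ AE]) auto
  have 1: "AE t in M. norm (g t) \<le> 1 * norm (f t)" "AE t in M. norm (f t) \<le> 1 * norm (g t)"
    using AE by (eventually_elim, simp)+
  show gL: "g \<in> Lp" using Lp_dominated(1)[OF f g _ 1(1)] by simp
  show "N g = N f"
    using Lp_dominated(2)[OF f g _ 1(1)] Lp_dominated(2)[OF gL Lp_measurable[OF f] _ 1(2)] by simp
qed

text \<open>Minkowski's inequality by convexity: for \<open>\<alpha> > N f\<close> and
  \<open>\<beta> > N g\<close>, the quotient of \<open>|f| + |g|\<close> by
  \<open>\<alpha> + \<beta>\<close> is a convex combination of \<open>|f| / \<alpha>\<close> and
  \<open>|g| / \<beta>\<close>, whose q-th powers have integral at most 1. The strict slack avoids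
  division by a vanishing norm and is removed at the end.\<close>

lemma Lp_add:
  fixes f g :: "real \<Rightarrow> 'a::euclidean_space"
  assumes f: "f \<in> Lp" and g: "g \<in> Lp"
  shows "(\<lambda>t. f t + g t) \<in> Lp" "N (\<lambda>t. f t + g t) \<le> N f + N g"
proof -
  have m: "(\<lambda>t. f t + g t) \<in> borel_measurable M"
    using Lp_measurable[OF f] Lp_measurable[OF g] by measurable
  have "(\<lambda>t. f t + g t) \<in> Lp \<and> N (\<lambda>t. f t + g t) \<le> N f + N g"
  proof (cases "p = \<infinity>")
    case True
    have "AE t in M. norm (f t + g t) \<le> N f + N g"
      using Linf_AE[OF True f] Linf_AE[OF True g] by eventually_elim (meson add_mono norm_triangle_le)
    then show ?thesis using LinfI[OF True m] by blast
  next
    case False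
    note q1 = q1[OF False]
    have fi: "integrable M (\<lambda>t. norm (f t) powr q)" and gi: "integrable M (\<lambda>t. norm (g t) powr q)"
      using f g by (auto simp: Lp_finite_iff[OF False])
    have main: "integrable M (\<lambda>t. norm (f t + g t) powr q) \<and> N (\<lambda>t. f t + g t) \<le> \<alpha> + \<beta>"
      if \<alpha>: "N f < \<alpha>" and \<beta>: "N g < \<beta>" for \<alpha> \<beta>
    proof -
      have pos: "0 < \<alpha>" "0 < \<beta>" using N_nonneg[of f] N_nonneg[of g] \<alpha> \<beta> by linarith+
      define u where "u = \<alpha> / (\<alpha> + \<beta>)"
      define v where "v = \<beta> / (\<alpha> + \<beta>)"
      have uv: "0 \<le> u" "0 \<le> v" "u + v = 1" using pos by (auto simp: u_def v_def add_divide_distrib[symmetric])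
      define h where "h t = (\<alpha> + \<beta>) powr q * (u * (norm (f t) powr q / \<alpha> powr q) + v * (norm (g t) powr q / \<beta> powr q))" for t
      have hi: "integrable M h" unfolding h_def using fi gi by simp
      have le: "norm (f t + g t) powr q \<le> h t" for t
      proof -
        have "norm (f t + g t) powr q \<le> (norm (f t) + norm (g t)) powr q"
          using q1 by (intro powr_mono2 norm_triangle_ineq) auto
        also have "norm (f t) + norm (g t) = (\<alpha> + \<beta>) * (u * (norm (f t) / \<alpha>) + v * (norm (g t) / \<beta>))"
        proof -
          have "u * (norm (f t) / \<alpha>) + v * (norm (g t) / \<beta>) = (norm (f t) + norm (g t)) / (\<alpha> + \<beta>)"
            using pos by (simp add: u_def v_def add_divide_distrib)
          then show ?thesis using pos by simp
        qed
        also have "\<dots> powr q = (\<alpha> + \<beta>) powr q * (u * (norm (f t) / \<alpha>) + v * (norm (g t) / \<beta>)) powr q"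
          by (rule powr_mult)
        also have "\<dots> \<le> (\<alpha> + \<beta>) powr q * (u * (norm (f t) / \<alpha>) powr q + v * (norm (g t) / \<beta>) powr q)"
          using pos uv q1 by (intro mult_left_mono powr_convex_nonneg) auto
        also have "\<dots> = h t"
          using pos by (simp add: h_def powr_divide)
        finally show ?thesis .
      qed
      have si: "integrable M (\<lambda>t. norm (f t + g t) powr q)"
      proof (rule Bochner_Integration.integrable_bound[OF hi])
        show "(\<lambda>t. norm (f t + g t) powr q) \<in> borel_measurable M" using m by measurable
        show "AE t in M. norm (norm (f t + g t) powr q) \<le> norm (h t)"
          using le by (intro AE_I2) (smt (verit) powr_ge_zero real_norm_def)
      qed
      have Ile: "I f / \<alpha> powr q \<le> 1" "I g / \<beta> powr q \<le> 1"
        using N_le_iff[OF False, of \<alpha> f] N_le_iff[OF False, of \<beta> g] \<alpha> \<beta> pos by (auto simp: divide_le_eq_1)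
      have "I (\<lambda>t. f t + g t) \<le> (LINT t|M. h t)"
        unfolding I_def using si hi le by (intro integral_mono) auto
      also have "\<dots> = (\<alpha> + \<beta>) powr q * (u * (I f / \<alpha> powr q) + v * (I g / \<beta> powr q))"
        unfolding h_def I_def using fi gi by simp
      also have "\<dots> \<le> (\<alpha> + \<beta>) powr q * (u * 1 + v * 1)"
        using Ile uv by (intro mult_left_mono add_mono) auto
      also have "\<dots> = (\<alpha> + \<beta>) powr q" using uv by simp
      finally show ?thesis using si pos by (simp add: N_le_iff[OF False])
    qed
    have "N (\<lambda>t. f t + g t) \<le> N f + N g"
    proof (rule field_le_epsilon)
      fix e :: real assume "0 < e"
      then show "N (\<lambda>t. f t + g t) \<le> N f + N g + e"
        using main[of "N f + e / 2" "N g + e / 2"] by simp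
    qed
    moreover have "integrable M (\<lambda>t. norm (f t + g t) powr q)"
      using main[of "N f + 1" "N g + 1"] by simp
    ultimately show ?thesis using m by (simp add: Lp_finite_iff[OF False])
  qed
  then show "(\<lambda>t. f t + g t) \<in> Lp" "N (\<lambda>t. f t + g t) \<le> N f + N g" by auto
qed

lemma Lp_bounded:
  fixes f :: "real \<Rightarrow> 'a::euclidean_space"
  assumes f: "f \<in> borel_measurable M" and le: "AE t in M. norm (f t) \<le> C"
  shows "f \<in> Lp" "N f \<le> C * N (\<lambda>t. 1::real)"
proof -
  have one: "(\<lambda>t. 1::real) \<in> Lp"
  proof (cases "p = \<infinity>")
    case True then show ?thesis by (rule LinfI(1)[where C = 1]) auto
  next
    case False
    have "integrable M (\<lambda>t. 1::real)"
      using finite_measure.integrable_const[OF finite_M] .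
    then show ?thesis by (simp add: Lp_finite_iff[OF False])
  qed
  \<comment> \<open>A constant statement that holds a.e. is true, since the interval has positive
    measure.\<close>
  have "AE t in M. 0 \<le> C"
    using le by eventually_elim (meson norm_ge_zero order_trans)
  then have "0 \<le> C"
    using eventually_const[of "ae_filter M" "0 \<le> C"] emeasure_M ab by (simp add: ae_filter_eq_bot_iff)
  then show "f \<in> Lp" "N f \<le> C * N (\<lambda>t. 1::real)"
    using Lp_dominated[OF one f, of C] le by auto
qed

text \<open>The elementary bound \<open>x \<le> 1 + x powr q\<close>, applied to
  \<open>|f| / \<alpha>\<close> with \<open>\<alpha>\<close> slightly above the norm, takes the
  place of Hoelder's inequality. It produces the constant \<open>b - a + 1\<close>, which also
  serves the infinite exponent.\<close>

lemma Lp_integrable: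
  fixes f :: "real \<Rightarrow> 'a::euclidean_space"
  assumes f: "f \<in> Lp"
  shows "integrable M f" "(LINT t|M. norm (f t)) \<le> (b - a + 1) * N f"
proof -
  interpret finite_measure M by (rule finite_M)
  have m: "f \<in> borel_measurable M" by (rule Lp_measurable[OF f])
  have vol: "measure M {a..b} = b - a" using emeasure_M ab by (simp add: measure_def)
  have "integrable M f \<and> (LINT t|M. norm (f t)) \<le> (b - a + 1) * N f"
  proof (cases "p = \<infinity>")
    case True
    note le = Linf_AE[OF True f]
    have fi: "integrable M f"
      by (rule integrable_const_bound[OF le m])
    have "(LINT t|M. norm (f t)) \<le> (LINT t|M. N f)"
      using fi le by (intro integral_mono_AE) auto
    also have "\<dots> \<le> (b - a + 1) * N f" using N_nonneg[of f] ab by (simp add: vol algebra_simps)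
    finally show ?thesis using fi by blast
  next
    case False
    note q1 = q1[OF False]
    have fi: "integrable M (\<lambda>t. norm (f t) powr q)" using f by (simp add: Lp_finite_iff[OF False])
    have main: "integrable M f \<and> (LINT t|M. norm (f t)) \<le> (b - a + 1) * \<alpha>" if \<alpha>: "N f < \<alpha>" for \<alpha>
    proof -
      have pos: "0 < \<alpha>" using N_nonneg[of f] \<alpha> by linarith
      define h where "h t = \<alpha> * (1 + norm (f t) powr q / \<alpha> powr q)" for t
      have hi: "integrable M h" unfolding h_def using fi by simp
      have le: "norm (f t) \<le> h t" for t
      proof -
        have "x \<le> 1 + x powr q" if "0 \<le> x" for x :: real
        proof (cases "x \<le> 1")
          case False
          then have "x powr 1 \<le> x powr q" using q1 by (intro powr_mono) auto
          then show ?thesis using False by simp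
        qed (simp add: add_increasing2)
        from this[of "norm (f t) / \<alpha>"] have "norm (f t) / \<alpha> \<le> 1 + norm (f t) powr q / \<alpha> powr q"
          using pos by (simp add: powr_divide)
        then show ?thesis using pos by (simp add: h_def pos_divide_le_eq mult.commute)
      qed
      have si: "integrable M f"
        by (rule Bochner_Integration.integrable_bound[OF hi m]) (use le in \<open>auto intro: order_trans[OF _ abs_ge_self]\<close>)
      have Ile: "I f / \<alpha> powr q \<le> 1"
        using N_le_iff[OF False, of \<alpha> f] \<alpha> pos by (auto simp: divide_le_eq_1)
      have "(LINT t|M. norm (f t)) \<le> (LINT t|M. h t)"
        using si hi le by (intro integral_mono) auto
      also have "\<dots> = \<alpha> * (b - a + I f / \<alpha> powr q)"
        unfolding h_def I_def using fi by (simp add: vol)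
      also have "\<dots> \<le> \<alpha> * (b - a + 1)"
        using Ile pos by (intro mult_left_mono add_mono) auto
      finally show ?thesis using si by (simp add: mult.commute)
    qed
    have "(LINT t|M. norm (f t)) \<le> (b - a + 1) * N f"
    proof (rule field_le_epsilon)
      fix e :: real assume "0 < e"
      then have "0 < e / (b - a + 1)" using ab by simp
      then show "(LINT t|M. norm (f t)) \<le> (b - a + 1) * N f + e"
        using main[of "N f + e / (b - a + 1)"] ab by (simp add: distrib_left)
    qed
    then show ?thesis using main[of "N f + 1"] by simp
  qed
  then show "integrable M f" "(LINT t|M. norm (f t)) \<le> (b - a + 1) * N f" by auto
qed

lemma Lp_linear:
  fixes f :: "real \<Rightarrow> 'a::euclidean_space" and h :: "'a \<Rightarrow> 'b::euclidean_space"
  assumes "bounded_linear h" and f: "f \<in> Lp"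
  shows "(\<lambda>t. h (f t)) \<in> Lp" "N (\<lambda>t. h (f t)) \<le> onorm h * N f"
proof -
  interpret h: bounded_linear h by fact
  have "h \<in> borel_measurable borel"
    by (intro borel_measurable_continuous_onI h.continuous_on continuous_on_id)
  then have m: "(\<lambda>t. h (f t)) \<in> borel_measurable M"
    using Lp_measurable[OF f] by (rule measurable_compose[rotated])
  show "(\<lambda>t. h (f t)) \<in> Lp" "N (\<lambda>t. h (f t)) \<le> onorm h * N f"
    using Lp_dominated[OF f m onorm_pos_le[OF assms(1)]] onorm[OF assms(1)] by auto
qed

lemma Lp_zero: "(\<lambda>t. 0::'a::euclidean_space) \<in> Lp" "N (\<lambda>t. 0::'a::euclidean_space) = 0"
  using Lp_bounded[of "\<lambda>t. 0::'a" 0] N_nonneg[of "\<lambda>t. 0::'a"] by auto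

lemma Lp_uminus: "f \<in> Lp \<Longrightarrow> (\<lambda>t. - f t) \<in> Lp" "f \<in> Lp \<Longrightarrow> N (\<lambda>t. - f t) \<le> N f"
  using Lp_dominated[of f "\<lambda>t. - f t" 1] Lp_measurable[of f] by auto

lemma Lp_sum:
  assumes "finite S" "\<And>i. i \<in> S \<Longrightarrow> f i \<in> Lp"
  shows "(\<lambda>t. \<Sum>i\<in>S. f i t) \<in> Lp \<and> N (\<lambda>t. \<Sum>i\<in>S. f i t) \<le> (\<Sum>i\<in>S. N (f i))"
  using assms
proof (induction S rule: finite_induct)
  case empty then show ?case by (simp add: Lp_zero)
next
  case (insert x F)
  then show ?case using Lp_add[of "f x" "\<lambda>t. \<Sum>i\<in>F. f i t"] by force
qed

lemma Lp_mult_bounded: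
  fixes f :: "real \<Rightarrow> 'a::euclidean_space" and g :: "real \<Rightarrow> 'b::euclidean_space"
    and h :: "'a \<Rightarrow> 'b \<Rightarrow> 'c::euclidean_space"
  assumes h: "bounded_bilinear h" and K: "\<And>x y. norm (h x y) \<le> norm x * norm y * K" "0 \<le> K"
    and f: "f \<in> Lp" and g: "g \<in> borel_measurable M" "AE t in M. norm (g t) \<le> C" "0 \<le> C"
  shows "(\<lambda>t. h (f t) (g t)) \<in> Lp" "N (\<lambda>t. h (f t) (g t)) \<le> K * C * N f"
proof -
  have "continuous_on UNIV (\<lambda>x. h (fst x) (snd x))"
    by (intro bounded_bilinear.continuous_on[OF h] continuous_intros)
  then have m: "(\<lambda>t. h (f t) (g t)) \<in> borel_measurable M"
    using borel_measurable_continuous_Pair[OF Lp_measurable[OF f] g(1)] by blast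
  have "AE t in M. norm (h (f t) (g t)) \<le> K * C * norm (f t)"
    using g(2)
  proof eventually_elim
    case (elim t)
    have "norm (h (f t) (g t)) \<le> norm (f t) * norm (g t) * K" by (rule K(1))
    also have "\<dots> \<le> norm (f t) * C * K" using elim K(2) by (intro mult_right_mono mult_left_mono) auto
    finally show ?case by (simp add: algebra_simps)
  qed
  then show "(\<lambda>t. h (f t) (g t)) \<in> Lp" "N (\<lambda>t. h (f t) (g t)) \<le> K * C * N f"
    using Lp_dominated[OF f m, of "K * C"] K(2) g(3) by auto
qed

text \<open>Fatou's lemma on the q-th powers for finite exponents; for
  \<open>p = \<infinity>\<close> the countably many a.e. bounds hold simultaneously and pass to the
  limit.\<close>

lemma Lp_fatou:
  fixes f :: "nat \<Rightarrow> real \<Rightarrow> 'a::euclidean_space"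
  assumes f: "\<And>n. f n \<in> Lp" "\<And>n. N (f n) \<le> C" and g: "g \<in> borel_measurable M"
    and lim: "AE t in M. (\<lambda>n. f n t) \<longlonglongrightarrow> g t"
  shows "g \<in> Lp" "N g \<le> C"
proof -
  have C0: "0 \<le> C" using f(2)[of 0] N_nonneg[of "f 0"] by linarith
  have "g \<in> Lp \<and> N g \<le> C"
  proof (cases "p = \<infinity>")
    case True
    have "AE t in M. \<forall>n. norm (f n t) \<le> N (f n)"
      unfolding AE_all_countable using Linf_AE[OF True f(1)] by blast
    then have "AE t in M. norm (g t) \<le> C"
      using lim
    proof eventually_elim
      case (elim t)
      then have "\<And>n. norm (f n t) \<le> C" using f(2) order_trans by blast
      then show ?case using Lim_bounded[OF tendsto_norm[OF elim(2)]] by blast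
    qed
    then show ?thesis using LinfI[OF True g] by blast
  next
    case False
    note q1 = q1[OF False]
    have nn: "(\<integral>\<^sup>+t. ennreal (norm (f n t) powr q) \<partial>M) \<le> ennreal (C powr q)" for n
    proof -
      have "(\<integral>\<^sup>+t. ennreal (norm (f n t) powr q) \<partial>M) = ennreal (I (f n))"
        unfolding I_def using f(1)[of n] by (intro nn_integral_eq_integral) (auto simp: Lp_finite_iff[OF False])
      also have "I (f n) \<le> C powr q" using f(2)[of n] N_le_iff[OF False C0] by blast
      finally show ?thesis by (simp add: ennreal_leI)
    qed
    have "(\<integral>\<^sup>+t. ennreal (norm (g t) powr q) \<partial>M) = (\<integral>\<^sup>+t. liminf (\<lambda>n. ennreal (norm (f n t) powr q)) \<partial>M)"
    proof (rule nn_integral_cong_AE)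
      show "AE t in M. ennreal (norm (g t) powr q) = liminf (\<lambda>n. ennreal (norm (f n t) powr q))"
        using lim
      proof eventually_elim
        case (elim t)
        have "(\<lambda>n. ennreal (norm (f n t) powr q)) \<longlonglongrightarrow> ennreal (norm (g t) powr q)"
          using elim q1 by (intro tendsto_ennrealI tendsto_powr' tendsto_norm tendsto_const) auto
        then show ?case by (rule lim_imp_Liminf[symmetric, rotated]) simp
      qed
    qed
    also have "\<dots> \<le> liminf (\<lambda>n. \<integral>\<^sup>+t. ennreal (norm (f n t) powr q) \<partial>M)"
      using Lp_measurable[OF f(1)] by (intro nn_integral_liminf) measurable
    also have "\<dots> \<le> ennreal (C powr q)"
      by (rule Liminf_le) (use nn in auto)
    finally have le: "(\<integral>\<^sup>+t. ennreal (norm (g t) powr q) \<partial>M) \<le> ennreal (C powr q)" .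
    have gi: "integrable M (\<lambda>t. norm (g t) powr q)"
    proof (rule integrableI_bounded)
      show "(\<lambda>t. norm (g t) powr q) \<in> borel_measurable M" using g by measurable
      show "(\<integral>\<^sup>+t. ennreal (norm (norm (g t) powr q)) \<partial>M) < \<infinity>"
        using le by (simp add: order_le_less_trans)
    qed
    then have "ennreal (I g) \<le> ennreal (C powr q)"
      using le unfolding I_def by (subst (asm) nn_integral_eq_integral) auto
    then have "N g \<le> C" using C0 by (simp add: N_le_iff[OF False])
    then show ?thesis using gi g by (simp add: Lp_finite_iff[OF False])
  qed
  then show "g \<in> Lp" "N g \<le> C" by auto
qed

text \<open>Riesz-Fischer for absolutely summable series. Norm summability in L1 forces a.e.
  convergence of the series, and Fatou applied to the remainders bounds them by the tails of the
  norm series.\<close>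

lemma Lp_complete:
  fixes f :: "nat \<Rightarrow> real \<Rightarrow> 'a::euclidean_space"
  assumes f: "\<And>n. f n \<in> Lp" and sm: "summable (\<lambda>n. N (f n))"
  shows "\<exists>g\<in>Lp. (\<lambda>n. N (\<lambda>t. g t - (\<Sum>k<n. f k t))) \<longlonglongrightarrow> 0"
proof -
  have m: "f n \<in> borel_measurable M" for n by (rule Lp_measurable[OF f])
  have "(\<integral>\<^sup>+t. (\<Sum>n. ennreal (norm (f n t))) \<partial>M) = (\<Sum>n. \<integral>\<^sup>+t. ennreal (norm (f n t)) \<partial>M)"
    using m by (intro nn_integral_suminf) measurable
  also have "\<dots> = (\<Sum>n. ennreal (LINT t|M. norm (f n t)))"
    using Lp_integrable(1)[OF f] by (intro suminf_cong nn_integral_eq_integral) auto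
  also have "\<dots> = ennreal (\<Sum>n. LINT t|M. norm (f n t))"
  proof (rule suminf_ennreal2)
    show "summable (\<lambda>n. LINT t|M. norm (f n t))"
      by (rule summable_comparison_test'[OF summable_mult[OF sm, of "b - a + 1"], of 0])
        (use Lp_integrable(2)[OF f] in auto)
  qed auto
  finally have "(\<integral>\<^sup>+t. (\<Sum>n. ennreal (norm (f n t))) \<partial>M) \<noteq> \<infinity>" by simp
  then have "AE t in M. (\<Sum>n. ennreal (norm (f n t))) \<noteq> \<infinity>"
    using m by (intro nn_integral_PInf_AE) measurable
  then have sm_t: "AE t in M. summable (\<lambda>n. f n t)"
  proof eventually_elim
    case (elim t)
    then have "summable (\<lambda>n. norm (f n t))" by (intro summable_suminf_not_top) auto
    then show ?case by (rule summable_norm_cancel)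
  qed
  define g where "g t = (\<Sum>n. f n t)" for t
  have gm: "g \<in> borel_measurable M"
    unfolding g_def using m by (intro borel_measurable_suminf)
  have tail: "(\<lambda>t. g t - (\<Sum>k<n. f k t)) \<in> Lp \<and> N (\<lambda>t. g t - (\<Sum>k<n. f k t)) \<le> (\<Sum>k. N (f (k + n)))" for n
  proof -
      have A: "(\<lambda>t. \<Sum>k<j. f (k + n) t) \<in> Lp" for j
        using Lp_sum[of "{..<j}" "\<lambda>k. f (k + n)"] f by simp
      have B: "N (\<lambda>t. \<Sum>k<j. f (k + n) t) \<le> (\<Sum>k. N (f (k + n)))" for j
      proof -
        have "N (\<lambda>t. \<Sum>k<j. f (k + n) t) \<le> (\<Sum>k<j. N (f (k + n)))"
          using Lp_sum[of "{..<j}" "\<lambda>k. f (k + n)"] f by simp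
        also have "\<dots> \<le> (\<Sum>k. N (f (k + n)))"
          using N_nonneg by (intro sum_le_suminf summable_ignore_initial_segment[OF sm]) auto
        finally show ?thesis .
      qed
      have C: "(\<lambda>t. g t - (\<Sum>k<n. f k t)) \<in> borel_measurable M"
        using gm m by measurable
      have E: "AE t in M. (\<lambda>j. \<Sum>k<j. f (k + n) t) \<longlonglongrightarrow> g t - (\<Sum>k<n. f k t)"
        using sm_t
      proof eventually_elim
        case (elim t)
        then have "(\<lambda>k. f k t) sums g t" by (simp add: g_def summable_sums)
        then have "(\<lambda>k. f (k + n) t) sums (g t - (\<Sum>k<n. f k t))" by (rule sums_split_initial_segment)
        then show ?case by (simp add: sums_def)
      qed
    show ?thesis using Lp_fatou[OF A B C E] by blast
  qed
  have T: "(\<lambda>n. \<Sum>k. N (f (k + n))) \<longlonglongrightarrow> 0"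
    using suminf_exist_split2[OF sm] .
  have "(\<lambda>n. N (\<lambda>t. g t - (\<Sum>k<n. f k t))) \<longlonglongrightarrow> 0"
  proof (rule tendsto_sandwich[OF _ _ tendsto_const T])
    show "\<forall>\<^sub>F n in sequentially. 0 \<le> N (\<lambda>t. g t - (\<Sum>k<n. f k t))"
      by (simp add: N_nonneg)
    show "\<forall>\<^sub>F n in sequentially. N (\<lambda>t. g t - (\<Sum>k<n. f k t)) \<le> (\<Sum>k. N (f (k + n)))"
      using tail by simp
  qed
  moreover have "g \<in> Lp" using tail[of 0] by simp
  ultimately show ?thesis by blast
qed

end

section \<open>Sobolev spaces as iterated primitives\<close>

lemma integrable_lebesgue_on_Icc:
  fixes f :: "real \<Rightarrow> 'a::euclidean_space"
  assumes "integrable (lebesgue_on {a..b::real}) f" "t \<le> b"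
  shows "f integrable_on {a..t}"
proof (rule integrable_subinterval_real)
  show "f integrable_on {a..b}" using assms by (intro integrable_on_lebesgue_on) auto
  show "{a..t} \<subseteq> {a..b}" using assms by auto
qed

lemma integral_bounded_linear_lebesgue_on:
  fixes f :: "real \<Rightarrow> 'a::euclidean_space" and h :: "'a \<Rightarrow> 'b::euclidean_space"
  assumes "bounded_linear h" "integrable (lebesgue_on {a..b::real}) f" "t \<le> b"
  shows "integral {a..t} (\<lambda>t. h (f t)) = h (integral {a..t} f)"
  using integral_linear[OF integrable_lebesgue_on_Icc[OF assms(2,3)] assms(1)] by (simp add: o_def)

lemma integral_lebesgue_on_add:
  fixes f g :: "real \<Rightarrow> 'a::euclidean_space"
  assumes "integrable (lebesgue_on {a..b::real}) f" "integrable (lebesgue_on {a..b::real}) g" "t \<le> b"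
  shows "integral {a..t} (\<lambda>t. f t + g t) = integral {a..t} f + integral {a..t} g"
  by (intro Henstock_Kurzweil_Integration.integral_add integrable_lebesgue_on_Icc[OF assms(1,3)]
      integrable_lebesgue_on_Icc[OF assms(2,3)])

context interval_Lp
begin

abbreviation W :: "nat \<Rightarrow> (real \<Rightarrow> 'a::euclidean_space) set" where "W \<equiv> sobolev_space a b p"
abbreviation NW :: "nat \<Rightarrow> (real \<Rightarrow> 'a::euclidean_space) \<Rightarrow> real" where "NW \<equiv> sobolev_norm a b p"
abbreviation D :: "nat \<Rightarrow> (real \<Rightarrow> 'a::euclidean_space) \<Rightarrow> real \<Rightarrow> 'a" where "D \<equiv> ideriv a b"

text \<open>A relation between \<open>y\<close> and \<open>g\<close> in integral form: it survives
  changes of \<open>g\<close> on null sets (\<open>primitive_cong\<close>), unlike an equation for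
  \<open>vector_derivative\<close>.\<close>

definition primitive :: "(real \<Rightarrow> 'a::euclidean_space) \<Rightarrow> (real \<Rightarrow> 'a) \<Rightarrow> bool" where
  "primitive y g \<longleftrightarrow> (\<forall>t\<in>{a..b}. y t = y a + integral {a..t} g)"

text \<open>This is the sense in which the differential equation holds for a right-hand side in \<open>W s\<close>.\<close>

definition eqW :: "nat \<Rightarrow> (real \<Rightarrow> 'a::euclidean_space) \<Rightarrow> (real \<Rightarrow> 'a) \<Rightarrow> bool" where
  "eqW s f g \<longleftrightarrow> (if s = 0 then AE t in M. f t = g t else \<forall>t\<in>{a..b}. f t = g t)"

lemma eqW_AE: "eqW s f g \<Longrightarrow> AE t in M. f t = g t"
  by (auto simp: eqW_def split: if_splits)

lemma eqW_I: "(\<And>t. t \<in> {a..b} \<Longrightarrow> f t = g t) \<Longrightarrow> eqW s f g"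
  by (auto simp: eqW_def)

lemma eqW_trans: "eqW s f g \<Longrightarrow> eqW s g h \<Longrightarrow> eqW s f h"
  by (auto simp: eqW_def split: if_splits elim: AE_mp)

lemma eqW_sym: "eqW s f g \<Longrightarrow> eqW s g f"
  by (auto simp: eqW_def split: if_splits elim: AE_mp)

lemma ideriv_0 [simp]: "D 0 y = y"
  by (simp add: ideriv_def)

lemma ideriv_Suc: "D (Suc k) y t = vector_derivative (D k y) (at t within {a..b})"
  by (simp add: ideriv_def)

lemma ideriv_ideriv: "D j (D k y) = D (j + k) y"
  by (simp add: ideriv_def funpow_add)

lemma ideriv_Suc2: "D k (D (Suc 0) y) = D (Suc k) y"
  by (simp add: ideriv_ideriv)

lemma vector_derivative_Icc:
  assumes "(f has_vector_derivative f') (at t within {a..b})" "t \<in> {a..b}"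
  shows "vector_derivative f (at t within {a..b}) = f'"
  using vector_derivative_within_cbox[of a b t f f'] assms ab by simp

text \<open>This includes points without a derivative: the derivative is chosen by a predicate that
  sees only the values in \<open>[a, b]\<close>, so even the arbitrary values coincide.\<close>

lemma ideriv_cong:
  assumes "\<And>t. t \<in> {a..b} \<Longrightarrow> y t = z t" "t \<in> {a..b}"
  shows "D k y t = D k z t"
  using assms(2)
proof (induction k arbitrary: t)
  case (Suc k)
  have "(D k y has_vector_derivative f') (at t within {a..b}) \<longleftrightarrow> (D k z has_vector_derivative f') (at t within {a..b})" for f'
    by (rule has_vector_derivative_cong_ev) (use Suc in \<open>auto simp: eventually_at_filter\<close>)
  then show ?case by (simp add: ideriv_Suc vector_derivative_def)
qed (use assms(1) in simp)

lemma primitiveD: "primitive y g \<Longrightarrow> t \<in> {a..b} \<Longrightarrow> y t = y a + integral {a..t} g"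
  unfolding primitive_def by blast

lemma primitive_cong:
  assumes "primitive y g" "AE t in M. g t = h t"
  shows "primitive y h"
  unfolding primitive_def
proof
  fix t assume t: "t \<in> {a..b}"
  then have "integral {a..t} g = integral {a..t} h" by (intro integral_AE_cong[OF assms(2)]) simp
  then show "y t = y a + integral {a..t} h" using primitiveD[OF assms(1) t] by (rule subst)
qed

lemma primitive_derivative_AE:
  assumes "primitive y g" "integrable M g"
  shows "AE t in M. (y has_vector_derivative g t) (at t within {a..b})"
proof -
  have "AE t in M. ((\<lambda>t. integral {a..t} g) has_vector_derivative g t) (at t within {a..b})"
    using assms(2) by (intro has_vector_derivative_integral_AE integrable_on_lebesgue_on) auto
  then show ?thesis
    using AE_space
  proof eventually_elim
    case (elim t)
    then have t: "t \<in> {a..b}" by simp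
    have "((\<lambda>t. y a + integral {a..t} g) has_vector_derivative g t) (at t within {a..b})"
      using has_vector_derivative_add[OF has_vector_derivative_const[of "y a"] elim(1)] by (simp only: add_0_left)
    then show ?case
      by (rule has_vector_derivative_transform[OF t, rotated]) (use assms(1) in \<open>unfold primitive_def, blast\<close>)
  qed
qed

lemma primitive_derivative:
  assumes "primitive y g" "continuous_on {a..b} g" "t \<in> {a..b}"
  shows "(y has_vector_derivative g t) (at t within {a..b})"
proof -
  have "((\<lambda>t. y a + integral {a..t} g) has_vector_derivative g t) (at t within {a..b})"
    using has_vector_derivative_add[OF has_vector_derivative_const[of "y a"] integral_has_vector_derivative[OF assms(2,3)]]
    by (simp only: add_0_left)
  then show ?thesis
    by (rule has_vector_derivative_transform[OF assms(3), rotated]) (use assms(1) in \<open>unfold primitive_def, blast\<close>)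
qed

lemma primitive_continuous:
  assumes "primitive y g" "integrable M g"
  shows "continuous_on {a..b} y"
proof -
  have "continuous_on {a..b} (\<lambda>t. y a + integral {a..t} g)"
    using assms(2) by (intro continuous_on_add continuous_on_const indefinite_integral_continuous_1 integrable_on_lebesgue_on) auto
  then show ?thesis
    by (rule continuous_on_eq) (rule primitiveD[OF assms(1), symmetric])
qed

lemma primitive_abs_continuous:
  assumes "primitive y g" "integrable M g"
  shows "abs_continuous_on a b y"
proof (rule abs_continuous_on_lipschitz[OF abs_continuous_on_integral[OF assms(2)], of 1])
  fix s t assume "s \<in> {a..b}" "t \<in> {a..b}"
  then have "y t - y s = integral {a..t} g - integral {a..s} g"
    by (simp only: primitiveD[OF assms(1), of t] primitiveD[OF assms(1), of s] add_diff_cancel_left)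
  then show "norm (y t - y s) \<le> 1 * norm (integral {a..t} g - integral {a..s} g)" by simp
qed simp

lemma abs_continuous_on_primitive:
  assumes "abs_continuous_on a b y"
  shows "\<exists>g. integrable M g \<and> primitive y g"
  using abs_continuous_on_has_density[OF assms ab] unfolding primitive_def .

lemma C_space_continuous: "y \<in> C_space a b k \<Longrightarrow> i \<le> k \<Longrightarrow> continuous_on {a..b} (D i y)"
  by (simp add: C_space_def)

lemma W_Suc_continuous: "y \<in> W (Suc s) \<Longrightarrow> i \<le> s \<Longrightarrow> continuous_on {a..b} (D i y)"
  by (auto simp: sobolev_space_def intro: C_space_continuous)

lemma W_integrable: "g \<in> W s \<Longrightarrow> integrable M g"
proof (cases s)
  case 0
  then show "g \<in> W s \<Longrightarrow> integrable M g" by (simp add: sobolev_space_def Lp_integrable)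
next
  case (Suc k)
  assume "g \<in> W s"
  then have "continuous_on {a..b} g" using W_Suc_continuous[of g k 0] Suc by simp
  then show "integrable M g"
    by (intro absolutely_integrable_imp_integrable absolutely_integrable_continuous_real) auto
qed

text \<open>With \<open>W_SucI\<close> this is the recursion behind the inductions on the order. At
  \<open>s = 0\<close> the density of an absolutely continuous function is identified a.e. with its
  derivative; for higher orders the derivative is continuous and the classical fundamental theorem
  applies.\<close>

lemma W_SucD:
  assumes y: "y \<in> W (Suc s)"
  shows "D (Suc 0) y \<in> W s" "primitive y (D (Suc 0) y)"
proof -
  have y': "y \<in> C_space a b s" "abs_continuous_on a b (D s y)" "D (Suc s) y \<in> Lp"
    using y by (auto simp: sobolev_space_def)
  have "D (Suc 0) y \<in> W s \<and> primitive y (D (Suc 0) y)"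
  proof (cases s)
    case 0
    obtain g where g: "integrable M g" "primitive y g"
      using abs_continuous_on_primitive y'(2) 0 by auto
    have "AE t in M. g t = D (Suc 0) y t"
      using primitive_derivative_AE[OF g(2,1)] AE_space
      by eventually_elim (simp add: ideriv_Suc vector_derivative_Icc)
    from primitive_cong[OF g(2) this] show ?thesis
      using y' 0 by (simp add: sobolev_space_def)
  next
    case (Suc k)
    have diff: "y differentiable_on {a..b}" and c: "continuous_on {a..b} (D (Suc 0) y)"
      using y'(1) Suc by (auto simp: C_space_def)
    have vd: "(y has_vector_derivative D (Suc 0) y t) (at t within {a..b})" if "t \<in> {a..b}" for t
      using diff that by (simp add: ideriv_Suc differentiable_on_def vector_derivative_works[symmetric])
    have "primitive y (D (Suc 0) y)"
      unfolding primitive_def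
    proof
      fix t assume t: "t \<in> {a..b}"
      have "(D (Suc 0) y has_integral (y t - y a)) {a..t}"
        by (rule fundamental_theorem_of_calculus)
          (use t in \<open>auto intro!: has_vector_derivative_within_subset[OF vd]\<close>)
      then show "y t = y a + integral {a..t} (D (Suc 0) y)" by (simp add: integral_unique)
    qed
    moreover have "D (Suc 0) y \<in> W s"
      using y' Suc by (auto simp: sobolev_space_def C_space_def ideriv_ideriv)
    ultimately show ?thesis by simp
  qed
  then show "D (Suc 0) y \<in> W s" "primitive y (D (Suc 0) y)" by auto
qed

lemma abs_continuous_on_cong:
  assumes "abs_continuous_on a b f" "\<And>t. t \<in> {a..b} \<Longrightarrow> f t = g t"
  shows "abs_continuous_on a b g"
  by (rule abs_continuous_on_lipschitz[OF assms(1), of 1]) (use assms(2) in auto)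

text \<open>For \<open>s = 0\<close> the derivative of \<open>y\<close> recovers \<open>g\<close>
  only a.e.; for \<open>s > 0\<close> the function \<open>g\<close> is continuous and is recovered
  at every point, which is exactly what \<open>eqW s\<close> records.\<close>

lemma W_SucI:
  assumes g: "g \<in> W s" and y: "primitive y g"
  shows "y \<in> W (Suc s)" "eqW s (D (Suc 0) y) g"
proof -
  note gi = W_integrable[OF g]
  have "y \<in> W (Suc s) \<and> eqW s (D (Suc 0) y) g"
  proof (cases s)
    case 0
    have AE: "AE t in M. g t = D (Suc 0) y t"
      using primitive_derivative_AE[OF y gi] AE_space
      by eventually_elim (simp add: ideriv_Suc vector_derivative_Icc)
    moreover have "D (Suc 0) y \<in> Lp" using Lp_AE_cong(1)[OF _ AE] g 0 by (simp add: sobolev_space_def)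
    ultimately show ?thesis
      using primitive_continuous[OF y gi] primitive_abs_continuous[OF y gi] 0
      by (auto simp: sobolev_space_def C_space_def eqW_def elim: AE_mp)
  next
    case (Suc k)
    have g': "g \<in> C_space a b k" "abs_continuous_on a b (D k g)" "D s g \<in> Lp"
      using g Suc by (auto simp: sobolev_space_def)
    have gc: "continuous_on {a..b} g" using C_space_continuous[OF g'(1), of 0] by simp
    have vd: "(y has_vector_derivative g t) (at t within {a..b})" if "t \<in> {a..b}" for t
      by (rule primitive_derivative[OF y gc that])
    have 1: "D (Suc 0) y t = g t" if "t \<in> {a..b}" for t
      using vector_derivative_Icc[OF vd[OF that] that] by (simp add: ideriv_Suc)
    have D: "D (Suc i) y t = D i g t" if "t \<in> {a..b}" for i t
      unfolding ideriv_Suc2[symmetric, of i] by (rule ideriv_cong) (use 1 that in auto)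
    have "y \<in> C_space a b s"
      unfolding C_space_def
    proof (intro CollectI conjI allI impI)
      fix i assume i: "i < s"
      show "D i y differentiable_on {a..b}"
      proof (cases i)
        case 0
        then show ?thesis unfolding differentiable_on_def using differentiableI_vector[OF vd] by simp
      next
        case (Suc j)
        then have "D j g differentiable_on {a..b}" using i \<open>s = Suc k\<close> g'(1) by (auto simp: C_space_def)
        then have dj: "D j g differentiable at x within {a..b}" if "x \<in> {a..b}" for x
          using that by (simp add: differentiable_on_def)
        show ?thesis
          unfolding differentiable_on_def Suc
        proof
          fix x assume x: "x \<in> {a..b}"
          show "D (Suc j) y differentiable at x within {a..b}"
            by (rule differentiable_transform_within[OF dj[OF x] zero_less_one x]) (rule D[symmetric])
        qed
      qed
    next
      fix i assume i: "i \<le> s"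
      show "continuous_on {a..b} (D i y)"
      proof (cases i)
        case 0
        then show ?thesis using primitive_continuous[OF y gi] by simp
      next
        case (Suc j)
        then have "continuous_on {a..b} (D j g)" using i \<open>s = Suc k\<close> C_space_continuous[OF g'(1)] by auto
        then show ?thesis unfolding Suc by (subst continuous_on_cong[OF refl D]) auto
      qed
    qed
    moreover have "abs_continuous_on a b (D s y)"
      by (rule abs_continuous_on_cong[OF g'(2)]) (simp add: D Suc)
    moreover have "D (Suc s) y \<in> Lp"
      by (rule Lp_AE_cong(1)[OF g'(3)]) (use D in \<open>auto intro!: AE_I2\<close>)
    ultimately show ?thesis using 1 by (auto simp: sobolev_space_def eqW_def)
  qed
  then show "y \<in> W (Suc s)" "eqW s (D (Suc 0) y) g" by auto
qed

lemma eqW_ideriv: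
  assumes "eqW s u v" "k \<le> s"
  shows "eqW (s - k) (D k u) (D k v)"
proof (cases "s = 0")
  case False
  then have "\<forall>t\<in>{a..b}. u t = v t" using assms(1) by (simp add: eqW_def)
  then show ?thesis by (intro eqW_I ideriv_cong) auto
qed (use assms in simp)

lemma W_ideriv: "y \<in> W (s + k) \<Longrightarrow> D k y \<in> W s"
proof (induction k arbitrary: y)
  case (Suc k)
  then show ?case using Suc.IH[of "D (Suc 0) y"] W_SucD(1)[of y "s + k"] by (simp add: ideriv_Suc2)
qed simp

lemma W_ideriv_le: "y \<in> W s \<Longrightarrow> k \<le> s \<Longrightarrow> D k y \<in> W (s - k)"
  using W_ideriv[of y "s - k" k] by simp

lemma continuous_Lp: "continuous_on {a..b} f \<Longrightarrow> f \<in> borel_measurable M"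
  by (rule continuous_imp_measurable_on_sets_lebesgue) auto

lemma W_Suc_subset: "y \<in> W (Suc s) \<Longrightarrow> y \<in> W s"
proof (induction s arbitrary: y)
  case 0
  have c: "continuous_on {a..b} y" using W_Suc_continuous[OF 0, of 0] by simp
  then obtain B where "\<forall>t\<in>{a..b}. norm (y t) \<le> B"
    using compact_imp_bounded[OF compact_continuous_image[OF c compact_Icc]] by (auto simp: bounded_iff)
  then have "AE t in M. norm (y t) \<le> B" by (intro AE_I2) simp
  then have "y \<in> Lp" by (rule Lp_bounded(1)[OF continuous_Lp[OF c]])
  then show ?case by (simp add: sobolev_space_def)
next
  case (Suc s)
  show ?case using W_SucI(1)[OF Suc.IH W_SucD(2)[OF Suc.prems]] W_SucD(1)[OF Suc.prems] by blast
qed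

lemma W_mono: "y \<in> W s \<Longrightarrow> j \<le> s \<Longrightarrow> y \<in> W j"
  by (induction s) (auto simp: le_Suc_eq dest: W_Suc_subset)

lemma W_0: "W 0 = Lp"
  by (simp add: sobolev_space_def)

lemma W_ideriv_Lp: "y \<in> W s \<Longrightarrow> k \<le> s \<Longrightarrow> D k y \<in> Lp"
  using W_ideriv_le[of y s k] W_mono[of "D k y" "s - k" 0] by (simp add: W_0)

lemma NW_0: "NW 0 y = N y"
  by (simp add: sobolev_norm_def)

lemma NW_Suc: "NW (Suc s) y = N y + NW s (D (Suc 0) y)"
  by (simp add: sobolev_norm_def ideriv_Suc2 sum.atMost_Suc_shift del: sum.atMost_Suc)

lemma NW_nonneg [simp]: "0 \<le> NW s y"
  unfolding sobolev_norm_def by (intro sum_nonneg N_nonneg)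

lemma NW_mono: "j \<le> s \<Longrightarrow> NW j y \<le> NW s y"
  unfolding sobolev_norm_def by (intro sum_mono2) (auto simp: N_nonneg)

lemma NW_ideriv: "NW s (D k y) \<le> NW (s + k) y"
proof (induction k arbitrary: y)
  case (Suc k)
  have "NW s (D (Suc k) y) \<le> NW (s + k) (D (Suc 0) y)" unfolding ideriv_Suc2[symmetric, of k] by (rule Suc.IH)
  also have "\<dots> \<le> NW (s + Suc k) y" using N_nonneg[of y] by (simp add: NW_Suc)
  finally show ?case .
qed simp

text \<open>Allows equations modulo \<open>eqW\<close> to be inserted into norms.\<close>

lemma NW_cong:
  assumes "y \<in> W s" "eqW s y z"
  shows "z \<in> W s" "NW s z = NW s y"
proof -
  have AE: "AE t in M. D k y t = D k z t" if "k \<le> s" for k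
    using eqW_AE[OF eqW_ideriv[OF assms(2) that]] .
  show "z \<in> W s"
  proof (cases s)
    case 0
    then show ?thesis using assms AE[of 0] Lp_AE_cong(1)[of y z] by (simp add: W_0)
  next
    case (Suc k)
    then have yz: "\<forall>t\<in>{a..b}. y t = z t" using assms(2) by (simp add: eqW_def)
    have "primitive z (D (Suc 0) y)"
      using W_SucD(2)[of y k] assms(1) Suc yz ab unfolding primitive_def
      by (metis atLeastAtMost_iff less_eq_real_def)
    then show ?thesis using W_SucI(1)[OF W_SucD(1)] assms(1) Suc by blast
  qed
  show "NW s z = NW s y"
    unfolding sobolev_norm_def using AE W_ideriv_Lp[OF assms(1)] by (intro sum.cong refl Lp_AE_cong(2)) auto
qed

lemma NW_primitive:
  assumes "g \<in> W s" "primitive y g"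
  shows "NW (Suc s) y = N y + NW s g"
  using NW_cong(2)[OF W_SucD(1)[OF W_SucI(1)[OF assms]] W_SucI(2)[OF assms]] by (simp add: NW_Suc)

lemma primitive_add:
  assumes "primitive y g" "primitive z h" "integrable M g" "integrable M h"
  shows "primitive (\<lambda>t. y t + z t) (\<lambda>t. g t + h t)"
  unfolding primitive_def
proof
  fix t assume t: "t \<in> {a..b}"
  have "y t = y a + integral {a..t} g" "z t = z a + integral {a..t} h"
    using assms(1,2) t unfolding primitive_def by blast+
  then show "y t + z t = y a + z a + integral {a..t} (\<lambda>t. g t + h t)"
    using integral_lebesgue_on_add[OF assms(3,4), of t] t by simp
qed

lemma primitive_linear:
  assumes "primitive y g" "bounded_linear h" "integrable M g"
  shows "primitive (\<lambda>t. h (y t)) (\<lambda>t. h (g t))"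
  unfolding primitive_def
proof
  interpret h: bounded_linear h by fact
  fix t assume t: "t \<in> {a..b}"
  have "y t = y a + integral {a..t} g"
    using assms(1) t unfolding primitive_def by blast
  then show "h (y t) = h (y a) + integral {a..t} (\<lambda>t. h (g t))"
    using integral_bounded_linear_lebesgue_on[OF assms(2,3), of t] t by (simp add: h.add)
qed

lemma W_add:
  "y \<in> W s \<Longrightarrow> z \<in> W s \<Longrightarrow> (\<lambda>t. y t + z t) \<in> W s \<and> NW s (\<lambda>t. y t + z t) \<le> NW s y + NW s z"
proof (induction s arbitrary: y z)
  case 0
  then show ?case using Lp_add[of y z] by (simp add: W_0 NW_0)
next
  case (Suc s)
  note y = W_SucD[OF Suc.prems(1)] and z = W_SucD[OF Suc.prems(2)]
  have pr: "primitive (\<lambda>t. y t + z t) (\<lambda>t. D (Suc 0) y t + D (Suc 0) z t)"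
    by (rule primitive_add[OF y(2) z(2) W_integrable[OF y(1)] W_integrable[OF z(1)]])
  have IH: "(\<lambda>t. D (Suc 0) y t + D (Suc 0) z t) \<in> W s" "NW s (\<lambda>t. D (Suc 0) y t + D (Suc 0) z t) \<le> NW s (D (Suc 0) y) + NW s (D (Suc 0) z)"
    using Suc.IH[OF y(1) z(1)] by auto
  have "N (\<lambda>t. y t + z t) \<le> N y + N z"
    using Lp_add(2)[of y z] W_mono[OF Suc.prems(1), of 0] W_mono[OF Suc.prems(2), of 0] by (simp add: W_0)
  then show ?case using W_SucI(1)[OF IH(1) pr] IH(2) NW_primitive[OF IH(1) pr] by (simp add: NW_Suc)
qed

lemma W_linear:
  assumes "bounded_linear h"
  shows "y \<in> W s \<Longrightarrow> (\<lambda>t. h (y t)) \<in> W s \<and> NW s (\<lambda>t. h (y t)) \<le> onorm h * NW s y"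
proof (induction s arbitrary: y)
  case 0
  then show ?case using Lp_linear[OF assms, of y] by (simp add: W_0 NW_0)
next
  case (Suc s)
  note y = W_SucD[OF Suc.prems(1)]
  have pr: "primitive (\<lambda>t. h (y t)) (\<lambda>t. h (D (Suc 0) y t))"
    by (rule primitive_linear[OF y(2) assms W_integrable[OF y(1)]])
  have IH: "(\<lambda>t. h (D (Suc 0) y t)) \<in> W s" "NW s (\<lambda>t. h (D (Suc 0) y t)) \<le> onorm h * NW s (D (Suc 0) y)"
    using Suc.IH[OF y(1)] by auto
  have "N (\<lambda>t. h (y t)) \<le> onorm h * N y"
    using Lp_linear(2)[OF assms, of y] W_mono[OF Suc.prems(1), of 0] by (simp add: W_0)
  then show ?case using W_SucI(1)[OF IH(1) pr] IH(2) NW_primitive[OF IH(1) pr] by (simp add: NW_Suc distrib_left)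
qed

text \<open>The index \<open>s - k\<close> is the regularity left after \<open>k\<close>
  derivatives: pointwise equality below the top order, a.e. equality at \<open>k = s\<close>, where
  the arbitrary values at exceptional points need not add up.\<close>

lemma ideriv_add:
  "y \<in> W s \<Longrightarrow> z \<in> W s \<Longrightarrow> k \<le> s \<Longrightarrow> eqW (s - k) (D k (\<lambda>t. y t + z t)) (\<lambda>t. D k y t + D k z t)"
proof (induction s arbitrary: y z k)
  case 0
  then show ?case by (auto intro: eqW_I)
next
  case (Suc s)
  show ?case
  proof (cases k)
    case 0
    then show ?thesis by (auto intro: eqW_I)
  next
    case k: (Suc j)
    note y = W_SucD[OF Suc.prems(1)] and z = W_SucD[OF Suc.prems(2)]
    have pr: "primitive (\<lambda>t. y t + z t) (\<lambda>t. D (Suc 0) y t + D (Suc 0) z t)"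
      by (rule primitive_add[OF y(2) z(2) W_integrable[OF y(1)] W_integrable[OF z(1)]])
    have "eqW s (D (Suc 0) (\<lambda>t. y t + z t)) (\<lambda>t. D (Suc 0) y t + D (Suc 0) z t)"
      using W_SucI(2)[OF _ pr] W_add[OF y(1) z(1)] by blast
    from eqW_ideriv[OF this, of j] Suc.IH[OF y(1) z(1), of j] show ?thesis
      using Suc.prems(3) unfolding k ideriv_Suc2 by (auto intro: eqW_trans)
  qed
qed

lemma ideriv_linear:
  assumes "bounded_linear h"
  shows "y \<in> W s \<Longrightarrow> k \<le> s \<Longrightarrow> eqW (s - k) (D k (\<lambda>t. h (y t))) (\<lambda>t. h (D k y t))"
proof (induction s arbitrary: y k)
  case 0
  then show ?case by (auto intro: eqW_I)
next
  case (Suc s)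
  show ?case
  proof (cases k)
    case 0
    then show ?thesis by (auto intro: eqW_I)
  next
    case k: (Suc j)
    note y = W_SucD[OF Suc.prems(1)]
    have pr: "primitive (\<lambda>t. h (y t)) (\<lambda>t. h (D (Suc 0) y t))"
      by (rule primitive_linear[OF y(2) assms W_integrable[OF y(1)]])
    have "eqW s (D (Suc 0) (\<lambda>t. h (y t))) (\<lambda>t. h (D (Suc 0) y t))"
      using W_SucI(2)[OF _ pr] W_linear[OF assms y(1)] by blast
    from eqW_ideriv[OF this, of j] Suc.IH[OF y(1), of j] show ?thesis
      using Suc.prems(2) unfolding k ideriv_Suc2 by (auto intro: eqW_trans)
  qed
qed

end

section \<open>Embedding, products and completeness of the Sobolev spaces\<close>

context interval_Lp
begin

text \<open>Averages \<open>|y t| \<le> |y u| + (integral of |y'|)\<close> over all base points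
  \<open>u\<close> of the interval.\<close>

lemma W_1_sup_bound:
  "\<exists>C\<ge>0. \<forall>(y::real \<Rightarrow> 'a::euclidean_space)\<in>W 1. \<forall>t\<in>{a..b}. norm (y t) \<le> C * NW 1 y"
proof -
  define c where "c = b - a + 1"
  have c: "c > 0" using ab by (simp add: c_def)
  define C where "C = c / (b - a) + c"
  have "norm (y t) \<le> C * NW 1 y" if y: "y \<in> W 1" and t: "t \<in> {a..b}" for y :: "real \<Rightarrow> 'a" and t
  proof -
    interpret finite_measure M by (rule finite_M)
    note yd = W_SucD[of y 0, OF y[unfolded One_nat_def]]
    let ?g = "D (Suc 0) y"
    have gi: "integrable M ?g" by (rule W_integrable[OF yd(1)])
    have ngi: "integrable M (\<lambda>t. norm (?g t))" using gi by simp
    have yi: "integrable M y" by (rule W_integrable[OF y])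
    have gN: "integral {a..b} (\<lambda>t. norm (?g t)) \<le> c * N ?g"
      using Lp_integrable(2)[of ?g] yd(1) lebesgue_integral_eq_integral[OF ngi] by (simp add: W_0 c_def)
    have yN: "(LINT t|M. norm (y t)) \<le> c * N y"
      using Lp_integrable(2)[of y] W_mono[OF y, of 0] by (simp add: W_0 c_def)
    have diff: "norm (y v - y u) \<le> c * N ?g" if "a \<le> u" "u \<le> v" "v \<le> b" for u v
    proof -
      have "integral {a..u} ?g + integral {u..v} ?g = integral {a..v} ?g"
        using that by (intro Henstock_Kurzweil_Integration.integral_combine integrable_lebesgue_on_Icc[OF gi]) auto
      then have "y v - y u = integral {u..v} ?g"
        using primitiveD[OF yd(2), of u] primitiveD[OF yd(2), of v] that by (simp add: algebra_simps)
      also have "norm \<dots> \<le> integral {u..v} (\<lambda>t. norm (?g t))"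
        using that by (intro integral_norm_bound_integral integrable_subinterval_real[OF integrable_lebesgue_on_Icc[OF gi order_refl]]
          integrable_subinterval_real[OF integrable_lebesgue_on_Icc[OF ngi order_refl]]) auto
      also have "\<dots> \<le> integral {a..b} (\<lambda>t. norm (?g t))"
        using that by (intro integral_subset_le integrable_subinterval_real[OF integrable_lebesgue_on_Icc[OF ngi order_refl]]
          integrable_lebesgue_on_Icc[OF ngi order_refl]) auto
      finally show ?thesis using gN by linarith
    qed
    have le: "norm (y t) \<le> norm (y u) + c * N ?g" if "u \<in> {a..b}" for u
    proof -
      have "norm (y t - y u) \<le> c * N ?g"
        using diff[of u t] diff[of t u] t that norm_minus_commute[of "y t" "y u"] by (cases "u \<le> t") auto
      then show ?thesis using norm_triangle_sub[of "y t" "y u"] by linarith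
    qed
    have vol: "measure M {a..b} = b - a" using emeasure_M ab by (simp add: measure_def)
    \<comment> \<open>Division by \<open>b - a\<close> after this averaging is the origin of the
      summand \<open>c / (b - a)\<close> in \<open>C\<close>; \<open>c\<close> is the constant
      comparing the L1 norm with \<open>N\<close>.\<close>
    have "(LINT u|M. norm (y t)) \<le> (LINT u|M. norm (y u) + c * N ?g)"
      using yi le by (intro integral_mono) auto
    then have "(b - a) * norm (y t) \<le> (LINT u|M. norm (y u)) + (b - a) * (c * N ?g)"
      using yi by (simp add: vol)
    then have "(b - a) * norm (y t) \<le> c * N y + (b - a) * (c * N ?g)" using yN by linarith
    then have "norm (y t) \<le> (c * N y + (b - a) * (c * N ?g)) / (b - a)"
      using ab by (simp add: pos_le_divide_eq mult.commute)
    also have "\<dots> = c / (b - a) * N y + c * N ?g" using ab by (simp add: field_simps)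
    also have "\<dots> \<le> C * N y + C * N ?g"
      using ab c N_nonneg[of y] N_nonneg[of ?g] unfolding C_def by (intro add_mono mult_right_mono) auto
    also have "\<dots> = C * NW 1 y" by (simp add: NW_Suc NW_0 distrib_left)
    finally show ?thesis .
  qed
  moreover have "0 \<le> C" using ab c by (simp add: C_def)
  ultimately show ?thesis by blast
qed

lemma W_Suc_sup_bound:
  "\<exists>C\<ge>0. \<forall>s. \<forall>(y::real \<Rightarrow> 'a::euclidean_space)\<in>W (Suc s). \<forall>t\<in>{a..b}. norm (y t) \<le> C * NW (Suc s) y"
proof -
  obtain C where C: "C \<ge> 0" "\<forall>(y::real \<Rightarrow> 'a)\<in>W 1. \<forall>t\<in>{a..b}. norm (y t) \<le> C * NW 1 y"
    using W_1_sup_bound by blast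
  have "norm (y t) \<le> C * NW (Suc s) y" if "y \<in> W (Suc s)" "t \<in> {a..b}" for s t and y :: "real \<Rightarrow> 'a"
  proof -
    have "norm (y t) \<le> C * NW 1 y" using C(2) W_mono[OF that(1), of 1] that(2) by simp
    also have "\<dots> \<le> C * NW (Suc s) y" using C(1) by (intro mult_left_mono NW_mono) auto
    finally show ?thesis .
  qed
  then show ?thesis using C(1) by blast
qed

text \<open>Boundedness of integration: \<open>y\<close> is controlled uniformly by its initial
  value and the L1 norm of \<open>g\<close>, and the norm of the constant 1 converts this into a
  bound for \<open>N y\<close>. The constant does not depend on \<open>s\<close>.\<close>

lemma NW_primitive_bound:
  "\<exists>C\<ge>0. \<forall>s. \<forall>(y::real \<Rightarrow> 'a::euclidean_space) g. g \<in> W s \<longrightarrow> primitive y g \<longrightarrow>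
     NW (Suc s) y \<le> C * (norm (y a) + NW s g)"
proof -
  define c where "c = b - a + 1"
  have c: "c \<ge> 1" using ab by (simp add: c_def)
  let ?N1 = "N (\<lambda>t. 1::real)"
  have "NW (Suc s) y \<le> (c * ?N1 + 1) * (norm (y a) + NW s g)" if g: "g \<in> W s" and y: "primitive y g"
    for s and y g :: "real \<Rightarrow> 'a"
  proof -
    have gi: "integrable M g" by (rule W_integrable[OF g])
    have ngi: "integrable M (\<lambda>t. norm (g t))" using gi by simp
    have gL: "g \<in> Lp" using W_mono[OF g, of 0] by (simp add: W_0)
    have gN: "integral {a..b} (\<lambda>t. norm (g t)) \<le> c * N g"
      using Lp_integrable(2)[OF gL] lebesgue_integral_eq_integral[OF ngi] by (simp add: c_def)
    have Ng: "N g \<le> NW s g" using NW_mono[of 0 s g] by (simp add: NW_0)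
    have "norm (y t) \<le> c * (norm (y a) + NW s g)" if t: "t \<in> {a..b}" for t
    proof -
      have "norm (y t) \<le> norm (y a) + norm (integral {a..t} g)"
        unfolding primitiveD[OF y t] by (rule norm_triangle_ineq)
      also have "norm (integral {a..t} g) \<le> integral {a..t} (\<lambda>t. norm (g t))"
        using t by (intro integral_norm_bound_integral integrable_lebesgue_on_Icc[OF gi] integrable_lebesgue_on_Icc[OF ngi]) auto
      also have "\<dots> \<le> integral {a..b} (\<lambda>t. norm (g t))"
        using t by (intro integral_subset_le integrable_lebesgue_on_Icc[OF ngi]) auto
      also have "\<dots> \<le> c * NW s g" using gN mult_left_mono[OF Ng, of c] c by linarith
      also have "norm (y a) + c * NW s g \<le> c * norm (y a) + c * NW s g"
        using mult_right_mono[OF c, of "norm (y a)"] by simp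
      finally show ?thesis by (simp add: distrib_left)
    qed
    then have "N y \<le> (c * (norm (y a) + NW s g)) * ?N1"
      by (intro Lp_bounded(2) continuous_Lp[OF primitive_continuous[OF y gi]] AE_I2) simp
    moreover have "(c * ?N1 + 1) * u = (c * u) * ?N1 + u" for u by (simp add: algebra_simps)
    moreover have "NW s g \<le> norm (y a) + NW s g" by simp
    ultimately show ?thesis
      unfolding NW_primitive[OF g y] by (metis add_mono)
  qed
  moreover have "0 \<le> c * ?N1 + 1" using c N_nonneg[of "\<lambda>t. 1::real"] by simp
  ultimately show ?thesis by blast
qed

text \<open>The product of bounded absolutely continuous functions is absolutely continuous, hence
  has a density; the product rule at points where both factors are differentiable identifies it
  a.e.\<close>

lemma primitive_bilinear:
  fixes h :: "'a::euclidean_space \<Rightarrow> 'b::euclidean_space \<Rightarrow> 'c::euclidean_space"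
  assumes h: "bounded_bilinear h"
    and y: "primitive y f" "integrable M f" and z: "primitive z g" "integrable M g"
  shows "primitive (\<lambda>t. h (y t) (z t)) (\<lambda>t. h (f t) (z t) + h (y t) (g t))"
proof -
  interpret h: bounded_bilinear h by fact
  obtain K where K: "0 \<le> K" "\<And>u v. norm (h u v) \<le> norm u * norm v * K"
    using h.nonneg_bounded by blast
  have yc: "continuous_on {a..b} y" and zc: "continuous_on {a..b} z"
    using primitive_continuous y z by blast+
  obtain B1 where B1: "\<forall>t\<in>{a..b}. norm (y t) \<le> B1"
    using compact_imp_bounded[OF compact_continuous_image[OF yc compact_Icc]] by (auto simp: bounded_iff)
  obtain B2 where B2: "\<forall>t\<in>{a..b}. norm (z t) \<le> B2"
    using compact_imp_bounded[OF compact_continuous_image[OF zc compact_Icc]] by (auto simp: bounded_iff)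
  define B where "B = max 0 (max B1 B2)"
  have B: "0 \<le> B" "\<And>t. t \<in> {a..b} \<Longrightarrow> norm (y t) \<le> B" "\<And>t. t \<in> {a..b} \<Longrightarrow> norm (z t) \<le> B"
    using B1 B2 by (auto simp: B_def le_max_iff_disj)
  have "abs_continuous_on a b (\<lambda>t. h (y t) (z t))"
  proof (rule abs_continuous_on_lipschitz2[OF primitive_abs_continuous[OF y] primitive_abs_continuous[OF z], of "K * B"])
    fix s t assume st: "s \<in> {a..b}" "t \<in> {a..b}"
    have "h (y t) (z t) - h (y s) (z s) = h (y t - y s) (z t) + h (y s) (z t - z s)"
      by (simp add: h.diff_left h.diff_right)
    also have "norm \<dots> \<le> norm (y t - y s) * norm (z t) * K + norm (y s) * norm (z t - z s) * K"
      by (intro order_trans[OF norm_triangle_ineq] add_mono K)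
    also have "\<dots> \<le> norm (y t - y s) * B * K + B * norm (z t - z s) * K"
      using B st K by (intro add_mono mult_right_mono mult_left_mono) auto
    finally show "norm (h (y t) (z t) - h (y s) (z s)) \<le> K * B * (norm (y t - y s) + norm (z t - z s))"
      by (simp add: algebra_simps)
  qed (use K B in auto)
  then obtain G where G: "integrable M G" "primitive (\<lambda>t. h (y t) (z t)) G"
    using abs_continuous_on_primitive by blast
  have "AE t in M. G t = h (f t) (z t) + h (y t) (g t)"
    using primitive_derivative_AE[OF G(2,1)] primitive_derivative_AE[OF y] primitive_derivative_AE[OF z] AE_space
  proof eventually_elim
    case (elim t)
    then have t: "t \<in> {a..b}" by simp
    have "((\<lambda>t. h (y t) (z t)) has_vector_derivative h (y t) (g t) + h (f t) (z t)) (at t within {a..b})"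
      by (rule h.has_vector_derivative[OF elim(2,3)])
    then show ?case
      using vector_derivative_Icc[OF elim(1) t] vector_derivative_Icc[OF _ t] by (metis add.commute)
  qed
  with G(2) show ?thesis by (rule primitive_cong)
qed

lemma W_mult_0:
  fixes h :: "'a::euclidean_space \<Rightarrow> 'b::euclidean_space \<Rightarrow> 'c::euclidean_space"
  assumes h: "bounded_bilinear h"
  shows "\<exists>C\<ge>0. \<forall>f\<in>Lp. \<forall>g\<in>W 1. (\<lambda>t. h (f t) (g t)) \<in> Lp \<and> N (\<lambda>t. h (f t) (g t)) \<le> C * N f * NW 1 g"
proof -
  obtain K where K: "0 \<le> K" "\<And>u v. norm (h u v) \<le> norm u * norm v * K"
    using bounded_bilinear.nonneg_bounded[OF h] by blast
  obtain C where C: "C \<ge> 0" "\<forall>(y::real \<Rightarrow> 'b)\<in>W 1. \<forall>t\<in>{a..b}. norm (y t) \<le> C * NW 1 y"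
    using W_1_sup_bound by blast
  have "(\<lambda>t. h (f t) (g t)) \<in> Lp \<and> N (\<lambda>t. h (f t) (g t)) \<le> (K * C) * N f * NW 1 g"
    if f: "f \<in> Lp" and g: "g \<in> W 1" for f g
  proof -
    have "g \<in> borel_measurable M" using W_integrable[OF g] by auto
    moreover have "AE t in M. norm (g t) \<le> C * NW 1 g" using C(2) g by (intro AE_I2) auto
    moreover have "0 \<le> C * NW 1 g" using C(1) by simp
    ultimately have "(\<lambda>t. h (f t) (g t)) \<in> Lp" "N (\<lambda>t. h (f t) (g t)) \<le> K * (C * NW 1 g) * N f"
      by (rule Lp_mult_bounded[OF h K(2,1) f])+
    then show ?thesis by (simp add: mult_ac)
  qed
  then show ?thesis using K(1) C(1) by (intro exI[of _ "K * C"]) auto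
qed

text \<open>From order 1 on the spaces are closed under products. In the base case the
  differentiated factor is only in Lp while the other is in \<open>W 1\<close>; as \<open>h\<close>
  need not be symmetric, this is used for \<open>h\<close> and for its flip.\<close>

lemma W_mult_Suc:
  fixes h :: "'a::euclidean_space \<Rightarrow> 'b::euclidean_space \<Rightarrow> 'c::euclidean_space"
  assumes h: "bounded_bilinear h"
  shows "\<exists>C\<ge>0. \<forall>f\<in>W (Suc s). \<forall>g\<in>W (Suc s).
    (\<lambda>t. h (f t) (g t)) \<in> W (Suc s) \<and> NW (Suc s) (\<lambda>t. h (f t) (g t)) \<le> C * NW (Suc s) f * NW (Suc s) g"
proof -
  obtain C0 where C0: "C0 \<ge> 0" "\<forall>f\<in>Lp. \<forall>g\<in>W 1. (\<lambda>t. h (f t) (g t)) \<in> Lp \<and> N (\<lambda>t. h (f t) (g t)) \<le> C0 * N f * NW 1 g"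
    using W_mult_0[OF h] by blast
  obtain C1 where C1: "C1 \<ge> 0" "\<forall>g\<in>Lp. \<forall>f\<in>W 1. (\<lambda>t. h (f t) (g t)) \<in> Lp \<and> N (\<lambda>t. h (f t) (g t)) \<le> C1 * N g * NW 1 f"
    using W_mult_0[OF bounded_bilinear.flip[OF h]] by blast
  \<comment> \<open>The product rule transfers bounds for both mixed terms at order \<open>s\<close>
    to the product at order \<open>s + 1\<close>.\<close>
  have step: "(\<lambda>t. h (f t) (g t)) \<in> W (Suc s) \<and>
      NW (Suc s) (\<lambda>t. h (f t) (g t)) \<le> (C0 + A + B) * NW (Suc s) f * NW (Suc s) g"
    if f: "f \<in> W (Suc s)" and g: "g \<in> W (Suc s)" and "0 \<le> A" "0 \<le> B"
      and 1: "(\<lambda>t. h (D (Suc 0) f t) (g t)) \<in> W s" "NW s (\<lambda>t. h (D (Suc 0) f t) (g t)) \<le> A * NW (Suc s) f * NW (Suc s) g"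
      and 2: "(\<lambda>t. h (f t) (D (Suc 0) g t)) \<in> W s" "NW s (\<lambda>t. h (f t) (D (Suc 0) g t)) \<le> B * NW (Suc s) f * NW (Suc s) g"
    for f g s A B
  proof -
    note f' = W_SucD[OF f] and g' = W_SucD[OF g]
    have pr: "primitive (\<lambda>t. h (f t) (g t)) (\<lambda>t. h (D (Suc 0) f t) (g t) + h (f t) (D (Suc 0) g t))"
      by (rule primitive_bilinear[OF h f'(2) W_integrable[OF f'(1)] g'(2) W_integrable[OF g'(1)]])
    have S: "(\<lambda>t. h (D (Suc 0) f t) (g t) + h (f t) (D (Suc 0) g t)) \<in> W s"
      "NW s (\<lambda>t. h (D (Suc 0) f t) (g t) + h (f t) (D (Suc 0) g t)) \<le> A * NW (Suc s) f * NW (Suc s) g + B * NW (Suc s) f * NW (Suc s) g"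
      using W_add[OF 1(1) 2(1)] 1(2) 2(2) by auto
    have "f \<in> Lp" "g \<in> W 1" using W_mono[OF f, of 0] W_mono[OF g, of 1] by (auto simp: W_0)
    then have "N (\<lambda>t. h (f t) (g t)) \<le> C0 * N f * NW 1 g" using C0 by blast
    also have "\<dots> \<le> C0 * NW (Suc s) f * NW (Suc s) g"
      using NW_mono[of 0 "Suc s" f] NW_mono[of 1 "Suc s" g] C0(1)
      by (intro mult_mono) (auto simp: NW_0)
    finally show ?thesis
      using W_SucI(1)[OF S(1) pr] NW_primitive[OF S(1) pr] S(2) by (simp add: algebra_simps)
  qed
  show ?thesis
  proof (induction s)
    case 0
    have "(\<lambda>t. h (f t) (g t)) \<in> W (Suc 0) \<and>
      NW (Suc 0) (\<lambda>t. h (f t) (g t)) \<le> (C0 + C0 + C1) * NW (Suc 0) f * NW (Suc 0) g"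
      if f: "f \<in> W (Suc 0)" and g: "g \<in> W (Suc 0)" for f g
    proof (rule step[OF f g C0(1) C1(1)])
      have fg: "D (Suc 0) f \<in> Lp" "D (Suc 0) g \<in> Lp" using W_SucD(1)[OF f] W_SucD(1)[OF g] by (auto simp: W_0)
      have le: "N (D (Suc 0) f) \<le> NW (Suc 0) f" "N (D (Suc 0) g) \<le> NW (Suc 0) g"
        using N_nonneg[of f] N_nonneg[of g] by (auto simp: NW_Suc NW_0)
      have "(\<lambda>t. h (D (Suc 0) f t) (g t)) \<in> Lp" "N (\<lambda>t. h (D (Suc 0) f t) (g t)) \<le> C0 * N (D (Suc 0) f) * NW (Suc 0) g"
        using C0(2) fg(1) g by auto
      moreover have "C0 * N (D (Suc 0) f) * NW (Suc 0) g \<le> C0 * NW (Suc 0) f * NW (Suc 0) g"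
        using le(1) C0(1) by (intro mult_right_mono mult_left_mono) auto
      ultimately show "(\<lambda>t. h (D (Suc 0) f t) (g t)) \<in> W 0"
        "NW 0 (\<lambda>t. h (D (Suc 0) f t) (g t)) \<le> C0 * NW (Suc 0) f * NW (Suc 0) g" by (auto simp: W_0 NW_0)
      have "(\<lambda>t. h (f t) (D (Suc 0) g t)) \<in> Lp" "N (\<lambda>t. h (f t) (D (Suc 0) g t)) \<le> C1 * N (D (Suc 0) g) * NW (Suc 0) f"
        using C1(2) fg(2) f by auto
      moreover have "C1 * N (D (Suc 0) g) * NW (Suc 0) f \<le> C1 * NW (Suc 0) g * NW (Suc 0) f"
        using le(2) C1(1) by (intro mult_right_mono mult_left_mono) auto
      ultimately show "(\<lambda>t. h (f t) (D (Suc 0) g t)) \<in> W 0"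
        "NW 0 (\<lambda>t. h (f t) (D (Suc 0) g t)) \<le> C1 * NW (Suc 0) f * NW (Suc 0) g" by (auto simp: W_0 NW_0 algebra_simps)
    qed
    then show ?case using C0(1) C1(1) by (intro exI[of _ "C0 + C0 + C1"]) auto
  next
    case (Suc s)
    then obtain C where C: "C \<ge> 0" "\<forall>f\<in>W (Suc s). \<forall>g\<in>W (Suc s).
      (\<lambda>t. h (f t) (g t)) \<in> W (Suc s) \<and> NW (Suc s) (\<lambda>t. h (f t) (g t)) \<le> C * NW (Suc s) f * NW (Suc s) g"
      by blast
    have "(\<lambda>t. h (f t) (g t)) \<in> W (Suc (Suc s)) \<and>
      NW (Suc (Suc s)) (\<lambda>t. h (f t) (g t)) \<le> (C0 + C + C) * NW (Suc (Suc s)) f * NW (Suc (Suc s)) g"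
      if f: "f \<in> W (Suc (Suc s))" and g: "g \<in> W (Suc (Suc s))" for f g
    proof (rule step[OF f g C(1) C(1)])
      have fg: "D (Suc 0) f \<in> W (Suc s)" "D (Suc 0) g \<in> W (Suc s)" "f \<in> W (Suc s)" "g \<in> W (Suc s)"
        using W_SucD(1)[OF f] W_SucD(1)[OF g] W_Suc_subset[OF f] W_Suc_subset[OF g] by auto
      have le: "NW (Suc s) (D (Suc 0) f) \<le> NW (Suc (Suc s)) f" "NW (Suc s) (D (Suc 0) g) \<le> NW (Suc (Suc s)) g"
        "NW (Suc s) f \<le> NW (Suc (Suc s)) f" "NW (Suc s) g \<le> NW (Suc (Suc s)) g"
        using NW_ideriv[of "Suc s" "Suc 0" f] NW_ideriv[of "Suc s" "Suc 0" g] by (auto intro: NW_mono)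
      have m: "C * x * z \<le> C * x' * z'" if "x \<le> x'" "z \<le> z'" "0 \<le> x" "0 \<le> z" for x x' z z' :: real
        using that C(1) by (intro mult_mono) auto
      show "(\<lambda>t. h (D (Suc 0) f t) (g t)) \<in> W (Suc s)" "(\<lambda>t. h (f t) (D (Suc 0) g t)) \<in> W (Suc s)"
        using C(2) fg by blast+
      show "NW (Suc s) (\<lambda>t. h (D (Suc 0) f t) (g t)) \<le> C * NW (Suc (Suc s)) f * NW (Suc (Suc s)) g"
        using C(2) fg(1,4) m[OF le(1,4) NW_nonneg NW_nonneg] by (blast intro: order_trans)
      show "NW (Suc s) (\<lambda>t. h (f t) (D (Suc 0) g t)) \<le> C * NW (Suc (Suc s)) f * NW (Suc (Suc s)) g"
        using C(2) fg(3,2) m[OF le(3,2) NW_nonneg NW_nonneg] by (blast intro: order_trans)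
    qed
    then show ?case using C0(1) C(1) by (intro exI[of _ "C0 + C + C"]) auto
  qed
qed

text \<open>Lp is in general not closed under products, so the second factor is taken one order
  smoother. This is the shape of the terms of the equation: derivatives of \<open>y\<close> of order
  below \<open>r\<close> lie in \<open>W (Suc n)\<close>.\<close>

lemma W_mult:
  fixes h :: "'a::euclidean_space \<Rightarrow> 'b::euclidean_space \<Rightarrow> 'c::euclidean_space"
  assumes h: "bounded_bilinear h"
  shows "\<exists>C\<ge>0. \<forall>f\<in>W s. \<forall>g\<in>W (Suc s).
    (\<lambda>t. h (f t) (g t)) \<in> W s \<and> NW s (\<lambda>t. h (f t) (g t)) \<le> C * NW s f * NW (Suc s) g"
proof (cases s)
  case 0
  then show ?thesis using W_mult_0[OF h] by (simp add: W_0 NW_0)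
next
  case (Suc k)
  obtain C where C: "C \<ge> 0" "\<forall>f\<in>W s. \<forall>g\<in>W s.
      (\<lambda>t. h (f t) (g t)) \<in> W s \<and> NW s (\<lambda>t. h (f t) (g t)) \<le> C * NW s f * NW s g"
    using W_mult_Suc[OF h, of k] Suc by blast
  have "(\<lambda>t. h (f t) (g t)) \<in> W s \<and> NW s (\<lambda>t. h (f t) (g t)) \<le> C * NW s f * NW (Suc s) g"
    if f: "f \<in> W s" and g: "g \<in> W (Suc s)" for f g
  proof -
    have "C * NW s f * NW s g \<le> C * NW s f * NW (Suc s) g"
      using C(1) by (intro mult_left_mono NW_mono) auto
    then show ?thesis using C(2) f W_Suc_subset[OF g] by (blast intro: order_trans)
  qed
  then show ?thesis using C(1) by blast
qed

lemma W_uminus: "y \<in> W s \<Longrightarrow> (\<lambda>t. - y t) \<in> W s"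
  using W_linear[OF bounded_linear_minus[OF bounded_linear_ident]] by blast

lemma NW_uminus: "y \<in> W s \<Longrightarrow> NW s (\<lambda>t. - y t) \<le> NW s y"
proof -
  assume y: "y \<in> W s"
  have "onorm (\<lambda>x::'a. - x) \<le> 1"
    by (rule onorm_bound) auto
  then have "onorm (\<lambda>x::'a. - x) * NW s y \<le> 1 * NW s y" by (intro mult_right_mono NW_nonneg)
  then show "NW s (\<lambda>t. - y t) \<le> NW s y"
    using W_linear[OF bounded_linear_minus[OF bounded_linear_ident] y] by simp
qed

lemma W_diff:
  assumes "y \<in> W s" "z \<in> W s"
  shows "(\<lambda>t. y t - z t) \<in> W s" "NW s (\<lambda>t. y t - z t) \<le> NW s y + NW s z"
  using W_add[OF assms(1) W_uminus[OF assms(2)]] NW_uminus[OF assms(2)] by auto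

lemma NW_diff_commute:
  assumes "y \<in> W s" "z \<in> W s"
  shows "NW s (\<lambda>t. y t - z t) = NW s (\<lambda>t. z t - y t)"
  using NW_uminus[OF W_diff(1)[OF assms]] NW_uminus[OF W_diff(1)[OF assms(2,1)]] by simp

lemma W_zero: "(\<lambda>t. 0::'a::euclidean_space) \<in> W s" "NW s (\<lambda>t. 0::'a) = 0"
proof -
  have pr: "primitive (\<lambda>t. 0::'a) (\<lambda>t. 0)" by (simp add: primitive_def)
  have "(\<lambda>t. 0::'a) \<in> W s \<and> NW s (\<lambda>t. 0::'a) = 0"
  proof (induction s)
    case (Suc s)
    then show ?case using W_SucI(1)[OF _ pr] NW_primitive[OF _ pr] Lp_zero(2)[where 'a = 'a] by auto
  qed (simp add: W_0 NW_0 Lp_zero)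
  then show "(\<lambda>t. 0::'a) \<in> W s" "NW s (\<lambda>t. 0::'a) = 0" by auto
qed

lemma W_scaleR: "y \<in> W s \<Longrightarrow> (\<lambda>t. c *\<^sub>R y t) \<in> W s" "y \<in> W s \<Longrightarrow> NW s (\<lambda>t. c *\<^sub>R y t) \<le> \<bar>c\<bar> * NW s y"
proof -
  assume y: "y \<in> W s"
  have h: "bounded_linear (\<lambda>x::'a. c *\<^sub>R x)" by (rule bounded_linear_scaleR_right)
  show "(\<lambda>t. c *\<^sub>R y t) \<in> W s" using W_linear[OF h y] by blast
  have "onorm (\<lambda>x::'a. c *\<^sub>R x) \<le> \<bar>c\<bar>" by (rule onorm_bound) auto
  then have "onorm (\<lambda>x::'a. c *\<^sub>R x) * NW s y \<le> \<bar>c\<bar> * NW s y" by (intro mult_right_mono NW_nonneg)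
  then show "NW s (\<lambda>t. c *\<^sub>R y t) \<le> \<bar>c\<bar> * NW s y" using W_linear[OF h y] by simp
qed

lemma W_sum:
  assumes "finite S" "\<And>i. i \<in> S \<Longrightarrow> f i \<in> W s"
  shows "(\<lambda>t. \<Sum>i\<in>S. f i t) \<in> W s" "NW s (\<lambda>t. \<Sum>i\<in>S. f i t) \<le> (\<Sum>i\<in>S. NW s (f i))"
proof -
  have "(\<lambda>t. \<Sum>i\<in>S. f i t) \<in> W s \<and> NW s (\<lambda>t. \<Sum>i\<in>S. f i t) \<le> (\<Sum>i\<in>S. NW s (f i))"
    using assms
  proof (induction S rule: finite_induct)
    case empty then show ?case by (simp add: W_zero)
  next
    case (insert x F)
    then show ?case using W_add[of "f x" s "\<lambda>t. \<Sum>i\<in>F. f i t"] by force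
  qed
  then show "(\<lambda>t. \<Sum>i\<in>S. f i t) \<in> W s" "NW s (\<lambda>t. \<Sum>i\<in>S. f i t) \<le> (\<Sum>i\<in>S. NW s (f i))" by auto
qed

lemma ideriv_diff:
  assumes "y \<in> W s" "z \<in> W s" "k \<le> s"
  shows "eqW (s - k) (D k (\<lambda>t. y t - z t)) (\<lambda>t. D k y t - D k z t)"
proof -
  have "eqW (s - k) (D k (\<lambda>t. y t + - z t)) (\<lambda>t. D k y t + D k (\<lambda>t. - z t) t)"
    by (rule ideriv_add[OF assms(1) W_uminus[OF assms(2)] assms(3)])
  moreover have "eqW (s - k) (D k (\<lambda>t. - z t)) (\<lambda>t. - D k z t)"
    by (rule ideriv_linear[OF bounded_linear_minus[OF bounded_linear_ident] assms(2,3)])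
  then have "eqW (s - k) (\<lambda>t. D k y t + D k (\<lambda>t. - z t) t) (\<lambda>t. D k y t - D k z t)"
    by (auto simp: eqW_def elim: AE_mp split: if_splits)
  ultimately show ?thesis by (auto intro: eqW_trans)
qed

text \<open>By recursion on the order: the series of derivatives converges in the lower space, the
  values at \<open>a\<close> converge by the embedding, and integration is bounded.\<close>

lemma W_complete:
  fixes f :: "nat \<Rightarrow> real \<Rightarrow> 'a::euclidean_space"
  assumes "\<And>n. f n \<in> W s" "summable (\<lambda>n. NW s (f n))"
  shows "\<exists>g\<in>W s. (\<lambda>n. NW s (\<lambda>t. g t - (\<Sum>k<n. f k t))) \<longlonglongrightarrow> 0"
  using assms
proof (induction s arbitrary: f)
  case 0
  then show ?case using Lp_complete[of f] by (simp add: W_0 NW_0)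
next
  case (Suc s)
  let ?f' = "\<lambda>n. D (Suc 0) (f n)"
  note f' = W_SucD[OF Suc.prems(1)]
  have "NW s (?f' n) \<le> NW (Suc s) (f n)" for n using NW_ideriv[of s "Suc 0" "f n"] by simp
  then have "summable (\<lambda>n. NW s (?f' n))"
    by (intro summable_comparison_test'[OF Suc.prems(2), of 0]) (simp add: NW_nonneg)
  from Suc.IH[OF f'(1) this] obtain g where g: "g \<in> W s" "(\<lambda>n. NW s (\<lambda>t. g t - (\<Sum>k<n. ?f' k t))) \<longlonglongrightarrow> 0"
    by blast
  obtain C where C: "C \<ge> 0" "\<forall>s. \<forall>(y::real \<Rightarrow> 'a)\<in>W (Suc s). \<forall>t\<in>{a..b}. norm (y t) \<le> C * NW (Suc s) y"
    using W_Suc_sup_bound by blast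
  have "summable (\<lambda>n. f n a)"
    by (rule summable_norm_cancel, rule summable_comparison_test'[OF summable_mult[OF Suc.prems(2), of C], of 0])
      (use C(2) Suc.prems(1) ab in simp)
  then have lim_a: "(\<lambda>n. \<Sum>k<n. f k a) \<longlonglongrightarrow> (\<Sum>n. f n a)" by (rule summable_LIMSEQ)
  define y where "y t = (\<Sum>n. f n a) + integral {a..t} g" for t
  have y: "primitive y g" by (simp add: primitive_def y_def)
  have prS: "primitive (\<lambda>t. \<Sum>k<n. f k t) (\<lambda>t. \<Sum>k<n. ?f' k t)" for n
  proof (induction n)
    case (Suc n)
    then show ?case
      using primitive_add[OF Suc f'(2)] W_integrable[OF W_sum(1)] W_integrable[OF f'(1)] f'(1) by auto
  qed (simp add: primitive_def)
  have WS: "(\<lambda>t. \<Sum>k<n. ?f' k t) \<in> W s" for n by (intro W_sum f'(1)) auto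
  have prd: "primitive (\<lambda>t. y t - (\<Sum>k<n. f k t)) (\<lambda>t. g t - (\<Sum>k<n. ?f' k t))" for n
    using primitive_add[OF y primitive_linear[OF prS bounded_linear_minus[OF bounded_linear_ident]], of n]
      W_integrable[OF g(1)] W_integrable[OF WS, of n] by simp
  obtain C' where C': "C' \<ge> 0" "\<forall>s. \<forall>(y::real \<Rightarrow> 'a) g. g \<in> W s \<longrightarrow> primitive y g \<longrightarrow> NW (Suc s) y \<le> C' * (norm (y a) + NW s g)"
    using NW_primitive_bound by blast
  have "(\<lambda>n. NW (Suc s) (\<lambda>t. y t - (\<Sum>k<n. f k t))) \<longlonglongrightarrow> 0"
  proof (rule tendsto_sandwich[OF _ _ tendsto_const])
    show "\<forall>\<^sub>F n in sequentially. 0 \<le> NW (Suc s) (\<lambda>t. y t - (\<Sum>k<n. f k t))"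
      by (simp add: NW_nonneg)
    show "\<forall>\<^sub>F n in sequentially. NW (Suc s) (\<lambda>t. y t - (\<Sum>k<n. f k t))
      \<le> C' * (norm (y a - (\<Sum>k<n. f k a)) + NW s (\<lambda>t. g t - (\<Sum>k<n. ?f' k t)))"
      using C'(2) W_diff(1)[OF g(1) WS] prd by (intro always_eventually allI) blast
    have "(\<lambda>n. C' * (norm (y a - (\<Sum>k<n. f k a)) + NW s (\<lambda>t. g t - (\<Sum>k<n. ?f' k t)))) \<longlonglongrightarrow> C' * (norm (y a - (\<Sum>n. f n a)) + 0)"
      by (intro tendsto_intros lim_a g(2))
    then show "(\<lambda>n. C' * (norm (y a - (\<Sum>k<n. f k a)) + NW s (\<lambda>t. g t - (\<Sum>k<n. ?f' k t)))) \<longlonglongrightarrow> 0"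
      by (simp add: y_def)
  qed
  then show ?case using W_SucI(1)[OF g(1) y] by blast
qed

lemma W_lift: "y \<in> W (Suc l) \<Longrightarrow> D l y \<in> W s \<Longrightarrow> 0 < s \<Longrightarrow> y \<in> W (s + l)"
proof (induction l arbitrary: y)
  case (Suc l)
  have "D (Suc 0) y \<in> W (s + l)"
    using Suc.IH[of "D (Suc 0) y"] W_SucD(1)[OF Suc.prems(1)] Suc.prems(2,3) by (simp add: ideriv_Suc2)
  from W_SucI(1)[OF this W_SucD(2)[OF Suc.prems(1)]] show ?case by simp
qed simp

text \<open>Repeated integration from \<open>a\<close>: initial values and the derivative of order
  \<open>r\<close> control the full norm.\<close>

lemma NW_initial_bound:
  "\<exists>C\<ge>0. \<forall>(y::real \<Rightarrow> 'a::euclidean_space)\<in>W (s + r). NW (s + r) y \<le> C * ((\<Sum>l<r. norm (D l y a)) + NW s (D r y))"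
proof (induction r)
  case 0
  show ?case by (intro exI[of _ 1]) simp
next
  case (Suc r)
  then obtain C where C: "C \<ge> 0" "\<forall>(y::real \<Rightarrow> 'a)\<in>W (s + r). NW (s + r) y \<le> C * ((\<Sum>l<r. norm (D l y a)) + NW s (D r y))"
    by blast
  obtain C' where C': "C' \<ge> 0" "\<forall>s. \<forall>(y::real \<Rightarrow> 'a) g. g \<in> W s \<longrightarrow> primitive y g \<longrightarrow> NW (Suc s) y \<le> C' * (norm (y a) + NW s g)"
    using NW_primitive_bound by blast
  have "NW (s + Suc r) y \<le> (C' * (C + 1)) * ((\<Sum>l<Suc r. norm (D l y a)) + NW s (D (Suc r) y))"
    if y: "y \<in> W (s + Suc r)" for y :: "real \<Rightarrow> 'a"
  proof -
    have y': "D (Suc 0) y \<in> W (s + r)" "primitive y (D (Suc 0) y)" using W_SucD[of y "s + r"] y by auto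
    let ?T = "(\<Sum>l<r. norm (D (Suc l) y a)) + NW s (D (Suc r) y)"
    have T: "0 \<le> ?T" by (intro add_nonneg_nonneg sum_nonneg NW_nonneg) auto
    have "NW (Suc (s + r)) y \<le> C' * (norm (y a) + NW (s + r) (D (Suc 0) y))"
      using C'(2) y' by blast
    also have "\<dots> \<le> C' * (norm (y a) + C * ?T)"
      using C(2)[rule_format, OF y'(1)] C'(1) unfolding ideriv_Suc2 by (intro mult_left_mono add_left_mono) auto
    also have "\<dots> \<le> C' * ((C + 1) * (norm (y a) + ?T))"
      using C(1) C'(1) T by (intro mult_left_mono) (auto simp: algebra_simps)
    also have "norm (y a) + ?T = (\<Sum>l<Suc r. norm (D l y a)) + NW s (D (Suc r) y)"
      by (simp add: sum.lessThan_Suc_shift del: sum.lessThan_Suc)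
    finally show ?thesis by (simp add: mult.assoc)
  qed
  then show ?case using C(1) C'(1) by (intro exI[of _ "C' * (C + 1)"]) auto
qed

end

section \<open>The Cauchy problem\<close>

lemma bounded_bilinear_matrix_vector_mult:
  "bounded_bilinear ((*v) :: complex ^ 'n ^ 'm \<Rightarrow> complex ^ 'n \<Rightarrow> complex ^ 'm)"
proof -
  have "bilinear ((*v) :: complex ^ 'n ^ 'm \<Rightarrow> complex ^ 'n \<Rightarrow> complex ^ 'm)"
    unfolding bilinear_def
    by (intro conjI allI linearI)
      (simp_all add: matrix_vector_mult_def vec_eq_iff sum.distrib scaleR_sum_right algebra_simps)
  then show ?thesis by (simp add: bilinear_conv_bounded_bilinear)
qed

locale interval_ode = interval_Lp +
  fixes n r :: nat
  assumes r1: "1 \<le> r"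
begin

abbreviation L :: "(nat \<Rightarrow> real \<Rightarrow> complex ^ 'm ^ 'm) \<Rightarrow> (real \<Rightarrow> complex ^ 'm) \<Rightarrow> real \<Rightarrow> complex ^ 'm" where
  "L \<equiv> diff_op a b r"

definition coeffs :: "(nat \<Rightarrow> real \<Rightarrow> complex ^ 'm ^ 'm) \<Rightarrow> bool" where
  "coeffs A \<longleftrightarrow> (\<forall>l<r. A l \<in> W n)"

lemma L_eq: "L A y t = D r y t + (\<Sum>l<r. A l t *v D l y t)"
proof -
  have "(\<Sum>j=1..r. A (r - j) t *v D (r - j) y t) = (\<Sum>l<r. A l t *v D l y t)"
    by (rule sum.reindex_bij_witness[where i = "\<lambda>l. r - l" and j = "\<lambda>j. r - j"]) auto
  then show ?thesis by (simp add: diff_op_def)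
qed

text \<open>Valid at every point, including those where the top derivative is arbitrary, because the
  definition of the operator is merely rearranged.\<close>

lemma D_top: "D r y = (\<lambda>t. L A y t - (\<Sum>l<r. A l t *v D l y t))"
  by (simp add: L_eq fun_eq_iff)

lemma W_low_ideriv:
  assumes "y \<in> W (k + r)" "l < r"
  shows "D l y \<in> W (Suc k)" "NW (Suc k) (D l y) \<le> NW (k + r) y"
proof -
  show "D l y \<in> W (Suc k)"
    using W_mono[OF W_ideriv_le[OF assms(1), of l], of "Suc k"] assms(2) by simp
  have "NW (Suc k) (D l y) \<le> NW (k + r - l) (D l y)" using assms(2) by (intro NW_mono) simp
  also have "\<dots> \<le> NW (k + r - l + l) y" by (rule NW_ideriv)
  finally show "NW (Suc k) (D l y) \<le> NW (k + r) y" using assms(2) by simp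
qed

text \<open>For positive order both functions are continuous and share a primitive, so
  differentiating it gives equality everywhere.\<close>

lemma eqW_of_AE:
  assumes "u \<in> W s" "v \<in> W s" "AE t in M. u t = v t"
  shows "eqW s u v"
proof (cases s)
  case 0
  then show ?thesis using assms(3) by (simp add: eqW_def)
next
  case (Suc k)
  define y where "y t = integral {a..t} u" for t
  have yu: "primitive y u" by (simp add: primitive_def y_def)
  have yv: "primitive y v" by (rule primitive_cong[OF yu assms(3)])
  have c: "continuous_on {a..b} u" "continuous_on {a..b} v"
    using W_Suc_continuous[of u k 0] W_Suc_continuous[of v k 0] assms Suc by auto
  show ?thesis
  proof (rule eqW_I)
    fix t assume t: "t \<in> {a..b}"
    show "u t = v t"
      using vector_derivative_Icc[OF primitive_derivative[OF yu c(1) t] t]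
        vector_derivative_Icc[OF primitive_derivative[OF yv c(2) t] t] by simp
  qed
qed

lemma coeff_term_bound:
  "\<exists>C\<ge>0. \<forall>(A::real \<Rightarrow> complex ^ 'm ^ 'm)\<in>W n. \<forall>y\<in>W (n + r). \<forall>l<r. (\<lambda>t. A t *v D l y t) \<in> W n \<and>
     NW n (\<lambda>t. A t *v D l y t) \<le> C * NW n A * NW (n + r) y"
proof -
  obtain C where C: "C \<ge> 0" "\<forall>(A::real \<Rightarrow> complex ^ 'm ^ 'm)\<in>W n. \<forall>g\<in>W (Suc n). (\<lambda>t. A t *v g t) \<in> W n \<and>
     NW n (\<lambda>t. A t *v g t) \<le> C * NW n A * NW (Suc n) g"
    using W_mult[OF bounded_bilinear_matrix_vector_mult, of n] by blast
  have "(\<lambda>t. A t *v D l y t) \<in> W n \<and> NW n (\<lambda>t. A t *v D l y t) \<le> C * NW n A * NW (n + r) y"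
    if A: "A \<in> W n" and y: "y \<in> W (n + r)" and l: "l < r" for A :: "real \<Rightarrow> complex ^ 'm ^ 'm" and y l
  proof -
    note Dl = W_low_ideriv[OF y l]
    have "C * NW n A * NW (Suc n) (D l y) \<le> C * NW n A * NW (n + r) y"
      using Dl(2) C(1) by (intro mult_left_mono) auto
    then show ?thesis using C(2) A Dl(1) by (blast intro: order_trans)
  qed
  then show ?thesis using C(1) by blast
qed

lemma L_in_W:
  assumes A: "coeffs A" and y: "y \<in> W (n + r)"
  shows "L A y \<in> W n"
proof -
  have "(\<lambda>t. A l t *v D l y t) \<in> W n" if "l < r" for l
    using coeff_term_bound A y that unfolding coeffs_def by blast
  then have "(\<lambda>t. \<Sum>l<r. A l t *v D l y t) \<in> W n" by (intro W_sum(1)) auto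
  from W_add[OF W_ideriv[OF y] this] show ?thesis by (simp add: L_eq[abs_def])
qed

text \<open>The top derivatives cancel exactly, leaving products of coefficient differences with
  lower derivatives.\<close>

lemma L_diff_bound:
  "\<exists>C\<ge>0. \<forall>(A::nat \<Rightarrow> real \<Rightarrow> complex ^ 'm ^ 'm) A'. coeffs A \<longrightarrow> coeffs A' \<longrightarrow> (\<forall>y\<in>W (n + r).
     NW n (\<lambda>t. L A y t - L A' y t) \<le> C * (\<Sum>l<r. NW n (\<lambda>t. A l t - A' l t)) * NW (n + r) y)"
proof -
  obtain C where C: "C \<ge> 0" "\<forall>(A::real \<Rightarrow> complex ^ 'm ^ 'm)\<in>W n. \<forall>y\<in>W (n + r). \<forall>l<r. (\<lambda>t. A t *v D l y t) \<in> W n \<and>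
     NW n (\<lambda>t. A t *v D l y t) \<le> C * NW n A * NW (n + r) y"
    using coeff_term_bound by blast
  have "NW n (\<lambda>t. L A y t - L A' y t) \<le> C * (\<Sum>l<r. NW n (\<lambda>t. A l t - A' l t)) * NW (n + r) y"
    if A: "coeffs A" "coeffs A'" and y: "y \<in> W (n + r)" for A A' :: "nat \<Rightarrow> real \<Rightarrow> complex ^ 'm ^ 'm" and y
  proof -
    have Ad: "(\<lambda>t. A l t - A' l t) \<in> W n" if "l < r" for l using A that by (auto simp: coeffs_def intro: W_diff)
    have eq: "(\<lambda>t. L A y t - L A' y t) = (\<lambda>t. \<Sum>l<r. (A l t - A' l t) *v D l y t)"
      by (simp add: L_eq fun_eq_iff sum_subtractf matrix_vector_mult_diff_rdistrib)
    have "NW n (\<lambda>t. L A y t - L A' y t) \<le> (\<Sum>l<r. NW n (\<lambda>t. (A l t - A' l t) *v D l y t))"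
      unfolding eq using C(2) Ad y by (intro W_sum(2)) auto
    also have "\<dots> \<le> (\<Sum>l<r. C * NW n (\<lambda>t. A l t - A' l t) * NW (n + r) y)"
      using C(2) Ad y by (intro sum_mono) auto
    finally show ?thesis by (simp add: sum_distrib_left sum_distrib_right)
  qed
  then show ?thesis using C(1) by blast
qed

lemma L_add:
  assumes "coeffs A" "y \<in> W (n + r)" "z \<in> W (n + r)"
  shows "eqW n (L A (\<lambda>t. y t + z t)) (\<lambda>t. L A y t + L A z t)"
proof -
  have low: "D l (\<lambda>t. y t + z t) t = D l y t + D l z t" if "l < r" "t \<in> {a..b}" for l t
    using ideriv_add[OF assms(2,3), of l] that by (auto simp: eqW_def)
  have "(\<Sum>l<r. A l t *v D l (\<lambda>t. y t + z t) t) = (\<Sum>l<r. A l t *v D l y t) + (\<Sum>l<r. A l t *v D l z t)" if "t \<in> {a..b}" for t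
    unfolding sum.distrib[symmetric] using low that by (intro sum.cong) (auto simp: matrix_vector_right_distrib)
  moreover have "eqW n (D r (\<lambda>t. y t + z t)) (\<lambda>t. D r y t + D r z t)"
    using ideriv_add[OF assms(2,3), of r] by simp
  ultimately show ?thesis
    unfolding eqW_def L_eq using AE_space[of M] by (auto split: if_splits elim!: AE_mp)
qed

lemma L_scaleR:
  assumes "coeffs A" "y \<in> W (n + r)"
  shows "eqW n (L A (\<lambda>t. k *\<^sub>R y t)) (\<lambda>t. k *\<^sub>R L A y t)"
proof -
  note h = bounded_linear_scaleR_right[of k]
  have low: "D l (\<lambda>t. k *\<^sub>R y t) t = k *\<^sub>R D l y t" if "l < r" "t \<in> {a..b}" for l t
    using ideriv_linear[OF h assms(2), of l] that by (auto simp: eqW_def)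
  have m: "A l t *v (k *\<^sub>R x) = k *\<^sub>R (A l t *v x)" for l t x
    using bounded_bilinear.scaleR_right[OF bounded_bilinear_matrix_vector_mult] .
  have "(\<Sum>l<r. A l t *v D l (\<lambda>t. k *\<^sub>R y t) t) = k *\<^sub>R (\<Sum>l<r. A l t *v D l y t)" if "t \<in> {a..b}" for t
    unfolding scaleR_sum_right using low that by (intro sum.cong) (auto simp: m)
  moreover have "eqW n (D r (\<lambda>t. k *\<^sub>R y t)) (\<lambda>t. k *\<^sub>R D r y t)"
    using ideriv_linear[OF h assms(2), of r] by simp
  ultimately show ?thesis
    unfolding eqW_def L_eq using AE_space[of M] by (auto split: if_splits elim!: AE_mp simp: scaleR_add_right)
qed

lemma L_diff:
  assumes "coeffs A" "y \<in> W (n + r)" "z \<in> W (n + r)"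
  shows "eqW n (L A (\<lambda>t. y t - z t)) (\<lambda>t. L A y t - L A z t)"
proof -
  have "eqW n (L A (\<lambda>t. y t + (-1) *\<^sub>R z t)) (\<lambda>t. L A y t + L A (\<lambda>t. (-1) *\<^sub>R z t) t)"
    by (rule L_add[OF assms(1,2) W_scaleR(1)[OF assms(3)]])
  moreover have "eqW n (L A (\<lambda>t. (-1) *\<^sub>R z t)) (\<lambda>t. (-1) *\<^sub>R L A z t)"
    by (rule L_scaleR[OF assms(1,3)])
  then have "eqW n (\<lambda>t. L A y t + L A (\<lambda>t. (-1) *\<^sub>R z t) t) (\<lambda>t. L A y t - L A z t)"
    by (auto simp: eqW_def elim: AE_mp split: if_splits)
  ultimately show ?thesis by (auto intro: eqW_trans)
qed

lemma L_zero: "coeffs A \<Longrightarrow> eqW n (L A (\<lambda>t. 0)) (\<lambda>t. 0)"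
  using L_scaleR[OF _ W_zero(1), of A 0] by simp

text \<open>Gronwall's inequality for \<open>\<Phi>\<close>, the sum of the norms of the derivatives
  below order \<open>r\<close>. The right-hand side enters only through its L1 norm, so integrable
  coefficients suffice.\<close>

lemma ode_sup_bound:
  fixes A :: "nat \<Rightarrow> real \<Rightarrow> complex ^ 'm ^ 'm"
  assumes A: "coeffs A"
  shows "\<exists>C\<ge>0. \<forall>y\<in>W (n + r). \<forall>t\<in>{a..b}. (\<Sum>l<r. norm (D l y t)) \<le> C * ((\<Sum>l<r. norm (D l y a)) + N (L A y))"
proof -
  obtain K where K: "0 \<le> K" "\<And>(B::complex^'m^'m) v. norm (B *v v) \<le> norm B * norm v * K"
    using bounded_bilinear.nonneg_bounded[OF bounded_bilinear_matrix_vector_mult] by blast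
  \<comment> \<open>The summand 1 accounts for derivatives of order below \<open>r\<close> that
    reappear when each order is integrated from the next; the rest bounds the derivative of order
    \<open>r\<close> through the equation.\<close>
  define \<beta> where "\<beta> t = 1 + K * (\<Sum>l<r. norm (A l t))" for t
  have Ai: "integrable M (A l)" if "l < r" for l using A that by (auto simp: coeffs_def intro: W_integrable)
  have "integrable M (\<lambda>t. 1::real)" using finite_measure.integrable_const[OF finite_M] .
  then have \<beta>i: "integrable M \<beta>" unfolding \<beta>_def using Ai
    by (intro Bochner_Integration.integrable_add integrable_mult_right Bochner_Integration.integrable_sum integrable_norm) auto
  have \<beta>0: "0 \<le> \<beta> t" for t unfolding \<beta>_def using K(1) by (intro add_nonneg_nonneg mult_nonneg_nonneg sum_nonneg) auto
  obtain C where C: "0 \<le> C" "\<And>\<Phi> S t. \<lbrakk>continuous_on {a..b} \<Phi>; \<And>t. t \<in> {a..b} \<Longrightarrow> 0 \<le> \<Phi> t; 0 \<le> S;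
      \<And>t. t \<in> {a..b} \<Longrightarrow> \<Phi> t \<le> S + integral {a..t} (\<lambda>t. \<beta> t * \<Phi> t); t \<in> {a..b}\<rbrakk> \<Longrightarrow> \<Phi> t \<le> C * S"
    by (rule gronwall_integrable[OF \<beta>i \<beta>0 ab]) blast
  define c where "c = b - a + 1"
  have c: "1 \<le> c" using ab by (simp add: c_def)
  have "(\<Sum>l<r. norm (D l y t)) \<le> (C * c) * ((\<Sum>l<r. norm (D l y a)) + N (L A y))"
    if y: "y \<in> W (n + r)" and t: "t \<in> {a..b}" for y t
  proof -
    define \<Phi> where "\<Phi> t = (\<Sum>l<r. norm (D l y t))" for t
    define S where "S = \<Phi> a + c * N (L A y)"
    have LL: "L A y \<in> Lp" using W_mono[OF L_in_W[OF A y], of 0] by (simp add: W_0)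
    have Li: "integrable M (\<lambda>t. norm (L A y t))" using Lp_integrable(1)[OF LL] by simp
    have Dc: "continuous_on {a..b} (D l y)" if "l < r" for l
      using W_Suc_continuous[OF W_low_ideriv(1)[OF y that], of 0] by simp
    have \<Phi>c: "continuous_on {a..b} \<Phi>"
      unfolding \<Phi>_def using Dc by (intro continuous_on_sum continuous_on_norm) auto
    have Di: "integrable M (D l y)" if "l \<le> r" for l
      using W_integrable[OF W_ideriv_le[OF y]] that by simp
    have top: "norm (D r y t) \<le> norm (L A y t) + K * (\<Sum>l<r. norm (A l t)) * \<Phi> t" for t
    proof -
      have "norm (A l t *v D l y t) \<le> K * norm (A l t) * \<Phi> t" if "l < r" for l
      proof -
        have "norm (D l y t) \<le> \<Phi> t" unfolding \<Phi>_def using that by (intro member_le_sum) auto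
        then have "norm (A l t) * norm (D l y t) * K \<le> norm (A l t) * \<Phi> t * K"
          using K(1) by (intro mult_right_mono mult_left_mono) auto
        then show ?thesis using K(2)[of "A l t" "D l y t"] by (simp add: algebra_simps)
      qed
      then have "norm (\<Sum>l<r. A l t *v D l y t) \<le> (\<Sum>l<r. K * norm (A l t) * \<Phi> t)"
        by (intro sum_norm_le) auto
      then show ?thesis
        unfolding fun_cong[OF D_top[of y A]] using norm_triangle_ineq4[of "L A y t" "\<Sum>l<r. A l t *v D l y t"]
        by (simp add: sum_distrib_left sum_distrib_right)
    qed
    have shift: "(\<Sum>l<r. norm (D (Suc l) y t)) \<le> \<Phi> t + norm (D r y t)" for t
    proof -
      have "norm (D 0 y t) + (\<Sum>l<r. norm (D (Suc l) y t)) = \<Phi> t + norm (D r y t)"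
        unfolding \<Phi>_def using sum.lessThan_Suc_shift[of "\<lambda>l. norm (D l y t)" r] by simp
      then show ?thesis by (smt (verit) norm_ge_zero)
    qed
    have \<beta>\<Phi>: "integrable M (\<lambda>t. \<beta> t * \<Phi> t)"
    proof -
      obtain B where "\<forall>t\<in>{a..b}. norm (\<Phi> t) \<le> B"
        using compact_imp_bounded[OF compact_continuous_image[OF \<Phi>c compact_Icc]] by (auto simp: bounded_iff)
      then have B: "\<bar>\<Phi> t\<bar> \<le> B" if "t \<in> {a..b}" for t using that by simp
      show ?thesis
      proof (rule Bochner_Integration.integrable_bound[OF integrable_mult_right[OF \<beta>i, of B]])
        show "(\<lambda>t. \<beta> t * \<Phi> t) \<in> borel_measurable M"
          using \<beta>i by (intro borel_measurable_times continuous_Lp[OF \<Phi>c]) auto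
        show "AE t in M. norm (\<beta> t * \<Phi> t) \<le> norm (B * \<beta> t)"
        proof (rule AE_I2)
          fix t assume "t \<in> space M"
          then have "\<bar>\<Phi> t\<bar> \<le> \<bar>B\<bar>" using B[of t] by simp
          then show "norm (\<beta> t * \<Phi> t) \<le> norm (B * \<beta> t)"
            by (simp add: abs_mult mult.commute mult_left_mono mult_right_mono)
        qed
      qed
    qed
    have "\<Phi> t \<le> C * S"
    proof (rule C(2)[OF \<Phi>c _ _ _ t])
      show "0 \<le> \<Phi> t" for t unfolding \<Phi>_def by (intro sum_nonneg) auto
      then show "0 \<le> S" unfolding S_def using c by simp
      fix t assume t: "t \<in> {a..b}"
      have Dl: "norm (D l y t) \<le> norm (D l y a) + integral {a..t} (\<lambda>t. norm (D (Suc l) y t))" if "l < r" for l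
      proof -
        have pr: "primitive (D l y) (D (Suc l) y)"
          using W_SucD(2)[OF W_low_ideriv(1)[OF y that]] by (simp add: ideriv_ideriv)
        have "norm (D l y t) \<le> norm (D l y a) + norm (integral {a..t} (D (Suc l) y))"
          unfolding primitiveD[OF pr t] by (rule norm_triangle_ineq)
        also have "norm (integral {a..t} (D (Suc l) y)) \<le> integral {a..t} (\<lambda>t. norm (D (Suc l) y t))"
          using t that Di[of "Suc l"] by (intro integral_norm_bound_integral integrable_lebesgue_on_Icc) auto
        finally show ?thesis by simp
      qed
      have tb: "t \<le> b" using t by simp
      have nDi: "(\<lambda>t. norm (D (Suc l) y t)) integrable_on {a..t}" if "l < r" for l
        using integrable_lebesgue_on_Icc[OF integrable_norm[OF Di[of "Suc l"]] tb] that by simp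
      have "\<Phi> t \<le> (\<Sum>l<r. norm (D l y a) + integral {a..t} (\<lambda>t. norm (D (Suc l) y t)))"
        unfolding \<Phi>_def using Dl by (intro sum_mono) auto
      also have "\<dots> = \<Phi> a + integral {a..t} (\<lambda>t. \<Sum>l<r. norm (D (Suc l) y t))"
        unfolding sum.distrib \<Phi>_def using nDi
        by (subst Henstock_Kurzweil_Integration.integral_sum) auto
      also have "integral {a..t} (\<lambda>t. \<Sum>l<r. norm (D (Suc l) y t)) \<le> integral {a..t} (\<lambda>t. norm (L A y t) + \<beta> t * \<Phi> t)"
      proof (rule integral_le)
        show "(\<lambda>t. \<Sum>l<r. norm (D (Suc l) y t)) integrable_on {a..t}"
          using nDi by (intro integrable_sum) auto
        show "(\<lambda>t. norm (L A y t) + \<beta> t * \<Phi> t) integrable_on {a..t}"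
          by (intro integrable_lebesgue_on_Icc[OF _ tb] Bochner_Integration.integrable_add Li \<beta>\<Phi>)
        fix u
        show "(\<Sum>l<r. norm (D (Suc l) y u)) \<le> norm (L A y u) + \<beta> u * \<Phi> u"
          using shift[of u] top[of u] by (simp add: \<beta>_def distrib_right)
      qed
      also have "\<dots> = integral {a..t} (\<lambda>t. norm (L A y t)) + integral {a..t} (\<lambda>t. \<beta> t * \<Phi> t)"
        by (rule integral_lebesgue_on_add[OF Li \<beta>\<Phi> tb])
      also have "integral {a..t} (\<lambda>t. norm (L A y t)) \<le> integral {a..b} (\<lambda>t. norm (L A y t))"
        using t by (intro integral_subset_le integrable_lebesgue_on_Icc[OF Li]) auto
      also have "\<dots> \<le> c * N (L A y)"
        using Lp_integrable(2)[OF LL] lebesgue_integral_eq_integral[OF Li] by (simp add: c_def)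
      finally show "\<Phi> t \<le> S + integral {a..t} (\<lambda>t. \<beta> t * \<Phi> t)" by (simp add: S_def)
    qed
    also have "S \<le> c * (\<Phi> a + N (L A y))"
      using mult_right_mono[OF c, of "\<Phi> a"] by (simp add: S_def distrib_left \<Phi>_def sum_nonneg)
    finally show ?thesis using C(1) by (simp add: \<Phi>_def mult.assoc mult_left_mono)
  qed
  then show ?thesis using C(1) c by (intro exI[of _ "C * c"]) auto
qed

text \<open>Bootstrap in \<open>k\<close>: a bound on \<open>NW (k + r) y\<close> bounds the lower
  derivatives in \<open>W (Suc k)\<close>, hence the products with the coefficients, hence the top
  derivative through the equation, and \<open>NW_initial_bound\<close> closes the step. At
  \<open>k = 0\<close> the coefficients are only in Lp and the supremum bound is used
  instead.\<close>

lemma ode_apriori: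
  fixes A :: "nat \<Rightarrow> real \<Rightarrow> complex ^ 'm ^ 'm"
  assumes A: "coeffs A"
  shows "\<exists>C\<ge>0. \<forall>y\<in>W (n + r). NW (n + r) y \<le> C * ((\<Sum>l<r. norm (D l y a)) + NW n (L A y))"
proof -
  have "k \<le> n \<Longrightarrow> \<exists>C\<ge>0. \<forall>y\<in>W (n + r). NW (k + r) y \<le> C * ((\<Sum>l<r. norm (D l y a)) + NW k (L A y))" for k
  proof (induction k)
    case 0
    obtain K where K: "0 \<le> K" "\<And>(B::complex^'m^'m) v. norm (B *v v) \<le> norm B * norm v * K"
      using bounded_bilinear.nonneg_bounded[OF bounded_bilinear_matrix_vector_mult] by blast
    obtain C where C: "C \<ge> 0" "\<forall>y\<in>W (n + r). \<forall>t\<in>{a..b}. (\<Sum>l<r. norm (D l y t)) \<le> C * ((\<Sum>l<r. norm (D l y a)) + N (L A y))"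
      using ode_sup_bound[OF A] by blast
    obtain C' where C': "C' \<ge> 0" "\<forall>(y::real \<Rightarrow> complex^'m)\<in>W (0 + r). NW (0 + r) y \<le> C' * ((\<Sum>l<r. norm (D l y a)) + NW 0 (D r y))"
      using NW_initial_bound[of 0 r] by blast
    let ?Q = "K * C * (\<Sum>l<r. N (A l))"
    have Q: "0 \<le> ?Q" using K C by (intro mult_nonneg_nonneg sum_nonneg) auto
    have "NW (0 + r) y \<le> (C' * (1 + ?Q)) * ((\<Sum>l<r. norm (D l y a)) + NW 0 (L A y))" if y: "y \<in> W (n + r)" for y
    proof -
      define T where "T = (\<Sum>l<r. norm (D l y a)) + N (L A y)"
      have T: "0 \<le> T" unfolding T_def by (intro add_nonneg_nonneg sum_nonneg) auto
      have LL: "L A y \<in> Lp" using W_mono[OF L_in_W[OF A y], of 0] by (simp add: W_0)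
      have summand: "(\<lambda>t. A l t *v D l y t) \<in> Lp" "N (\<lambda>t. A l t *v D l y t) \<le> K * (C * T) * N (A l)" if l: "l < r" for l
      proof -
        have Al: "A l \<in> Lp" using A l W_mono[of "A l" n 0] by (auto simp: coeffs_def W_0)
        have m: "D l y \<in> borel_measurable M" using W_integrable[OF W_low_ideriv(1)[OF y l]] by auto
        have "AE t in M. norm (D l y t) \<le> C * T"
        proof (rule AE_I2)
          fix t assume "t \<in> space M"
          then have "(\<Sum>l<r. norm (D l y t)) \<le> C * T" using C(2) y by (simp add: T_def)
          moreover have "norm (D l y t) \<le> (\<Sum>l<r. norm (D l y t))" using l by (intro member_le_sum) auto
          ultimately show "norm (D l y t) \<le> C * T" by linarith
        qed
        from Lp_mult_bounded[OF bounded_bilinear_matrix_vector_mult K(2,1) Al m this] C(1) T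
        show "(\<lambda>t. A l t *v D l y t) \<in> Lp" "N (\<lambda>t. A l t *v D l y t) \<le> K * (C * T) * N (A l)" by auto
      qed
      have "(\<lambda>t. \<Sum>l<r. A l t *v D l y t) \<in> W 0" using summand(1) by (intro W_sum(1)) (auto simp: W_0)
      then have "N (D r y) \<le> N (L A y) + NW 0 (\<lambda>t. \<Sum>l<r. A l t *v D l y t)"
        using W_diff(2)[of "L A y" 0 "\<lambda>t. \<Sum>l<r. A l t *v D l y t"] LL D_top[of y A]
        by (simp add: NW_0 W_0)
      also have "NW 0 (\<lambda>t. \<Sum>l<r. A l t *v D l y t) \<le> (\<Sum>l<r. NW 0 (\<lambda>t. A l t *v D l y t))"
        using summand(1) by (intro W_sum(2)) (auto simp: W_0)
      also have "\<dots> \<le> (\<Sum>l<r. K * (C * T) * N (A l))" using summand(2) by (intro sum_mono) (auto simp: NW_0)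
      also have "\<dots> = ?Q * T" by (simp add: sum_distrib_left sum_distrib_right algebra_simps)
      finally have "(\<Sum>l<r. norm (D l y a)) + NW 0 (D r y) \<le> (1 + ?Q) * T"
        by (simp add: NW_0 T_def algebra_simps)
      then have "C' * ((\<Sum>l<r. norm (D l y a)) + NW 0 (D r y)) \<le> C' * ((1 + ?Q) * T)"
        using C'(1) by (rule mult_left_mono)
      moreover have "y \<in> W (0 + r)" using W_mono[OF y, of r] by simp
      ultimately show ?thesis using C'(2) unfolding T_def NW_0 mult.assoc by (blast intro: order_trans)
    qed
    then show ?case using C'(1) Q by (intro exI[of _ "C' * (1 + ?Q)"]) auto
  next
    case (Suc k)
    then obtain C where C: "C \<ge> 0" "\<forall>y\<in>W (n + r). NW (k + r) y \<le> C * ((\<Sum>l<r. norm (D l y a)) + NW k (L A y))"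
      by auto
    obtain C' where C': "C' \<ge> 0" "\<forall>(y::real \<Rightarrow> complex^'m)\<in>W (Suc k + r). NW (Suc k + r) y \<le> C' * ((\<Sum>l<r. norm (D l y a)) + NW (Suc k) (D r y))"
      using NW_initial_bound[of "Suc k" r] by blast
    obtain P where P: "P \<ge> 0" "\<forall>(B::real \<Rightarrow> complex ^ 'm ^ 'm)\<in>W (Suc k). \<forall>g\<in>W (Suc k). (\<lambda>t. B t *v g t) \<in> W (Suc k) \<and>
      NW (Suc k) (\<lambda>t. B t *v g t) \<le> P * NW (Suc k) B * NW (Suc k) g"
      using W_mult_Suc[OF bounded_bilinear_matrix_vector_mult, of k] by blast
    let ?Q = "P * C * (\<Sum>l<r. NW (Suc k) (A l))"
    have Q: "0 \<le> ?Q" using P C by (intro mult_nonneg_nonneg sum_nonneg) auto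
    have "NW (Suc k + r) y \<le> (C' * (1 + ?Q)) * ((\<Sum>l<r. norm (D l y a)) + NW (Suc k) (L A y))" if y: "y \<in> W (n + r)" for y
    proof -
      define T where "T = (\<Sum>l<r. norm (D l y a)) + NW (Suc k) (L A y)"
      have T: "0 \<le> T" unfolding T_def by (intro add_nonneg_nonneg sum_nonneg) auto
      have "(\<Sum>l<r. norm (D l y a)) + NW k (L A y) \<le> T"
        unfolding T_def by (intro add_left_mono NW_mono) simp
      then have "C * ((\<Sum>l<r. norm (D l y a)) + NW k (L A y)) \<le> C * T" using C(1) by (rule mult_left_mono)
      then have kr: "NW (k + r) y \<le> C * T" using C(2) y by (blast intro: order_trans)
      have LW: "L A y \<in> W (Suc k)" using W_mono[OF L_in_W[OF A y], of "Suc k"] Suc.prems by simp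
      have ykr: "y \<in> W (k + r)" using W_mono[OF y, of "k + r"] Suc.prems by simp
      have summand: "(\<lambda>t. A l t *v D l y t) \<in> W (Suc k)" "NW (Suc k) (\<lambda>t. A l t *v D l y t) \<le> P * NW (Suc k) (A l) * (C * T)" if l: "l < r" for l
      proof -
        have Al: "A l \<in> W (Suc k)" using A l W_mono[of "A l" n "Suc k"] Suc.prems by (auto simp: coeffs_def)
        note Dl = W_low_ideriv[OF ykr l]
        show "(\<lambda>t. A l t *v D l y t) \<in> W (Suc k)" using P(2) Al Dl(1) by blast
        have "P * NW (Suc k) (A l) * NW (Suc k) (D l y) \<le> P * NW (Suc k) (A l) * (C * T)"
          using Dl(2) kr P(1) by (intro mult_left_mono) auto
        then show "NW (Suc k) (\<lambda>t. A l t *v D l y t) \<le> P * NW (Suc k) (A l) * (C * T)"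
          using P(2) Al Dl(1) by (blast intro: order_trans)
      qed
      have "NW (Suc k) (D r y) \<le> NW (Suc k) (L A y) + NW (Suc k) (\<lambda>t. \<Sum>l<r. A l t *v D l y t)"
        unfolding D_top[of y A] using summand(1) by (intro W_diff(2) LW W_sum(1)) auto
      also have "NW (Suc k) (\<lambda>t. \<Sum>l<r. A l t *v D l y t) \<le> (\<Sum>l<r. NW (Suc k) (\<lambda>t. A l t *v D l y t))"
        using summand(1) by (intro W_sum(2)) auto
      also have "\<dots> \<le> (\<Sum>l<r. P * NW (Suc k) (A l) * (C * T))" using summand(2) by (intro sum_mono) auto
      also have "\<dots> = ?Q * T" by (simp add: sum_distrib_left sum_distrib_right algebra_simps)
      finally have "(\<Sum>l<r. norm (D l y a)) + NW (Suc k) (D r y) \<le> (1 + ?Q) * T"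
        by (simp add: T_def algebra_simps)
      then have "C' * ((\<Sum>l<r. norm (D l y a)) + NW (Suc k) (D r y)) \<le> C' * ((1 + ?Q) * T)"
        using C'(1) by (rule mult_left_mono)
      moreover have "y \<in> W (Suc k + r)" using W_mono[OF y, of "Suc k + r"] Suc.prems by simp
      ultimately show ?thesis using C'(2) unfolding T_def mult.assoc by (blast intro: order_trans)
    qed
    then show ?case using C'(1) Q by (intro exI[of _ "C' * (1 + ?Q)"]) auto
  qed
  from this[of n] show ?thesis by simp
qed

section \<open>Existence and regularity for the Cauchy problem\<close>

text \<open>If \<open>w\<close> is the derivative of order \<open>r - 1\<close> of a function with Cauchy data \<open>c\<close> at \<open>a\<close>, then
  \<open>iterated c w k\<close> is its derivative of order \<open>r - 1 - k\<close>.\<close>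

fun iterated :: "(nat \<Rightarrow> 'a::euclidean_space) \<Rightarrow> (real \<Rightarrow> 'a) \<Rightarrow> nat \<Rightarrow> real \<Rightarrow> 'a" where
  "iterated c w 0 = w"
| "iterated c w (Suc k) = (\<lambda>t. c (r - 1 - Suc k) + integral {a..t} (iterated c w k))"

lemma iterated_primitive: "primitive (iterated c w (Suc k)) (iterated c w k)"
  by (simp add: primitive_def)

lemma continuous_integrable:
  fixes f :: "real \<Rightarrow> 'a::euclidean_space"
  shows "continuous_on {a..b} f \<Longrightarrow> integrable M f"
  by (intro absolutely_integrable_imp_integrable absolutely_integrable_continuous_real) auto

lemma iterated_continuous:
  assumes "continuous_on {a..b} w"
  shows "continuous_on {a..b} (iterated c w k)"
proof (induction k)
  case (Suc k)
  show ?case by (rule primitive_continuous[OF iterated_primitive continuous_integrable[OF Suc]])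
qed (use assms in simp)

lemma iterated_in_W:
  assumes "w \<in> W (Suc s)"
  shows "iterated c w k \<in> W (s + Suc k)"
proof (induction k)
  case (Suc k)
  show ?case using W_SucI(1)[OF Suc iterated_primitive] by simp
qed (use assms in simp)

lemma ideriv_iterated:
  assumes w: "continuous_on {a..b} w" and "l \<le> k" "t \<in> {a..b}"
  shows "D l (iterated c w k) t = iterated c w (k - l) t"
  using assms(2,3)
proof (induction l arbitrary: t)
  case (Suc l)
  obtain j where j: "k - l = Suc j" "k - Suc l = j" using Suc.prems by (cases "k - l") auto
  have "D (Suc l) (iterated c w k) t = D 1 (D l (iterated c w k)) t" by (simp add: ideriv_ideriv)
  also have "\<dots> = D 1 (iterated c w (Suc j)) t"
    by (rule ideriv_cong) (use Suc j in auto)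
  also have "\<dots> = iterated c w j t"
    using vector_derivative_Icc[OF primitive_derivative[OF iterated_primitive iterated_continuous[OF w] Suc.prems(2)] Suc.prems(2)]
    by (simp add: ideriv_Suc)
  finally show ?case using j by simp
qed simp

text \<open>The weight is nondecreasing, so it can be taken out of the integral at the upper limit;
  each integration then costs a factor \<open>b - a\<close>.\<close>

lemma iterated_diff_bound:
  assumes w: "continuous_on {a..b} w1" "continuous_on {a..b} w2" and \<phi>: "\<And>s t. \<lbrakk>a \<le> s; s \<le> t; t \<le> b\<rbrakk> \<Longrightarrow> \<phi> s \<le> \<phi> t"
    and le: "\<And>t. t \<in> {a..b} \<Longrightarrow> norm (w1 t - w2 t) \<le> d * \<phi> t" and d: "0 \<le> d" and "\<And>t. 0 \<le> \<phi> t" and t: "t \<in> {a..b}"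
  shows "norm (iterated c w1 k t - iterated c w2 k t) \<le> (b - a) ^ k * d * \<phi> t"
  using t
proof (induction k arbitrary: t)
  case 0
  then show ?case using le by simp
next
  case (Suc k)
  have tb: "t \<le> b" "a \<le> t" using Suc.prems by auto
  have int: "integrable M (iterated c w1 k)" "integrable M (iterated c w2 k)"
    using continuous_integrable[OF iterated_continuous] w by auto
  then have I: "iterated c w1 k integrable_on {a..t}" "iterated c w2 k integrable_on {a..t}"
    using integrable_lebesgue_on_Icc tb by blast+
  have "iterated c w1 (Suc k) t - iterated c w2 (Suc k) t = integral {a..t} (\<lambda>t. iterated c w1 k t - iterated c w2 k t)"
    by (simp add: Henstock_Kurzweil_Integration.integral_diff[OF I])
  also have "norm \<dots> \<le> integral {a..t} (\<lambda>s. (b - a) ^ k * d * \<phi> t)"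
  proof (rule integral_norm_bound_integral)
    show "(\<lambda>t. iterated c w1 k t - iterated c w2 k t) integrable_on {a..t}"
      using I by (rule Henstock_Kurzweil_Integration.integrable_diff)
    show "(\<lambda>s. (b - a) ^ k * d * \<phi> t) integrable_on {a..t}" by (rule integrable_const_ivl)
    fix s assume s: "s \<in> {a..t}"
    have "norm (iterated c w1 k s - iterated c w2 k s) \<le> (b - a) ^ k * d * \<phi> s" using Suc.IH s tb by auto
    also have "\<dots> \<le> (b - a) ^ k * d * \<phi> t" using \<phi>[of s t] s tb ab d by (intro mult_left_mono) auto
    finally show "norm (iterated c w1 k s - iterated c w2 k s) \<le> (b - a) ^ k * d * \<phi> t" .
  qed
  also have "\<dots> = (t - a) * ((b - a) ^ k * d * \<phi> t)" using tb by simp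
  also have "\<dots> \<le> (b - a) * ((b - a) ^ k * d * \<phi> t)" using tb ab d assms(6)[of t] by (intro mult_right_mono) auto
  finally show ?case by (simp add: mult.assoc)
qed

text \<open>The unknown is \<open>w\<close>, standing for the derivative of order
  \<open>r - 1\<close>. All lower derivatives are iterated integrals of \<open>w\<close>, so the
  equation becomes a single Volterra fixed point equation.\<close>

lemma ode_exists_Lp:
  fixes A :: "nat \<Rightarrow> real \<Rightarrow> complex ^ 'm ^ 'm"
  assumes A: "\<And>l. l < r \<Longrightarrow> A l \<in> Lp" and f: "f \<in> Lp"
  shows "\<exists>y\<in>W r. (AE t in M. L A y t = f t) \<and> (\<forall>l<r. D l y a = c l)"
proof -
  obtain K where K: "0 \<le> K" "\<And>(B::complex^'m^'m) v. norm (B *v v) \<le> norm B * norm v * K"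
    using bounded_bilinear.nonneg_bounded[OF bounded_bilinear_matrix_vector_mult] by blast
  \<comment> \<open>One bound for all powers of \<open>b - a\<close> produced by up to
    \<open>r - 1\<close> integrations, whether \<open>b - a\<close> is below or above 1.\<close>
  define m where "m = (max 1 (b - a)) ^ r"
  have m: "0 \<le> m" "\<And>k. k < r \<Longrightarrow> (b - a) ^ k \<le> m"
  proof -
    show "0 \<le> m" by (simp add: m_def)
    show "(b - a) ^ k \<le> m" if "k < r" for k
    proof -
      have "(b - a) ^ k \<le> (max 1 (b - a)) ^ k" using ab by (intro power_mono) auto
      also have "\<dots> \<le> m" unfolding m_def using that by (intro power_increasing) auto
      finally show ?thesis .
    qed
  qed
  \<comment> \<open>Kernel bound of the Volterra operator: \<open>K\<close> from matrix
    multiplication, \<open>m\<close> from the iterated integrals. The weight built from it makes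
    \<open>T\<close> a contraction with factor 1/2.\<close>
  define \<alpha> where "\<alpha> t = (\<Sum>l<r. K * m * norm (A l t))" for t
  have Ai: "integrable M (A l)" if "l < r" for l using Lp_integrable(1)[OF A[OF that]] .
  have \<alpha>i: "integrable M \<alpha>" unfolding \<alpha>_def using Ai by auto
  have \<alpha>0: "0 \<le> \<alpha> t" for t unfolding \<alpha>_def using K m by (intro sum_nonneg) auto
  obtain \<phi> where \<phi>: "continuous_on {a..b} \<phi>" "\<And>t. 1 \<le> \<phi> t"
    "\<And>s t. \<lbrakk>a \<le> s; s \<le> t; t \<le> b\<rbrakk> \<Longrightarrow> \<phi> s \<le> \<phi> t"
    "integrable M (\<lambda>t. \<alpha> t * \<phi> t)"
    "\<And>t. t \<in> {a..b} \<Longrightarrow> integral {a..t} (\<lambda>t. \<alpha> t * \<phi> t) \<le> \<phi> t / 2"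
    by (rule volterra_weight[OF \<alpha>i \<alpha>0 ab]) blast
  have \<phi>0: "0 \<le> \<phi> t" for t using \<phi>(2)[of t] by linarith
  \<comment> \<open>The equation solved for the derivative of order \<open>r\<close>; the index
    \<open>r - 1 - l\<close> converts the order of a derivative into a number of
    integrations.\<close>
  define u where "u w t = f t - (\<Sum>l<r. A l t *v iterated c w (r - 1 - l) t)" for w t
  define T where "T w t = c (r - 1) + integral {a..t} (u w)" for w t
  have AY: "(\<lambda>t. A l t *v iterated c w k t) \<in> Lp" if w: "continuous_on {a..b} w" and l: "l < r" for w l k
  proof -
    note ic = iterated_continuous[OF w, of c k]
    obtain B where B: "\<forall>t\<in>{a..b}. norm (iterated c w k t) \<le> B"
      using compact_imp_bounded[OF compact_continuous_image[OF ic compact_Icc]] by (auto simp: bounded_iff)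
    then have "AE t in M. norm (iterated c w k t) \<le> max B 0" by (intro AE_I2) (auto simp: le_max_iff_disj)
    then show ?thesis
      by (rule Lp_mult_bounded(1)[OF bounded_bilinear_matrix_vector_mult K(2,1) A[OF l] continuous_Lp[OF ic]]) simp
  qed
  have uL: "u w \<in> Lp" if "continuous_on {a..b} w" for w
  proof -
    have "(\<lambda>t. \<Sum>l<r. A l t *v iterated c w (r - 1 - l) t) \<in> Lp"
      using Lp_sum[of "{..<r}" "\<lambda>l t. A l t *v iterated c w (r - 1 - l) t"] AY[OF that] by simp
    from Lp_add(1)[OF f Lp_uminus(1)[OF this]] show ?thesis by (simp add: u_def[abs_def])
  qed
  have prT: "primitive (T w) (u w)" for w by (simp add: primitive_def T_def)
  have Tc: "continuous_on {a..b} (T w)" if "continuous_on {a..b} w" for w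
    by (rule primitive_continuous[OF prT Lp_integrable(1)[OF uL[OF that]]])
  have Tl: "norm (T w1 t - T w2 t) \<le> d / 2 * \<phi> t"
    if w: "continuous_on {a..b} w1" "continuous_on {a..b} w2" and d: "0 \<le> d"
      and le: "\<And>t. t \<in> {a..b} \<Longrightarrow> norm (w1 t - w2 t) \<le> d * \<phi> t" and t: "t \<in> {a..b}" for w1 w2 d t
  proof -
    have tb: "t \<le> b" using t by simp
    have I: "u w1 integrable_on {a..t}" "u w2 integrable_on {a..t}"
      using integrable_lebesgue_on_Icc[OF Lp_integrable(1)[OF uL] tb] w by auto
    have "T w1 t - T w2 t = integral {a..t} (\<lambda>t. u w1 t - u w2 t)"
      by (simp add: T_def Henstock_Kurzweil_Integration.integral_diff[OF I])
    also have "norm \<dots> \<le> integral {a..t} (\<lambda>t. d * (\<alpha> t * \<phi> t))"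
    proof (rule integral_norm_bound_integral)
      show "(\<lambda>t. u w1 t - u w2 t) integrable_on {a..t}"
        using I by (rule Henstock_Kurzweil_Integration.integrable_diff)
      show "(\<lambda>t. d * (\<alpha> t * \<phi> t)) integrable_on {a..t}"
        by (rule integrable_lebesgue_on_Icc[OF integrable_mult_right[OF \<phi>(4)] tb])
      fix s assume "s \<in> {a..t}"
      then have s: "s \<in> {a..b}" using tb by auto
      have "norm (A l s *v iterated c w2 k s - A l s *v iterated c w1 k s) \<le> K * m * norm (A l s) * (d * \<phi> s)"
        if k: "k < r" for l k
      proof -
        have "norm (iterated c w2 k s - iterated c w1 k s) \<le> (b - a) ^ k * d * \<phi> s"
          unfolding norm_minus_commute[of "iterated c w2 k s"]
          by (rule iterated_diff_bound[OF w \<phi>(3) le d \<phi>0 s])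
        also have "\<dots> \<le> m * d * \<phi> s" using m(2)[OF k] d \<phi>0[of s] by (intro mult_right_mono) auto
        finally have "norm (A l s) * norm (iterated c w2 k s - iterated c w1 k s) * K \<le> norm (A l s) * (m * d * \<phi> s) * K"
          using K(1) by (intro mult_right_mono mult_left_mono) auto
        then show ?thesis
          using K(2)[of "A l s" "iterated c w2 k s - iterated c w1 k s"]
          by (simp add: matrix_vector_mult_diff_distrib algebra_simps)
      qed
      then have "norm (\<Sum>l<r. A l s *v iterated c w2 (r - 1 - l) s - A l s *v iterated c w1 (r - 1 - l) s)
        \<le> (\<Sum>l<r. K * m * norm (A l s) * (d * \<phi> s))"
        using r1 by (intro sum_norm_le) auto
      then show "norm (u w1 s - u w2 s) \<le> d * (\<alpha> s * \<phi> s)"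
        by (simp add: u_def \<alpha>_def sum_subtractf[symmetric] sum_distrib_right sum_distrib_left algebra_simps)
    qed
    also have "\<dots> = d * integral {a..t} (\<lambda>t. \<alpha> t * \<phi> t)" by simp
    also have "\<dots> \<le> d * (\<phi> t / 2)" using \<phi>(5)[OF t] d by (rule mult_left_mono)
    finally show ?thesis by simp
  qed
  obtain w where w: "continuous_on {a..b} w" "\<And>t. t \<in> {a..b} \<Longrightarrow> T w t = w t"
    by (rule volterra_fixed_point[OF ab \<phi>(1,2) Tc Tl]) blast+
  have wa: "w a = c (r - 1)" using w(2)[of a] ab by (simp add: T_def)
  have prw: "primitive w (u w)"
    unfolding primitive_def
  proof
    fix t assume "t \<in> {a..b}"
    from w(2)[OF this] show "w t = w a + integral {a..t} (u w)" by (simp add: T_def wa)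
  qed
  have uW: "u w \<in> W 0" using uL[OF w(1)] by (simp add: W_0)
  note wW = W_SucI[OF uW prw]
  define y where "y = iterated c w (r - 1)"
  have yW: "y \<in> W r" using iterated_in_W[OF wW(1), of c "r - 1"] r1 by (simp add: y_def)
  have Dl: "D l y t = iterated c w (r - 1 - l) t" if "l < r" "t \<in> {a..b}" for l t
    unfolding y_def using that by (intro ideriv_iterated[OF w(1)]) auto
  have Dr: "D r y t = D (Suc 0) w t" if t: "t \<in> {a..b}" for t
  proof -
    have "D r y = D (Suc 0) (D (r - 1) y)" using r1 by (simp add: ideriv_ideriv)
    then have "D r y t = D (Suc 0) (D (r - 1) y) t" by simp
    also have "\<dots> = D (Suc 0) w t" by (rule ideriv_cong[OF _ t]) (use Dl[of "r - 1"] r1 in simp)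
    finally show ?thesis .
  qed
  have "AE t in M. D (Suc 0) w t = u w t" using eqW_AE[OF wW(2)] .
  then have "AE t in M. L A y t = f t"
    using AE_space
  proof eventually_elim
    case (elim t)
    then have t: "t \<in> {a..b}" by simp
    have "(\<Sum>l<r. A l t *v D l y t) = (\<Sum>l<r. A l t *v iterated c w (r - 1 - l) t)"
      using Dl t by (intro sum.cong) auto
    then show ?case using elim(1) Dr[OF t] by (simp add: L_eq u_def)
  qed
  moreover have "D l y a = c l" if l: "l < r" for l
  proof -
    have "iterated c w (r - 1 - l) a = c l"
    proof (cases "r - 1 - l")
      case 0
      then have "l = r - 1" using l by simp
      then show ?thesis using wa 0 by simp
    next
      case (Suc k)
      then have "r - 1 - Suc k = l" using l by simp
      then show ?thesis using Suc by simp
    qed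
    then show ?thesis using Dl[OF l, of a] ab by simp
  qed
  ultimately show ?thesis using yW by blast
qed

text \<open>Each round puts the lower derivatives into \<open>W (Suc k)\<close>, so the derivative
  of order \<open>r\<close> agrees a.e. with a function of that class and \<open>y\<close> gains one
  order. The final pointwise form follows because both sides of the equation lie in
  \<open>W n\<close>.\<close>

lemma ode_regularity:
  fixes A :: "nat \<Rightarrow> real \<Rightarrow> complex ^ 'm ^ 'm"
  assumes A: "coeffs A" and f: "f \<in> W n" and y: "y \<in> W r" and eq: "AE t in M. L A y t = f t"
  shows "y \<in> W (n + r)" "eqW n (L A y) f"
proof -
  have "k \<le> n \<Longrightarrow> y \<in> W (k + r)" for k
  proof (induction k)
    case 0
    then show ?case using y by simp
  next
    case (Suc k)
    then have yk: "y \<in> W (k + r)" by simp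
    obtain P where P: "\<forall>(B::real \<Rightarrow> complex ^ 'm ^ 'm)\<in>W (Suc k). \<forall>g\<in>W (Suc k). (\<lambda>t. B t *v g t) \<in> W (Suc k)"
      using W_mult_Suc[OF bounded_bilinear_matrix_vector_mult, of k] by blast
    have "(\<lambda>t. A l t *v D l y t) \<in> W (Suc k)" if "l < r" for l
      using P W_low_ideriv(1)[OF yk that] W_mono[of "A l" n "Suc k"] A that Suc.prems by (auto simp: coeffs_def)
    then have "(\<lambda>t. \<Sum>l<r. A l t *v D l y t) \<in> W (Suc k)" by (intro W_sum(1)) auto
    from W_diff(1)[OF W_mono[OF f Suc.prems] this]
    have u: "(\<lambda>t. f t - (\<Sum>l<r. A l t *v D l y t)) \<in> W (Suc k)" (is "?u \<in> _") .
    have AE: "AE t in M. D r y t = ?u t"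
      using eq by eventually_elim (simp add: L_eq algebra_simps)
    have r': "Suc (r - 1) = r" using r1 by simp
    have "D (r - 1) y \<in> W (Suc 0)" using W_ideriv[of y "Suc 0" "r - 1"] y r' by simp
    from W_SucD(2)[OF this] have "primitive (D (r - 1) y) (D r y)" using r' by (simp add: ideriv_ideriv)
    from W_SucI(1)[OF u primitive_cong[OF this AE]] have "D (r - 1) y \<in> W (Suc (Suc k))" .
    from W_lift[OF _ this] y r' have "y \<in> W (Suc (Suc k) + (r - 1))" by simp
    then show ?case using r' by (simp add: add_Suc_right[symmetric] del: add_Suc_right)
  qed
  from this[of n] show yn: "y \<in> W (n + r)" by simp
  show "eqW n (L A y) f" by (rule eqW_of_AE[OF L_in_W[OF A yn] f eq])
qed

lemma ode_exists:
  assumes A: "coeffs A" and f: "f \<in> W n"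
  shows "\<exists>y\<in>W (n + r). eqW n (L A y) f \<and> (\<forall>l<r. D l y a = c l)"
proof -
  have "A l \<in> Lp" if "l < r" for l using A that W_mono[of "A l" n 0] by (simp add: coeffs_def W_0)
  moreover have "f \<in> Lp" using W_mono[OF f, of 0] by (simp add: W_0)
  ultimately obtain y where "y \<in> W r" "AE t in M. L A y t = f t" "\<forall>l<r. D l y a = c l"
    using ode_exists_Lp by blast
  with ode_regularity[OF A f] show ?thesis by blast
qed

lemma ode_unique:
  assumes A: "coeffs A" and y: "y \<in> W (n + r)" and eq: "eqW n (L A y) (\<lambda>t. 0)" and "\<forall>l<r. D l y a = 0"
  shows "NW (n + r) y = 0" "\<And>t. t \<in> {a..b} \<Longrightarrow> y t = 0"
proof -
  obtain C where C: "C \<ge> 0" "NW (n + r) y \<le> C * ((\<Sum>l<r. norm (D l y a)) + NW n (L A y))"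
    using ode_apriori[OF A] y by blast
  have "NW n (L A y) = 0" using NW_cong(2)[OF W_zero(1) eqW_sym[OF eq]] W_zero(2) by simp
  then show NW: "NW (n + r) y = 0"
    using C(2) assms(4) NW_nonneg[of "n + r" y] by simp
  obtain k where k: "n + r = Suc k" using r1 by (cases "n + r") auto
  obtain C' where "\<forall>s. \<forall>(y::real \<Rightarrow> complex^'a)\<in>W (Suc s). \<forall>t\<in>{a..b}. norm (y t) \<le> C' * NW (Suc s) y"
    using W_Suc_sup_bound by blast
  then show "y t = 0" if "t \<in> {a..b}" for t
    using that y NW unfolding k by fastforce
qed

text \<open>The end points form a null set, which settles \<open>n = 0\<close>. For
  \<open>n > 0\<close> equality on the open interval gives equality a.e., and regularity of both
  sides extends it to the closed interval.\<close>

lemma bvp_solution_iff: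
  assumes A: "coeffs A" and f: "f \<in> W n"
  shows "bvp_solution a b p n r A B f c y \<longleftrightarrow> y \<in> W (n + r) \<and> eqW n (L A y) f \<and> B y = c"
proof -
  have "(if n = 0 then AE t in lebesgue_on {a<..<b}. L A y t = f t else \<forall>t\<in>{a<..<b}. L A y t = f t) \<longleftrightarrow> eqW n (L A y) f"
    if y: "y \<in> W (n + r)"
  proof -
    have neg: "negligible {t \<in> {a..b}. \<not> Q t} \<longleftrightarrow> negligible {t \<in> {a<..<b}. \<not> Q t}" for Q
    proof
      assume "negligible {t \<in> {a<..<b}. \<not> Q t}"
      then have "negligible ({t \<in> {a<..<b}. \<not> Q t} \<union> {a, b})" by (simp add: negligible_Un)
      then show "negligible {t \<in> {a..b}. \<not> Q t}" by (rule negligible_subset) force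
    qed (auto elim: negligible_subset)
    have AE: "(AE t in lebesgue_on {a<..<b}. L A y t = f t) \<longleftrightarrow> (AE t in M. L A y t = f t)"
      unfolding AE_lebesgue_on_Icc neg by (rule AE_lebesgue_on_negligible) auto
    show ?thesis
    proof (cases "n = 0")
      case True
      then show ?thesis using AE by (simp add: eqW_def)
    next
      case False
      have "eqW n (L A y) f" if "\<forall>t\<in>{a<..<b}. L A y t = f t"
      proof (rule eqW_of_AE[OF L_in_W[OF A y] f])
        have "AE t in lebesgue_on {a<..<b}. L A y t = f t" using that by (intro AE_I2) auto
        then show "AE t in M. L A y t = f t" using AE by blast
      qed
      then show ?thesis using False by (auto simp: eqW_def)
    qed
  qed
  then show ?thesis unfolding bvp_solution_def by blast
qed

end

section \<open>Uniform boundedness\<close>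

text \<open>In finite dimension convergence on a basis is convergence in operator norm, and a
  perturbation of norm at most half the lower bound \<open>B\<close> keeps the lower bound
  \<open>B / 2\<close>.\<close>

lemma linear_family_bounded_below:
  fixes \<Lambda> :: "real \<Rightarrow> 'a::euclidean_space \<Rightarrow> 'a" and F :: "real filter"
  assumes lin: "\<And>\<epsilon>. \<epsilon> \<in> S \<Longrightarrow> linear (\<Lambda> \<epsilon>)" and ev: "eventually (\<lambda>\<epsilon>. \<epsilon> \<in> S) F"
    and lin0: "linear \<Lambda>0" "inj \<Lambda>0" and lim: "\<And>b. b \<in> Basis \<Longrightarrow> ((\<lambda>\<epsilon>. \<Lambda> \<epsilon> b) \<longlongrightarrow> \<Lambda>0 b) F"
  obtains \<kappa> where "\<kappa> > 0" "\<forall>x. \<kappa> * norm x \<le> norm (\<Lambda>0 x)" "eventually (\<lambda>\<epsilon>. \<forall>x. \<kappa> * norm x \<le> norm (\<Lambda> \<epsilon> x)) F"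
proof -
  obtain B where B: "B > 0" "\<And>x. B * norm x \<le> norm (\<Lambda>0 x)"
    using linear_inj_bounded_below_pos[OF lin0] by blast
  have "((\<lambda>\<epsilon>. \<Sum>b\<in>Basis. norm (\<Lambda> \<epsilon> b - \<Lambda>0 b)) \<longlongrightarrow> (\<Sum>b\<in>(Basis::'a set). 0)) F"
    by (intro tendsto_sum tendsto_norm_zero) (use lim in \<open>simp add: LIM_zero\<close>)
  then have "eventually (\<lambda>\<epsilon>. (\<Sum>b\<in>Basis. norm (\<Lambda> \<epsilon> b - \<Lambda>0 b)) < B / 2) F"
    using B(1) by (intro order_tendstoD(2)) auto
  with ev have "eventually (\<lambda>\<epsilon>. \<forall>x. B / 2 * norm x \<le> norm (\<Lambda> \<epsilon> x)) F"
  proof eventually_elim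
    case (elim \<epsilon>)
    show ?case
    proof
      fix x :: 'a
      have l: "linear (\<lambda>x. \<Lambda> \<epsilon> x - \<Lambda>0 x)" using lin[OF elim(1)] lin0(1) by (rule linear_compose_sub)
      have "\<Lambda> \<epsilon> x - \<Lambda>0 x = (\<Lambda> \<epsilon> (\<Sum>b\<in>Basis. (x \<bullet> b) *\<^sub>R b) - \<Lambda>0 (\<Sum>b\<in>Basis. (x \<bullet> b) *\<^sub>R b))"
        by (simp add: euclidean_representation)
      also have "\<dots> = (\<Sum>b\<in>Basis. (x \<bullet> b) *\<^sub>R (\<Lambda> \<epsilon> b - \<Lambda>0 b))"
        using linear_sum[OF l, of "\<lambda>b. (x \<bullet> b) *\<^sub>R b" Basis] linear_scale[OF l] by simp
      also have "norm \<dots> \<le> (\<Sum>b\<in>Basis. norm x * norm (\<Lambda> \<epsilon> b - \<Lambda>0 b))"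
        by (rule sum_norm_le) (auto intro!: mult_right_mono Basis_le_norm)
      also have "\<dots> = norm x * (\<Sum>b\<in>Basis. norm (\<Lambda> \<epsilon> b - \<Lambda>0 b))" by (simp add: sum_distrib_left)
      also have "\<dots> \<le> norm x * (B / 2)" using elim(2) by (intro mult_left_mono) auto
      finally have "norm (\<Lambda> \<epsilon> x - \<Lambda>0 x) \<le> B / 2 * norm x" by (simp add: mult.commute)
      moreover have "norm (\<Lambda>0 x) \<le> norm (\<Lambda> \<epsilon> x) + norm (\<Lambda> \<epsilon> x - \<Lambda>0 x)"
        using norm_triangle_sub[of "\<Lambda>0 x" "\<Lambda> \<epsilon> x"] by (simp add: norm_minus_commute)
      ultimately show "B / 2 * norm x \<le> norm (\<Lambda> \<epsilon> x)" using B(2)[of x] by simp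
    qed
  qed
  moreover have "\<forall>x. B / 2 * norm x \<le> norm (\<Lambda>0 x)"
  proof
    fix x :: 'a
    have "B / 2 * norm x \<le> B * norm x" using B(1) by (intro mult_right_mono) auto
    then show "B / 2 * norm x \<le> norm (\<Lambda>0 x)" using B(2)[of x] by linarith
  qed
  ultimately show ?thesis using that[of "B / 2"] B(1) by simp
qed

context interval_Lp
begin

text \<open>Homogeneity is stated over the reals, so that targets such as
  \<open>complex ^ 'q\<close> are treated by their real Euclidean structure.\<close>

definition bounded_operator :: "nat \<Rightarrow> ((real \<Rightarrow> 'a::euclidean_space) \<Rightarrow> 'b::real_normed_vector) \<Rightarrow> bool" where
  "bounded_operator s T \<longleftrightarrow> (\<forall>y\<in>W s. \<forall>z\<in>W s. T (\<lambda>t. y t + z t) = T y + T z) \<and>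
     (\<forall>c. \<forall>y\<in>W s. T (\<lambda>t. c *\<^sub>R y t) = c *\<^sub>R T y) \<and> (\<exists>C\<ge>0. \<forall>y\<in>W s. norm (T y) \<le> C * NW s y)"

lemma bounded_operatorD:
  assumes "bounded_operator s T"
  shows "y \<in> W s \<Longrightarrow> z \<in> W s \<Longrightarrow> T (\<lambda>t. y t + z t) = T y + T z"
    "y \<in> W s \<Longrightarrow> T (\<lambda>t. c *\<^sub>R y t) = c *\<^sub>R T y"
    "\<exists>C\<ge>0. \<forall>y\<in>W s. norm (T y) \<le> C * NW s y"
  using assms unfolding bounded_operator_def by blast+

lemma bounded_operator_diff:
  assumes T: "bounded_operator s T" and y: "y \<in> W s" and z: "z \<in> W s"
  shows "T (\<lambda>t. y t - z t) = T y - T z"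
  using bounded_operatorD(1)[OF T y W_scaleR(1)[OF z, of "-1"]] bounded_operatorD(2)[OF T z, of "-1"] by simp

text \<open>Bounded operators do not see values outside \<open>[a, b]\<close> or any other
  modification of norm zero.\<close>

lemma bounded_operator_cong:
  assumes T: "bounded_operator s T" and y: "y \<in> W s" and z: "z \<in> W s" and "NW s (\<lambda>t. y t - z t) = 0"
  shows "T y = T z"
proof -
  obtain C where "\<forall>y\<in>W s. norm (T y) \<le> C * NW s y" using bounded_operatorD(3)[OF T] by blast
  then have "norm (T (\<lambda>t. y t - z t)) \<le> C * NW s (\<lambda>t. y t - z t)" using W_diff(1)[OF y z] by blast
  then show ?thesis using bounded_operator_diff[OF T y z] assms(4) by simp
qed

text \<open>Sokal's elementary argument: for \<open>\<parallel>z\<parallel> \<le> 1\<close> one of \<open>\<parallel>T (x + \<rho> z)\<parallel>\<close>, \<open>\<parallel>T (x - \<rho> z)\<parallel>\<close> is at least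
  \<open>\<rho> \<parallel>T z\<parallel>\<close>, so a geometric series produces a point at which the operators are unbounded.\<close>

lemma bounded_operator_hump:
  assumes T: "bounded_operator s T" and x: "x \<in> W s" and "0 < \<rho>"
    and S: "\<forall>y\<in>W s. norm (T y) \<le> S * NW s y" and z: "z \<in> W s" "NW s z \<le> 1" "3 / 4 * S \<le> norm (T z)"
  shows "\<exists>x'\<in>W s. NW s (\<lambda>t. x' t - x t) \<le> \<rho> \<and> 3 / 4 * \<rho> * S \<le> norm (T x')"
proof -
  have main: "\<exists>x'\<in>W s. NW s (\<lambda>t. x' t - x t) \<le> \<rho> \<and> norm (T x + c *\<^sub>R T z) = norm (T x')" if c: "\<bar>c\<bar> = \<rho>" for c
  proof (intro bexI[of _ "\<lambda>t. x t + c *\<^sub>R z t"] conjI)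
    have "NW s (\<lambda>t. c *\<^sub>R z t) \<le> \<bar>c\<bar> * NW s z" by (rule W_scaleR(2)[OF z(1)])
    also have "\<dots> \<le> \<rho> * 1" unfolding c using z(2) \<open>0 < \<rho>\<close> by (intro mult_left_mono) auto
    finally show "NW s (\<lambda>t. x t + c *\<^sub>R z t - x t) \<le> \<rho>" by simp
    show "norm (T x + c *\<^sub>R T z) = norm (T (\<lambda>t. x t + c *\<^sub>R z t))"
      using bounded_operatorD(1)[OF T x W_scaleR(1)[OF z(1)]] bounded_operatorD(2)[OF T z(1)] by simp
    show "(\<lambda>t. x t + c *\<^sub>R z t) \<in> W s" using W_add[OF x W_scaleR(1)[OF z(1)]] by blast
  qed
  have "(T x + \<rho> *\<^sub>R T z) - (T x + (- \<rho>) *\<^sub>R T z) = (2 * \<rho>) *\<^sub>R T z"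
    by (simp add: scaleR_2[symmetric])
  then have "norm ((2 * \<rho>) *\<^sub>R T z) \<le> norm (T x + \<rho> *\<^sub>R T z) + norm (T x + (- \<rho>) *\<^sub>R T z)"
    using norm_triangle_ineq4[of "T x + \<rho> *\<^sub>R T z" "T x + (- \<rho>) *\<^sub>R T z"] by simp
  then have "2 * (\<rho> * norm (T z)) \<le> norm (T x + \<rho> *\<^sub>R T z) + norm (T x + (- \<rho>) *\<^sub>R T z)"
    using \<open>0 < \<rho>\<close> by simp
  moreover have "3 / 4 * \<rho> * S \<le> \<rho> * norm (T z)"
    using mult_left_mono[OF z(3), of \<rho>] \<open>0 < \<rho>\<close> by (simp add: algebra_simps)
  ultimately have "3 / 4 * \<rho> * S \<le> norm (T x + \<rho> *\<^sub>R T z) \<or> 3 / 4 * \<rho> * S \<le> norm (T x + (- \<rho>) *\<^sub>R T z)"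
    by linarith
  then show ?thesis using main[of \<rho>] main[of "- \<rho>"] \<open>0 < \<rho>\<close> by fastforce
qed

text \<open>\<open>S\<close> is the operator norm, a supremum over the unit ball. It exceeds
  \<open>C\<close> because \<open>C\<close> is no bound, hence is positive, and some unit vector
  reaches the fraction 3/4 of it.\<close>

lemma bounded_operator_norm:
  fixes T :: "(real \<Rightarrow> 'a::euclidean_space) \<Rightarrow> 'b::real_normed_vector"
  assumes T: "bounded_operator s T" and "\<not> (\<forall>y\<in>W s. norm (T y) \<le> C * NW s y)" "0 < C"
  shows "\<exists>S\<ge>C. (\<forall>y\<in>W s. norm (T y) \<le> S * NW s y) \<and> (\<exists>z\<in>W s. NW s z \<le> 1 \<and> 3 / 4 * S \<le> norm (T z))"
proof -
  obtain C0 where C0: "C0 \<ge> 0" "\<forall>y\<in>W s. norm (T y) \<le> C0 * NW s y" using bounded_operatorD(3)[OF T] by blast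
  define U where "U = {z::real \<Rightarrow> 'a. z \<in> W s \<and> NW s z \<le> 1}"
  define S where "S = (SUP z\<in>U. norm (T z))"
  have bdd: "bdd_above ((\<lambda>z. norm (T z)) ` U)"
  proof (rule bdd_aboveI2)
    fix z assume "z \<in> U"
    then have "norm (T z) \<le> C0 * NW s z" "C0 * NW s z \<le> C0 * 1"
      using C0 mult_left_mono[of "NW s z" 1 C0] unfolding U_def by auto
    then show "norm (T z) \<le> C0" by linarith
  qed
  have zero: "(\<lambda>t. 0) \<in> U" by (simp add: U_def W_zero)
  have scale: "\<exists>z\<in>U. norm (T y) = NW s y * norm (T z)" if y: "y \<in> W s" for y
  proof (cases "NW s y = 0")
    case True
    then have "norm (T y) = 0" using C0(2) y by fastforce
    then show ?thesis using zero True by (intro bexI[of _ "\<lambda>t. 0"]) auto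
  next
    case False
    then have pos: "0 < NW s y" using NW_nonneg[of s y] by linarith
    let ?z = "\<lambda>t. (1 / NW s y) *\<^sub>R y t"
    have "?z \<in> U" unfolding U_def using W_scaleR[OF y, of "1 / NW s y"] pos by auto
    moreover have "norm (T y) = NW s y * norm (T ?z)" using bounded_operatorD(2)[OF T y] pos by simp
    ultimately show ?thesis by blast
  qed
  have Sb: "norm (T y) \<le> S * NW s y" if y: "y \<in> W s" for y
  proof -
    obtain z where z: "z \<in> U" "norm (T y) = NW s y * norm (T z)" using scale[OF y] by blast
    have "norm (T z) \<le> S" unfolding S_def by (rule cSUP_upper[OF z(1) bdd])
    then show ?thesis unfolding z(2) by (simp add: mult.commute mult_right_mono)
  qed
  have SC: "C \<le> S"
  proof (rule ccontr)
    assume "\<not> C \<le> S"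
    then have "S * NW s y \<le> C * NW s y" for y :: "real \<Rightarrow> 'a" by (intro mult_right_mono) auto
    then show False using Sb assms(2) by (blast intro: order_trans)
  qed
  have "3 / 4 * S < S" using SC \<open>0 < C\<close> by simp
  then obtain z where "z \<in> U" "3 / 4 * S < norm (T z)"
    unfolding S_def using less_cSUP_iff[OF _ bdd] zero by blast
  then have "\<exists>z\<in>W s. NW s z \<le> 1 \<and> 3 / 4 * S \<le> norm (T z)"
    unfolding U_def by (intro bexI[of _ z]) auto
  with SC Sb show ?thesis by (intro exI[of _ S]) blast
qed

text \<open>Steps of size \<open>(1/3) ^ j\<close> towards operators of norm \<open>S\<close> at
  least \<open>4 ^ j\<close>: the point reached gains \<open>3/4 * (1/3) ^ j * S\<close>, all later
  steps together lose at most \<open>1/2 * (1/3) ^ j * S\<close>, and what remains is at least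
  \<open>1/4 * (4/3) ^ j\<close>.\<close>

lemma uniform_boundedness:
  fixes T :: "nat \<Rightarrow> (real \<Rightarrow> 'a::euclidean_space) \<Rightarrow> 'b::real_normed_vector"
  assumes T: "\<And>k. bounded_operator s (T k)" and ptw: "\<And>y. y \<in> W s \<Longrightarrow> \<exists>C. \<forall>k. norm (T k y) \<le> C"
  shows "\<exists>C>0. \<forall>k. \<forall>y\<in>W s. norm (T k y) \<le> C * NW s y"
proof (rule ccontr)
  assume neg: "\<not> ?thesis"
  \<comment> \<open>The pair \<open>p\<close> carries the next point of the sequence together with
    the index of the operator that is large there.\<close>
  have "\<exists>p. fst p \<in> W s \<and> NW s (\<lambda>t. fst p t - x t) \<le> (1/3) ^ j \<and>
      (\<exists>S\<ge>4 ^ j. (\<forall>y\<in>W s. norm (T (snd p) y) \<le> S * NW s y) \<and> 3 / 4 * (1/3) ^ j * S \<le> norm (T (snd p) (fst p)))"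
    if x: "x \<in> W s" for x and j :: nat
  proof -
    obtain k where k: "\<not> (\<forall>y\<in>W s. norm (T k y) \<le> 4 ^ j * NW s y)"
      using neg by (metis zero_less_numeral zero_less_power)
    obtain S z where S: "4 ^ j \<le> S" "\<forall>y\<in>W s. norm (T k y) \<le> S * NW s y" "z \<in> W s" "NW s z \<le> 1" "3 / 4 * S \<le> norm (T k z)"
      using bounded_operator_norm[OF T k] by auto
    obtain x' where "x' \<in> W s" "NW s (\<lambda>t. x' t - x t) \<le> (1/3) ^ j" "3 / 4 * (1/3) ^ j * S \<le> norm (T k x')"
      using bounded_operator_hump[OF T x _ S(2-5), of "(1/3) ^ j"] by auto
    then show ?thesis using S by (intro exI[of _ "(x', k)"]) auto
  qed
  then have "\<forall>j x. \<exists>p. x \<in> W s \<longrightarrow> (fst p \<in> W s \<and> NW s (\<lambda>t. fst p t - x t) \<le> (1/3) ^ j \<and>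
      (\<exists>S\<ge>4 ^ j. (\<forall>y\<in>W s. norm (T (snd p) y) \<le> S * NW s y) \<and> 3 / 4 * (1/3) ^ j * S \<le> norm (T (snd p) (fst p))))"
    by blast
  then obtain F where F: "\<And>j x. x \<in> W s \<Longrightarrow> (fst (F j x) \<in> W s \<and> NW s (\<lambda>t. fst (F j x) t - x t) \<le> (1/3) ^ j \<and>
      (\<exists>S\<ge>4 ^ j. (\<forall>y\<in>W s. norm (T (snd (F j x)) y) \<le> S * NW s y) \<and> 3 / 4 * (1/3) ^ j * S \<le> norm (T (snd (F j x)) (fst (F j x)))))"
    unfolding choice_iff by blast
  define X where "X = rec_nat (\<lambda>t. 0) (\<lambda>j x. fst (F j x))"
  have X0: "X 0 = (\<lambda>t. 0)" and XS: "X (Suc j) = fst (F j (X j))" for j by (auto simp: X_def)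
  have XW: "X j \<in> W s" for j by (induction j) (auto simp: X0 XS W_zero F)
  have Xd: "NW s (\<lambda>t. X (Suc j) t - X j t) \<le> (1/3) ^ j" for j using F[OF XW] by (simp add: XS)
  have dW: "(\<lambda>t. X (Suc j) t - X j t) \<in> W s" for j by (intro W_diff XW)
  have "summable (\<lambda>j. (1/3::real) ^ j)" by (rule summable_geometric) simp
  then have "summable (\<lambda>j. NW s (\<lambda>t. X (Suc j) t - X j t))"
    by (rule summable_comparison_test'[of _ 0]) (use Xd in auto)
  from W_complete[of "\<lambda>j t. X (Suc j) t - X j t", OF dW this] obtain x where x: "x \<in> W s"
    "(\<lambda>n. NW s (\<lambda>t. x t - (\<Sum>k<n. X (Suc k) t - X k t))) \<longlonglongrightarrow> 0"
    by blast
  have lim: "(\<lambda>n. NW s (\<lambda>t. x t - X n t)) \<longlonglongrightarrow> 0"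
  proof -
    have "(\<Sum>k<n. X (Suc k) t - X k t) = X n t" for n t
      using sum_lessThan_telescope[of "\<lambda>k. X k t" n] by (simp add: X0)
    then show ?thesis using x(2) by simp
  qed
  \<comment> \<open>Geometric series: the steps from \<open>j\<close> on sum to
    \<open>3/2 * (1/3) ^ j\<close>.\<close>
  have tail: "NW s (\<lambda>t. x t - X j t) \<le> 3 / 2 * (1/3) ^ j" for j
  proof -
    have step: "NW s (\<lambda>t. x t - X j t) \<le> NW s (\<lambda>t. x t - X (j + i) t) + (3 / 2 * (1/3) ^ j - 3 / 2 * (1/3) ^ (j + i))" for i
    proof (induction i)
      case (Suc i)
      have "NW s (\<lambda>t. x t - X (j + i) t) \<le> NW s (\<lambda>t. x t - X (Suc (j + i)) t) + NW s (\<lambda>t. X (Suc (j + i)) t - X (j + i) t)"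
        using W_add[OF W_diff(1)[OF x(1) XW] dW, of "Suc (j + i)" "j + i"] by simp
      then show ?case using Suc Xd[of "j + i"] by simp
    qed simp
    have "(\<lambda>i. NW s (\<lambda>t. x t - X (j + i) t)) \<longlonglongrightarrow> 0"
      using LIMSEQ_ignore_initial_segment[OF lim, of j] by (simp add: add.commute)
    then have "(\<lambda>i. NW s (\<lambda>t. x t - X (j + i) t) + 3 / 2 * (1/3) ^ j) \<longlonglongrightarrow> 0 + 3 / 2 * (1/3) ^ j"
      by (intro tendsto_add tendsto_const)
    moreover have "NW s (\<lambda>t. x t - X j t) \<le> NW s (\<lambda>t. x t - X (j + i) t) + 3 / 2 * (1/3) ^ j" for i
      using step[of i] zero_le_power[of "1/3::real" "j + i"] by linarith
    ultimately show ?thesis by (intro LIMSEQ_le_const[of _ "3 / 2 * (1/3) ^ j"]) auto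
  qed
  obtain C where C: "\<And>k. norm (T k x) \<le> C" using ptw[OF x(1)] by blast
  have upper: "1 / 4 * (4 / 3) ^ j \<le> C" for j :: nat
  proof -
    let ?k = "snd (F j (X j))"
    obtain S where S: "4 ^ j \<le> S" "\<forall>y\<in>W s. norm (T ?k y) \<le> S * NW s y" "3 / 4 * (1/3) ^ j * S \<le> norm (T ?k (X (Suc j)))"
      using F[OF XW, of j j] by (auto simp: XS)
    have S0: "0 \<le> S" using S(1) zero_le_power[of "4::real" j] by linarith
    have "norm (T ?k (\<lambda>t. x t - X (Suc j) t)) \<le> S * NW s (\<lambda>t. x t - X (Suc j) t)"
      using S(2) W_diff(1)[OF x(1) XW] by blast
    \<comment> \<open>The tail is taken from \<open>Suc j\<close>, where the hump sits, so that its
      bound is \<open>1/2 * (1/3) ^ j\<close> and stays below the gain of 3/4.\<close>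
    also have "\<dots> \<le> S * (3 / 2 * (1/3) ^ Suc j)" using tail S0 by (rule mult_left_mono)
    also have "\<dots> = 1 / 2 * (1/3) ^ j * S" by simp
    finally have 1: "norm (T ?k x - T ?k (X (Suc j))) \<le> 1 / 2 * (1/3) ^ j * S"
      unfolding bounded_operator_diff[OF T x(1) XW] .
    have "norm (T ?k (X (Suc j))) \<le> norm (T ?k x) + norm (T ?k x - T ?k (X (Suc j)))"
      using norm_triangle_sub[of "T ?k (X (Suc j))" "T ?k x"] by (simp add: norm_minus_commute)
    then have "1 / 4 * (1/3) ^ j * S \<le> norm (T ?k x)" using 1 S(3) by linarith
    moreover have "1 / 4 * (1/3) ^ j * 4 ^ j \<le> 1 / 4 * (1/3) ^ j * S" using S(1) by (intro mult_left_mono) auto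
    moreover have "1 / 4 * (1/3) ^ j * 4 ^ j = 1 / 4 * (4 / 3 :: real) ^ j" by (simp add: power_divide)
    ultimately show ?thesis using C[of ?k] by linarith
  qed
  obtain j where "4 * C < (4 / 3) ^ j" using real_arch_pow[of "4 / 3" "4 * C"] by auto
  with upper[of j] show False by simp
qed

text \<open>Split into \<open>T \<epsilon> (y \<epsilon> - y 0)\<close> and
  \<open>(T \<epsilon> - T 0) (y 0)\<close>. The first part needs a uniform bound on the operators,
  and along each sequence tending to 0 pointwise convergence supplies one.\<close>

lemma operator_convergence:
  fixes T :: "real \<Rightarrow> (real \<Rightarrow> 'a::euclidean_space) \<Rightarrow> 'b::real_normed_vector"
  assumes "0 < \<delta>" and T: "\<And>\<epsilon>. \<epsilon> \<in> {0..<\<delta>} \<Longrightarrow> bounded_operator s (T \<epsilon>)"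
    and ptw: "\<And>y. y \<in> W s \<Longrightarrow> ((\<lambda>\<epsilon>. T \<epsilon> y) \<longlongrightarrow> T 0 y) (at_right 0)"
    and y: "\<And>\<epsilon>. \<epsilon> \<in> {0..<\<delta>} \<Longrightarrow> y \<epsilon> \<in> W s"
    and lim: "((\<lambda>\<epsilon>. NW s (\<lambda>t. y \<epsilon> t - y 0 t)) \<longlongrightarrow> 0) (at_right 0)"
  shows "((\<lambda>\<epsilon>. T \<epsilon> (y \<epsilon>)) \<longlongrightarrow> T 0 (y 0)) (at_right 0)"
proof -
  have F: "at_right 0 = at 0 within {0..\<delta> / 2}"
    using at_within_Icc_at_right[of 0 "\<delta> / 2"] \<open>0 < \<delta>\<close> by simp
  show ?thesis
    unfolding F tendsto_at_iff_sequentially comp_def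
  proof (intro allI impI)
    fix X :: "nat \<Rightarrow> real" assume X: "\<forall>i. X i \<in> {0..\<delta> / 2} - {0}" "X \<longlonglongrightarrow> 0"
    have X\<delta>: "X i \<in> {0..<\<delta>}" for i using X(1)[rule_format, of i] \<open>0 < \<delta>\<close> by auto
    have 0: "0 \<in> {0..<\<delta>}" using \<open>0 < \<delta>\<close> by simp
    have seq: "(\<lambda>i. T (X i) z) \<longlonglongrightarrow> T 0 z" if "z \<in> W s" for z
      using ptw[OF that] X unfolding F tendsto_at_iff_sequentially comp_def by blast
    have "\<exists>C. \<forall>k. norm (T (X k) z) \<le> C" if "z \<in> W s" for z
      using Bseq_conv_Bfun convergent_imp_Bseq[OF convergentI[OF seq[OF that]]] unfolding Bseq_def by blast
    then obtain C where C: "C > 0" "\<forall>k. \<forall>z\<in>W s. norm (T (X k) z) \<le> C * NW s z"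
      using uniform_boundedness[of s "\<lambda>k. T (X k)", OF T[OF X\<delta>]] by blast
    have NX: "(\<lambda>i. NW s (\<lambda>t. y (X i) t - y 0 t)) \<longlonglongrightarrow> 0"
      using lim X unfolding F tendsto_at_iff_sequentially comp_def by blast
    have "(\<lambda>i. T (X i) (y (X i)) - T 0 (y 0)) \<longlonglongrightarrow> 0"
    proof (rule Lim_null_comparison)
      show "\<forall>\<^sub>F i in sequentially. norm (T (X i) (y (X i)) - T 0 (y 0))
        \<le> C * NW s (\<lambda>t. y (X i) t - y 0 t) + norm (T (X i) (y 0) - T 0 (y 0))"
      proof (intro always_eventually allI)
        fix i
        have "T (X i) (y (X i)) - T 0 (y 0) = T (X i) (\<lambda>t. y (X i) t - y 0 t) + (T (X i) (y 0) - T 0 (y 0))"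
          by (simp add: bounded_operator_diff[OF T[OF X\<delta>] y[OF X\<delta>] y[OF 0]])
        moreover have "norm (T (X i) (\<lambda>t. y (X i) t - y 0 t)) \<le> C * NW s (\<lambda>t. y (X i) t - y 0 t)"
          using C(2) W_diff(1)[OF y[OF X\<delta>] y[OF 0]] by blast
        ultimately show "norm (T (X i) (y (X i)) - T 0 (y 0))
          \<le> C * NW s (\<lambda>t. y (X i) t - y 0 t) + norm (T (X i) (y 0) - T 0 (y 0))"
          by (metis add_right_mono norm_triangle_le)
      qed
      have "(\<lambda>i. C * NW s (\<lambda>t. y (X i) t - y 0 t) + norm (T (X i) (y 0) - T 0 (y 0))) \<longlonglongrightarrow> C * 0 + norm (T 0 (y 0) - T 0 (y 0))"
        by (intro tendsto_intros NX seq y[OF 0])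
      then show "(\<lambda>i. C * NW s (\<lambda>t. y (X i) t - y 0 t) + norm (T (X i) (y 0) - T 0 (y 0))) \<longlonglongrightarrow> 0" by simp
    qed
    then show "(\<lambda>i. T (X i) (y (X i))) \<longlonglongrightarrow> T 0 (y 0)" by (simp add: LIM_zero_iff)
  qed
qed

text \<open>Continuity at 0 together with scaling into the ball of radius
  \<open>\<delta>\<close>.\<close>

lemma continuous_linear_operator_bounded:
  fixes T :: "(real \<Rightarrow> complex ^ 'm) \<Rightarrow> complex ^ 'q"
  assumes T: "continuous_linear_operator a b p s T"
  shows "bounded_operator s T"
proof -
  have add: "T (\<lambda>t. y t + z t) = T y + T z" if "y \<in> W s" "z \<in> W s" for y z
    using T that unfolding continuous_linear_operator_def by blast
  have sc: "complex_of_real c *s v = c *\<^sub>R v" for c and v :: "complex ^ 'k"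
    by (simp add: vec_eq_iff) (simp add: scaleR_conv_of_real)
  have scale: "T (\<lambda>t. c *\<^sub>R y t) = c *\<^sub>R T y" if y: "y \<in> W s" for y c
  proof -
    have "T (\<lambda>t. complex_of_real c *s y t) = complex_of_real c *s T y"
      using T y unfolding continuous_linear_operator_def by blast
    then show ?thesis unfolding sc .
  qed
  have T0: "T (\<lambda>t. 0) = 0" using scale[OF W_zero(1), of 0] by simp
  have "\<forall>y\<in>W s. \<forall>e>0. \<exists>\<delta>>0. \<forall>z\<in>W s. NW s (\<lambda>t. z t - y t) < \<delta> \<longrightarrow> norm (T z - T y) < e"
    using T unfolding continuous_linear_operator_def by blast
  from this[rule_format, OF W_zero(1), of 1] obtain \<delta> where \<delta>: "\<delta> > 0" "\<And>z. z \<in> W s \<Longrightarrow> NW s z < \<delta> \<Longrightarrow> norm (T z) < 1"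
    by (auto simp: T0)
  have "norm (T y) \<le> (2 / \<delta>) * NW s y" if y: "y \<in> W s" for y
  proof (rule field_le_epsilon)
    fix e :: real assume "e > 0"
    \<comment> \<open>The slack makes the scaling factor meaningful even for functions of norm zero;
      its size is chosen so that exactly \<open>e\<close> appears at the end.\<close>
    define N' where "N' = NW s y + e * \<delta> / 2"
    have N': "0 < N'" "NW s y < N'" using \<open>e > 0\<close> \<delta>(1) NW_nonneg[of s y] by (auto simp: N'_def intro: add_nonneg_pos)
    define k where "k = \<delta> / (2 * N')"
    have k: "0 < k" using \<delta>(1) N'(1) by (simp add: k_def)
    have "NW s (\<lambda>t. k *\<^sub>R y t) \<le> k * NW s y" using W_scaleR(2)[OF y, of k] k by simp
    also have "\<dots> < k * (2 * N')" using k N' by (intro mult_strict_left_mono) auto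
    also have "\<dots> = \<delta>" using N'(1) by (simp add: k_def)
    finally have "norm (T (\<lambda>t. k *\<^sub>R y t)) < 1" by (intro \<delta>(2) W_scaleR(1)[OF y])
    then have "k * norm (T y) < 1" using scale[OF y, of k] k by simp
    then have "norm (T y) < 1 / k" using k by (simp add: pos_less_divide_eq mult.commute)
    also have "1 / k = (2 / \<delta>) * NW s y + e" using \<delta>(1) N'(1) by (simp add: k_def N'_def field_simps)
    finally show "norm (T y) \<le> (2 / \<delta>) * NW s y + e" by simp
  qed
  then show ?thesis unfolding bounded_operator_def using add scale \<delta>(1)
    by (auto intro!: exI[of _ "2 / \<delta>"])
qed

end

section \<open>Convergence of solutions\<close>

context interval_ode
begin

lemma L_bound:
  fixes A :: "nat \<Rightarrow> real \<Rightarrow> complex ^ 'm ^ 'm"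
  assumes A: "coeffs A"
  shows "\<exists>C\<ge>0. \<forall>y\<in>W (n + r). NW n (L A y) \<le> C * NW (n + r) y"
proof -
  obtain C where C: "C \<ge> 0" "\<forall>(A::real \<Rightarrow> complex ^ 'm ^ 'm)\<in>W n. \<forall>y\<in>W (n + r). \<forall>l<r. (\<lambda>t. A t *v D l y t) \<in> W n \<and>
     NW n (\<lambda>t. A t *v D l y t) \<le> C * NW n A * NW (n + r) y"
    using coeff_term_bound by blast
  have "NW n (L A y) \<le> (1 + C * (\<Sum>l<r. NW n (A l))) * NW (n + r) y" if y: "y \<in> W (n + r)" for y
  proof -
    have Al: "A l \<in> W n" if "l < r" for l using A that by (simp add: coeffs_def)
    have S: "(\<lambda>t. A l t *v D l y t) \<in> W n" "NW n (\<lambda>t. A l t *v D l y t) \<le> C * NW n (A l) * NW (n + r) y" if "l < r" for l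
      using C(2) Al[OF that] y that by blast+
    have "NW n (L A y) \<le> NW n (D r y) + NW n (\<lambda>t. \<Sum>l<r. A l t *v D l y t)"
      unfolding L_eq[abs_def] using W_add[OF W_ideriv[OF y] W_sum(1)[of "{..<r}" "\<lambda>l t. A l t *v D l y t"]] S(1) by simp
    also have "NW n (\<lambda>t. \<Sum>l<r. A l t *v D l y t) \<le> (\<Sum>l<r. NW n (\<lambda>t. A l t *v D l y t))"
      using S(1) by (intro W_sum(2)) auto
    also have "\<dots> \<le> (\<Sum>l<r. C * NW n (A l) * NW (n + r) y)" using S(2) by (intro sum_mono) auto
    finally show ?thesis
      using NW_ideriv[of n r y] by (simp add: sum_distrib_left sum_distrib_right distrib_right)
  qed
  moreover have "0 \<le> 1 + C * (\<Sum>l<r. NW n (A l))" using C(1) by (intro add_nonneg_nonneg mult_nonneg_nonneg sum_nonneg) auto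
  ultimately show ?thesis by blast
qed

text \<open>The boundary-value problem on the closed interval modulo \<open>eqW\<close>, the form in
  which solutions can be superposed.\<close>

definition sol :: "(nat \<Rightarrow> real \<Rightarrow> complex ^ 'm ^ 'm) \<Rightarrow> ((real \<Rightarrow> complex ^ 'm) \<Rightarrow> complex ^ 'q) \<Rightarrow> (real \<Rightarrow> complex ^ 'm)
    \<Rightarrow> complex ^ 'q \<Rightarrow> (real \<Rightarrow> complex ^ 'm) \<Rightarrow> bool" where
  "sol A B f c y \<longleftrightarrow> y \<in> W (n + r) \<and> eqW n (L A y) f \<and> B y = c"

lemma sol_add:
  assumes A: "coeffs A" and B: "bounded_operator (n + r) B" and y: "sol A B f c y" and z: "sol A B g d z"
  shows "sol A B (\<lambda>t. f t + g t) (c + d) (\<lambda>t. y t + z t)"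
proof -
  have yz: "y \<in> W (n + r)" "z \<in> W (n + r)" "eqW n (L A y) f" "eqW n (L A z) g"
    using y z by (auto simp: sol_def)
  have "eqW n (\<lambda>t. L A y t + L A z t) (\<lambda>t. f t + g t)"
    using yz(3,4) by (auto simp: eqW_def elim: AE_mp split: if_splits)
  then show ?thesis
    using W_add[OF yz(1,2)] eqW_trans[OF L_add[OF A yz(1,2)]] bounded_operatorD(1)[OF B yz(1,2)] y z
    by (auto simp: sol_def)
qed

lemma sol_scaleR:
  assumes A: "coeffs A" and B: "bounded_operator (n + r) B" and y: "sol A B f c y"
  shows "sol A B (\<lambda>t. k *\<^sub>R f t) (k *\<^sub>R c) (\<lambda>t. k *\<^sub>R y t)"
proof -
  have yz: "y \<in> W (n + r)" "eqW n (L A y) f" using y by (auto simp: sol_def)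
  have "eqW n (\<lambda>t. k *\<^sub>R L A y t) (\<lambda>t. k *\<^sub>R f t)"
    using yz(2) by (auto simp: eqW_def elim: AE_mp split: if_splits)
  then show ?thesis
    using W_scaleR(1)[OF yz(1)] eqW_trans[OF L_scaleR[OF A yz(1)]] bounded_operatorD(2)[OF B yz(1)] y
    by (auto simp: sol_def)
qed

lemma sol_diff:
  assumes A: "coeffs A" and B: "bounded_operator (n + r) B" and y: "sol A B f c y" and z: "sol A B g d z"
  shows "sol A B (\<lambda>t. f t - g t) (c - d) (\<lambda>t. y t - z t)"
  using sol_add[OF A B y sol_scaleR[OF A B z, of "-1"]] by simp

lemma sol_zero:
  assumes "coeffs A" "bounded_operator (n + r) B"
  shows "sol A B (\<lambda>t. 0) 0 (\<lambda>t. 0)"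
  using L_zero[OF assms(1)] W_zero(1) bounded_operatorD(2)[OF assms(2) W_zero(1), of 0] by (simp add: sol_def)

lemma sol_sum:
  assumes A: "coeffs A" and B: "bounded_operator (n + r) B" and "finite S"
    and y: "\<And>i. i \<in> S \<Longrightarrow> sol A B (\<lambda>t. 0) (c i) (y i)"
  shows "sol A B (\<lambda>t. 0) (\<Sum>i\<in>S. c i) (\<lambda>t. \<Sum>i\<in>S. y i t)"
  using assms(3,4)
proof (induction S rule: finite_induct)
  case empty
  then show ?case using sol_zero[OF A B] by simp
next
  case (insert x F)
  then show ?case using sol_add[OF A B, of "\<lambda>t. 0" "c x" "y x" "\<lambda>t. 0" "\<Sum>i\<in>F. c i" "\<lambda>t. \<Sum>i\<in>F. y i t"] by simp
qed

lemma D_low_diff: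
  assumes "y \<in> W (n + r)" "z \<in> W (n + r)" "l < r"
  shows "D l (\<lambda>t. y t - z t) a = D l y a - D l z a"
  using ideriv_diff[OF assms(1,2), of l] assms(3) ab by (auto simp: eqW_def)

text \<open>The a priori estimate is applied at parameter 0 to \<open>y \<epsilon> - y 0\<close>, so
  its constant is fixed. The operator at 0 maps this difference to a vanishing part plus the
  coefficient defect times the norm of \<open>y \<epsilon>\<close>.\<close>

lemma ode_convergence:
  fixes A :: "nat \<Rightarrow> real \<Rightarrow> real \<Rightarrow> complex ^ 'm ^ 'm"
  assumes "0 < \<delta>" and A: "\<And>\<epsilon>. \<epsilon> \<in> {0..<\<delta>} \<Longrightarrow> coeffs (\<lambda>l. A l \<epsilon>)"
    and limA: "\<And>l. l < r \<Longrightarrow> ((\<lambda>\<epsilon>. NW n (\<lambda>t. A l \<epsilon> t - A l 0 t)) \<longlongrightarrow> 0) (at_right 0)"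
    and y: "\<And>\<epsilon>. \<epsilon> \<in> {0..<\<delta>} \<Longrightarrow> y \<epsilon> \<in> W (n + r)"
    and limf: "((\<lambda>\<epsilon>. NW n (\<lambda>t. L (\<lambda>l. A l \<epsilon>) (y \<epsilon>) t - L (\<lambda>l. A l 0) (y 0) t)) \<longlongrightarrow> 0) (at_right 0)"
    and limc: "\<And>l. l < r \<Longrightarrow> ((\<lambda>\<epsilon>. D l (y \<epsilon>) a) \<longlongrightarrow> D l (y 0) a) (at_right 0)"
  shows "((\<lambda>\<epsilon>. NW (n + r) (\<lambda>t. y \<epsilon> t - y 0 t)) \<longlongrightarrow> 0) (at_right 0)"
proof -
  have 0: "0 \<in> {0..<\<delta>}" using \<open>0 < \<delta>\<close> by simp
  have ev: "eventually (\<lambda>\<epsilon>. \<epsilon> \<in> {0..<\<delta>}) (at_right 0)"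
    using eventually_at_right_less[of 0] \<open>0 < \<delta>\<close> by (auto simp: eventually_at_right_field intro: exI[of _ \<delta>])
  let ?Az = "\<lambda>l. A l 0"
  obtain C where C: "C \<ge> 0" "\<forall>y\<in>W (n + r). NW (n + r) y \<le> C * ((\<Sum>l<r. norm (D l y a)) + NW n (L ?Az y))"
    using ode_apriori[OF A[OF 0]] by blast
  obtain C' where C': "C' \<ge> 0" "\<forall>(A::nat \<Rightarrow> real \<Rightarrow> complex ^ 'm ^ 'm) A'. coeffs A \<longrightarrow> coeffs A' \<longrightarrow> (\<forall>y\<in>W (n + r).
     NW n (\<lambda>t. L A y t - L A' y t) \<le> C' * (\<Sum>l<r. NW n (\<lambda>t. A l t - A' l t)) * NW (n + r) y)"
    using L_diff_bound by blast
  define \<eta> where "\<eta> \<epsilon> = C' * (\<Sum>l<r. NW n (\<lambda>t. A l \<epsilon> t - A l 0 t))" for \<epsilon>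
  define g where "g \<epsilon> = NW n (\<lambda>t. L (\<lambda>l. A l \<epsilon>) (y \<epsilon>) t - L ?Az (y 0) t)" for \<epsilon>
  define h where "h \<epsilon> = (\<Sum>l<r. norm (D l (y \<epsilon>) a - D l (y 0) a))" for \<epsilon>
  define d where "d \<epsilon> = NW (n + r) (\<lambda>t. y \<epsilon> t - y 0 t)" for \<epsilon>
  have \<eta>0: "0 \<le> \<eta> \<epsilon>" for \<epsilon> unfolding \<eta>_def using C'(1) by (intro mult_nonneg_nonneg sum_nonneg) auto
  have d0: "0 \<le> d \<epsilon>" for \<epsilon> by (simp add: d_def)
  have \<eta>: "(\<eta> \<longlongrightarrow> 0) (at_right 0)"
  proof -
    have "(\<eta> \<longlongrightarrow> C' * (\<Sum>l<r. 0)) (at_right 0)"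
      unfolding \<eta>_def[abs_def] by (intro tendsto_mult tendsto_const tendsto_sum limA) auto
    then show ?thesis by simp
  qed
  have h: "(h \<longlongrightarrow> 0) (at_right 0)"
  proof -
    have "(h \<longlongrightarrow> (\<Sum>l<r. 0)) (at_right 0)"
      unfolding h_def[abs_def] by (intro tendsto_sum tendsto_norm_zero LIM_zero limc) auto
    then show ?thesis by simp
  qed
  \<comment> \<open>The unknown distance \<open>d \<epsilon>\<close> occurs on the right as well,
    since the norm of \<open>y \<epsilon>\<close> is estimated by \<open>d \<epsilon>\<close> plus
    that of \<open>y 0\<close>.\<close>
  have main: "d \<epsilon> \<le> C * (h \<epsilon> + (\<eta> \<epsilon> * (d \<epsilon> + NW (n + r) (y 0)) + g \<epsilon>))" if \<epsilon>: "\<epsilon> \<in> {0..<\<delta>}" for \<epsilon>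
  proof -
    let ?A = "\<lambda>l. A l \<epsilon>"
    note W\<epsilon> = y[OF \<epsilon>] and W0 = y[OF 0]
    have Wd: "(\<lambda>t. y \<epsilon> t - y 0 t) \<in> W (n + r)" by (rule W_diff(1)[OF W\<epsilon> W0])
    have LW: "L ?Az (y \<epsilon>) \<in> W n" "L ?A (y \<epsilon>) \<in> W n" "L ?Az (y 0) \<in> W n"
      using L_in_W A \<epsilon> 0 W\<epsilon> W0 by blast+
    have "NW n (L ?Az (\<lambda>t. y \<epsilon> t - y 0 t)) = NW n (\<lambda>t. L ?Az (y \<epsilon>) t - L ?Az (y 0) t)"
      using NW_cong(2)[OF L_in_W[OF A[OF 0] Wd] L_diff[OF A[OF 0] W\<epsilon> W0]] by simp
    also have "\<dots> = NW n (\<lambda>t. (L ?Az (y \<epsilon>) t - L ?A (y \<epsilon>) t) + (L ?A (y \<epsilon>) t - L ?Az (y 0) t))" by simp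
    also have "\<dots> \<le> NW n (\<lambda>t. L ?Az (y \<epsilon>) t - L ?A (y \<epsilon>) t) + NW n (\<lambda>t. L ?A (y \<epsilon>) t - L ?Az (y 0) t)"
      using W_add[OF W_diff(1)[OF LW(1,2)] W_diff(1)[OF LW(2,3)]] by blast
    also have "NW n (\<lambda>t. L ?Az (y \<epsilon>) t - L ?A (y \<epsilon>) t) = NW n (\<lambda>t. L ?A (y \<epsilon>) t - L ?Az (y \<epsilon>) t)"
      by (rule NW_diff_commute[OF LW(1,2)])
    also have "\<dots> \<le> \<eta> \<epsilon> * NW (n + r) (y \<epsilon>)"
      using C'(2)[rule_format, OF A[OF \<epsilon>] A[OF 0] W\<epsilon>] by (simp add: \<eta>_def)
    also have "NW (n + r) (y \<epsilon>) \<le> d \<epsilon> + NW (n + r) (y 0)"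
      using W_add[OF Wd W0] by (simp add: d_def)
    finally have "NW n (L ?Az (\<lambda>t. y \<epsilon> t - y 0 t)) \<le> \<eta> \<epsilon> * (d \<epsilon> + NW (n + r) (y 0)) + g \<epsilon>"
      using \<eta>0[of \<epsilon>] by (simp add: g_def mult_left_mono)
    moreover have "(\<Sum>l<r. norm (D l (\<lambda>t. y \<epsilon> t - y 0 t) a)) = h \<epsilon>"
      unfolding h_def using D_low_diff[OF W\<epsilon> W0] by (intro sum.cong) auto
    ultimately have "C * ((\<Sum>l<r. norm (D l (\<lambda>t. y \<epsilon> t - y 0 t) a)) + NW n (L ?Az (\<lambda>t. y \<epsilon> t - y 0 t)))
      \<le> C * (h \<epsilon> + (\<eta> \<epsilon> * (d \<epsilon> + NW (n + r) (y 0)) + g \<epsilon>))"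
      using C(1) by (intro mult_left_mono add_mono) auto
    then show ?thesis using C(2) Wd unfolding d_def by (blast intro: order_trans)
  qed
  have "((\<lambda>\<epsilon>. C * \<eta> \<epsilon>) \<longlongrightarrow> C * 0) (at_right 0)" by (intro tendsto_intros \<eta>)
  then have "eventually (\<lambda>\<epsilon>. C * \<eta> \<epsilon> < 1 / 2) (at_right 0)" by (intro order_tendstoD(2)) auto
  \<comment> \<open>Once \<open>C * \<eta> \<epsilon> < 1 / 2\<close>, the term containing
    \<open>d \<epsilon>\<close> is absorbed into the left-hand side.\<close>
  with ev have "eventually (\<lambda>\<epsilon>. norm (d \<epsilon>) \<le> 2 * (C * (h \<epsilon> + (\<eta> \<epsilon> * NW (n + r) (y 0) + g \<epsilon>)))) (at_right 0)"
  proof eventually_elim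
    case (elim \<epsilon>)
    have "(C * \<eta> \<epsilon>) * d \<epsilon> \<le> 1 / 2 * d \<epsilon>" using elim(2) d0 by (intro mult_right_mono) auto
    moreover have "C * (h \<epsilon> + (\<eta> \<epsilon> * (d \<epsilon> + NW (n + r) (y 0)) + g \<epsilon>))
      = (C * \<eta> \<epsilon>) * d \<epsilon> + C * (h \<epsilon> + (\<eta> \<epsilon> * NW (n + r) (y 0) + g \<epsilon>))" by (simp add: algebra_simps)
    ultimately have "d \<epsilon> \<le> 2 * (C * (h \<epsilon> + (\<eta> \<epsilon> * NW (n + r) (y 0) + g \<epsilon>)))"
      using main[OF elim(1)] by linarith
    then show ?case using d0[of \<epsilon>] by simp
  qed
  moreover have "((\<lambda>\<epsilon>. 2 * (C * (h \<epsilon> + (\<eta> \<epsilon> * NW (n + r) (y 0) + g \<epsilon>)))) \<longlongrightarrow> 2 * (C * (0 + (0 * NW (n + r) (y 0) + 0)))) (at_right 0)"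
    using limf unfolding g_def[symmetric] by (intro tendsto_intros h \<eta>)
  ultimately have "(d \<longlongrightarrow> 0) (at_right 0)" by (intro Lim_null_comparison[of d]) auto
  then show ?thesis by (simp add: d_def[abs_def])
qed

end

section \<open>Sufficiency of the three conditions\<close>

text \<open>A bijection between index sets of equal cardinality identifies the boundary data space
  with r-tuples of Cauchy data. This makes the system for the Cauchy data square.\<close>

lemma cauchy_data_param:
  assumes card: "CARD('q) = r * CARD('m)"
  shows "\<exists>cd :: complex ^ 'q \<Rightarrow> nat \<Rightarrow> complex ^ 'm. (\<forall>l. bounded_linear (\<lambda>x. cd x l)) \<and>
    (\<forall>c. \<exists>x. \<forall>l<r. cd x l = c l) \<and> (\<forall>x. (\<forall>l<r. cd x l = 0) \<longrightarrow> x = 0)"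
proof -
  have "card ({..<r} \<times> (UNIV :: 'm set)) = card (UNIV :: 'q set)"
    using card by (simp add: card_cartesian_product)
  then obtain \<tau> :: "nat \<times> 'm \<Rightarrow> 'q" where \<tau>: "bij_betw \<tau> ({..<r} \<times> UNIV) UNIV"
    using finite_same_card_bij[of "{..<r} \<times> (UNIV :: 'm set)" "UNIV :: 'q set"] by auto
  let ?\<sigma> = "inv_into ({..<r} \<times> UNIV) \<tau>"
  have \<tau>\<sigma>: "\<tau> (?\<sigma> i) = i" "fst (?\<sigma> i) < r" for i
    using bij_betw_inv_into_right[OF \<tau>, of i] bij_betw_apply[OF bij_betw_inv_into[OF \<tau>], of i] by auto
  have \<sigma>\<tau>: "?\<sigma> (\<tau> (l, k)) = (l, k)" if "l < r" for l k
    using bij_betw_inv_into_left[OF \<tau>, of "(l, k)"] that by simp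
  define cd :: "complex ^ 'q \<Rightarrow> nat \<Rightarrow> complex ^ 'm" where "cd x l = (\<chi> k. x $ \<tau> (l, k))" for x l
  have "linear (\<lambda>x. cd x l)" for l by (rule linearI) (auto simp: cd_def vec_eq_iff)
  then have "bounded_linear (\<lambda>x. cd x l)" for l by (simp add: linear_conv_bounded_linear)
  moreover have "\<exists>x. \<forall>l<r. cd x l = c l" for c
  proof (intro exI allI impI)
    fix l assume "l < r"
    then show "cd (\<chi> i. c (fst (?\<sigma> i)) $ snd (?\<sigma> i)) l = c l"
      by (simp add: cd_def vec_eq_iff \<sigma>\<tau>)
  qed
  moreover have "x = 0" if "\<forall>l<r. cd x l = 0" for x
  proof -
    have "x $ i = cd x (fst (?\<sigma> i)) $ snd (?\<sigma> i)" for i using \<tau>\<sigma>(1)[of i] by (simp add: cd_def)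
    then show ?thesis using that \<tau>\<sigma>(2) by (simp add: vec_eq_iff)
  qed
  ultimately show ?thesis by blast
qed

locale bvp_family = interval_ode a b p n r for a b :: real and p :: ereal and n r :: nat +
  fixes \<epsilon>0 :: real and A :: "nat \<Rightarrow> real \<Rightarrow> real \<Rightarrow> complex ^ 'm ^ 'm"
    and B :: "real \<Rightarrow> (real \<Rightarrow> complex ^ 'm) \<Rightarrow> complex ^ 'q"
  assumes \<epsilon>0: "0 < \<epsilon>0" and coeffs: "\<And>\<epsilon>. \<epsilon> \<in> {0..<\<epsilon>0} \<Longrightarrow> coeffs (\<lambda>l. A l \<epsilon>)"
    and operator: "\<And>\<epsilon>. \<epsilon> \<in> {0..<\<epsilon>0} \<Longrightarrow> bounded_operator (n + r) (B \<epsilon>)"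
begin

abbreviation SOL where "SOL \<epsilon> \<equiv> sol (\<lambda>l. A l \<epsilon>) (B \<epsilon>)"

definition coeffs_converge :: bool where
  "coeffs_converge \<longleftrightarrow> (\<forall>l<r. ((\<lambda>\<epsilon>. NW n (\<lambda>t. A l \<epsilon> t - A l 0 t)) \<longlongrightarrow> 0) (at_right 0))"

definition operators_converge :: bool where
  "operators_converge \<longleftrightarrow> (\<forall>y\<in>W (n + r). ((\<lambda>\<epsilon>. B \<epsilon> y) \<longlongrightarrow> B 0 y) (at_right 0))"

definition well_posed :: "real \<Rightarrow> bool" where
  "well_posed \<epsilon>1 \<longleftrightarrow> (\<forall>\<epsilon>\<in>{0..<\<epsilon>1}. \<forall>f\<in>W n. \<forall>c. \<exists>y. SOL \<epsilon> f c y \<and> (\<forall>z. SOL \<epsilon> f c z \<longrightarrow> (\<forall>t\<in>{a..b}. z t = y t)))"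

definition solutions_converge :: "real \<Rightarrow> bool" where
  "solutions_converge \<epsilon>1 \<longleftrightarrow> (\<forall>f c y. (\<forall>\<epsilon>\<in>{0..<\<epsilon>1}. f \<epsilon> \<in> W n) \<longrightarrow> (\<forall>\<epsilon>\<in>{0..<\<epsilon>1}. SOL \<epsilon> (f \<epsilon>) (c \<epsilon>) (y \<epsilon>)) \<longrightarrow>
     ((\<lambda>\<epsilon>. NW n (\<lambda>t. f \<epsilon> t - f 0 t)) \<longlongrightarrow> 0) (at_right 0) \<longrightarrow> (c \<longlongrightarrow> c 0) (at_right 0) \<longrightarrow>
     ((\<lambda>\<epsilon>. NW (n + r) (\<lambda>t. y \<epsilon> t - y 0 t)) \<longlongrightarrow> 0) (at_right 0))"

lemma zero_in: "0 \<in> {0..<\<epsilon>0}" using \<epsilon>0 by simp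

text \<open>Two such functions differ by a homogeneous solution with zero Cauchy data, which has
  norm zero and is invisible to a bounded operator.\<close>

lemma operator_unique:
  assumes "\<epsilon> \<in> {0..<\<epsilon>0}" "y \<in> W (n + r)" "z \<in> W (n + r)" "eqW n (L (\<lambda>l. A l \<epsilon>) y) (L (\<lambda>l. A l \<epsilon>) z)"
    "\<forall>l<r. D l y a = D l z a"
  shows "B \<epsilon> y = B \<epsilon> z"
proof (rule bounded_operator_cong[OF operator[OF assms(1)] assms(2,3)])
  have "eqW n (\<lambda>t. L (\<lambda>l. A l \<epsilon>) y t - L (\<lambda>l. A l \<epsilon>) z t) (\<lambda>t. 0)"
    using assms(4) by (auto simp: eqW_def elim: AE_mp split: if_splits)
  then have "eqW n (L (\<lambda>l. A l \<epsilon>) (\<lambda>t. y t - z t)) (\<lambda>t. 0)"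
    using eqW_trans[OF L_diff[OF coeffs[OF assms(1)] assms(2,3)]] by blast
  moreover have "\<forall>l<r. D l (\<lambda>t. y t - z t) a = 0" using D_low_diff[OF assms(2,3)] assms(5) by simp
  ultimately show "NW (n + r) (\<lambda>t. y t - z t) = 0"
    by (rule ode_unique(1)[OF coeffs[OF assms(1)] W_diff(1)[OF assms(2,3)]])
qed

theorem continuous_dependence_sufficient:
  assumes card: "CARD('q) = r * CARD('m)"
    and trivial: "\<forall>y. SOL 0 (\<lambda>t. 0) 0 y \<longrightarrow> (\<forall>t\<in>{a..b}. y t = 0)"
    and cA: coeffs_converge and cB: operators_converge
  shows "\<exists>\<epsilon>1. 0 < \<epsilon>1 \<and> \<epsilon>1 < \<epsilon>0 \<and> well_posed \<epsilon>1 \<and> solutions_converge \<epsilon>1"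
proof -
  obtain cd :: "complex ^ 'q \<Rightarrow> nat \<Rightarrow> complex ^ 'm" where cd: "\<And>l. bounded_linear (\<lambda>x. cd x l)"
    "\<And>c. \<exists>x. \<forall>l<r. cd x l = c l" "\<And>x. (\<forall>l<r. cd x l = 0) \<Longrightarrow> x = 0"
    using cauchy_data_param[OF card] by blast
  have limA: "((\<lambda>\<epsilon>. NW n (\<lambda>t. A l \<epsilon> t - A l 0 t)) \<longlongrightarrow> 0) (at_right 0)" if "l < r" for l
    using cA that by (simp add: coeffs_converge_def)
  have limB: "((\<lambda>\<epsilon>. B \<epsilon> y) \<longlongrightarrow> B 0 y) (at_right 0)" if "y \<in> W (n + r)" for y
    using cB that by (simp add: operators_converge_def)
  let ?A = "\<lambda>\<epsilon> l. A l \<epsilon>"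
  \<comment> \<open>The homogeneous solution with Cauchy data \<open>x\<close>. Being chosen, it
    need not depend linearly on \<open>x\<close>; linearity is recovered for
    \<open>\<Lambda>\<close> because boundary values do not depend on the choice.\<close>
  define V where "V \<epsilon> x = (SOME y. y \<in> W (n + r) \<and> eqW n (L (?A \<epsilon>) y) (\<lambda>t. 0) \<and> (\<forall>l<r. D l y a = cd x l))" for \<epsilon> x
  have V: "V \<epsilon> x \<in> W (n + r)" "eqW n (L (?A \<epsilon>) (V \<epsilon> x)) (\<lambda>t. 0)" "\<And>l. l < r \<Longrightarrow> D l (V \<epsilon> x) a = cd x l"
    if \<epsilon>: "\<epsilon> \<in> {0..<\<epsilon>0}" for \<epsilon> x
  proof -
    have "\<exists>y. y \<in> W (n + r) \<and> eqW n (L (?A \<epsilon>) y) (\<lambda>t. 0) \<and> (\<forall>l<r. D l y a = cd x l)"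
      using ode_exists[OF coeffs[OF \<epsilon>] W_zero(1), of "cd x"] by blast
    from someI_ex[OF this] show "V \<epsilon> x \<in> W (n + r)" "eqW n (L (?A \<epsilon>) (V \<epsilon> x)) (\<lambda>t. 0)" "\<And>l. l < r \<Longrightarrow> D l (V \<epsilon> x) a = cd x l"
      unfolding V_def by blast+
  qed
  define \<Lambda> where "\<Lambda> \<epsilon> x = B \<epsilon> (V \<epsilon> x)" for \<epsilon> x
  \<comment> \<open>Evaluates the boundary operator on any homogeneous solution through its Cauchy
    data alone.\<close>
  have kernel: "B \<epsilon> y = \<Lambda> \<epsilon> x"
    if "\<epsilon> \<in> {0..<\<epsilon>0}" "y \<in> W (n + r)" "eqW n (L (?A \<epsilon>) y) (\<lambda>t. 0)" "\<forall>l<r. D l y a = cd x l" for \<epsilon> y x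
    unfolding \<Lambda>_def using that V(1)[OF that(1), of x] V(2)[OF that(1), of x] V(3)[OF that(1), of _ x]
    by (intro operator_unique) (auto intro: eqW_trans eqW_sym)
  have lin: "linear (\<Lambda> \<epsilon>)" if \<epsilon>: "\<epsilon> \<in> {0..<\<epsilon>0}" for \<epsilon>
  proof (rule linearI)
    note co = coeffs[OF \<epsilon>] and op = operator[OF \<epsilon>]
    have s: "SOL \<epsilon> (\<lambda>t. 0) (\<Lambda> \<epsilon> x) (V \<epsilon> x)" for x using V(1,2)[OF \<epsilon>] by (simp add: sol_def \<Lambda>_def)
    fix x y
    have "SOL \<epsilon> (\<lambda>t. 0) (\<Lambda> \<epsilon> x + \<Lambda> \<epsilon> y) (\<lambda>t. V \<epsilon> x t + V \<epsilon> y t)"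
      using sol_add[OF co op s[of x] s[of y]] by simp
    moreover have "D l (\<lambda>t. V \<epsilon> x t + V \<epsilon> y t) a = cd (x + y) l" if "l < r" for l
      using ideriv_add[OF V(1)[OF \<epsilon>, of x] V(1)[OF \<epsilon>, of y], of l] that ab V(3)[OF \<epsilon> that]
        linear_add[OF bounded_linear.linear[OF cd(1)]] by (auto simp: eqW_def)
    ultimately show "\<Lambda> \<epsilon> (x + y) = \<Lambda> \<epsilon> x + \<Lambda> \<epsilon> y"
      using kernel[OF \<epsilon>, of "\<lambda>t. V \<epsilon> x t + V \<epsilon> y t" "x + y"] by (simp add: sol_def)
    fix k
    have "SOL \<epsilon> (\<lambda>t. 0) (k *\<^sub>R \<Lambda> \<epsilon> x) (\<lambda>t. k *\<^sub>R V \<epsilon> x t)"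
      using sol_scaleR[OF co op s[of x], of k] by simp
    moreover have "D l (\<lambda>t. k *\<^sub>R V \<epsilon> x t) a = cd (k *\<^sub>R x) l" if "l < r" for l
      using ideriv_linear[OF bounded_linear_scaleR_right V(1)[OF \<epsilon>, of x], of l k] that ab V(3)[OF \<epsilon> that]
        linear_scale[OF bounded_linear.linear[OF cd(1)]] by (auto simp: eqW_def)
    ultimately show "\<Lambda> \<epsilon> (k *\<^sub>R x) = k *\<^sub>R \<Lambda> \<epsilon> x"
      using kernel[OF \<epsilon>, of "\<lambda>t. k *\<^sub>R V \<epsilon> x t" "k *\<^sub>R x"] by (simp add: sol_def)
  qed
  \<comment> \<open>Right-hand side and Cauchy data of \<open>V \<epsilon> x\<close> are the same
    for all parameters, so only the coefficients and the boundary operators vary.\<close>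
  have limV: "((\<lambda>\<epsilon>. \<Lambda> \<epsilon> x) \<longlongrightarrow> \<Lambda> 0 x) (at_right 0)" for x
  proof -
    have z: "NW n (\<lambda>t. L (?A \<epsilon>) (V \<epsilon> x) t - L (?A 0) (V 0 x) t) = 0" if "\<epsilon> \<in> {0..<\<epsilon>0}" for \<epsilon>
    proof -
      have "eqW n (\<lambda>t. 0) (\<lambda>t. L (?A \<epsilon>) (V \<epsilon> x) t - L (?A 0) (V 0 x) t)"
        using V(2)[OF that, of x] V(2)[OF zero_in, of x] by (auto simp: eqW_def elim: AE_mp split: if_splits)
      from NW_cong(2)[OF W_zero(1) this] show ?thesis by (simp add: W_zero)
    qed
    have ev: "eventually (\<lambda>\<epsilon>. \<epsilon> \<in> {0..<\<epsilon>0}) (at_right 0)"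
      using \<epsilon>0 by (auto simp: eventually_at_right_field intro: exI[of _ \<epsilon>0])
    have "((\<lambda>\<epsilon>. NW (n + r) (\<lambda>t. V \<epsilon> x t - V 0 x t)) \<longlongrightarrow> 0) (at_right 0)"
    proof (rule ode_convergence[OF \<epsilon>0 coeffs limA V(1)])
      show "((\<lambda>\<epsilon>. NW n (\<lambda>t. L (?A \<epsilon>) (V \<epsilon> x) t - L (?A 0) (V 0 x) t)) \<longlongrightarrow> 0) (at_right 0)"
        by (rule tendsto_eventually) (rule eventually_mono[OF ev z])
      show "((\<lambda>\<epsilon>. D l (V \<epsilon> x) a) \<longlongrightarrow> D l (V 0 x) a) (at_right 0)" if "l < r" for l
        by (rule tendsto_eventually) (rule eventually_mono[OF ev], simp add: V(3)[OF _ that] V(3)[OF zero_in that])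
    qed
    from operator_convergence[OF \<epsilon>0 operator limB V(1) this] show ?thesis by (simp add: \<Lambda>_def)
  qed
  \<comment> \<open>A kernel vector gives a solution of the homogeneous problem at 0. By condition
    (0) it vanishes on \<open>[a, b]\<close> with all its derivatives there, hence so do its Cauchy
    data.\<close>
  have inj0: "inj (\<Lambda> 0)"
    unfolding linear_injective_0[OF lin[OF zero_in]]
  proof (intro allI impI)
    fix x assume "\<Lambda> 0 x = 0"
    then have "SOL 0 (\<lambda>t. 0) 0 (V 0 x)" using V(1,2)[OF zero_in, of x] by (simp add: sol_def \<Lambda>_def)
    then have v0: "V 0 x t = 0" if "t \<in> {a..b}" for t using trivial that by blast
    have "D l (V 0 x) a = 0" for l
    proof -
      have "D l (V 0 x) a = D l (\<lambda>t. 0) a" using v0 ab by (intro ideriv_cong) auto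
      also have "\<dots> = 0"
        using ideriv_linear[OF bounded_linear_scaleR_right[of 0] W_zero(1)[of "Suc l"], of l] ab
        by (auto simp: eqW_def)
      finally show ?thesis .
    qed
    then show "x = 0" using V(3)[OF zero_in, of _ x] cd(3) by simp
  qed
  have ev0: "eventually (\<lambda>\<epsilon>. \<epsilon> \<in> {0..<\<epsilon>0}) (at_right 0)"
    using \<epsilon>0 by (auto simp: eventually_at_right_field intro: exI[of _ \<epsilon>0])
  obtain \<kappa> where \<kappa>: "\<kappa> > 0" "\<forall>x. \<kappa> * norm x \<le> norm (\<Lambda> 0 x)"
    "eventually (\<lambda>\<epsilon>. \<forall>x. \<kappa> * norm x \<le> norm (\<Lambda> \<epsilon> x)) (at_right 0)"
    by (rule linear_family_bounded_below[OF lin ev0 lin[OF zero_in] inj0 limV]) blast+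
  then obtain \<delta> where \<delta>: "\<delta> > 0" "\<And>\<epsilon>. 0 < \<epsilon> \<Longrightarrow> \<epsilon> < \<delta> \<Longrightarrow> \<forall>x. \<kappa> * norm x \<le> norm (\<Lambda> \<epsilon> x)"
    unfolding eventually_at_right_field by blast
  \<comment> \<open>Halving \<open>\<epsilon>0\<close> gives the strict inequality required of
    \<open>\<epsilon>1\<close>; \<open>\<delta>\<close> is where the lower bound on
    \<open>\<Lambda>\<close> holds.\<close>
  define \<epsilon>1 where "\<epsilon>1 = min \<delta> (\<epsilon>0 / 2)"
  have \<epsilon>1: "0 < \<epsilon>1" "\<epsilon>1 < \<epsilon>0" "\<epsilon>1 \<le> \<delta>" using \<delta>(1) \<epsilon>0 by (auto simp: \<epsilon>1_def)
  have below: "\<kappa> * norm x \<le> norm (\<Lambda> \<epsilon> x)" if "\<epsilon> \<in> {0..<\<epsilon>1}" for \<epsilon> x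
    using \<kappa>(2) \<delta>(2)[of \<epsilon>] that \<epsilon>1(3) by (cases "\<epsilon> = 0") auto
  have in0: "\<epsilon> \<in> {0..<\<epsilon>0}" if "\<epsilon> \<in> {0..<\<epsilon>1}" for \<epsilon> using that \<epsilon>1 by auto
  have "well_posed \<epsilon>1"
    unfolding well_posed_def
  proof (intro ballI allI)
    fix \<epsilon> and f :: "real \<Rightarrow> complex ^ 'm" and c :: "complex ^ 'q" assume \<epsilon>: "\<epsilon> \<in> {0..<\<epsilon>1}" and f: "f \<in> W n"
    note co = coeffs[OF in0[OF \<epsilon>]] and op = operator[OF in0[OF \<epsilon>]]
    note lin\<epsilon> = lin[OF in0[OF \<epsilon>]]
    have "x = 0" if "\<Lambda> \<epsilon> x = 0" for x using below[OF \<epsilon>, of x] that \<kappa>(1) by (simp add: mult_le_0_iff)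
    then have "inj (\<Lambda> \<epsilon>)" using linear_injective_0[OF lin\<epsilon>] by blast
    \<comment> \<open>Here the square shape matters: for a linear map of a finite-dimensional space
      into itself, uniqueness yields existence.\<close>
    then have "surj (\<Lambda> \<epsilon>)" by (rule linear_inj_imp_surj[OF lin\<epsilon>])
    obtain g where g: "g \<in> W (n + r)" "eqW n (L (?A \<epsilon>) g) f"
      using ode_exists[OF co f, of "\<lambda>l. 0"] by blast
    obtain x where x: "\<Lambda> \<epsilon> x = c - B \<epsilon> g" using \<open>surj (\<Lambda> \<epsilon>)\<close> by (metis surjD)
    have "SOL \<epsilon> f (B \<epsilon> g) g" using g by (simp add: sol_def)
    moreover have "SOL \<epsilon> (\<lambda>t. 0) (\<Lambda> \<epsilon> x) (V \<epsilon> x)" using V(1,2)[OF in0[OF \<epsilon>]] by (simp add: sol_def \<Lambda>_def)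
    ultimately have y: "SOL \<epsilon> f c (\<lambda>t. g t + V \<epsilon> x t)"
      using sol_add[OF co op, of f "B \<epsilon> g" g "\<lambda>t. 0" "\<Lambda> \<epsilon> x" "V \<epsilon> x"] x by simp
    show "\<exists>y. SOL \<epsilon> f c y \<and> (\<forall>z. SOL \<epsilon> f c z \<longrightarrow> (\<forall>t\<in>{a..b}. z t = y t))"
    proof (intro exI conjI allI impI ballI)
      show "SOL \<epsilon> f c (\<lambda>t. g t + V \<epsilon> x t)" by (rule y)
      fix z t assume z: "SOL \<epsilon> f c z" and t: "t \<in> {a..b}"
      let ?d = "\<lambda>t. z t - (g t + V \<epsilon> x t)"
      have d: "SOL \<epsilon> (\<lambda>t. 0) 0 ?d" using sol_diff[OF co op z y] by simp
      \<comment> \<open>Uniqueness on the level of Cauchy data: those of the difference lie in the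
        kernel of \<open>\<Lambda> \<epsilon>\<close>.\<close>
      obtain x' where x': "\<forall>l<r. cd x' l = D l ?d a" using cd(2)[of "\<lambda>l. D l ?d a"] by blast
      have "\<Lambda> \<epsilon> x' = 0" using kernel[OF in0[OF \<epsilon>], of ?d x'] d x' by (simp add: sol_def)
      then have "x' = 0" using below[OF \<epsilon>, of x'] \<kappa>(1) by (simp add: mult_le_0_iff)
      then have "\<forall>l<r. D l ?d a = 0" using x' linear_0[OF bounded_linear.linear[OF cd(1)]] by metis
      from ode_unique(2)[OF co _ _ this t] d have "?d t = 0" by (simp add: sol_def)
      then show "z t = g t + V \<epsilon> x t" by simp
    qed
  qed
  moreover have "solutions_converge \<epsilon>1"
    unfolding solutions_converge_def
  proof (intro allI impI)
    fix f y :: "real \<Rightarrow> real \<Rightarrow> complex ^ 'm" and c :: "real \<Rightarrow> complex ^ 'q"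
    assume f: "\<forall>\<epsilon>\<in>{0..<\<epsilon>1}. f \<epsilon> \<in> W n" and y: "\<forall>\<epsilon>\<in>{0..<\<epsilon>1}. SOL \<epsilon> (f \<epsilon>) (c \<epsilon>) (y \<epsilon>)"
      and limf: "((\<lambda>\<epsilon>. NW n (\<lambda>t. f \<epsilon> t - f 0 t)) \<longlongrightarrow> 0) (at_right 0)" and limc: "(c \<longlongrightarrow> c 0) (at_right 0)"
    have z1: "0 \<in> {0..<\<epsilon>1}" using \<epsilon>1 by simp
    have ev: "eventually (\<lambda>\<epsilon>. \<epsilon> \<in> {0..<\<epsilon>1}) (at_right 0)"
      using \<epsilon>1 by (auto simp: eventually_at_right_field intro: exI[of _ \<epsilon>1])
    \<comment> \<open>Particular solutions with zero Cauchy data. They converge by the Cauchy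
      problem alone, which reduces the claim to convergence of the Cauchy data of
      \<open>y \<epsilon>\<close>.\<close>
    have "\<exists>g. g \<in> W (n + r) \<and> eqW n (L (?A \<epsilon>) g) (f \<epsilon>) \<and> (\<forall>l<r. D l g a = 0)" if "\<epsilon> \<in> {0..<\<epsilon>1}" for \<epsilon>
      using ode_exists[OF coeffs[OF in0[OF that]], of "f \<epsilon>" "\<lambda>l. 0"] f that by blast
    then have "\<forall>\<epsilon>\<in>{0..<\<epsilon>1}. \<exists>g. g \<in> W (n + r) \<and> eqW n (L (?A \<epsilon>) g) (f \<epsilon>) \<and> (\<forall>l<r. D l g a = 0)" by blast
    from bchoice[OF this] obtain g where g: "\<And>\<epsilon>. \<epsilon> \<in> {0..<\<epsilon>1} \<Longrightarrow> g \<epsilon> \<in> W (n + r)"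
      "\<And>\<epsilon>. \<epsilon> \<in> {0..<\<epsilon>1} \<Longrightarrow> eqW n (L (?A \<epsilon>) (g \<epsilon>)) (f \<epsilon>)" "\<And>\<epsilon> l. \<epsilon> \<in> {0..<\<epsilon>1} \<Longrightarrow> l < r \<Longrightarrow> D l (g \<epsilon>) a = 0"
      by blast
    have yW: "y \<epsilon> \<in> W (n + r)" "eqW n (L (?A \<epsilon>) (y \<epsilon>)) (f \<epsilon>)" "B \<epsilon> (y \<epsilon>) = c \<epsilon>" if "\<epsilon> \<in> {0..<\<epsilon>1}" for \<epsilon>
      using y that by (auto simp: sol_def)
    have limL: "((\<lambda>\<epsilon>. NW n (\<lambda>t. L (?A \<epsilon>) (u \<epsilon>) t - L (?A 0) (u 0) t)) \<longlongrightarrow> 0) (at_right 0)"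
      if u: "\<And>\<epsilon>. \<epsilon> \<in> {0..<\<epsilon>1} \<Longrightarrow> u \<epsilon> \<in> W (n + r)" "\<And>\<epsilon>. \<epsilon> \<in> {0..<\<epsilon>1} \<Longrightarrow> eqW n (L (?A \<epsilon>) (u \<epsilon>)) (f \<epsilon>)" for u
    proof -
      have eq: "NW n (\<lambda>t. L (?A \<epsilon>) (u \<epsilon>) t - L (?A 0) (u 0) t) = NW n (\<lambda>t. f \<epsilon> t - f 0 t)" if \<epsilon>: "\<epsilon> \<in> {0..<\<epsilon>1}" for \<epsilon>
      proof -
        have "eqW n (\<lambda>t. f \<epsilon> t - f 0 t) (\<lambda>t. L (?A \<epsilon>) (u \<epsilon>) t - L (?A 0) (u 0) t)"
          using u(2)[OF \<epsilon>] u(2)[OF z1] by (auto simp: eqW_def elim: AE_mp split: if_splits)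
        from NW_cong(2)[OF W_diff(1) this] f \<epsilon> z1 show ?thesis by blast
      qed
      have "eventually (\<lambda>\<epsilon>. NW n (\<lambda>t. f \<epsilon> t - f 0 t) = NW n (\<lambda>t. L (?A \<epsilon>) (u \<epsilon>) t - L (?A 0) (u 0) t)) (at_right 0)"
        using ev by eventually_elim (simp add: eq)
      with limf show ?thesis by (rule Lim_transform_eventually)
    qed
    have "((\<lambda>\<epsilon>. NW (n + r) (\<lambda>t. g \<epsilon> t - g 0 t)) \<longlongrightarrow> 0) (at_right 0)"
    proof (rule ode_convergence[OF \<epsilon>1(1) coeffs[OF in0] limA g(1) limL[OF g(1,2)]])
      show "((\<lambda>\<epsilon>. D l (g \<epsilon>) a) \<longlongrightarrow> D l (g 0) a) (at_right 0)" if "l < r" for l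
        by (rule tendsto_eventually) (rule eventually_mono[OF ev], simp add: g(3)[OF _ that] g(3)[OF z1 that])
    qed
    from operator_convergence[OF \<epsilon>1(1) operator[OF in0] limB g(1) this]
    have limBg: "((\<lambda>\<epsilon>. B \<epsilon> (g \<epsilon>)) \<longlongrightarrow> B 0 (g 0)) (at_right 0)" .
    have "\<forall>\<epsilon>. \<exists>x. \<forall>l<r. cd x l = D l (y \<epsilon>) a" by (intro allI cd(2))
    from choice[OF this] obtain x where x: "\<And>\<epsilon> l. l < r \<Longrightarrow> cd (x \<epsilon>) l = D l (y \<epsilon>) a" by blast
    have \<Lambda>x: "\<Lambda> \<epsilon> (x \<epsilon>) = c \<epsilon> - B \<epsilon> (g \<epsilon>)" if \<epsilon>: "\<epsilon> \<in> {0..<\<epsilon>1}" for \<epsilon>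
    proof -
      note co = coeffs[OF in0[OF \<epsilon>]] and op = operator[OF in0[OF \<epsilon>]]
      have "SOL \<epsilon> (f \<epsilon>) (c \<epsilon>) (y \<epsilon>)" "SOL \<epsilon> (f \<epsilon>) (B \<epsilon> (g \<epsilon>)) (g \<epsilon>)" using y g \<epsilon> by (auto simp: sol_def)
      then have d: "SOL \<epsilon> (\<lambda>t. 0) (c \<epsilon> - B \<epsilon> (g \<epsilon>)) (\<lambda>t. y \<epsilon> t - g \<epsilon> t)"
        using sol_diff[OF co op, of "f \<epsilon>" "c \<epsilon>" "y \<epsilon>" "f \<epsilon>" "B \<epsilon> (g \<epsilon>)" "g \<epsilon>"] by simp
      moreover have "\<forall>l<r. D l (\<lambda>t. y \<epsilon> t - g \<epsilon> t) a = cd (x \<epsilon>) l"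
        using D_low_diff[OF yW(1)[OF \<epsilon>] g(1)[OF \<epsilon>]] g(3)[OF \<epsilon>] x by simp
      ultimately show ?thesis using kernel[OF in0[OF \<epsilon>], of "\<lambda>t. y \<epsilon> t - g \<epsilon> t" "x \<epsilon>"] by (simp add: sol_def)
    qed
    \<comment> \<open>This is the image of \<open>x \<epsilon> - x 0\<close> under
      \<open>\<Lambda> \<epsilon>\<close>; the uniform lower bound \<open>\<kappa>\<close> then
      forces the Cauchy data to converge.\<close>
    have "((\<lambda>\<epsilon>. (c \<epsilon> - B \<epsilon> (g \<epsilon>)) - \<Lambda> \<epsilon> (x 0)) \<longlongrightarrow> (c 0 - B 0 (g 0)) - \<Lambda> 0 (x 0)) (at_right 0)"
      by (intro tendsto_diff limc limBg limV)
    then have lim\<Lambda>: "((\<lambda>\<epsilon>. (c \<epsilon> - B \<epsilon> (g \<epsilon>)) - \<Lambda> \<epsilon> (x 0)) \<longlongrightarrow> 0) (at_right 0)"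
      using \<Lambda>x[OF z1] by simp
    have "((\<lambda>\<epsilon>. x \<epsilon> - x 0) \<longlongrightarrow> 0) (at_right 0)"
    proof (rule Lim_null_comparison)
      show "\<forall>\<^sub>F \<epsilon> in at_right 0. norm (x \<epsilon> - x 0) \<le> norm ((c \<epsilon> - B \<epsilon> (g \<epsilon>)) - \<Lambda> \<epsilon> (x 0)) / \<kappa>"
        using ev
      proof eventually_elim
        case (elim \<epsilon>)
        have "\<kappa> * norm (x \<epsilon> - x 0) \<le> norm (\<Lambda> \<epsilon> (x \<epsilon> - x 0))" by (rule below[OF elim])
        also have "\<Lambda> \<epsilon> (x \<epsilon> - x 0) = (c \<epsilon> - B \<epsilon> (g \<epsilon>)) - \<Lambda> \<epsilon> (x 0)"
          using linear_diff[OF lin[OF in0[OF elim]]] \<Lambda>x[OF elim] by simp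
        finally show ?case using \<kappa>(1) by (simp add: pos_le_divide_eq mult.commute)
      qed
      have "((\<lambda>\<epsilon>. norm ((c \<epsilon> - B \<epsilon> (g \<epsilon>)) - \<Lambda> \<epsilon> (x 0)) / \<kappa>) \<longlongrightarrow> 0 / \<kappa>) (at_right 0)"
        using \<kappa>(1) by (intro tendsto_divide tendsto_const tendsto_norm_zero lim\<Lambda>) auto
      then show "((\<lambda>\<epsilon>. norm ((c \<epsilon> - B \<epsilon> (g \<epsilon>)) - \<Lambda> \<epsilon> (x 0)) / \<kappa>) \<longlongrightarrow> 0) (at_right 0)" by simp
    qed
    then have limx: "(x \<longlongrightarrow> x 0) (at_right 0)" by (simp add: LIM_zero_iff)
    show "((\<lambda>\<epsilon>. NW (n + r) (\<lambda>t. y \<epsilon> t - y 0 t)) \<longlongrightarrow> 0) (at_right 0)"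
    proof (rule ode_convergence[OF \<epsilon>1(1) coeffs[OF in0] limA yW(1) limL[OF yW(1,2)]])
      show "((\<lambda>\<epsilon>. D l (y \<epsilon>) a) \<longlongrightarrow> D l (y 0) a) (at_right 0)" if "l < r" for l
        using bounded_linear.tendsto[OF cd(1) limx, of l] by (simp add: x[OF that])
    qed
  qed
  ultimately show ?thesis using \<epsilon>1 by blast
qed

end

section \<open>Test monomials and necessity of the three conditions\<close>

context interval_Lp
begin

definition monomial :: "'a::euclidean_space \<Rightarrow> nat \<Rightarrow> real \<Rightarrow> 'a" where
  "monomial e l t = ((t - a) ^ l / fact l) *\<^sub>R e"

lemma monomial_derivative: "(monomial e (Suc l) has_vector_derivative monomial e l t) (at t within S)"
proof -
  have "((\<lambda>t. t - a) has_field_derivative 1) (at t within S)"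
    by (auto intro!: derivative_eq_intros)
  from DERIV_cdivide[OF DERIV_power_Suc[OF this, of l], of "fact (Suc l)"]
  have "((\<lambda>t. (t - a) ^ Suc l / fact (Suc l)) has_field_derivative (real (Suc l) * (t - a) ^ l) / fact (Suc l)) (at t within S)"
    by (simp add: mult.commute)
  also have "(real (Suc l) * (t - a) ^ l) / fact (Suc l) = (t - a) ^ l / fact l"
    by (simp add: fact_Suc del: of_nat_Suc)
  finally have "((\<lambda>t. (t - a) ^ Suc l / fact (Suc l)) has_vector_derivative (t - a) ^ l / fact l) (at t within S)"
    by (simp add: has_real_derivative_iff_has_vector_derivative)
  from bounded_linear.has_vector_derivative[OF bounded_linear_scaleR_left[of e] this]
  show ?thesis unfolding monomial_def[abs_def] .
qed

lemma monomial_primitive: "primitive (monomial e (Suc l)) (monomial e l)"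
  unfolding primitive_def
proof
  fix t assume t: "t \<in> {a..b}"
  have "(monomial e l has_integral (monomial e (Suc l) t - monomial e (Suc l) a)) {a..t}"
    by (rule fundamental_theorem_of_calculus) (use t in \<open>auto intro: monomial_derivative\<close>)
  then show "monomial e (Suc l) t = monomial e (Suc l) a + integral {a..t} (monomial e l)"
    by (simp add: integral_unique)
qed

lemma monomial_in_W: "monomial e l \<in> W s"
proof (induction l arbitrary: s)
  case 0
  have "primitive (monomial e 0) (\<lambda>t. 0)" by (simp add: primitive_def monomial_def)
  then have "monomial e 0 \<in> W (Suc s)" by (rule W_SucI(1)[OF W_zero(1)])
  then show ?case by (rule W_Suc_subset)
next
  case (Suc l)
  have "monomial e (Suc l) \<in> W (Suc s)" by (rule W_SucI(1)[OF Suc monomial_primitive])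
  then show ?case by (rule W_Suc_subset)
qed

lemma ideriv_monomial:
  assumes "t \<in> {a..b}"
  shows "D k (monomial e l) t = (if k \<le> l then monomial e (l - k) t else 0)"
  using assms
proof (induction k arbitrary: t)
  case (Suc k)
  have "D (Suc k) (monomial e l) t = D (Suc 0) (D k (monomial e l)) t" by (simp add: ideriv_ideriv)
  also have "\<dots> = D (Suc 0) (\<lambda>t. if k \<le> l then monomial e (l - k) t else 0) t"
    by (rule ideriv_cong[OF _ Suc.prems]) (use Suc.IH in simp)
  also have "\<dots> = vector_derivative (\<lambda>t. if k \<le> l then monomial e (l - k) t else 0) (at t within {a..b})"
    by (simp add: ideriv_Suc)
  also have "\<dots> = (if Suc k \<le> l then monomial e (l - Suc k) t else 0)"
  proof (rule vector_derivative_Icc[OF _ Suc.prems])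
    consider "l < k" | "l = k" | j where "l - k = Suc j" "l - Suc k = j" "Suc k \<le> l"
      by (cases "l - k") (auto, linarith)
    then show "((\<lambda>t. if k \<le> l then monomial e (l - k) t else 0) has_vector_derivative
        (if Suc k \<le> l then monomial e (l - Suc k) t else 0)) (at t within {a..b})"
    proof cases
      case 3
      then show ?thesis using monomial_derivative[of e j t "{a..b}"] by simp
    qed (auto simp: monomial_def)
  qed
  finally show ?case .
qed simp

end

context interval_ode
begin

lemma L_diff_eq: "(\<lambda>t. L A y t - L A' y t) = (\<lambda>t. \<Sum>l<r. (A l t - A' l t) *v D l y t)"
  by (simp add: L_eq fun_eq_iff sum_subtractf matrix_vector_mult_diff_rdistrib)

text \<open>A matrix function is the sum of its columns, each embedded by a fixed bounded linear
  map, and the i-th column is its product with the i-th unit vector.\<close>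

lemma matrix_bound_by_columns:
  "\<exists>G\<ge>0. \<forall>(A::real \<Rightarrow> complex ^ 'm ^ 'm)\<in>W s. NW s A \<le> G * (\<Sum>i\<in>UNIV. NW s (\<lambda>t. A t *v axis i 1))"
proof -
  define \<Psi> :: "'m \<Rightarrow> complex ^ 'm \<Rightarrow> complex ^ 'm ^ 'm" where "\<Psi> i v = (\<chi> j k. if k = i then v $ j else 0)" for i v
  have "linear (\<Psi> i)" for i by (rule linearI) (auto simp: \<Psi>_def vec_eq_iff)
  then have bl: "bounded_linear (\<Psi> i)" for i by (simp add: linear_conv_bounded_linear)
  have entry: "(A *v axis i 1) $ j = A $ j $ i" for A :: "complex ^ 'm ^ 'm" and i j
    by (simp add: matrix_vector_mult_def axis_def if_distrib[where f = "(*) _"] cong: if_cong)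
  have dec: "A = (\<Sum>i\<in>UNIV. \<Psi> i (A *v axis i 1))" for A :: "complex ^ 'm ^ 'm"
    by (simp add: vec_eq_iff \<Psi>_def entry)
  define G where "G = (\<Sum>i\<in>UNIV. onorm (\<Psi> i))"
  have on: "0 \<le> onorm (\<Psi> i)" for i by (rule onorm_pos_le[OF bl])
  then have G: "0 \<le> G" "\<And>i. onorm (\<Psi> i) \<le> G" unfolding G_def by (auto intro: sum_nonneg member_le_sum)
  have "NW s A \<le> G * (\<Sum>i\<in>UNIV. NW s (\<lambda>t. A t *v axis i 1))" if A: "A \<in> W s" for A :: "real \<Rightarrow> complex ^ 'm ^ 'm"
  proof -
    have col: "(\<lambda>t. A t *v axis i 1) \<in> W s" for i
      using W_linear[OF bounded_bilinear.bounded_linear_left[OF bounded_bilinear_matrix_vector_mult] A] by blast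
    have "NW s A = NW s (\<lambda>t. \<Sum>i\<in>UNIV. \<Psi> i (A t *v axis i 1))" using dec by metis
    also have "\<dots> \<le> (\<Sum>i\<in>UNIV. NW s (\<lambda>t. \<Psi> i (A t *v axis i 1)))"
      using W_linear[OF bl col] by (intro W_sum(2)) auto
    also have "\<dots> \<le> (\<Sum>i\<in>UNIV. G * NW s (\<lambda>t. A t *v axis i 1))"
    proof (rule sum_mono)
      fix i
      have "NW s (\<lambda>t. \<Psi> i (A t *v axis i 1)) \<le> onorm (\<Psi> i) * NW s (\<lambda>t. A t *v axis i 1)"
        using W_linear[OF bl col] by blast
      also have "\<dots> \<le> G * NW s (\<lambda>t. A t *v axis i 1)" using G(2) by (intro mult_right_mono) auto
      finally show "NW s (\<lambda>t. \<Psi> i (A t *v axis i 1)) \<le> G * NW s (\<lambda>t. A t *v axis i 1)" .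
    qed
    finally show ?thesis by (simp add: sum_distrib_left)
  qed
  then show ?thesis using G(1) by blast
qed

text \<open>On \<open>(t - a)\<^sup>l / l!\<close> only the coefficients of order at most \<open>l\<close> act, so these test functions
  determine the coefficients through a triangular system.\<close>

lemma coeffs_bound_by_monomials:
  "\<exists>C\<ge>0. \<forall>A::nat \<Rightarrow> real \<Rightarrow> complex ^ 'm ^ 'm. coeffs A \<longrightarrow> (\<Sum>l<r. NW n (A l)) \<le>
     C * (\<Sum>l<r. \<Sum>i\<in>UNIV. NW n (\<lambda>t. \<Sum>k<r. A k t *v D k (monomial (axis i 1) l) t))"
proof -
  define Q where "Q A l i = NW n (\<lambda>t. \<Sum>k<r. A k t *v D k (monomial (axis i 1) l) t)" for A :: "nat \<Rightarrow> real \<Rightarrow> complex ^ 'm ^ 'm" and l i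
  define q where "q A = (\<Sum>l<r. \<Sum>i\<in>UNIV. Q A l i)" for A :: "nat \<Rightarrow> real \<Rightarrow> complex ^ 'm ^ 'm"
  have Q0: "0 \<le> Q A l i" for A l i by (simp add: Q_def)
  obtain G where G: "G \<ge> 0" "\<forall>(A::real \<Rightarrow> complex ^ 'm ^ 'm)\<in>W n. NW n A \<le> G * (\<Sum>i\<in>UNIV. NW n (\<lambda>t. A t *v axis i 1))"
    using matrix_bound_by_columns by blast
  obtain P where P: "P \<ge> 0" "\<forall>(A::real \<Rightarrow> complex ^ 'm ^ 'm)\<in>W n. \<forall>g\<in>W (Suc n). (\<lambda>t. A t *v g t) \<in> W n \<and>
     NW n (\<lambda>t. A t *v g t) \<le> P * NW n A * NW (Suc n) g"
    using W_mult[OF bounded_bilinear_matrix_vector_mult, of n] by blast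
  \<comment> \<open>A single bound for the norms of all test monomials, finite because only degrees
    up to \<open>r\<close> and finitely many unit vectors occur.\<close>
  define H where "H = (\<Sum>i\<in>UNIV. \<Sum>j\<le>r. NW (Suc n) (monomial (axis i (1::complex) :: complex ^ 'm) j))"
  have H: "NW (Suc n) (monomial (axis i (1::complex) :: complex ^ 'm) j) \<le> H" if "j \<le> r" for i j
  proof -
    have "NW (Suc n) (monomial (axis i (1::complex) :: complex ^ 'm) j) \<le> (\<Sum>j\<le>r. NW (Suc n) (monomial (axis i (1::complex) :: complex ^ 'm) j))"
      using that by (intro member_le_sum) auto
    also have "\<dots> \<le> H" unfolding H_def by (intro member_le_sum) (auto intro: sum_nonneg)
    finally show ?thesis .
  qed
  define K where "K = G * real CARD('m) * (P * H)"
  have H0: "0 \<le> H" unfolding H_def by (intro sum_nonneg) auto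
  have K0: "0 \<le> K" unfolding K_def using G(1) P(1) H0 by simp
  \<comment> \<open>Forward elimination: on the monomial of degree \<open>l\<close> the coefficient
    of order \<open>l\<close> meets the constant unit vector, and those of lower order are already
    under control. \<open>K\<close> collects one factor \<open>P * H\<close> for each of the
    CARD('m) columns.\<close>
  have step: "NW n (A l) \<le> G * q A + K * (\<Sum>k<l. NW n (A k))" if A: "coeffs A" and l: "l < r" for A l
  proof -
    have Ak: "A k \<in> W n" if "k < r" for k using A that by (simp add: coeffs_def)
    have col: "NW n (\<lambda>t. A l t *v axis i 1) \<le> Q A l i + P * H * (\<Sum>k<l. NW n (A k))" for i
    proof -
      let ?m = "monomial (axis i (1::complex) :: complex ^ 'm)"
      have prod: "(\<lambda>t. A k t *v ?m j t) \<in> W n" "NW n (\<lambda>t. A k t *v ?m j t) \<le> P * NW n (A k) * NW (Suc n) (?m j)"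
        if "k < r" for k j using P(2) Ak[OF that] monomial_in_W by blast+
      have S: "(\<lambda>t. \<Sum>k<l. A k t *v ?m (l - k) t) \<in> W n" using prod(1) l by (intro W_sum(1)) auto
      have T: "(\<lambda>t. \<Sum>k<r. A k t *v D k (?m l) t) \<in> W n"
      proof (rule W_sum(1))
        fix k assume "k \<in> {..<r}"
        then show "(\<lambda>t. A k t *v D k (?m l) t) \<in> W n"
          using coeff_term_bound Ak monomial_in_W by blast
      qed simp
      have "A l t *v axis i 1 = (\<Sum>k<r. A k t *v D k (?m l) t) - (\<Sum>k<l. A k t *v ?m (l - k) t)" if t: "t \<in> {a..b}" for t
      proof -
        have "(\<Sum>k<r. A k t *v D k (?m l) t) = (\<Sum>k<Suc l. A k t *v D k (?m l) t)"
          using l by (intro sum.mono_neutral_right) (auto simp: ideriv_monomial[OF t])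
        also have "\<dots> = (\<Sum>k<l. A k t *v ?m (l - k) t) + A l t *v ?m 0 t"
          by (simp add: ideriv_monomial[OF t])
        finally show ?thesis by (simp add: monomial_def)
      qed
      then have "eqW n (\<lambda>t. (\<Sum>k<r. A k t *v D k (?m l) t) - (\<Sum>k<l. A k t *v ?m (l - k) t)) (\<lambda>t. A l t *v axis i 1)"
        by (intro eqW_I) simp
      from NW_cong(2)[OF W_diff(1)[OF T S] this]
      have "NW n (\<lambda>t. A l t *v axis i 1) \<le> Q A l i + NW n (\<lambda>t. \<Sum>k<l. A k t *v ?m (l - k) t)"
        using W_diff(2)[OF T S] by (simp add: Q_def)
      also have "NW n (\<lambda>t. \<Sum>k<l. A k t *v ?m (l - k) t) \<le> (\<Sum>k<l. NW n (\<lambda>t. A k t *v ?m (l - k) t))"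
        using prod(1) l by (intro W_sum(2)) auto
      also have "\<dots> \<le> (\<Sum>k<l. P * NW n (A k) * H)"
      proof (rule sum_mono)
        fix k assume "k \<in> {..<l}"
        then have k: "k < r" "l - k \<le> r" using l by auto
        have "NW n (\<lambda>t. A k t *v ?m (l - k) t) \<le> P * NW n (A k) * NW (Suc n) (?m (l - k))" by (rule prod(2)[OF k(1)])
        also have "\<dots> \<le> P * NW n (A k) * H" using H[OF k(2)] P(1) by (intro mult_left_mono) auto
        finally show "NW n (\<lambda>t. A k t *v ?m (l - k) t) \<le> P * NW n (A k) * H" .
      qed
      finally show ?thesis by (simp add: sum_distrib_left algebra_simps)
    qed
    have "NW n (A l) \<le> G * (\<Sum>i\<in>UNIV. NW n (\<lambda>t. A l t *v axis i 1))" using G(2) Ak[OF l] by blast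
    also have "\<dots> \<le> G * (\<Sum>i\<in>UNIV. Q A l i + P * H * (\<Sum>k<l. NW n (A k)))"
      using col G(1) by (intro mult_left_mono sum_mono) auto
    also have "\<dots> = G * (\<Sum>i\<in>UNIV. Q A l i) + K * (\<Sum>k<l. NW n (A k))"
      by (simp add: sum.distrib K_def algebra_simps)
    also have "(\<Sum>i\<in>UNIV. Q A l i) \<le> q A"
      unfolding q_def using l Q0 by (intro member_le_sum[where f = "\<lambda>l. \<Sum>i\<in>UNIV. Q A l i"]) (auto intro: sum_nonneg)
    finally show ?thesis using G(1) by (simp add: mult_left_mono)
  qed
  \<comment> \<open>Solving the triangular system by accumulating the bounds order by order.\<close>
  have "m \<le> r \<Longrightarrow> \<exists>C\<ge>0. \<forall>A::nat \<Rightarrow> real \<Rightarrow> complex ^ 'm ^ 'm. coeffs A \<longrightarrow> (\<Sum>l<m. NW n (A l)) \<le> C * q A" for m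
  proof (induction m)
    case 0
    show ?case by (intro exI[of _ 0]) simp
  next
    case (Suc m)
    then obtain C where C: "C \<ge> 0" "\<forall>A::nat \<Rightarrow> real \<Rightarrow> complex ^ 'm ^ 'm. coeffs A \<longrightarrow> (\<Sum>l<m. NW n (A l)) \<le> C * q A" by auto
    have "(\<Sum>l<Suc m. NW n (A l)) \<le> (C + G + K * C) * q A" if A: "coeffs A" for A :: "nat \<Rightarrow> real \<Rightarrow> complex ^ 'm ^ 'm"
    proof -
      have "(\<Sum>l<m. NW n (A l)) \<le> C * q A" using C(2) A by blast
      moreover have "K * (\<Sum>l<m. NW n (A l)) \<le> K * (C * q A)" using calculation K0 by (rule mult_left_mono)
      moreover have "NW n (A m) \<le> G * q A + K * (\<Sum>k<m. NW n (A k))" using step[OF A, of m] Suc.prems by simp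
      ultimately show ?thesis by (simp add: algebra_simps)
    qed
    then show ?case using C(1) G(1) K0 by (intro exI[of _ "C + G + K * C"]) auto
  qed
  from this[of r] show ?thesis by (simp add: q_def Q_def)
qed

end

context bvp_family
begin

lemma solution_exists:
  assumes "well_posed \<epsilon>1" "\<And>\<epsilon>. \<epsilon> \<in> {0..<\<epsilon>1} \<Longrightarrow> f \<epsilon> \<in> W n" "SOL 0 (f 0) (c 0) y0"
  shows "\<exists>y. y 0 = y0 \<and> (\<forall>\<epsilon>\<in>{0..<\<epsilon>1}. SOL \<epsilon> (f \<epsilon>) (c \<epsilon>) (y \<epsilon>))"
proof -
  have "\<forall>\<epsilon>\<in>{0..<\<epsilon>1}. \<exists>y. SOL \<epsilon> (f \<epsilon>) (c \<epsilon>) y"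
    using assms(1,2) unfolding well_posed_def by blast
  from bchoice[OF this] obtain y where "\<forall>\<epsilon>\<in>{0..<\<epsilon>1}. SOL \<epsilon> (f \<epsilon>) (c \<epsilon>) (y \<epsilon>)" by blast
  \<comment> \<open>The value at parameter 0 is overwritten by the prescribed \<open>y0\<close>,
    since convergence of solutions is stated relative to the member at 0.\<close>
  then show ?thesis using assms(3) by (intro exI[of _ "y(0 := y0)"]) auto
qed

text \<open>The hypothesis of continuous dependence in usable form: any solution at parameter 0 is
  the limit of solutions for convergent data.\<close>

lemma solutions_approach:
  assumes wp: "well_posed \<epsilon>1" and sc: "solutions_converge \<epsilon>1"
    and f: "\<And>\<epsilon>. \<epsilon> \<in> {0..<\<epsilon>1} \<Longrightarrow> f \<epsilon> \<in> W n" and y0: "SOL 0 (f 0) (c 0) y0"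
    and lim: "((\<lambda>\<epsilon>. NW n (\<lambda>t. f \<epsilon> t - f 0 t)) \<longlongrightarrow> 0) (at_right 0)" "(c \<longlongrightarrow> c 0) (at_right 0)"
  shows "\<exists>y. (\<forall>\<epsilon>\<in>{0..<\<epsilon>1}. SOL \<epsilon> (f \<epsilon>) (c \<epsilon>) (y \<epsilon>)) \<and> ((\<lambda>\<epsilon>. NW (n + r) (\<lambda>t. y \<epsilon> t - y0 t)) \<longlongrightarrow> 0) (at_right 0)"
proof -
  obtain y where y: "y 0 = y0" "\<forall>\<epsilon>\<in>{0..<\<epsilon>1}. SOL \<epsilon> (f \<epsilon>) (c \<epsilon>) (y \<epsilon>)"
    using solution_exists[of \<epsilon>1 f c y0, OF wp f y0] by blast
  have "((\<lambda>\<epsilon>. NW (n + r) (\<lambda>t. y \<epsilon> t - y 0 t)) \<longlongrightarrow> 0) (at_right 0)"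
    using sc f y(2) lim unfolding solutions_converge_def by blast
  then show ?thesis using y by auto
qed

theorem continuous_dependence_necessary:
  assumes \<epsilon>1: "0 < \<epsilon>1" "\<epsilon>1 < \<epsilon>0" and wp: "well_posed \<epsilon>1" and sc: "solutions_converge \<epsilon>1"
  shows "\<forall>y. SOL 0 (\<lambda>t. 0) 0 y \<longrightarrow> (\<forall>t\<in>{a..b}. y t = 0)" "coeffs_converge" "operators_converge"
proof -
  let ?A = "\<lambda>\<epsilon> l. A l \<epsilon>"
  have z1: "0 \<in> {0..<\<epsilon>1}" using \<epsilon>1 by simp
  have in0: "\<epsilon> \<in> {0..<\<epsilon>0}" if "\<epsilon> \<in> {0..<\<epsilon>1}" for \<epsilon> using that \<epsilon>1 by auto
  have ev: "eventually (\<lambda>\<epsilon>. \<epsilon> \<in> {0..<\<epsilon>1}) (at_right 0)"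
    using \<epsilon>1 by (auto simp: eventually_at_right_field intro: exI[of _ \<epsilon>1])
  have unique: "y t = z t" if \<epsilon>: "\<epsilon> \<in> {0..<\<epsilon>1}" and f: "f \<in> W n" and "SOL \<epsilon> f c y" "SOL \<epsilon> f c z" "t \<in> {a..b}" for \<epsilon> f c y z t
  proof -
    obtain u where "\<forall>z. SOL \<epsilon> f c z \<longrightarrow> (\<forall>t\<in>{a..b}. z t = u t)" using wp \<epsilon> f unfolding well_posed_def by blast
    then have "y t = u t" "z t = u t" using that by blast+
    then show ?thesis by simp
  qed
  show "\<forall>y. SOL 0 (\<lambda>t. 0) 0 y \<longrightarrow> (\<forall>t\<in>{a..b}. y t = 0)"
    using unique[OF z1 W_zero(1) _ sol_zero[OF coeffs[OF zero_in] operator[OF zero_in]]] by blast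
  \<comment> \<open>The total distance of the coefficients, nothing about which is known near 0
    yet.\<close>
  define S where "S \<epsilon> = (\<Sum>l<r. NW n (\<lambda>t. A l \<epsilon> t - A l 0 t))" for \<epsilon>
  have S0: "0 \<le> S \<epsilon>" for \<epsilon> unfolding S_def by (intro sum_nonneg) auto
  obtain C' where C': "C' \<ge> 0" "\<forall>(A::nat \<Rightarrow> real \<Rightarrow> complex ^ 'm ^ 'm) A'. coeffs A \<longrightarrow> coeffs A' \<longrightarrow> (\<forall>y\<in>W (n + r).
     NW n (\<lambda>t. L A y t - L A' y t) \<le> C' * (\<Sum>l<r. NW n (\<lambda>t. A l t - A' l t)) * NW (n + r) y)"
    using L_diff_bound by blast
  have dL: "NW n (\<lambda>t. L (?A \<epsilon>) y t - L (?A 0) y t) \<le> C' * S \<epsilon> * NW (n + r) y" if "\<epsilon> \<in> {0..<\<epsilon>1}" "y \<in> W (n + r)" for \<epsilon> y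
    using C'(2)[rule_format, OF coeffs[OF in0[OF that(1)]] coeffs[OF zero_in] that(2)] by (simp add: S_def)
  obtain C0 where C0: "C0 \<ge> 0" "\<forall>y\<in>W (n + r). NW n (L (?A 0) y) \<le> C0 * NW (n + r) y"
    using L_bound[OF coeffs[OF zero_in]] by blast
  have LW: "L (?A \<epsilon>) y \<in> W n" if "\<epsilon> \<in> {0..<\<epsilon>1}" "y \<in> W (n + r)" for \<epsilon> y
    using L_in_W[OF coeffs[OF in0[OF that(1)]] that(2)] .
  \<comment> \<open>The norm of the operator at \<open>\<epsilon>\<close> is only known to be at
    most \<open>C0 + C' * S \<epsilon>\<close>, so the unknown \<open>S\<close> enters its own
    estimate, but multiplied by a quantity tending to 0.\<close>
  have approx: "\<exists>d. (d \<longlongrightarrow> 0) (at_right 0) \<and> (\<forall>\<epsilon>\<in>{0..<\<epsilon>1}. NW n (\<lambda>t. L (?A \<epsilon>) y t - L (?A 0) y t) \<le> (C0 + C' * S \<epsilon>) * d \<epsilon>)"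
    if y: "y \<in> W (n + r)" for y
  proof -
    have "SOL 0 (L (?A 0) y) (B 0 y) y" using y by (simp add: sol_def eqW_I)
    then obtain z where z: "\<forall>\<epsilon>\<in>{0..<\<epsilon>1}. SOL \<epsilon> (L (?A 0) y) (B 0 y) (z \<epsilon>)"
      "((\<lambda>\<epsilon>. NW (n + r) (\<lambda>t. z \<epsilon> t - y t)) \<longlongrightarrow> 0) (at_right 0)"
      using solutions_approach[OF wp sc, of "\<lambda>\<epsilon>. L (?A 0) y" "\<lambda>\<epsilon>. B 0 y" y] LW[OF z1 y] W_zero(2)[where 'a = "complex ^ 'm"] by auto
    have "NW n (\<lambda>t. L (?A \<epsilon>) y t - L (?A 0) y t) \<le> (C0 + C' * S \<epsilon>) * NW (n + r) (\<lambda>t. z \<epsilon> t - y t)"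
      if \<epsilon>: "\<epsilon> \<in> {0..<\<epsilon>1}" for \<epsilon>
    proof -
      have zs: "z \<epsilon> \<in> W (n + r)" "eqW n (L (?A \<epsilon>) (z \<epsilon>)) (L (?A 0) y)" using z(1) \<epsilon> by (auto simp: sol_def)
      let ?w = "\<lambda>t. z \<epsilon> t - y t"
      have w: "?w \<in> W (n + r)" by (rule W_diff(1)[OF zs(1) y])
      have "eqW n (\<lambda>t. L (?A \<epsilon>) (z \<epsilon>) t - L (?A \<epsilon>) y t) (\<lambda>t. L (?A 0) y t - L (?A \<epsilon>) y t)"
        using zs(2) by (auto simp: eqW_def elim: AE_mp split: if_splits)
      from eqW_trans[OF L_diff[OF coeffs[OF in0[OF \<epsilon>]] zs(1) y] this]
      have "NW n (\<lambda>t. L (?A 0) y t - L (?A \<epsilon>) y t) = NW n (L (?A \<epsilon>) ?w)"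
        by (rule NW_cong(2)[OF LW[OF \<epsilon> w]])
      then have "NW n (\<lambda>t. L (?A \<epsilon>) y t - L (?A 0) y t) = NW n (L (?A \<epsilon>) ?w)"
        using NW_diff_commute[OF LW[OF \<epsilon> y] LW[OF z1 y]] by simp
      also have "\<dots> = NW n (\<lambda>t. (L (?A \<epsilon>) ?w t - L (?A 0) ?w t) + L (?A 0) ?w t)" by simp
      also have "\<dots> \<le> NW n (\<lambda>t. L (?A \<epsilon>) ?w t - L (?A 0) ?w t) + NW n (L (?A 0) ?w)"
        using W_add[OF W_diff(1)[OF LW[OF \<epsilon> w] LW[OF z1 w]] LW[OF z1 w]] by blast
      also have "\<dots> \<le> C' * S \<epsilon> * NW (n + r) ?w + C0 * NW (n + r) ?w"
        using dL[OF \<epsilon> w] C0(2) w by (intro add_mono) auto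
      finally show ?thesis by (simp add: algebra_simps)
    qed
    then show ?thesis using z(2) by blast
  qed
  have limS: "(S \<longlongrightarrow> 0) (at_right 0)"
  proof -
    obtain C where C: "C \<ge> 0" "\<forall>A::nat \<Rightarrow> real \<Rightarrow> complex ^ 'm ^ 'm. coeffs A \<longrightarrow> (\<Sum>l<r. NW n (A l)) \<le>
     C * (\<Sum>l<r. \<Sum>i\<in>UNIV. NW n (\<lambda>t. \<Sum>k<r. A k t *v D k (monomial (axis i 1) l) t))"
      using coeffs_bound_by_monomials by blast
    let ?m = "\<lambda>i. monomial (axis i (1::complex) :: complex ^ 'm)"
    have "\<forall>i l. \<exists>d. (d \<longlongrightarrow> 0) (at_right 0) \<and> (\<forall>\<epsilon>\<in>{0..<\<epsilon>1}. NW n (\<lambda>t. L (?A \<epsilon>) (?m i l) t - L (?A 0) (?m i l) t) \<le> (C0 + C' * S \<epsilon>) * d \<epsilon>)"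
      using approx[OF monomial_in_W] by blast
    then obtain d where d: "\<And>i l. (d i l \<longlongrightarrow> 0) (at_right 0)"
      "\<And>i l \<epsilon>. \<epsilon> \<in> {0..<\<epsilon>1} \<Longrightarrow> NW n (\<lambda>t. L (?A \<epsilon>) (?m i l) t - L (?A 0) (?m i l) t) \<le> (C0 + C' * S \<epsilon>) * d i l \<epsilon>"
      unfolding choice_iff by blast
    define \<rho> where "\<rho> \<epsilon> = (\<Sum>l<r. \<Sum>i\<in>UNIV. d i l \<epsilon>)" for \<epsilon>
    have \<rho>: "(\<rho> \<longlongrightarrow> 0) (at_right 0)"
    proof -
      have "(\<rho> \<longlongrightarrow> (\<Sum>l<r. \<Sum>i\<in>(UNIV::'m set). 0)) (at_right 0)"
        unfolding \<rho>_def[abs_def] by (intro tendsto_sum d(1))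
      then show ?thesis by simp
    qed
    \<comment> \<open>The finitely many test monomials control \<open>S\<close>, which closes the
      loop.\<close>
    have Sle: "S \<epsilon> \<le> C * ((C0 + C' * S \<epsilon>) * \<rho> \<epsilon>)" if \<epsilon>: "\<epsilon> \<in> {0..<\<epsilon>1}" for \<epsilon>
    proof -
      have "coeffs (\<lambda>l t. A l \<epsilon> t - A l 0 t)"
        using coeffs[OF in0[OF \<epsilon>]] coeffs[OF zero_in] unfolding coeffs_def by (blast intro: W_diff(1))
      then have "S \<epsilon> \<le> C * (\<Sum>l<r. \<Sum>i\<in>UNIV. NW n (\<lambda>t. L (?A \<epsilon>) (?m i l) t - L (?A 0) (?m i l) t))"
        using C(2) unfolding S_def L_diff_eq by blast
      also have "\<dots> \<le> C * (\<Sum>l<r. \<Sum>i\<in>UNIV. (C0 + C' * S \<epsilon>) * d i l \<epsilon>)"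
        using d(2)[OF \<epsilon>] C(1) by (intro mult_left_mono sum_mono) auto
      also have "\<dots> = C * ((C0 + C' * S \<epsilon>) * \<rho> \<epsilon>)" by (simp add: \<rho>_def sum_distrib_left)
      finally show ?thesis .
    qed
    have "((\<lambda>\<epsilon>. C * C' * \<rho> \<epsilon>) \<longlongrightarrow> C * C' * 0) (at_right 0)" by (intro tendsto_intros \<rho>)
    then have "eventually (\<lambda>\<epsilon>. C * C' * \<rho> \<epsilon> < 1 / 2) (at_right 0)" by (intro order_tendstoD(2)) auto
    \<comment> \<open>Absorption: eventually the coefficient of \<open>S \<epsilon>\<close> on the
      right is below 1/2.\<close>
    with ev have "eventually (\<lambda>\<epsilon>. norm (S \<epsilon>) \<le> 2 * (C * C0 * \<rho> \<epsilon>)) (at_right 0)"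
    proof eventually_elim
      case (elim \<epsilon>)
      have "(C * C' * \<rho> \<epsilon>) * S \<epsilon> \<le> 1 / 2 * S \<epsilon>" using elim(2) S0 by (intro mult_right_mono) auto
      moreover have "C * ((C0 + C' * S \<epsilon>) * \<rho> \<epsilon>) = C * C0 * \<rho> \<epsilon> + (C * C' * \<rho> \<epsilon>) * S \<epsilon>" by (simp add: algebra_simps)
      ultimately have "S \<epsilon> \<le> 2 * (C * C0 * \<rho> \<epsilon>)" using Sle[OF elim(1)] by linarith
      then show ?case using S0[of \<epsilon>] by simp
    qed
    moreover have "((\<lambda>\<epsilon>. 2 * (C * C0 * \<rho> \<epsilon>)) \<longlongrightarrow> 2 * (C * C0 * 0)) (at_right 0)" by (intro tendsto_intros \<rho>)
    ultimately show ?thesis by (intro Lim_null_comparison[of S]) auto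
  qed
  show "coeffs_converge"
    unfolding coeffs_converge_def
  proof (intro allI impI)
    fix l assume l: "l < r"
    show "((\<lambda>\<epsilon>. NW n (\<lambda>t. A l \<epsilon> t - A l 0 t)) \<longlongrightarrow> 0) (at_right 0)"
    proof (rule Lim_null_comparison[OF _ limS])
      have "NW n (\<lambda>t. A l \<epsilon> t - A l 0 t) \<le> S \<epsilon>" for \<epsilon> unfolding S_def using l by (intro member_le_sum) auto
      then show "\<forall>\<^sub>F \<epsilon> in at_right 0. norm (NW n (\<lambda>t. A l \<epsilon> t - A l 0 t)) \<le> S \<epsilon>" by simp
    qed
  qed
  show "operators_converge"
    unfolding operators_converge_def
  proof
    fix y :: "real \<Rightarrow> complex ^ 'm" assume y: "y \<in> W (n + r)"
    have limf: "((\<lambda>\<epsilon>. NW n (\<lambda>t. L (?A \<epsilon>) y t - L (?A 0) y t)) \<longlongrightarrow> 0) (at_right 0)"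
    proof (rule Lim_null_comparison)
      show "\<forall>\<^sub>F \<epsilon> in at_right 0. norm (NW n (\<lambda>t. L (?A \<epsilon>) y t - L (?A 0) y t)) \<le> C' * S \<epsilon> * NW (n + r) y"
        using ev by eventually_elim (use dL y in simp)
      have "((\<lambda>\<epsilon>. C' * S \<epsilon> * NW (n + r) y) \<longlongrightarrow> C' * 0 * NW (n + r) y) (at_right 0)" by (intro tendsto_intros limS)
      then show "((\<lambda>\<epsilon>. C' * S \<epsilon> * NW (n + r) y) \<longlongrightarrow> 0) (at_right 0)" by simp
    qed
    have "SOL 0 (L (?A 0) y) (B 0 y) y" using y by (simp add: sol_def eqW_I)
    then obtain z where z: "\<forall>\<epsilon>\<in>{0..<\<epsilon>1}. SOL \<epsilon> (L (?A \<epsilon>) y) (B 0 y) (z \<epsilon>)"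
      "((\<lambda>\<epsilon>. NW (n + r) (\<lambda>t. z \<epsilon> t - y t)) \<longlongrightarrow> 0) (at_right 0)"
      using solutions_approach[OF wp sc, of "\<lambda>\<epsilon>. L (?A \<epsilon>) y" "\<lambda>\<epsilon>. B 0 y" y] LW y limf by auto
    \<comment> \<open>Homogeneous solutions with constant boundary data \<open>k\<close>; for basis
      vectors \<open>k\<close> they play the role of a fundamental system adapted to the boundary
      operators.\<close>
    have "\<exists>v v0. SOL 0 (\<lambda>t. 0) k v0 \<and> (\<forall>\<epsilon>\<in>{0..<\<epsilon>1}. SOL \<epsilon> (\<lambda>t. 0) k (v \<epsilon>)) \<and> ((\<lambda>\<epsilon>. NW (n + r) (\<lambda>t. v \<epsilon> t - v0 t)) \<longlongrightarrow> 0) (at_right 0)"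
      for k :: "complex ^ 'q"
    proof -
      obtain v0 where v0: "SOL 0 (\<lambda>t. 0) k v0" using wp z1 W_zero(1) unfolding well_posed_def by blast
      with solutions_approach[OF wp sc, of "\<lambda>\<epsilon> t. 0" "\<lambda>\<epsilon>. k" v0] show ?thesis
        using W_zero[where 'a = "complex ^ 'm"] by auto
    qed
    then have "\<forall>k. \<exists>v v0. SOL 0 (\<lambda>t. 0) k v0 \<and> (\<forall>\<epsilon>\<in>{0..<\<epsilon>1}. SOL \<epsilon> (\<lambda>t. 0) k (v \<epsilon>)) \<and> ((\<lambda>\<epsilon>. NW (n + r) (\<lambda>t. v \<epsilon> t - v0 t)) \<longlongrightarrow> 0) (at_right 0)"
      by blast
    then obtain v v0 where v: "\<And>k. SOL 0 (\<lambda>t. 0) k (v0 k)" "\<And>k \<epsilon>. \<epsilon> \<in> {0..<\<epsilon>1} \<Longrightarrow> SOL \<epsilon> (\<lambda>t. 0) k (v k \<epsilon>)"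
      "\<And>k. ((\<lambda>\<epsilon>. NW (n + r) (\<lambda>t. v k \<epsilon> t - v0 k t)) \<longlongrightarrow> 0) (at_right 0)"
      unfolding choice_iff by blast
    have vW: "v0 k \<in> W (n + r)" "\<epsilon> \<in> {0..<\<epsilon>1} \<Longrightarrow> v k \<epsilon> \<in> W (n + r)" for k \<epsilon> using v by (auto simp: sol_def)
    define \<tau> where "\<tau> \<epsilon> = (\<Sum>k\<in>Basis. NW (n + r) (\<lambda>t. v k \<epsilon> t - v0 k t))" for \<epsilon>
    have \<tau>: "(\<tau> \<longlongrightarrow> 0) (at_right 0)"
    proof -
      have "(\<tau> \<longlongrightarrow> (\<Sum>k\<in>(Basis::(complex ^ 'q) set). 0)) (at_right 0)"
        unfolding \<tau>_def[abs_def] by (intro tendsto_sum v(3))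
      then show ?thesis by simp
    qed
    obtain CB where CB: "CB \<ge> 0" "\<forall>y\<in>W (n + r). norm (B 0 y) \<le> CB * NW (n + r) y"
      using bounded_operatorD(3)[OF operator[OF zero_in]] by blast
    define d where "d \<epsilon> = B 0 y - B \<epsilon> y" for \<epsilon>
    \<comment> \<open>By uniqueness \<open>z \<epsilon> - y\<close> is the combination of the
      \<open>v k \<epsilon>\<close> with the coordinates of \<open>d \<epsilon>\<close>. The same
      combination of the \<open>v0 k\<close> has boundary value \<open>d \<epsilon>\<close> under
      \<open>B 0\<close>, so only the norm of \<open>B 0\<close> is used.\<close>
    have main: "norm (d \<epsilon>) \<le> CB * (NW (n + r) (\<lambda>t. z \<epsilon> t - y t) + norm (d \<epsilon>) * \<tau> \<epsilon>)" if \<epsilon>: "\<epsilon> \<in> {0..<\<epsilon>1}" for \<epsilon>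
    proof -
      note co = coeffs[OF in0[OF \<epsilon>]] and op = operator[OF in0[OF \<epsilon>]]
      have sumd: "(\<Sum>k\<in>Basis. (d \<epsilon> \<bullet> k) *\<^sub>R k) = d \<epsilon>" by (rule euclidean_representation)
      have y\<epsilon>: "SOL \<epsilon> (L (?A \<epsilon>) y) (B \<epsilon> y) y" using y by (simp add: sol_def eqW_I)
      have w: "SOL \<epsilon> (\<lambda>t. 0) (d \<epsilon>) (\<lambda>t. z \<epsilon> t - y t)"
        using sol_diff[OF co op, of "L (?A \<epsilon>) y" "B 0 y" "z \<epsilon>" "L (?A \<epsilon>) y" "B \<epsilon> y" y] z(1) \<epsilon> y\<epsilon> by (simp add: d_def)
      have "SOL \<epsilon> (\<lambda>t. 0) ((d \<epsilon> \<bullet> k) *\<^sub>R k) (\<lambda>t. (d \<epsilon> \<bullet> k) *\<^sub>R v k \<epsilon> t)" for k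
        using sol_scaleR[OF co op v(2)[OF \<epsilon>]] by simp
      from sol_sum[OF co op finite_Basis, of "\<lambda>k. (d \<epsilon> \<bullet> k) *\<^sub>R k" "\<lambda>k t. (d \<epsilon> \<bullet> k) *\<^sub>R v k \<epsilon> t", OF this]
      have u: "SOL \<epsilon> (\<lambda>t. 0) (d \<epsilon>) (\<lambda>t. \<Sum>k\<in>Basis. (d \<epsilon> \<bullet> k) *\<^sub>R v k \<epsilon> t)"
        unfolding sumd .
      have "SOL 0 (\<lambda>t. 0) ((d \<epsilon> \<bullet> k) *\<^sub>R k) (\<lambda>t. (d \<epsilon> \<bullet> k) *\<^sub>R v0 k t)" for k
        using sol_scaleR[OF coeffs[OF zero_in] operator[OF zero_in] v(1)] by simp
      from sol_sum[OF coeffs[OF zero_in] operator[OF zero_in] finite_Basis,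
          of "\<lambda>k. (d \<epsilon> \<bullet> k) *\<^sub>R k" "\<lambda>k t. (d \<epsilon> \<bullet> k) *\<^sub>R v0 k t", OF this]
      have u0: "SOL 0 (\<lambda>t. 0) (d \<epsilon>) (\<lambda>t. \<Sum>k\<in>Basis. (d \<epsilon> \<bullet> k) *\<^sub>R v0 k t)" unfolding sumd .
      have dv: "(\<lambda>t. v0 k t - v k \<epsilon> t) \<in> W (n + r)" for k by (intro W_diff vW \<epsilon>)
      have dvs: "(\<lambda>t. (d \<epsilon> \<bullet> k) *\<^sub>R (v0 k t - v k \<epsilon> t)) \<in> W (n + r)" for k by (rule W_scaleR(1)[OF dv])
      have sW: "(\<lambda>t. \<Sum>k\<in>Basis. (d \<epsilon> \<bullet> k) *\<^sub>R (v0 k t - v k \<epsilon> t)) \<in> W (n + r)"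
        by (rule W_sum(1)[OF finite_Basis dvs])
      have wW: "(\<lambda>t. z \<epsilon> t - y t) \<in> W (n + r)" using w by (simp add: sol_def)
      \<comment> \<open>The combination at parameter 0 differs from \<open>z \<epsilon> - y\<close>
        by terms bounded by \<open>norm (d \<epsilon>)\<close> times
        \<open>\<tau> \<epsilon>\<close>, which are absorbed once
        \<open>CB * \<tau> \<epsilon> < 1 / 2\<close>.\<close>
      let ?u0 = "\<lambda>t. \<Sum>k\<in>Basis. (d \<epsilon> \<bullet> k) *\<^sub>R v0 k t"
      have "(z \<epsilon> t - y t) + (\<Sum>k\<in>Basis. (d \<epsilon> \<bullet> k) *\<^sub>R (v0 k t - v k \<epsilon> t)) = ?u0 t" if "t \<in> {a..b}" for t
        using unique[OF \<epsilon> W_zero(1) w u that] by (simp add: scaleR_diff_right sum_subtractf)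
      then have "eqW (n + r) (\<lambda>t. (z \<epsilon> t - y t) + (\<Sum>k\<in>Basis. (d \<epsilon> \<bullet> k) *\<^sub>R (v0 k t - v k \<epsilon> t))) ?u0"
        by (rule eqW_I)
      from NW_cong(2)[OF conjunct1[OF W_add[OF wW sW]] this]
      have "NW (n + r) ?u0 \<le> NW (n + r) (\<lambda>t. z \<epsilon> t - y t) + NW (n + r) (\<lambda>t. \<Sum>k\<in>Basis. (d \<epsilon> \<bullet> k) *\<^sub>R (v0 k t - v k \<epsilon> t))"
        using W_add[OF wW sW] by simp
      also have "NW (n + r) (\<lambda>t. \<Sum>k\<in>Basis. (d \<epsilon> \<bullet> k) *\<^sub>R (v0 k t - v k \<epsilon> t)) \<le> (\<Sum>k\<in>Basis. NW (n + r) (\<lambda>t. (d \<epsilon> \<bullet> k) *\<^sub>R (v0 k t - v k \<epsilon> t)))"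
        by (rule W_sum(2)[OF finite_Basis dvs])
      also have "\<dots> \<le> (\<Sum>k\<in>Basis. norm (d \<epsilon>) * NW (n + r) (\<lambda>t. v k \<epsilon> t - v0 k t))"
      proof (rule sum_mono)
        fix k :: "complex ^ 'q" assume k: "k \<in> Basis"
        have "NW (n + r) (\<lambda>t. (d \<epsilon> \<bullet> k) *\<^sub>R (v0 k t - v k \<epsilon> t)) \<le> \<bar>d \<epsilon> \<bullet> k\<bar> * NW (n + r) (\<lambda>t. v0 k t - v k \<epsilon> t)"
          by (rule W_scaleR(2)[OF dv])
        also have "\<dots> \<le> norm (d \<epsilon>) * NW (n + r) (\<lambda>t. v0 k t - v k \<epsilon> t)"
          by (intro mult_right_mono Basis_le_norm[OF k]) auto
        also have "NW (n + r) (\<lambda>t. v0 k t - v k \<epsilon> t) = NW (n + r) (\<lambda>t. v k \<epsilon> t - v0 k t)"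
          by (intro NW_diff_commute vW \<epsilon>)
        finally show "NW (n + r) (\<lambda>t. (d \<epsilon> \<bullet> k) *\<^sub>R (v0 k t - v k \<epsilon> t)) \<le> norm (d \<epsilon>) * NW (n + r) (\<lambda>t. v k \<epsilon> t - v0 k t)" .
      qed
      also have "\<dots> = norm (d \<epsilon>) * \<tau> \<epsilon>" by (simp add: \<tau>_def sum_distrib_left)
      finally have "NW (n + r) ?u0 \<le> NW (n + r) (\<lambda>t. z \<epsilon> t - y t) + norm (d \<epsilon>) * \<tau> \<epsilon>" by simp
      then have "CB * NW (n + r) ?u0 \<le> CB * (NW (n + r) (\<lambda>t. z \<epsilon> t - y t) + norm (d \<epsilon>) * \<tau> \<epsilon>)"
        using CB(1) by (rule mult_left_mono)
      moreover have "norm (d \<epsilon>) \<le> CB * NW (n + r) ?u0"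
        using CB(2) u0 by (auto simp: sol_def)
      ultimately show ?thesis by linarith
    qed
    have "((\<lambda>\<epsilon>. CB * \<tau> \<epsilon>) \<longlongrightarrow> CB * 0) (at_right 0)" by (intro tendsto_intros \<tau>)
    then have "eventually (\<lambda>\<epsilon>. CB * \<tau> \<epsilon> < 1 / 2) (at_right 0)" by (intro order_tendstoD(2)) auto
    with ev have "eventually (\<lambda>\<epsilon>. norm (d \<epsilon>) \<le> 2 * (CB * NW (n + r) (\<lambda>t. z \<epsilon> t - y t))) (at_right 0)"
    proof eventually_elim
      case (elim \<epsilon>)
      have "(CB * \<tau> \<epsilon>) * norm (d \<epsilon>) \<le> 1 / 2 * norm (d \<epsilon>)" using elim(2) by (intro mult_right_mono) auto
      then show ?case using main[OF elim(1)] by (simp add: algebra_simps)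
    qed
    moreover have "((\<lambda>\<epsilon>. 2 * (CB * NW (n + r) (\<lambda>t. z \<epsilon> t - y t))) \<longlongrightarrow> 2 * (CB * 0)) (at_right 0)" by (intro tendsto_intros z(2))
    ultimately have "(d \<longlongrightarrow> 0) (at_right 0)" by (intro Lim_null_comparison[of d]) auto
    then have "((\<lambda>\<epsilon>. B 0 y - d \<epsilon>) \<longlongrightarrow> B 0 y - 0) (at_right 0)" by (intro tendsto_intros)
    then show "((\<lambda>\<epsilon>. B \<epsilon> y) \<longlongrightarrow> B 0 y) (at_right 0)" by (simp add: d_def)
  qed
qed

end

section \<open>Return to the original formulation of the boundary-value problem\<close>

theorem theorem4:
  fixes a b \<epsilon>0 :: real and p :: ereal and n r :: nat
    and A :: "nat \<Rightarrow> real \<Rightarrow> real \<Rightarrow> complex ^ 'm ^ 'm"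
    and B :: "real \<Rightarrow> (real \<Rightarrow> complex ^ 'm) \<Rightarrow> complex ^ 'q"
  assumes "a < b" and "r \<ge> 1" and "1 \<le> p" and "\<epsilon>0 > 0"
    and "CARD('q) = r * CARD('m)"
    and "\<And>\<epsilon> j. \<epsilon> \<in> {0..<\<epsilon>0} \<Longrightarrow> j \<in> {1..r} \<Longrightarrow> A (r - j) \<epsilon> \<in> sobolev_space a b p n"
    and "\<And>\<epsilon>. \<epsilon> \<in> {0..<\<epsilon>0} \<Longrightarrow> continuous_linear_operator a b p (n + r) (B \<epsilon>)"
  shows "depends_continuously a b p n r \<epsilon>0 A B \<longleftrightarrow>
     (\<forall>y. bvp_solution a b p n r (\<lambda>l. A l 0) (B 0) (\<lambda>t. 0) 0 y \<longrightarrow> (\<forall>t\<in>{a..b}. y t = 0)) \<and>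
     (\<forall>j\<in>{1..r}.
        ((\<lambda>\<epsilon>. sobolev_norm a b p n (\<lambda>t. A (r - j) \<epsilon> t - A (r - j) 0 t)) \<longlongrightarrow> 0) (at_right 0)) \<and>
     (\<forall>y\<in>sobolev_space a b p (n + r). ((\<lambda>\<epsilon>. B \<epsilon> y) \<longlongrightarrow> B 0 y) (at_right 0))"
proof -
  \<comment> \<open>The substitution \<open>l = r - j\<close> translates between the numbering of
    the coefficients in the statement and that of the proof.\<close>
  have rev: "(\<forall>j\<in>{1..r}. Q (r - j)) \<longleftrightarrow> (\<forall>l<r. Q l)" for Q
  proof
    assume *: "\<forall>j\<in>{1..r}. Q (r - j)"
    show "\<forall>l<r. Q l"
    proof (intro allI impI)
      fix l assume "l < r"
      then have "r - l \<in> {1..r}" "r - (r - l) = l" by auto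
      with * show "Q l" by metis
    qed
  qed auto
  interpret ode: interval_ode a b p n r using assms(1-3) by unfold_locales
  interpret bvp_family a b p n r \<epsilon>0 A B
  proof unfold_locales
    show "0 < \<epsilon>0" by (rule assms(4))
    show "ode.coeffs (\<lambda>l. A l \<epsilon>)" if "\<epsilon> \<in> {0..<\<epsilon>0}" for \<epsilon>
      unfolding ode.coeffs_def using assms(6)[OF that] rev[of "\<lambda>l. A l \<epsilon> \<in> sobolev_space a b p n"] by blast
    show "ode.bounded_operator (n + r) (B \<epsilon>)" if "\<epsilon> \<in> {0..<\<epsilon>0}" for \<epsilon>
      by (rule ode.continuous_linear_operator_bounded[OF assms(7)[OF that]])
  qed
  have bvp: "bvp_solution a b p n r (\<lambda>l. A l \<epsilon>) (B \<epsilon>) f c y \<longleftrightarrow> SOL \<epsilon> f c y"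
    if "\<epsilon> \<in> {0..<\<epsilon>0}" "f \<in> sobolev_space a b p n" for \<epsilon> f c y
    using ode.bvp_solution_iff[OF coeffs[OF that(1)] that(2)] by (simp add: ode.sol_def)
  have wp: "(\<forall>\<epsilon>\<in>{0..<\<epsilon>1}. \<forall>f\<in>sobolev_space a b p n. \<forall>c.
          \<exists>y. bvp_solution a b p n r (\<lambda>l. A l \<epsilon>) (B \<epsilon>) f c y \<and>
              (\<forall>z. bvp_solution a b p n r (\<lambda>l. A l \<epsilon>) (B \<epsilon>) f c z \<longrightarrow> (\<forall>t\<in>{a..b}. z t = y t))) \<longleftrightarrow> well_posed \<epsilon>1"
    if "\<epsilon>1 < \<epsilon>0" for \<epsilon>1
    unfolding well_posed_def by (intro ball_cong refl) (use bvp that in auto)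
  have sc: "(\<forall>f c y.
          (\<forall>\<epsilon>\<in>{0..<\<epsilon>1}. f \<epsilon> \<in> sobolev_space a b p n) \<longrightarrow>
          (\<forall>\<epsilon>\<in>{0..<\<epsilon>1}. bvp_solution a b p n r (\<lambda>l. A l \<epsilon>) (B \<epsilon>) (f \<epsilon>) (c \<epsilon>) (y \<epsilon>)) \<longrightarrow>
          ((\<lambda>\<epsilon>. sobolev_norm a b p n (\<lambda>t. f \<epsilon> t - f 0 t)) \<longlongrightarrow> 0) (at_right 0) \<longrightarrow>
          (c \<longlongrightarrow> c 0) (at_right 0) \<longrightarrow>
          ((\<lambda>\<epsilon>. sobolev_norm a b p (n + r) (\<lambda>t. y \<epsilon> t - y 0 t)) \<longlongrightarrow> 0) (at_right 0)) \<longleftrightarrow> solutions_converge \<epsilon>1"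
    if "\<epsilon>1 < \<epsilon>0" for \<epsilon>1
    unfolding solutions_converge_def by (intro all_cong1 imp_cong refl ball_cong) (use bvp that in auto)
  have "depends_continuously a b p n r \<epsilon>0 A B \<longleftrightarrow> (\<exists>\<epsilon>1. 0 < \<epsilon>1 \<and> \<epsilon>1 < \<epsilon>0 \<and> well_posed \<epsilon>1 \<and> solutions_converge \<epsilon>1)"
    unfolding depends_continuously_def using wp sc by blast
  also have "\<dots> \<longleftrightarrow> (\<forall>y. SOL 0 (\<lambda>t. 0) 0 y \<longrightarrow> (\<forall>t\<in>{a..b}. y t = 0)) \<and> coeffs_converge \<and> operators_converge"
    using continuous_dependence_sufficient[OF assms(5)] continuous_dependence_necessary by blast
  also have "\<dots> \<longleftrightarrow> (\<forall>y. bvp_solution a b p n r (\<lambda>l. A l 0) (B 0) (\<lambda>t. 0) 0 y \<longrightarrow> (\<forall>t\<in>{a..b}. y t = 0)) \<and>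
     (\<forall>j\<in>{1..r}.
        ((\<lambda>\<epsilon>. sobolev_norm a b p n (\<lambda>t. A (r - j) \<epsilon> t - A (r - j) 0 t)) \<longlongrightarrow> 0) (at_right 0)) \<and>
     (\<forall>y\<in>sobolev_space a b p (n + r). ((\<lambda>\<epsilon>. B \<epsilon> y) \<longlongrightarrow> B 0 y) (at_right 0))"
    unfolding bvp[OF zero_in ode.W_zero(1)] coeffs_converge_def operators_converge_def
    using rev[of "\<lambda>l. ((\<lambda>\<epsilon>. sobolev_norm a b p n (\<lambda>t. A l \<epsilon> t - A l 0 t)) \<longlongrightarrow> 0) (at_right 0)"] by simp
  finally show ?thesis .
qed

end
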